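(* Let $A$ be a compactly generated locally compact abelian group, $M$ a sheer LC $A$-module and $N$ a closed submodule of $M$. Then $N$ is sheer if and only if $M/N$ is sheer.
   Context: An LC $A$-module is an LCA group with a continuous action of $A$ by topological automorphisms. Compact parafinite: compact, no nonzero finite quotient module; purely discrete: discrete, no nonzero finite submodule; $\mathrm{W}^\flat(M)$ = sum of compact parafinite submodules; $\Omega^\sharp(M)$ = intersection of open submodules $U$ with $M/U$ purely discrete; $M$ is sheer if $\mathrm{W}^\flat(M)=0$ and $\Omega^\sharp(M)=M$. *)

theory Defs
  imports "HOL-Analysis.Analysis" "HOL-Algebra.Algebra"
begin

text \<open>Topological monoids/groups: a HOL-Algebra monoid record with a topology.
  LC A-modules: additionally an action of the elements of A.  Abelian groups are
  written multiplicatively, as is customary in HOL-Algebra.\<close>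

record 'a tmonoid = "'a monoid" + topo :: "'a topology"

record ('g, 'a) amod = "'a tmonoid" + act :: "'g \<Rightarrow> 'a \<Rightarrow> 'a"

definition topological_group :: "('a, 'b) tmonoid_scheme \<Rightarrow> bool" where
  "topological_group G \<longleftrightarrow> group G \<and> topspace (topo G) = carrier G
     \<and> continuous_map (prod_topology (topo G) (topo G)) (topo G) (\<lambda>(x, y). x \<otimes>\<^bsub>G\<^esub> y)
     \<and> continuous_map (topo G) (topo G) (\<lambda>x. inv\<^bsub>G\<^esub> x)"

definition LCA :: "('a, 'b) tmonoid_scheme \<Rightarrow> bool" where
  "LCA G \<longleftrightarrow> topological_group G \<and> comm_group G
     \<and> Hausdorff_space (topo G) \<and> locally_compact_space (topo G)"

definition compactly_generated :: "('a, 'b) tmonoid_scheme \<Rightarrow> bool" where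
  "compactly_generated G \<longleftrightarrow> (\<exists>K. compactin (topo G) K \<and> generate G K = carrier G)"

definition LC_module :: "'g tmonoid \<Rightarrow> ('g, 'a) amod \<Rightarrow> bool" where
  "LC_module A M \<longleftrightarrow> LCA M
     \<and> (\<forall>x\<in>carrier M. act M \<one>\<^bsub>A\<^esub> x = x)
     \<and> (\<forall>a\<in>carrier A. \<forall>b\<in>carrier A. \<forall>x\<in>carrier M.
           act M (a \<otimes>\<^bsub>A\<^esub> b) x = act M a (act M b x))
     \<and> (\<forall>a\<in>carrier A. act M a \<in> hom M M \<and> bij_betw (act M a) (carrier M) (carrier M)
           \<and> homeomorphic_map (topo M) (topo M) (act M a))
     \<and> continuous_map (prod_topology (topo A) (topo M)) (topo M) (\<lambda>(a, x). act M a x)"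

definition submodule :: "'g tmonoid \<Rightarrow> ('g, 'a) amod \<Rightarrow> 'a set \<Rightarrow> bool" where
  "submodule A M N \<longleftrightarrow> subgroup N M \<and> (\<forall>a\<in>carrier A. \<forall>x\<in>N. act M a x \<in> N)"

definition closed_submodule :: "'g tmonoid \<Rightarrow> ('g, 'a) amod \<Rightarrow> 'a set \<Rightarrow> bool" where
  "closed_submodule A M N \<longleftrightarrow> submodule A M N \<and> closedin (topo M) N"

definition submod :: "('g, 'a) amod \<Rightarrow> 'a set \<Rightarrow> ('g, 'a) amod" where
  "submod M N = M\<lparr>carrier := N, topo := subtopology (topo M) N\<rparr>"

definition quotmod :: "('g, 'a) amod \<Rightarrow> 'a set \<Rightarrow> ('g, 'a set) amod" where
  "quotmod M N = \<lparr>carrier = rcosets\<^bsub>M\<^esub> N, mult = set_mult M, one = N,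
     topo = topology (\<lambda>U. U \<subseteq> rcosets\<^bsub>M\<^esub> N \<and> openin (topo M) (\<Union>U)),
     act = (\<lambda>a C. act M a ` C)\<rparr>"

definition compact_parafinite :: "'g tmonoid \<Rightarrow> ('g, 'a) amod \<Rightarrow> bool" where
  "compact_parafinite A M \<longleftrightarrow> compact_space (topo M)
     \<and> (\<forall>U. closed_submodule A M U \<and> finite (carrier (quotmod M U)) \<longrightarrow> U = carrier M)"

definition purely_discrete :: "'g tmonoid \<Rightarrow> ('g, 'a) amod \<Rightarrow> bool" where
  "purely_discrete A M \<longleftrightarrow> topo M = discrete_topology (carrier M)
     \<and> (\<forall>S. submodule A M S \<and> finite S \<longrightarrow> S = {\<one>\<^bsub>M\<^esub>})"

definition W_flat :: "'g tmonoid \<Rightarrow> ('g, 'a) amod \<Rightarrow> 'a set" where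
  "W_flat A M = generate M (\<Union>{N. submodule A M N \<and> compact_parafinite A (submod M N)})"

definition Omega_sharp :: "'g tmonoid \<Rightarrow> ('g, 'a) amod \<Rightarrow> 'a set" where
  "Omega_sharp A M = \<Inter>{U. submodule A M U \<and> openin (topo M) U
                           \<and> purely_discrete A (quotmod M U)}"

definition sheer :: "'g tmonoid \<Rightarrow> ('g, 'a) amod \<Rightarrow> bool" where
  "sheer A M \<longleftrightarrow> W_flat A M = {\<one>\<^bsub>M\<^esub>} \<and> Omega_sharp A M = carrier M"

end

theory Submission
  imports Defs
begin

text \<open>
  M is replaced by a free abelian group mapping onto it, with the pulled back topology; a quotient
  M/N is then the same group with a coarser topology. For a compactly generated A, full sharp radical
  of Y means that Y is locally finite over each of its relatively open submodules. Closed submodules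
  of a sheer M have no compact parafinite submodules and quotients of M have full sharp radical, so it
  remains to prove that N has full sharp radical iff M/N has no compact parafinite submodule.

  In both directions one passes to the union of the compact subgroups, where the hypotheses supply a
  basis of compact open subgroups. Such a subgroup D has an open stabilizer, over which A is generated
  by finitely many elements. For each of these in turn one restricts to the submodule of points with
  relatively compact orbit, which keeps the sharp radical full. Then D lies in a compact open
  submodule, and a compact submodule without parafinite submodules is profinite as a module. If N has
  full sharp radical and Q/N is compact parafinite, this makes N dense in Q. If U is a relatively open
  pure submodule of N and M/N has no compact parafinite submodule, it yields an open submodule, of a
  submodule of M/U containing N/U, which meets N/U trivially; local finiteness then makes N/U trivial.
\<close>

section \<open>Abelian groups\<close>

text \<open>Full sharp radical does not pass to arbitrary closed submodules: for trivial
  \<open>A\<close>, the integers in the real line lose it. So every restriction has to be paid for.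
  An open \<open>U\<close> of the smaller module is extended to an open \<open>P\<close> of the
  larger one with trace \<open>U\<close>, and local finiteness over \<open>P\<close> is then cut
  down to the smaller module. In \<open>sharp_full_compt\<close> the added points are multiples
  \<open>n g\<close> from a compactly generated open subgroup, in \<open>sharp_full_restrict\<close>
  they are points whose orbits converge to \<open>U\<close>.

  The structure theory of compactly generated groups is replaced by a homogeneous seminorm
  (\<open>gnorm\<close>) obtained from word length. Its kernel consists of compact elements, and
  full sharp radical makes a submodule divisible up to that kernel.

  Operators are treated singly because one automorphism of a totally disconnected group has compact
  open subgroups that split into a part with bounded forward orbits and a part with bounded backward
  orbits. Commutativity of \<open>A\<close> keeps the submodules of bounded orbits invariant under
  the other operators.\<close>

definition subgrp :: "'f::ab_group_add set \<Rightarrow> bool" where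
  "subgrp S \<longleftrightarrow> 0 \<in> S \<and> (\<forall>x\<in>S. \<forall>y\<in>S. x - y \<in> S)"

lemma subgrp_0: "subgrp S \<Longrightarrow> 0 \<in> S"
  and subgrp_diff: "subgrp S \<Longrightarrow> x \<in> S \<Longrightarrow> y \<in> S \<Longrightarrow> x - y \<in> S"
  by (auto simp: subgrp_def)

lemma subgrp_minus: "subgrp S \<Longrightarrow> x \<in> S \<Longrightarrow> - x \<in> S"
  using subgrp_diff[of S 0 x] subgrp_0[of S] by simp

lemma subgrp_add: "subgrp S \<Longrightarrow> x \<in> S \<Longrightarrow> y \<in> S \<Longrightarrow> x + y \<in> S"
  using subgrp_diff[of S x "- y"] subgrp_minus[of S y] by simp

lemmas subgrp_closed = subgrp_0 subgrp_diff subgrp_minus subgrp_add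

lemma subgrp_add_iff1: "subgrp S \<Longrightarrow> x \<in> S \<Longrightarrow> x + y \<in> S \<longleftrightarrow> y \<in> S"
  using subgrp_diff[of S "x + y" x] subgrp_add[of S x y] by auto

lemma subgrp_add_iff2: "subgrp S \<Longrightarrow> y \<in> S \<Longrightarrow> x + y \<in> S \<longleftrightarrow> x \<in> S"
  using subgrp_add_iff1[of S y x] by (simp add: add.commute)

lemma subgrp_UNIV [simp]: "subgrp UNIV"
  by (simp add: subgrp_def)

lemma subgrp_Int: "subgrp S \<Longrightarrow> subgrp R \<Longrightarrow> subgrp (S \<inter> R)"
  by (auto simp: subgrp_def)

lemma subgrp_Inter: "(\<And>S. S \<in> \<S> \<Longrightarrow> subgrp S) \<Longrightarrow> subgrp (\<Inter>\<S>)"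
  by (auto simp: subgrp_def)

lemma subgrp_plus:
  assumes "subgrp S" "subgrp R"
  shows "subgrp (S + R)"
proof -
  have "x + y - (x' + y') = (x - x') + (y - y')" for x y x' y' :: 'a
    by simp
  then show ?thesis
    unfolding subgrp_def
    by (smt (verit, best) add.right_neutral assms set_plus_elim set_plus_intro subgrp_0 subgrp_diff)
qed

lemma subset_plus1: "0 \<in> R \<Longrightarrow> S \<subseteq> S + (R :: 'f::ab_group_add set)"
  using set_plus_intro[of _ S 0 R] by fastforce

lemma subset_plus2: "0 \<in> S \<Longrightarrow> R \<subseteq> S + (R :: 'f::ab_group_add set)"
  using set_plus_intro[of 0 S _ R] by fastforce

lemma subgrp_plus_least: "subgrp H \<Longrightarrow> S \<subseteq> H \<Longrightarrow> R \<subseteq> H \<Longrightarrow> S + R \<subseteq> H"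
  by (auto elim!: set_plus_elim intro: subgrp_add)

lemma subgrp_plus_idem: "subgrp S \<Longrightarrow> S + S = S"
  using subgrp_plus_least[of S S S] subset_plus1[of S S] subgrp_0[of S] by auto

lemma subgrp_sum: "subgrp S \<Longrightarrow> (\<And>i. i \<in> I \<Longrightarrow> g i \<in> S) \<Longrightarrow> sum g I \<in> S"
  by (induct I rule: infinite_finite_induct) (auto intro: subgrp_closed)

lemma subgrp_image:
  fixes h :: "'e::ab_group_add \<Rightarrow> 'f::ab_group_add"
  assumes "subgrp S" "\<And>x y. h (x + y) = h x + h y"
  shows "subgrp (h ` S)"
proof -
  have 0: "h 0 = 0"
    using assms(2)[of 0 0] by simp
  have d: "h (x - y) = h x - h y" for x y
    using assms(2)[of "x - y" y] by (simp add: algebra_simps)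
  show ?thesis
    unfolding subgrp_def
  proof (intro conjI ballI)
    show "0 \<in> h ` S" using 0 subgrp_0[OF assms(1)] by force
    fix x y assume "x \<in> h ` S" "y \<in> h ` S"
    then obtain u v where "u \<in> S" "v \<in> S" "x = h u" "y = h v" by auto
    then show "x - y \<in> h ` S"
      using d[of u v] subgrp_diff[OF assms(1), of u v] by (metis imageI)
  qed
qed

section \<open>Finite index as covering by finitely many translates\<close>

definition finite_index :: "'f::ab_group_add set \<Rightarrow> 'f set \<Rightarrow> bool" where
  "finite_index S U \<longleftrightarrow> (\<exists>F. finite F \<and> S \<subseteq> F + U)"

text \<open>A coset representative from \<open>F\<close> may lie outside
  \<open>S \<inter> B\<close>; it is exchanged for a point of \<open>S \<inter> B\<close> in the
  same coset of \<open>U\<close>. Two points of \<open>B\<close> in one coset of \<open>U\<close>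
  differ by an element of \<open>U \<inter> B\<close>.\<close>

lemma finite_index_Int:
  assumes "finite_index S U" "subgrp U" "subgrp B"
  shows "finite_index (S \<inter> B) (U \<inter> B)"
proof -
  obtain F where F: "finite F" "S \<subseteq> F + U"
    using assms(1) by (auto simp: finite_index_def)
  define g where "g f = (SOME y. y \<in> S \<inter> B \<and> y - f \<in> U)" for f
  have "S \<inter> B \<subseteq> g ` F + (U \<inter> B)"
  proof
    fix x assume x: "x \<in> S \<inter> B"
    then obtain f u where f: "f \<in> F" "u \<in> U" "x = f + u"
      using F(2) by (meson IntD1 set_plus_elim subsetD)
    have "g f \<in> S \<inter> B \<and> g f - f \<in> U"
      unfolding g_def by (rule someI[of _ x]) (use x f in auto)
    moreover have "x - g f = u - (g f - f)"
      using f by simp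
    ultimately have "x - g f \<in> U \<inter> B"
      using x f assms by (metis IntD2 IntI subgrp_diff)
    then have "g f + (x - g f) \<in> g ` F + (U \<inter> B)"
      using f by (intro set_plus_intro) auto
    then show "x \<in> g ` F + (U \<inter> B)" by simp
  qed
  then show ?thesis
    using F(1) by (auto simp: finite_index_def)
qed

lemma finite_index_mono: "finite_index S U \<Longrightarrow> S' \<subseteq> S \<Longrightarrow> U \<subseteq> U' \<Longrightarrow> finite_index S' U'"
  unfolding finite_index_def using set_plus_mono2[of _ _ U U'] by (meson order.trans order_refl)

lemma finite_index_refl: "finite_index U U"
  unfolding finite_index_def using subset_plus2[of "{0}" U] by (intro exI[of _ "{0}"]) auto

lemma finite_plus: "finite F \<Longrightarrow> finite F' \<Longrightarrow> finite (F + F')"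
  by (rule finite_set_plus)

lemma finite_index_plus:
  assumes "finite_index S U" "finite_index S' U" "subgrp U"
  shows "finite_index (S + S') U"
proof -
  obtain F F' where F: "finite F" "S \<subseteq> F + U" "finite F'" "S' \<subseteq> F' + U"
    using assms by (auto simp: finite_index_def)
  have "S + S' \<subseteq> (F + U) + (F' + U)"
    using F by (simp add: set_plus_mono2)
  also have "\<dots> = (F + F') + (U + U)"
    by (simp add: add_ac)
  finally show ?thesis
    using F subgrp_plus_idem[OF assms(3)] finite_plus[OF F(1,3)] unfolding finite_index_def by auto
qed

lemma finite_index_reps:
  assumes "finite_index S U" "subgrp S" "subgrp U" "U \<subseteq> S"
  obtains F where "finite F" "0 \<in> F" "F \<subseteq> S" "S = F + U"
proof -
  obtain F where F: "finite F" "S \<subseteq> F + U"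
    using assms by (auto simp: finite_index_def)
  let ?F = "insert 0 (F \<inter> S)"
  have "S \<subseteq> ?F + U"
  proof
    fix x assume x: "x \<in> S"
    then obtain f u where f: "f \<in> F" "u \<in> U" "x = f + u"
      using F(2) by (meson set_plus_elim subsetD)
    then have "f \<in> S" using x assms subgrp_add_iff2 by blast
    then show "x \<in> ?F + U" using f by auto
  qed
  moreover have "?F + U \<subseteq> S"
    using assms subgrp_0 by (intro subgrp_plus_least) auto
  ultimately show ?thesis
    using F that[of ?F] assms(2) subgrp_0 by auto
qed

section \<open>Natural multiples and generated subgroups\<close>

primrec nmul :: "nat \<Rightarrow> 'f::ab_group_add \<Rightarrow> 'f" where
  "nmul 0 x = 0"
| "nmul (Suc n) x = x + nmul n x"

lemma nmul_add: "nmul (m + n) x = nmul m x + nmul n x"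
  by (induct m) (simp_all add: add.assoc)

lemma nmul_distrib: "nmul n (x + y) = nmul n x + nmul n y"
  by (induct n) (simp_all add: algebra_simps)

lemma nmul_minus: "nmul n (- x) = - nmul n x"
  by (induct n) (simp_all add: algebra_simps)

lemma nmul_diff: "nmul n (x - y) = nmul n x - nmul n y"
  using nmul_distrib[of n x "- y"] by (simp add: nmul_minus)

lemma nmul_mult: "nmul (m * n) x = nmul m (nmul n x)"
  by (induct m) (simp_all add: nmul_add)

lemma nmul_zero [simp]: "nmul n 0 = 0"
  by (induct n) simp_all

lemma nmul_1 [simp]: "nmul 1 x = x" "nmul (Suc 0) x = x"
  by simp_all

lemma nmul_le_diff: "m \<le> n \<Longrightarrow> nmul (n - m) x = nmul n x - nmul m x"
  using nmul_add[of "n - m" m x] by (simp add: algebra_simps)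

lemma nmul_const: "(\<Sum>i\<in>I. x) = nmul (card I) x"
  by (induct I rule: infinite_finite_induct) auto

lemma nmul_hom:
  assumes "\<And>x y. h (x + y) = h x + (h y :: 'f::ab_group_add)"
  shows "h (nmul n x) = nmul n (h x)"
proof (induct n)
  case 0
  show ?case using assms[of 0 0] by simp
qed (simp add: assms)

lemma subgrp_nmul: "subgrp S \<Longrightarrow> x \<in> S \<Longrightarrow> nmul n x \<in> S"
  by (induct n) (auto intro: subgrp_closed)

definition gen :: "'f::ab_group_add set \<Rightarrow> 'f set" where
  "gen S = \<Inter>{H. subgrp H \<and> S \<subseteq> H}"

lemma subgrp_gen: "subgrp (gen S)"
  unfolding gen_def by (rule subgrp_Inter) auto

lemma gen_incl: "S \<subseteq> gen S"
  by (auto simp: gen_def)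

lemma gen_least: "subgrp H \<Longrightarrow> S \<subseteq> H \<Longrightarrow> gen S \<subseteq> H"
  by (auto simp: gen_def)

lemma gen_mono: "S \<subseteq> R \<Longrightarrow> gen S \<subseteq> gen R"
  using gen_incl[of R] by (intro gen_least subgrp_gen) auto

lemma gen_insert: "gen (insert f S) = gen {f} + gen S"
proof
  have "f \<in> gen {f} + gen S"
    using subset_plus1[OF subgrp_0[OF subgrp_gen[of S]], of "gen {f}"] gen_incl[of "{f}"] by auto
  moreover have "S \<subseteq> gen {f} + gen S"
    using subset_plus2[OF subgrp_0[OF subgrp_gen[of "{f}"]], of "gen S"] gen_incl[of S] by auto
  ultimately show "gen (insert f S) \<subseteq> gen {f} + gen S"
    by (intro gen_least subgrp_plus subgrp_gen) auto
  show "gen {f} + gen S \<subseteq> gen (insert f S)"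
    by (intro subgrp_plus_least subgrp_gen gen_mono) auto
qed

lemma gen_empty [simp]: "gen {} = {0}"
  using gen_least[of "{0}" "{}"] subgrp_0[OF subgrp_gen[of "{}"]] by (auto simp: subgrp_def)

lemma gen_singleton: "gen {f} = {nmul m f - nmul n f |m n. True}"
proof
  let ?H = "{nmul m f - nmul n f |m n. True}"
  have "subgrp ?H"
    unfolding subgrp_def
  proof (intro conjI ballI)
    show "0 \<in> ?H" by (auto intro!: exI[of _ 0])
    fix x y assume "x \<in> ?H" "y \<in> ?H"
    then obtain m n m' n' where "x = nmul m f - nmul n f" "y = nmul m' f - nmul n' f"
      by auto
    then have "x - y = nmul (m + n') f - nmul (n + m') f"
      by (simp add: nmul_add)
    then show "x - y \<in> ?H" by auto
  qed
  moreover have "f \<in> ?H" by (intro CollectI exI[of _ 1] exI[of _ 0]) simp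
  ultimately show "gen {f} \<subseteq> ?H"
    by (intro gen_least) auto
  show "?H \<subseteq> gen {f}"
    using gen_incl[of "{f}"] by (auto intro!: subgrp_diff subgrp_nmul subgrp_gen)
qed

lemma gen_singletonE:
  assumes "x \<in> gen {f}"
  obtains n where "x = nmul n f \<or> x = - nmul n f"
proof -
  obtain m n where mn: "x = nmul m f - nmul n f"
    using assms by (auto simp: gen_singleton)
  show ?thesis
  proof (cases "n \<le> m")
    case True
    then show ?thesis using mn that[of "m - n"] by (simp add: nmul_le_diff)
  next
    case False
    then show ?thesis using mn that[of "n - m"] by (simp add: nmul_le_diff)
  qed
qed

section \<open>Topological abelian groups\<close>

text \<open>No separation axiom is imposed: modules are represented on a free abelian group, with the
  topology pulled back from the module, so that the closure of zero is the kernel of the presentation.\<close>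

locale top_ab_group =
  fixes T :: "'f::ab_group_add topology"
  assumes topspace_UNIV [simp]: "topspace T = UNIV"
    and add_open: "\<And>U x y. openin T U \<Longrightarrow> x + y \<in> U \<Longrightarrow>
          \<exists>V W. openin T V \<and> openin T W \<and> x \<in> V \<and> y \<in> W \<and> (\<forall>v\<in>V. \<forall>w\<in>W. v + w \<in> U)"
    and minus_open: "\<And>U. openin T U \<Longrightarrow> openin T (uminus -` U)"
begin

lemma cont_add: "continuous_map (prod_topology T T) T (\<lambda>(x, y). x + y)"
  unfolding continuous_map
proof (intro conjI allI impI)
  fix U assume U: "openin T U"
  have *: "{x \<in> topspace (prod_topology T T). (case x of (x, y) \<Rightarrow> x + y) \<in> U} = {(x, y). x + y \<in> U}"
    by auto
  show "openin (prod_topology T T) {x \<in> topspace (prod_topology T T). (case x of (x, y) \<Rightarrow> x + y) \<in> U}"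
    unfolding * openin_prod_topology_alt
    using add_open[OF U] by (fastforce simp: subset_iff)
qed simp

lemma cont_minus: "continuous_map T T uminus"
  unfolding continuous_map using minus_open by (simp add: vimage_def)

lemma cont_translate: "continuous_map T T (\<lambda>x. c + x)"
proof -
  have "continuous_map T (prod_topology T T) (\<lambda>x. (c, x))"
    by (simp add: continuous_map_pairwise o_def)
  from continuous_map_compose[OF this cont_add] show ?thesis
    by (simp add: o_def)
qed

lemma open_vimage: "continuous_map T T h \<Longrightarrow> openin T U \<Longrightarrow> openin T {x. h x \<in> U}"
  by (simp add: continuous_map)

lemma open_translate: "openin T U \<Longrightarrow> openin T {x. c + x \<in> U}"
  by (rule open_vimage[OF cont_translate])

lemma open_translate': "openin T U \<Longrightarrow> openin T {x. x - c \<in> U}"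
  using open_translate[of U "- c"] by simp

lemma open_reflect: "openin T U \<Longrightarrow> openin T {x. c - x \<in> U}"
  using open_vimage[OF cont_minus open_translate[of U c]] by simp

lemma closed_vimage: "continuous_map T T h \<Longrightarrow> closedin T S \<Longrightarrow> closedin T {x. h x \<in> S}"
  using closedin_continuous_map_preimage[of T T h S] by simp

lemma closed_reflect: "closedin T S \<Longrightarrow> closedin T {x. c - x \<in> S}"
  using closed_vimage[OF cont_minus closed_vimage[OF cont_translate[of c]], of S] by simp

lemma closed_translate': "closedin T S \<Longrightarrow> closedin T {x. x - c \<in> S}"
  using closed_vimage[OF cont_translate[of "- c"], of S] by simp

lemma open_plus: "openin T U \<Longrightarrow> openin T (S + U)"
proof -
  assume U: "openin T U"
  have "S + U = (\<Union>s\<in>S. {x. x - s \<in> U})"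
    by (auto simp: set_plus_def) (metis add.commute diff_add_cancel)
  then show ?thesis
    using open_translate'[OF U] by (auto intro: openin_Union)
qed

lemma compact_plus: "compactin T C \<Longrightarrow> compactin T D \<Longrightarrow> compactin T (C + D)"
proof -
  assume "compactin T C" "compactin T D"
  then have "compactin (prod_topology T T) (C \<times> D)"
    by (simp add: compactin_Times)
  from image_compactin[OF this cont_add]
  have "compactin T ((\<lambda>(x, y). x + y) ` (C \<times> D))" .
  moreover have "(\<lambda>(x, y). x + y) ` (C \<times> D) = C + D"
    by (auto simp: set_plus_def image_iff)
  ultimately show ?thesis by simp
qed

section \<open>Neighbourhoods of zero, compactness and boundedness\<close>

definition small :: "'f set \<Rightarrow> bool" where
  "small U \<longleftrightarrow> openin T U \<and> 0 \<in> U"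

lemma smallD: "small U \<Longrightarrow> openin T U" "small U \<Longrightarrow> 0 \<in> U"
  by (auto simp: small_def)

lemma small_Int: "small U \<Longrightarrow> small V \<Longrightarrow> small (U \<inter> V)"
  by (auto simp: small_def)

lemma small_UNIV: "small UNIV"
  using openin_topspace[of T] by (simp add: small_def)

lemma small_Inter: "finite I \<Longrightarrow> (\<And>i. i \<in> I \<Longrightarrow> small (U i)) \<Longrightarrow> small (\<Inter>i\<in>I. U i)"
  by (induct I rule: finite_induct) (auto simp: small_UNIV small_Int)

lemma small_half:
  assumes "small U"
  obtains V where "small V" "\<And>x y. x \<in> V \<Longrightarrow> y \<in> V \<Longrightarrow> x + y \<in> U" "\<And>x. x \<in> V \<Longrightarrow> - x \<in> V"
proof -
  obtain V W where V: "openin T V" "openin T W" "0 \<in> V" "0 \<in> W" "\<forall>v\<in>V. \<forall>w\<in>W. v + w \<in> U"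
    using add_open[of U 0 0] assms by (auto simp: small_def)
  define N where "N = (V \<inter> W) \<inter> uminus -` (V \<inter> W)"
  have "small N"
    unfolding N_def small_def using V by (auto intro!: openin_Int minus_open)
  then show ?thesis
    by (rule that) (use V in \<open>auto simp: N_def\<close>)
qed

lemma small_quarter:
  assumes "small U"
  obtains V where "small V" "\<And>x y z w. x \<in> V \<Longrightarrow> y \<in> V \<Longrightarrow> z \<in> V \<Longrightarrow> w \<in> V \<Longrightarrow> x + y + z + w \<in> U"
    "\<And>x. x \<in> V \<Longrightarrow> - x \<in> V"
proof -
  obtain V where V: "small V" "\<And>x y. x \<in> V \<Longrightarrow> y \<in> V \<Longrightarrow> x + y \<in> U"
    using small_half[OF assms] by metis
  obtain W where W: "small W" "\<And>x y. x \<in> W \<Longrightarrow> y \<in> W \<Longrightarrow> x + y \<in> V" "\<And>x. x \<in> W \<Longrightarrow> - x \<in> W"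
    using small_half[OF V(1)] by metis
  show ?thesis
    by (rule that[OF W(1)]) (use V W in \<open>metis add.assoc\<close>)+
qed

lemma small_open_translate: "openin T G \<Longrightarrow> c \<in> G \<Longrightarrow> small {x. c + x \<in> G}"
  using open_translate by (simp add: small_def)

lemma small_nmul:
  assumes "small U"
  shows "\<exists>V. small V \<and> (\<forall>x\<in>V. \<forall>k\<le>n. nmul k x \<in> U)"
proof (induct n)
  case 0
  then show ?case using assms smallD by auto
next
  case (Suc n)
  obtain V where V: "small V" "\<And>x y. x \<in> V \<Longrightarrow> y \<in> V \<Longrightarrow> x + y \<in> U"
    using small_half[OF assms] by metis
  \<comment> \<open>The induction hypothesis speaks of \<open>U\<close>, while a sum of two terms in
    \<open>U\<close> calls for multiples inside the half-size \<open>V\<close>; hence a second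
    induction in which the neighbourhood stays arbitrary.\<close>
  have "\<exists>W. small W \<and> (\<forall>x\<in>W. \<forall>k\<le>n. nmul k x \<in> W')" if "small W'" for W'
    using that
  proof (induct n arbitrary: W')
    case (Suc n)
    obtain V where V: "small V" "\<And>x y. x \<in> V \<Longrightarrow> y \<in> V \<Longrightarrow> x + y \<in> W'"
      using small_half[OF Suc.prems] by metis
    obtain W where W: "small W" "\<forall>x\<in>W. \<forall>k\<le>n. nmul k x \<in> V"
      using Suc.hyps[OF V(1)] by auto
    have "nmul k x \<in> W'" if "x \<in> W \<inter> V" "k \<le> Suc n" for x k
    proof (cases k)
      case 0
      then show ?thesis using smallD(2)[OF Suc.prems] by simp
    next
      case (Suc j)
      then show ?thesis using that V W by auto
    qed
    then show ?case using small_Int[OF W(1) V(1)] by blast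
  qed (use smallD in auto)
  from this[OF V(1)] obtain W where W: "small W" "\<forall>x\<in>W. \<forall>k\<le>n. nmul k x \<in> V"
    by auto
  have "nmul k x \<in> U" if "x \<in> W \<inter> V" "k \<le> Suc n" for x k
  proof (cases k)
    case 0
    then show ?thesis using smallD(2)[OF assms] by simp
  next
    case (Suc j)
    then show ?thesis using that V W by auto
  qed
  then show ?case using small_Int[OF W(1) V(1)] by blast
qed

lemma closed_separate:
  assumes "closedin T S" "x \<notin> S"
  shows "\<exists>V. small V \<and> (\<forall>v\<in>V. x + v \<notin> S)"
proof -
  have "openin T (- S)"
    using assms(1) by (simp add: closedin_def Compl_eq_Diff_UNIV)
  then have "small {v. x + v \<in> - S}"
    using assms(2) by (intro small_open_translate) auto
  then show ?thesis by (rule exI[of _ "{v. x + v \<in> - S}", OF conjI]) auto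
qed

lemma closedI:
  assumes "\<And>x. x \<notin> S \<Longrightarrow> \<exists>V. small V \<and> (\<forall>v\<in>V. x + v \<notin> S)"
  shows "closedin T S"
proof -
  have "openin T (- S)"
  proof (subst openin_subopen, intro ballI)
    fix x assume "x \<in> - S"
    then obtain V where V: "small V" "\<forall>v\<in>V. x + v \<notin> S"
      using assms by auto
    have "openin T {y. y - x \<in> V}" "x \<in> {y. y - x \<in> V}"
      using V open_translate' by (auto simp: small_def)
    moreover have "{y. y - x \<in> V} \<subseteq> - S"
    proof
      fix y assume "y \<in> {y. y - x \<in> V}"
      then have "x + (y - x) \<notin> S" using V by blast
      then show "y \<in> - S" by simp
    qed
    ultimately show "\<exists>R. openin T R \<and> x \<in> R \<and> R \<subseteq> - S" by blast
  qed
  then show ?thesis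
    by (simp add: closedin_def Compl_eq_Diff_UNIV)
qed

lemma compact_cover_gen:
  assumes "compactin T C" "\<And>c. c \<in> C \<Longrightarrow> small (V c)"
  obtains F where "finite F" "F \<subseteq> C" "\<And>x. x \<in> C \<Longrightarrow> \<exists>c\<in>F. x - c \<in> V c"
proof -
  let ?U = "\<lambda>c. {x. x - c \<in> V c}"
  have 1: "\<forall>U\<in>?U ` C. openin T U"
    using open_translate'[OF smallD(1)[OF assms(2)]] by auto
  have 2: "C \<subseteq> \<Union>(?U ` C)"
    using smallD(2)[OF assms(2)] by auto
  obtain \<F> where \<F>: "finite \<F>" "\<F> \<subseteq> ?U ` C" "C \<subseteq> \<Union>\<F>"
    using assms(1) 1 2 unfolding compactin_def by meson
  obtain F where F: "finite F" "F \<subseteq> C" "\<F> = ?U ` F"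
    using finite_subset_image[OF \<F>(1,2)] by auto
  show ?thesis
    by (rule that[OF F(1,2)]) (use \<F>(3) F(3) in auto)
qed

lemma compact_cover:
  assumes "compactin T C" "small U"
  obtains F where "finite F" "F \<subseteq> C" "C \<subseteq> F + U"
proof -
  obtain F where F: "finite F" "F \<subseteq> C" "\<And>x. x \<in> C \<Longrightarrow> \<exists>c\<in>F. x - c \<in> U"
    using compact_cover_gen[OF assms(1), of "\<lambda>_. U"] assms(2) by metis
  have "C \<subseteq> F + U"
  proof
    fix x assume "x \<in> C"
    then obtain c where "c \<in> F" "x - c \<in> U" using F by auto
    then have "c + (x - c) \<in> F + U" by (intro set_plus_intro)
    then show "x \<in> F + U" by simp
  qed
  then show ?thesis using that F by blast
qed

text \<open>Finite intersection property for the closed sets \<open>A - G\<close>: if no member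
  satisfied the conclusion, directedness would give them a common point in \<open>C\<close>, against
  the hypothesis on the full intersection.\<close>

lemma compact_directed:
  assumes C: "compactin T C" and ne: "\<U> \<noteq> {}" and cl: "\<And>A. A \<in> \<U> \<Longrightarrow> closedin T A"
    and dir: "\<And>A B. A \<in> \<U> \<Longrightarrow> B \<in> \<U> \<Longrightarrow> \<exists>D\<in>\<U>. D \<subseteq> A \<inter> B"
    and G: "openin T G" "C \<inter> \<Inter>\<U> \<subseteq> G"
  shows "\<exists>A\<in>\<U>. C \<inter> A \<subseteq> G"
proof (rule ccontr)
  assume "\<not> ?thesis"
  then have no: "\<And>A. A \<in> \<U> \<Longrightarrow> \<not> C \<inter> A \<subseteq> G" by blast
  have fin: "\<exists>D\<in>\<U>. D \<subseteq> \<Inter>\<F>" if "finite \<F>" "\<F> \<subseteq> \<U>" for \<F>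
    using that
  proof (induct rule: finite_induct)
    case empty
    then show ?case using ne by auto
  next
    case (insert A \<F>)
    then obtain D where D: "D \<in> \<U>" "D \<subseteq> \<Inter>\<F>" by auto
    moreover have "A \<in> \<U>" using insert.prems by simp
    ultimately obtain E where "E \<in> \<U>" "E \<subseteq> A \<inter> D" using dir by meson
    then show ?case using D by (intro bexI[of _ E]) auto
  qed
  have clG: "closedin T (- G)"
    using G by (simp add: closedin_def Compl_eq_Diff_UNIV[symmetric])
  have "C \<inter> \<Inter>((\<lambda>A. A - G) ` \<U>) \<noteq> {}"
  proof -
    have a: "\<forall>B\<in>(\<lambda>A. A - G) ` \<U>. closedin T B"
      using cl clG by (auto simp: Diff_eq intro: closedin_Int)
    have b: "C \<inter> \<Inter>\<F> \<noteq> {}" if \<F>: "finite \<F>" "\<F> \<subseteq> (\<lambda>A. A - G) ` \<U>" for \<F>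
    proof -
      obtain \<F>' where F': "finite \<F>'" "\<F>' \<subseteq> \<U>" "\<F> = (\<lambda>A. A - G) ` \<F>'"
        using \<F> by (meson finite_subset_image)
      then obtain D where D: "D \<in> \<U>" "D \<subseteq> \<Inter>\<F>'" using fin by blast
      then show ?thesis using no[OF D(1)] F' by auto
    qed
    show ?thesis
      using C a b unfolding compactin_fip by blast
  qed
  then show False using G ne by auto
qed

definition zcl :: "'f set" where
  "zcl = T closure_of {0}"

lemma closed_zcl: "closedin T zcl"
  by (simp add: zcl_def)

lemma in_zclD: "z \<in> zcl \<Longrightarrow> openin T U \<Longrightarrow> z \<in> U \<Longrightarrow> 0 \<in> U"
  by (auto simp: zcl_def in_closure_of)

lemma zcl_in_open: "z \<in> zcl \<Longrightarrow> openin T U \<Longrightarrow> x \<in> U \<Longrightarrow> x - z \<in> U"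
proof -
  assume z: "z \<in> zcl" and U: "openin T U" "x \<in> U"
  have "openin T {y. (x - z) + y \<in> U}" "z \<in> {y. (x - z) + y \<in> U}"
    using open_translate[OF U(1)] U by auto
  then have "0 \<in> {y. (x - z) + y \<in> U}"
    by (rule in_zclD[OF z])
  then show ?thesis by simp
qed

lemma in_zclI: "(\<And>U. small U \<Longrightarrow> - z \<in> U) \<Longrightarrow> z \<in> zcl"
  unfolding zcl_def in_closure_of
proof (intro conjI allI impI)
  fix U assume *: "\<And>U. small U \<Longrightarrow> - z \<in> U" and "z \<in> U \<and> openin T U"
  then have "- z \<in> {x. z + x \<in> U}" by (intro *) (auto intro: small_open_translate)
  then show "\<exists>y. y \<in> {0} \<and> y \<in> U" by simp
qed simp

lemma subgrp_zcl: "subgrp zcl"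
  unfolding subgrp_def
proof (intro conjI ballI)
  show "0 \<in> zcl" by (rule in_zclI) (simp add: small_def)
  have m: "- y \<in> zcl" if "y \<in> zcl" for y
  proof (rule in_zclI)
    fix U assume "small U"
    then have "0 - y \<in> uminus -` U"
      by (intro zcl_in_open[OF that] minus_open) (auto simp: small_def)
    then show "- (- y) \<in> U" by simp
  qed
  fix x y assume xy: "x \<in> zcl" "y \<in> zcl"
  show "x - y \<in> zcl"
  proof (rule in_zclI)
    fix U assume U: "small U"
    then have "0 - x \<in> U" by (intro zcl_in_open[OF xy(1)]) (auto simp: small_def)
    then have "(0 - x) - (- y) \<in> U"
      using U by (intro zcl_in_open[OF m[OF xy(2)]]) (auto simp: small_def)
    then show "- (x - y) \<in> U" by simp
  qed
qed

text \<open>Open sets are unions of cosets of \<open>zcl\<close>: the topology is that of the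
  Hausdorff quotient, pulled back.\<close>

lemma zcl_open: "openin T U \<Longrightarrow> U + zcl = U"
proof (intro equalityI subsetI)
  fix x assume U: "openin T U" and "x \<in> U + zcl"
  then obtain u z where "x = u + z" "u \<in> U" "z \<in> zcl" by (auto elim: set_plus_elim)
  then show "x \<in> U" using zcl_in_open[OF subgrp_minus[OF subgrp_zcl] U, of z u] by simp
next
  fix x assume "x \<in> U"
  then show "x \<in> U + zcl" using subset_plus1[OF subgrp_0[OF subgrp_zcl]] by auto
qed

lemma zcl_subset: "closedin T S \<Longrightarrow> 0 \<in> S \<Longrightarrow> zcl \<subseteq> S"
  unfolding zcl_def by (simp add: closure_of_minimal)

lemma closed_plus_compact:
  assumes S: "closedin T S" and C: "compactin T C"
  shows "closedin T (S + C)"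
proof (rule closedI)
  fix x assume x: "x \<notin> S + C"
  have "\<exists>V. small V \<and> (\<forall>v\<in>V. \<forall>w\<in>V. (x - c) + (v + w) \<notin> S) \<and> (\<forall>v\<in>V. - v \<in> V)" if "c \<in> C" for c
  proof -
    have "x - c \<notin> S"
      using x that set_plus_intro[of "x - c" S c C] by auto
    then obtain U where U: "small U" "\<And>v. v \<in> U \<Longrightarrow> x - c + v \<notin> S"
      using closed_separate[OF S, of "x - c"] by blast
    obtain V where "small V" "\<And>x y. x \<in> V \<Longrightarrow> y \<in> V \<Longrightarrow> x + y \<in> U" "\<And>x. x \<in> V \<Longrightarrow> - x \<in> V"
      using small_half[OF U(1)] by metis
    then show ?thesis using U by blast
  qed
  then obtain V where V: "\<And>c. c \<in> C \<Longrightarrow> small (V c)"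
    "\<And>c v w. c \<in> C \<Longrightarrow> v \<in> V c \<Longrightarrow> w \<in> V c \<Longrightarrow> (x - c) + (v + w) \<notin> S"
    "\<And>c v. c \<in> C \<Longrightarrow> v \<in> V c \<Longrightarrow> - v \<in> V c"
    by metis
  obtain F where F: "finite F" "F \<subseteq> C" "\<And>y. y \<in> C \<Longrightarrow> \<exists>c\<in>F. y - c \<in> V c"
    using compact_cover_gen[OF C, of V] V(1) by metis
  let ?V = "\<Inter>c\<in>F. V c"
  have "small ?V" using F V by (intro small_Inter) auto
  moreover have "x + v \<notin> S + C" if v: "v \<in> ?V" for v
  proof
    assume "x + v \<in> S + C"
    then obtain s c where s: "x + v = s + c" "s \<in> S" "c \<in> C" by (auto elim: set_plus_elim)
    then obtain d where d: "d \<in> F" "c - d \<in> V d" using F by auto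
    then have "(x - d) + (v + - (c - d)) \<notin> S"
      using V F v by blast
    moreover have "(x - d) + (v + - (c - d)) = (x + v) - c"
      by (simp add: algebra_simps)
    ultimately show False using s by simp
  qed
  ultimately show "\<exists>V. small V \<and> (\<forall>v\<in>V. x + v \<notin> S + C)" by blast
qed

lemma compact_plus_zcl: "compactin T C \<Longrightarrow> compactin T (C + zcl)"
  unfolding compactin_def
proof (intro conjI allI impI)
  fix \<U> assume C: "C \<subseteq> topspace T \<and> (\<forall>\<U>. (\<forall>U\<in>\<U>. openin T U) \<and> C \<subseteq> \<Union>\<U> \<longrightarrow> (\<exists>\<F>. finite \<F> \<and> \<F> \<subseteq> \<U> \<and> C \<subseteq> \<Union>\<F>))"
    and U: "(\<forall>U\<in>\<U>. openin T U) \<and> C + zcl \<subseteq> \<Union>\<U>"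
  have "C \<subseteq> \<Union>\<U>" using U subset_plus1[OF subgrp_0[OF subgrp_zcl], of C] by auto
  then obtain \<F> where F: "finite \<F>" "\<F> \<subseteq> \<U>" "C \<subseteq> \<Union>\<F>" using C U by meson
  have "openin T (\<Union>\<F>)" using F U by auto
  then have "C + zcl \<subseteq> \<Union>\<F>"
    using zcl_open[of "\<Union>\<F>"] set_plus_mono2[OF F(3), of zcl zcl] by simp
  then show "\<exists>\<F>. finite \<F> \<and> \<F> \<subseteq> \<U> \<and> C + zcl \<subseteq> \<Union>\<F>" using F by blast
qed auto

text \<open>Relative compactness. A closed superset is demanded because compact sets need not be
  closed without a separation axiom; adding \<open>zcl\<close> to a compact set makes it closed and
  keeps it compact, see \<open>compact_bounded\<close>.\<close>

definition bounded_set :: "'f set \<Rightarrow> bool" where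
  "bounded_set S \<longleftrightarrow> (\<exists>C. compactin T C \<and> closedin T C \<and> S \<subseteq> C)"

lemma compact_bounded: "compactin T C \<Longrightarrow> S \<subseteq> C \<Longrightarrow> bounded_set S"
  unfolding bounded_set_def
  using compact_plus_zcl[of C] closed_plus_compact[OF closed_zcl, of C]
    subset_plus1[OF subgrp_0[OF subgrp_zcl], of C]
  by (metis add.commute order.trans)

lemma bounded_subset: "bounded_set S \<Longrightarrow> R \<subseteq> S \<Longrightarrow> bounded_set R"
  unfolding bounded_set_def by blast

lemma bounded_setE:
  assumes "bounded_set S"
  obtains C where "compactin T C" "closedin T C" "S \<subseteq> C"
  using assms by (auto simp: bounded_set_def)

lemma bounded_closed_compact: "bounded_set S \<Longrightarrow> closedin T S \<Longrightarrow> compactin T S"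
  by (metis bounded_setE closed_compactin)

lemma bounded_plus: "bounded_set S \<Longrightarrow> bounded_set R \<Longrightarrow> bounded_set (S + R)"
  by (metis bounded_setE compact_bounded compact_plus set_plus_mono2)

lemma bounded_Un: "bounded_set S \<Longrightarrow> bounded_set R \<Longrightarrow> bounded_set (S \<union> R)"
  by (metis bounded_setE compact_bounded compactin_Un sup_mono)

lemma bounded_finite: "finite F \<Longrightarrow> bounded_set F"
  by (rule compact_bounded[of F]) (auto intro: finite_imp_compactin)

lemma bounded_image: "bounded_set S \<Longrightarrow> continuous_map T T h \<Longrightarrow> bounded_set (h ` S)"
  by (metis bounded_setE compact_bounded image_compactin image_mono)

lemma bounded_uminus: "bounded_set S \<Longrightarrow> bounded_set (uminus ` S)"
  by (rule bounded_image[OF _ cont_minus])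

text \<open>Neighbourhoods of 0 in the subspace \<open>Y\<close>, phrased through the ambient
  topology so that moving between submodules involves no subtopology. \<open>U\<close> need not lie
  in \<open>Y\<close>.\<close>

definition nb :: "'f set \<Rightarrow> 'f set \<Rightarrow> bool" where
  "nb Y U \<longleftrightarrow> (\<exists>G. small G \<and> Y \<inter> G \<subseteq> U)"

lemma nbE: "nb Y U \<Longrightarrow> (\<And>G. small G \<Longrightarrow> Y \<inter> G \<subseteq> U \<Longrightarrow> thesis) \<Longrightarrow> thesis"
  by (auto simp: nb_def)

lemma nbI: "small G \<Longrightarrow> Y \<inter> G \<subseteq> U \<Longrightarrow> nb Y U"
  by (auto simp: nb_def)

lemma nb_Int: "nb Y U \<Longrightarrow> nb Y V \<Longrightarrow> nb Y (U \<inter> V)"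
  by (fastforce elim!: nbE intro: nbI[OF small_Int])

lemma nb_mono: "nb Y U \<Longrightarrow> U \<subseteq> V \<Longrightarrow> nb Y V"
  by (auto simp: nb_def)

lemma nb_sub: "nb Y U \<Longrightarrow> Z \<subseteq> Y \<Longrightarrow> nb Z (U \<inter> Z)"
  by (fastforce simp: nb_def)

lemma nb_self: "nb Y Y"
  using small_UNIV by (auto simp: nb_def)

lemma nb_vimage:
  assumes "nb Y U" "continuous_map T T h" "h 0 = 0" "h ` Y \<subseteq> Y"
  shows "nb Y {x. h x \<in> U}"
proof -
  obtain G where G: "small G" "Y \<inter> G \<subseteq> U" using assms(1) by (rule nbE)
  have "small {x. h x \<in> G}"
    using open_vimage[OF assms(2) smallD(1)[OF G(1)]] smallD(2)[OF G(1)] assms(3) by (simp add: small_def)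
  then show ?thesis by (rule nbI) (use G assms(4) in auto)
qed

lemma closed_nb_subgrp:
  assumes "subgrp U" "nb Y U" "U \<subseteq> Y" "closedin T Y" "subgrp Y"
  shows "closedin T U"
proof (rule closedI)
  fix x assume x: "x \<notin> U"
  show "\<exists>V. small V \<and> (\<forall>v\<in>V. x + v \<notin> U)"
  proof (cases "x \<in> Y")
    case False
    obtain V where V: "small V" "\<forall>v\<in>V. x + v \<notin> Y"
      using closed_separate[OF assms(4) False] by auto
    show ?thesis by (rule exI[of _ V]) (use V assms(3) in auto)
  next
    case True
    obtain G where G: "small G" "Y \<inter> G \<subseteq> U" using assms(2) by (rule nbE)
    have "x + v \<notin> U" if v: "v \<in> G" for v
    proof
      assume xv: "x + v \<in> U"
      then have "x + v - x \<in> Y" using True assms subgrp_diff by blast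
      then have "v \<in> U" using v G by auto
      then show False using subgrp_diff[OF assms(1) xv] x by fastforce
    qed
    then show ?thesis using G(1) by auto
  qed
qed

lemma compact_cover_nb:
  assumes "compactin T C" "C \<subseteq> Y" "subgrp Y" "nb Y U"
  obtains F where "finite F" "F \<subseteq> C" "C \<subseteq> F + U"
proof -
  obtain G where G: "small G" "Y \<inter> G \<subseteq> U" using assms(4) by (rule nbE)
  obtain F where F: "finite F" "F \<subseteq> C" "C \<subseteq> F + G"
    using compact_cover[OF assms(1) G(1)] by metis
  have "C \<subseteq> F + U"
  proof
    fix x assume x: "x \<in> C"
    then obtain f g where fg: "x = f + g" "f \<in> F" "g \<in> G" using F by (meson set_plus_elim subsetD)
    then have "g \<in> Y" using x F assms subgrp_add_iff1 by blast
    then show "x \<in> F + U" using fg G by auto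
  qed
  then show ?thesis using that F by blast
qed

lemma bounded_cover_nb:
  assumes "bounded_set C" "C \<subseteq> Y" "closedin T Y" "subgrp Y" "nb Y U"
  obtains F where "finite F" "F \<subseteq> Y" "C \<subseteq> F + U"
proof -
  obtain D where D: "compactin T D" "closedin T D" "C \<subseteq> D" using assms(1) by (rule bounded_setE)
  have "compactin T (D \<inter> Y)" using D assms(3) by (metis closed_compactin closedin_Int inf_le1)
  then obtain F where "finite F" "F \<subseteq> D \<inter> Y" "D \<inter> Y \<subseteq> F + U"
    by (rule compact_cover_nb[OF _ _ assms(4,5)]) auto
  then show ?thesis using that[of F] D assms(2) by blast
qed

lemma subgrp_closure: "subgrp S \<Longrightarrow> subgrp (T closure_of S)"
proof -
  assume S: "subgrp S"
  have *: "x \<in> T closure_of S \<longleftrightarrow> (\<forall>U. small U \<longrightarrow> (\<exists>u\<in>U. x + u \<in> S))" for x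
  proof
    assume x: "x \<in> T closure_of S"
    show "\<forall>U. small U \<longrightarrow> (\<exists>u\<in>U. x + u \<in> S)"
    proof (intro allI impI)
      fix U assume "small U"
      then have "openin T {y. y - x \<in> U}" "x \<in> {y. y - x \<in> U}"
        using open_translate' by (auto simp: small_def)
      then obtain y where "y \<in> S" "y \<in> {y. y - x \<in> U}" using x unfolding in_closure_of by metis
      then show "\<exists>u\<in>U. x + u \<in> S" by (intro bexI[of _ "y - x"]) auto
    qed
  next
    assume "\<forall>U. small U \<longrightarrow> (\<exists>u\<in>U. x + u \<in> S)"
    then show "x \<in> T closure_of S"
      unfolding in_closure_of using small_open_translate by fastforce
  qed
  show ?thesis
    unfolding subgrp_def
  proof (intro conjI ballI)
    show "0 \<in> T closure_of S" using subgrp_0[OF S] closure_of_subset[of S T] by auto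
    fix x y assume xy: "x \<in> T closure_of S" "y \<in> T closure_of S"
    show "x - y \<in> T closure_of S"
      unfolding *
    proof (intro allI impI)
      fix U assume "small U"
      then obtain V where V: "small V" "\<And>x y. x \<in> V \<Longrightarrow> y \<in> V \<Longrightarrow> x + y \<in> U" "\<And>x. x \<in> V \<Longrightarrow> - x \<in> V"
        using small_half by metis
      obtain u v where uv: "u \<in> V" "x + u \<in> S" "v \<in> V" "y + v \<in> S"
        using xy V(1) unfolding * by blast
      have "u + - v \<in> U" using uv V by blast
      moreover have "(x - y) + (u + - v) = (x + u) - (y + v)" by simp
      ultimately show "\<exists>u\<in>U. x - y + u \<in> S" using uv S by (metis subgrp_diff)
    qed
  qed
qed

end

section \<open>Compactly generated groups\<close>

locale lc_ab_group = top_ab_group T for T :: "'f::ab_group_add topology" +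
  assumes locally_compact: "\<exists>G C. small G \<and> compactin T C \<and> G \<subseteq> C"
begin

lemma compact_nb:
  assumes "closedin T Y" "subgrp Y"
  obtains V where "compactin T V" "closedin T V" "V \<subseteq> Y" "nb Y V" "0 \<in> V" "\<And>x. x \<in> V \<Longrightarrow> - x \<in> V"
proof -
  obtain G C where G: "small G" "compactin T C" "G \<subseteq> C"
    using locally_compact by auto
  then obtain D where D: "compactin T D" "closedin T D" "G \<subseteq> D"
    using compact_bounded bounded_setE by metis
  define V where "V = (D \<inter> {x. - x \<in> D}) \<inter> Y"
  have cl: "closedin T V"
    unfolding V_def using D(2) assms(1) closed_vimage[OF cont_minus D(2)] by (auto intro!: closedin_Int)
  show ?thesis
  proof (rule that)
    show "closedin T V" by (rule cl)
    show "compactin T V" using closed_compactin[OF D(1) _ cl] by (auto simp: V_def)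
    have "small (G \<inter> uminus -` G)"
      using G(1) minus_open by (intro small_Int) (auto simp: small_def)
    then show "nb Y V" by (rule nbI) (use D in \<open>auto simp: V_def\<close>)
    show "0 \<in> V" using smallD(2)[OF G(1)] D subgrp_0[OF assms(2)] by (auto simp: V_def)
  qed (use subgrp_minus[OF assms(2)] in \<open>auto simp: V_def\<close>)
qed

text \<open>Pigeonhole: finitely many translates of \<open>W\<close> cover the bounded set, so
  infinitely many multiples fall, modulo \<open>L\<close>, into one translate, and the difference of
  two of them is small. Infinitely many indices leave room for a gap larger than
  \<open>N\<close>.\<close>

lemma recurrent_multiples:
  assumes L: "subgrp L" and C: "bounded_set C" and inf: "infinite {n. nmul n f \<in> C + L}" and U: "small U"
  shows "\<exists>n>N. nmul n f \<in> U + L"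
proof -
  obtain W where W: "small W" "\<And>x y. x \<in> W \<Longrightarrow> y \<in> W \<Longrightarrow> x + y \<in> U" "\<And>x. x \<in> W \<Longrightarrow> - x \<in> W"
    using small_half[OF U] by metis
  obtain D where D: "compactin T D" "C \<subseteq> D" using C by (rule bounded_setE)
  obtain F where F: "finite F" "D \<subseteq> F + W" using compact_cover[OF D(1) W(1)] by metis
  let ?S = "{n. nmul n f \<in> C + L}"
  have "\<exists>\<phi>\<in>F. \<exists>w\<in>W. \<exists>l\<in>L. nmul n f = \<phi> + w + l" if nS: "n \<in> ?S" for n
  proof -
    obtain c l where cl: "nmul n f = c + l" "c \<in> C" "l \<in> L"
      using nS unfolding mem_Collect_eq by (rule set_plus_elim)
    obtain \<phi> w where "c = \<phi> + w" "\<phi> \<in> F" "w \<in> W"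
      using cl(2) D(2) F(2) by (meson set_plus_elim subsetD)
    then show ?thesis using cl by blast
  qed
  then obtain \<phi> where phi: "\<And>n. n \<in> ?S \<Longrightarrow> \<phi> n \<in> F \<and> (\<exists>w\<in>W. \<exists>l\<in>L. nmul n f = \<phi> n + w + l)"
    by metis
  have "\<exists>y\<in>\<phi> ` ?S. infinite (\<phi> -` {y} \<inter> ?S)"
    using inf F(1) phi by (intro inf_img_fin_dom') (auto intro: finite_subset)
  then obtain y where y: "infinite (\<phi> -` {y} \<inter> ?S)" by auto
  then obtain m where m: "m \<in> \<phi> -` {y} \<inter> ?S" by (meson finite.emptyI infinite_super subsetI)
  obtain n where n: "n \<in> \<phi> -` {y} \<inter> ?S" "n > m + N"
    using y by (meson infinite_nat_iff_unbounded)
  obtain w l w' l' where *: "nmul m f = y + w + l" "nmul n f = y + w' + l'" "w \<in> W" "w' \<in> W" "l \<in> L" "l' \<in> L"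
    using phi m n by (metis (no_types, lifting) IntD1 IntD2 vimage_singleton_eq)
  have "nmul (n - m) f = (w' + - w) + (l' - l)"
    using * n(2) by (simp add: nmul_le_diff)
  then have "nmul (n - m) f \<in> U + L"
    using * W subgrp_diff[OF L] by (metis set_plus_intro)
  then show ?thesis using n(2) by (intro exI[of _ "n - m"]) auto
qed

text \<open>A cyclic group meeting a compact set infinitely often returns to each neighbourhood with
  bounded gaps, hence is relatively compact.\<close>

lemma recurrent_bounded:
  assumes Y: "closedin T Y" "subgrp Y" and f: "f \<in> Y" and L: "subgrp L" "L \<subseteq> Y"
    and C: "bounded_set C" and inf: "infinite {n. nmul n f \<in> C + L}"
  shows "\<exists>C'. bounded_set C' \<and> (\<forall>n. nmul n f \<in> C' + L)"
proof -
  obtain V where V: "compactin T V" "closedin T V" "V \<subseteq> Y" "nb Y V" "\<And>x. x \<in> V \<Longrightarrow> - x \<in> V"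
    using compact_nb[OF Y] by metis
  obtain G where G: "small G" "Y \<inter> G \<subseteq> V" using V(4) by (rule nbE)
  obtain W where W: "small W" "\<And>x y z w. x \<in> W \<Longrightarrow> y \<in> W \<Longrightarrow> z \<in> W \<Longrightarrow> w \<in> W \<Longrightarrow> x + y + z + w \<in> G"
    "\<And>x. x \<in> W \<Longrightarrow> - x \<in> W"
    using small_quarter[OF G(1)] by metis
  have rec: "\<exists>n>N. \<exists>u\<in>U. \<exists>l\<in>L. nmul n f = u + l" if "small U" for U N
    using recurrent_multiples[OF L(1) C inf that, of N] by (auto elim!: set_plus_elim)
  define H where "H = T closure_of (gen {f} + L)"
  have gfL: "subgrp (gen {f} + L)" by (intro subgrp_plus subgrp_gen L)
  have H: "closedin T H" "subgrp H" "gen {f} + L \<subseteq> H"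
    using subgrp_closure[OF gfL] closure_of_subset[of "gen {f} + L" T] by (auto simp: H_def)
  \<comment> \<open>A point of \<open>H\<close> is close, modulo \<open>L\<close>, to some
    \<open>k f\<close> or \<open>- k f\<close>. Adding a return time \<open>n > k\<close> changes
    little and makes the coefficient, now \<open>n + k\<close> or \<open>n - k\<close>,
    positive.\<close>
  have step: "\<exists>n\<ge>1. h - nmul n f \<in> G + L" if h: "h \<in> H" for h
  proof -
    have "openin T {y. y - h \<in> W}" "h \<in> {y. y - h \<in> W}"
      using W(1) open_translate' by (auto simp: small_def)
    then obtain y where y: "y \<in> gen {f} + L" "y - h \<in> W"
      using h unfolding H_def in_closure_of by (metis mem_Collect_eq)
    then obtain g l where gl: "y = g + l" "g \<in> gen {f}" "l \<in> L" by (auto elim: set_plus_elim)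
    then obtain k where k: "g = nmul k f \<or> g = - nmul k f" by (auto elim: gen_singletonE)
    obtain n u l' where n: "n > k" "u \<in> W" "l' \<in> L" "nmul n f = u + l'" using rec[OF W(1), of k] by auto
    have in_G: "- (y - h) + - u \<in> G"
      using W(2)[OF W(3)[OF y(2)] W(3)[OF n(2)] smallD(2)[OF W(1)] smallD(2)[OF W(1)]] by simp
    have in_L: "l - l' \<in> L" using subgrp_diff[OF L(1) gl(3) n(3)] .
    from k show ?thesis
    proof
      assume g: "g = nmul k f"
      have "h - nmul (n + k) f = (- (y - h) + - u) + (l - l')"
        by (simp add: nmul_add n(4) gl(1) g)
      then have "h - nmul (n + k) f \<in> G + L" using in_G in_L by (metis set_plus_intro)
      then show ?thesis using n(1) by (intro exI[of _ "n + k"]) auto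
    next
      assume g: "g = - nmul k f"
      have "h - nmul (n - k) f = (- (y - h) + - u) + (l - l')"
        using n(1) by (simp add: nmul_le_diff n(4) gl(1) g)
      then have "h - nmul (n - k) f \<in> G + L" using in_G in_L by (metis set_plus_intro)
      then show ?thesis using n(1) by (intro exI[of _ "n - k"]) auto
    qed
  qed
  then obtain \<nu> where nu: "\<And>h. h \<in> H \<Longrightarrow> \<nu> h \<ge> 1 \<and> h - nmul (\<nu> h) f \<in> G + L" by metis
  have GL: "openin T (G + L)" using open_plus[OF smallD(1)[OF G(1)], of L] by (simp add: add.commute)
  have "compactin T (V \<inter> H)" using V(1,2) H(1) by (metis closed_compactin closedin_Int inf_le1)
  moreover have "small {x. (h - nmul (\<nu> h) f) + x \<in> G + L}" if "h \<in> V \<inter> H" for h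
    using nu[of h] that by (intro small_open_translate GL) auto
  ultimately obtain F where F: "finite F" "F \<subseteq> V \<inter> H"
    "\<And>x. x \<in> V \<inter> H \<Longrightarrow> \<exists>h\<in>F. x - h \<in> {x. (h - nmul (\<nu> h) f) + x \<in> G + L}"
    using compact_cover_gen[of "V \<inter> H" "\<lambda>h. {x. (h - nmul (\<nu> h) f) + x \<in> G + L}"] by metis
  \<comment> \<open>By compactness of \<open>V \<inter> H\<close> finitely many return times
    suffice, and \<open>N\<close> bounds the gaps; the inserted 1 keeps the maximum meaningful for
    empty \<open>F\<close>.\<close>
  define N where "N = Max (insert 1 (\<nu> ` F))"
  have ret: "\<exists>i. 1 \<le> i \<and> i \<le> N \<and> v - nmul i f \<in> G + L" if v: "v \<in> V \<inter> H" for v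
  proof -
    obtain h where h: "h \<in> F" "(h - nmul (\<nu> h) f) + (v - h) \<in> G + L" using F(3)[OF v] by auto
    have "\<nu> h \<le> N" unfolding N_def using h(1) F(1) by (intro Max_ge) auto
    moreover have "1 \<le> \<nu> h" using nu h(1) F(2) by blast
    moreover have "(h - nmul (\<nu> h) f) + (v - h) = v - nmul (\<nu> h) f" by simp
    ultimately show ?thesis using h(2) by metis
  qed
  have ret_mult: "\<exists>i. 1 \<le> i \<and> i \<le> N \<and> (i \<le> m \<longrightarrow> nmul (m - i) f \<in> V + L)" if m: "nmul m f \<in> V + L" for m
  proof -
    obtain v l where v: "nmul m f = v + l" "v \<in> V" "l \<in> L" using m by (auto elim: set_plus_elim)
    have "v = nmul m f + - l" using v(1) by simp
    moreover have "nmul m f + - l \<in> gen {f} + L"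
      using subgrp_nmul[OF subgrp_gen[of "{f}"], of f m] gen_incl[of "{f}"] subgrp_minus[OF L(1) v(3)]
      by (intro set_plus_intro) auto
    ultimately have "v \<in> H" using H(3) by auto
    then obtain i where i: "1 \<le> i" "i \<le> N" "v - nmul i f \<in> G + L" using ret v(2) by blast
    obtain g l' where g: "v - nmul i f = g + l'" "g \<in> G" "l' \<in> L" using i(3) by (auto elim: set_plus_elim)
    have "g = v - nmul i f - l'" using g(1) by simp
    then have "g \<in> Y"
      using v(2) V(3) L(2) g(3) subgrp_nmul[OF Y(2) f] Y(2) by (auto intro!: subgrp_diff[OF Y(2)])
    then have "g \<in> V" using G g by auto
    moreover have "nmul m f - nmul i f = g + (l + l')" using v(1) g(1) by (simp add: algebra_simps)
    moreover have "l + l' \<in> L" using subgrp_add[OF L(1) v(3) g(3)] .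
    ultimately have "nmul m f - nmul i f \<in> V + L" by auto
    then show ?thesis using i by (metis nmul_le_diff)
  qed
  define C' where "C' = V + (\<lambda>i. - nmul i f) ` {..N}"
  have "bounded_set C'"
    unfolding C'_def by (rule bounded_plus[OF compact_bounded[OF V(1) order_refl] bounded_finite]) simp
  moreover have "nmul j f \<in> C' + L" for j
  proof -
    have "\<exists>m\<ge>j. nmul m f \<in> V + L"
    proof -
      obtain n u l where n: "n > j" "u \<in> G" "l \<in> L" "nmul n f = u + l" using rec[OF G(1), of j] by auto
      have "u = nmul n f - l" using n(4) by simp
      then have "u \<in> Y" using L(2) n(3) subgrp_nmul[OF Y(2) f] by (auto intro!: subgrp_diff[OF Y(2)])
      then have "nmul n f \<in> V + L" using n G by auto
      then show ?thesis using n(1) by (intro exI[of _ n]) auto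
    qed
    \<comment> \<open>\<open>m\<close> is the first index from \<open>j\<close> on with a return to
      \<open>V + L\<close>. Going back by some \<open>i \<le> N\<close> is again a return, hence
      drops below \<open>j\<close>, so \<open>m - j \<le> N\<close>.\<close>
    then obtain m where m: "j \<le> m" "nmul m f \<in> V + L" "\<And>k. k < m \<Longrightarrow> \<not> (j \<le> k \<and> nmul k f \<in> V + L)"
      using exists_least_iff[of "\<lambda>m. j \<le> m \<and> nmul m f \<in> V + L"] by metis
    obtain i where i: "1 \<le> i" "i \<le> N" "i \<le> m \<longrightarrow> nmul (m - i) f \<in> V + L" using ret_mult[OF m(2)] by auto
    have "m - j \<le> N"
    proof (cases "i \<le> m")
      case True
      then have "\<not> j \<le> m - i" using m(3)[of "m - i"] i by auto
      then show ?thesis using i by auto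
    qed (use i in auto)
    obtain v l where v: "nmul m f = v + l" "v \<in> V" "l \<in> L" using m(2) by (auto elim: set_plus_elim)
    have "nmul j f = (v + - nmul (m - j) f) + l" using m(1) v(1) by (simp add: nmul_le_diff algebra_simps)
    moreover have "v + - nmul (m - j) f \<in> C'" unfolding C'_def using v(2) \<open>m - j \<le> N\<close> by (intro set_plus_intro imageI) auto
    ultimately show ?thesis using v(3) by (metis set_plus_intro)
  qed
  ultimately show ?thesis by blast
qed

text \<open>One generator is removed at a time. If its multiples meet a bounded set infinitely often
  modulo \<open>L\<close>, they are bounded modulo \<open>L\<close> and are absorbed into
  \<open>C0\<close>; otherwise the generator is moved into \<open>L\<close>, which for this reason
  varies in the induction.\<close>

lemma doubling_proper:
  assumes Y: "closedin T Y" "subgrp Y"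
  shows "subgrp L \<Longrightarrow> L \<subseteq> Y \<Longrightarrow> set fs \<subseteq> Y \<Longrightarrow> bounded_set C0 \<Longrightarrow> G \<subseteq> C0 + (L + gen (set fs)) \<Longrightarrow>
    bounded_set C \<Longrightarrow> \<exists>C'. bounded_set C' \<and> (\<forall>z\<in>G. z + z \<in> C + L \<longrightarrow> z \<in> C' + L)"
proof (induct fs arbitrary: L C0 C)
  case Nil
  then show ?case by (intro exI[of _ C0]) auto
next
  case (Cons f fs)
  have gfs: "gen (set (f # fs)) = gen {f} + gen (set fs)" using gen_insert[of f "set fs"] by simp
  have f: "f \<in> Y" and fs: "set fs \<subseteq> Y" using Cons.prems(3) by auto
  show ?case
  proof (cases "\<exists>C1. bounded_set C1 \<and> infinite {n. nmul n f \<in> C1 + L}")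
    case True
    then obtain C2 where C2: "bounded_set C2" "\<And>n. nmul n f \<in> C2 + L"
      using recurrent_bounded[OF Y f Cons.prems(1,2)] by metis
    define C3 where "C3 = C2 + uminus ` C2"
    have C3: "bounded_set C3" unfolding C3_def using C2 by (intro bounded_plus bounded_uminus)
    have "gen {f} \<subseteq> C3 + L"
    proof
      fix x assume "x \<in> gen {f}"
      then obtain m n where x: "x = nmul m f - nmul n f" by (auto simp: gen_singleton)
      obtain a l b l' where ab: "nmul m f = a + l" "nmul n f = b + l'" "a \<in> C2" "b \<in> C2" "l \<in> L" "l' \<in> L"
        using C2(2) by (metis set_plus_elim)
      have "x = (a + - b) + (l - l')" using x ab by simp
      moreover have "a + - b \<in> C3" unfolding C3_def using ab by (intro set_plus_intro) auto
      ultimately show "x \<in> C3 + L" using subgrp_diff[OF Cons.prems(1) ab(5,6)] by (metis set_plus_intro)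
    qed
    then have "C0 + (L + (gen {f} + gen (set fs))) \<subseteq> C0 + (L + ((C3 + L) + gen (set fs)))"
      by (intro set_plus_mono2) auto
    also have "\<dots> = (C0 + C3) + ((L + L) + gen (set fs))" by (simp add: add_ac)
    also have "L + L = L" by (rule subgrp_plus_idem[OF Cons.prems(1)])
    finally have "G \<subseteq> (C0 + C3) + (L + gen (set fs))" using Cons.prems(5) gfs by auto
    from Cons.hyps[OF Cons.prems(1,2) fs _ this Cons.prems(6)] show ?thesis
      using bounded_plus[OF Cons.prems(4) C3] by simp
  next
    case False
    let ?L = "L + gen {f}"
    have L': "subgrp ?L" by (intro subgrp_plus subgrp_gen Cons.prems)
    have L'Y: "?L \<subseteq> Y"
      using Cons.prems f Y by (intro subgrp_plus_least gen_least) auto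
    have "G \<subseteq> C0 + (?L + gen (set fs))" using Cons.prems(5) gfs by (simp add: add_ac)
    from Cons.hyps[OF L' L'Y fs Cons.prems(4) this Cons.prems(6)]
    obtain C1 where C1: "bounded_set C1" "\<And>z. z \<in> G \<Longrightarrow> z + z \<in> C + ?L \<Longrightarrow> z \<in> C1 + ?L" by auto
    \<comment> \<open>For \<open>z = c + (l + g)\<close> the double \<open>g + g\<close> is
      \<open>z + z - (c + c)\<close> up to \<open>L\<close>, an element of \<open>D + L\<close>.
      With \<open>g\<close> equal to \<open>nmul n f\<close> or its negative this puts
      \<open>2 n\<close> into the finite set \<open>I\<close>, and \<open>Ph\<close> lists the
      possible \<open>g\<close>.\<close>
    define D where "D = C + uminus ` (C1 + C1)"
    define E where "E = D \<union> uminus ` D"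
    have E: "bounded_set E"
      unfolding E_def D_def using C1 Cons.prems(6) by (intro bounded_Un bounded_plus bounded_uminus)
    define I where "I = {n. nmul n f \<in> E + L}"
    have finI: "finite I" using False E unfolding I_def by blast
    define Ph where "Ph = (\<lambda>n. nmul (n div 2) f) ` I \<union> (\<lambda>n. - nmul (n div 2) f) ` I"
    have "bounded_set (C1 + Ph)"
      by (rule bounded_plus[OF C1(1) bounded_finite]) (simp add: Ph_def finI)
    moreover have "z \<in> (C1 + Ph) + L" if z: "z \<in> G" "z + z \<in> C + L" for z
    proof -
      have "C + L \<subseteq> C + ?L"
        using subset_plus1[OF subgrp_0[OF subgrp_gen[of "{f}"]], of L] by (intro set_plus_mono2) auto
      then have "z \<in> C1 + ?L" using C1(2)[OF z(1)] z(2) by auto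
      then obtain c l g where c: "z = c + (l + g)" "c \<in> C1" "l \<in> L" "g \<in> gen {f}" by (metis set_plus_elim)
      obtain n where n: "g = nmul n f \<or> g = - nmul n f" using c(4) by (rule gen_singletonE)
      obtain c' l' where c': "z + z = c' + l'" "c' \<in> C" "l' \<in> L" using z(2) by (auto elim: set_plus_elim)
      have gg: "g + g = (c' + - (c + c)) + (l' - (l + l))" using c(1) c'(1) by (simp add: algebra_simps)
      have d: "c' + - (c + c) \<in> D" unfolding D_def using c' c by (intro set_plus_intro imageI)
      have l2: "l' - (l + l) \<in> L" using c c' Cons.prems(1) by (intro subgrp_diff subgrp_add)
      have "2 * n \<in> I"
      proof -
        have nn: "nmul (2 * n) f = nmul n f + nmul n f" by (simp add: mult_2 nmul_add)
        from n show ?thesis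
        proof
          assume "g = nmul n f"
          then have "nmul (2 * n) f = (c' + - (c + c)) + (l' - (l + l))" using gg nn by simp
          then show ?thesis using d l2 unfolding I_def E_def by (auto simp: set_plus_intro)
        next
          assume "g = - nmul n f"
          then have "nmul (2 * n) f = - (c' + - (c + c)) + - (l' - (l + l))"
            using gg nn by (metis add_uminus_conv_diff minus_add_distrib minus_minus uminus_add_conv_diff add.commute)
          moreover have "- (c' + - (c + c)) \<in> E" unfolding E_def using d by blast
          ultimately show ?thesis using subgrp_minus[OF Cons.prems(1) l2] unfolding I_def
            by (metis mem_Collect_eq set_plus_intro)
        qed
      qed
      then have "g \<in> Ph" using n unfolding Ph_def by force
      moreover have "z = (c + g) + l" using c(1) by (simp add: algebra_simps)
      ultimately show ?thesis using c by (metis set_plus_intro)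
    qed
    ultimately show ?thesis by blast
  qed
qed

end

text \<open>Hyers's argument: consecutive terms differ by at most \<open>c / 2^(n+1)\<close>, so the
  sequence converges and its limit stays within \<open>c\<close> of the initial term
  \<open>len x\<close>.\<close>

lemma doubling_limit:
  fixes len :: "'f::ab_group_add \<Rightarrow> real"
  assumes G: "subgrp G" and c: "\<And>x. x \<in> G \<Longrightarrow> \<bar>len (x + x) - 2 * len x\<bar> \<le> c"
  shows "\<exists>\<rho>. \<forall>x\<in>G. (\<lambda>n. len (nmul (2 ^ n) x) / 2 ^ n) \<longlonglongrightarrow> \<rho> x \<and> \<bar>\<rho> x - len x\<bar> \<le> c"
proof -
  have "\<exists>r. (\<lambda>n. len (nmul (2 ^ n) x) / 2 ^ n) \<longlonglongrightarrow> r \<and> \<bar>r - len x\<bar> \<le> c" if x: "x \<in> G" for x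
  proof -
    define a where "a n = len (nmul (2 ^ n) x) / 2 ^ n" for n
    define d where "d n = a (Suc n) - a n" for n
    have d: "\<bar>d n\<bar> \<le> c * (1/2) ^ Suc n" for n
    proof -
      let ?y = "nmul (2 ^ n) x"
      have "nmul (2 ^ Suc n) x = ?y + ?y" by (simp add: mult_2 nmul_add)
      then have "d n = (len (?y + ?y) - 2 * len ?y) / 2 ^ Suc n"
        by (simp add: d_def a_def field_simps)
      moreover have "\<bar>len (?y + ?y) - 2 * len ?y\<bar> \<le> c" by (rule c[OF subgrp_nmul[OF G x]])
      ultimately show ?thesis by (simp add: power_one_over field_simps)
    qed
    have geo: "(\<lambda>n. c * (1/2) ^ Suc n) sums c"
      using sums_mult[OF power_half_series, of c] by simp
    have sd: "summable (\<lambda>n. \<bar>d n\<bar>)"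
      by (rule summable_comparison_test'[OF sums_summable[OF geo], of 0]) (use d in simp)
    have "(\<lambda>n. \<Sum>i<n. d i) \<longlonglongrightarrow> suminf d"
      using summable_LIMSEQ[OF summable_rabs_cancel[OF sd]] .
    then have "(\<lambda>n. a n - a 0) \<longlonglongrightarrow> suminf d"
      unfolding d_def by (simp add: sum_lessThan_telescope)
    then have "(\<lambda>n. (a n - a 0) + a 0) \<longlonglongrightarrow> suminf d + a 0"
      by (intro tendsto_add) auto
    moreover have "\<bar>suminf d\<bar> \<le> c"
    proof -
      have "\<bar>suminf d\<bar> \<le> suminf (\<lambda>n. \<bar>d n\<bar>)" by (rule summable_rabs[OF sd])
      also have "\<dots> \<le> suminf (\<lambda>n. c * (1/2) ^ Suc n)"
        by (rule suminf_le[OF d sd sums_summable[OF geo]])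
      also have "\<dots> = c" by (rule sums_unique[OF geo, symmetric])
      finally show ?thesis .
    qed
    ultimately show ?thesis
      by (intro exI[of _ "suminf d + a 0"]) (simp add: a_def)
  qed
  then show ?thesis by metis
qed

section \<open>Word length and the homogeneous seminorm\<close>

primrec spow :: "nat \<Rightarrow> 'f::ab_group_add set \<Rightarrow> 'f set" where
  "spow 0 F = {0}"
| "spow (Suc n) F = F + spow n F"

lemma spow_add: "spow (m + n) F = spow m F + spow n F"
  by (induct m) (simp_all add: add.assoc)

lemma spow_mono: "0 \<in> F \<Longrightarrow> m \<le> n \<Longrightarrow> spow m F \<subseteq> spow n F"
proof (induct n rule: nat_induct)
  case (Suc n)
  show ?case
  proof (cases "m \<le> n")
    case True
    then show ?thesis using Suc subset_plus2[of F "spow n F"] by auto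
  next
    case False
    then have "m = Suc n" using Suc by auto
    then show ?thesis by simp
  qed
qed simp

lemma spow_minus: "(\<And>x. x \<in> F \<Longrightarrow> - x \<in> F) \<Longrightarrow> x \<in> spow n F \<Longrightarrow> - x \<in> spow n F"
proof (induct n arbitrary: x)
  case (Suc n)
  then obtain f y where "x = f + y" "f \<in> F" "y \<in> spow n F" by (auto elim: set_plus_elim)
  then have "- x = - f + - y" "- f \<in> F" "- y \<in> spow n F" using Suc by auto
  then show ?case unfolding spow.simps by (metis set_plus_intro)
qed simp

lemma spow_subset: "subgrp H \<Longrightarrow> F \<subseteq> H \<Longrightarrow> spow k F \<subseteq> H"
  by (induct k) (simp_all add: subgrp_0 subgrp_plus_least)

text \<open>Equal letters of a word are paired off. What remains is a sum over a subset of
  \<open>F\<close>, one of finitely many, plus twice a word of at most half the length; this is how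
  word length gets halved.\<close>

lemma spow_parity:
  assumes "finite F" "x \<in> spow n F"
  shows "\<exists>S j y. S \<subseteq> F \<and> y \<in> spow j F \<and> x = \<Sum>S + (y + y) \<and> card S + 2 * j \<le> n"
  using assms(2)
proof (induct n arbitrary: x)
  case 0
  then show ?case by (intro exI[of _ "{}"] exI[of _ 0] exI[of _ "0::'a"]) auto
next
  case (Suc n)
  then obtain f z where z: "x = f + z" "f \<in> F" "z \<in> spow n F" by (auto elim: set_plus_elim)
  obtain S j y where S: "S \<subseteq> F" "y \<in> spow j F" "z = \<Sum>S + (y + y)" "card S + 2 * j \<le> n"
    using Suc.hyps[OF z(3)] by auto
  have finS: "finite S" using S(1) assms(1) finite_subset by blast
  show ?case
  proof (cases "f \<in> S")
    case False
    then have "x = \<Sum>(insert f S) + (y + y)" using z S finS by (simp add: add.assoc)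
    moreover have "insert f S \<subseteq> F" using z S by auto
    ultimately show ?thesis using S finS False by (intro exI[of _ "insert f S"] exI[of _ j] exI[of _ y]) auto
  next
    case True
    then have "\<Sum>S = f + \<Sum>(S - {f})" using finS by (simp add: sum.remove)
    then have "x = \<Sum>(S - {f}) + ((f + y) + (f + y))" using z S by (simp add: algebra_simps)
    moreover have "f + y \<in> spow (Suc j) F" using z S by auto
    moreover have "card (S - {f}) + 2 * Suc j \<le> Suc n"
      using S(4) True finS card_Suc_Diff1[OF finS True] by simp
    ultimately show ?thesis using S by (intro exI[of _ "S - {f}"] exI[of _ "Suc j"] exI[of _ "f + y"]) auto
  qed
qed

context lc_ab_group
begin

text \<open>A seminorm on the relatively open subgroup \<open>G\<close> of \<open>Y\<close>,
  homogeneous over the natural numbers, with relatively compact balls, and continuous at 0. On a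
  vector group times a lattice times a compact group it plays the role of a norm on the first two
  factors.\<close>

definition gnorm :: "'f set \<Rightarrow> 'f set \<Rightarrow> ('f \<Rightarrow> real) \<Rightarrow> bool" where
  "gnorm Y G \<rho> \<longleftrightarrow> subgrp G \<and> G \<subseteq> Y \<and> (\<forall>x\<in>G. 0 \<le> \<rho> x) \<and> (\<forall>x\<in>G. \<forall>y\<in>G. \<rho> (x + y) \<le> \<rho> x + \<rho> y) \<and>
    (\<forall>x\<in>G. \<rho> (- x) = \<rho> x) \<and> (\<forall>x\<in>G. \<forall>n. \<rho> (nmul n x) = real n * \<rho> x) \<and>
    (\<forall>c. bounded_set {x\<in>G. \<rho> x \<le> c}) \<and> (\<forall>\<epsilon>>0. nb Y {x\<in>G. \<rho> x < \<epsilon>})"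

lemma gnormD:
  assumes "gnorm Y G \<rho>"
  shows "subgrp G" "G \<subseteq> Y" "\<And>x. x \<in> G \<Longrightarrow> 0 \<le> \<rho> x" "\<And>x y. x \<in> G \<Longrightarrow> y \<in> G \<Longrightarrow> \<rho> (x + y) \<le> \<rho> x + \<rho> y"
    "\<And>x. x \<in> G \<Longrightarrow> \<rho> (- x) = \<rho> x" "\<And>x n. x \<in> G \<Longrightarrow> \<rho> (nmul n x) = real n * \<rho> x"
    "\<And>c. bounded_set {x\<in>G. \<rho> x \<le> c}" "\<And>\<epsilon>. \<epsilon> > 0 \<Longrightarrow> nb Y {x\<in>G. \<rho> x < \<epsilon>}"
  using assms by (auto simp: gnorm_def)

lemma spow_gen:
  assumes V: "0 \<in> V" "\<And>x. x \<in> V \<Longrightarrow> - x \<in> V" and F: "0 \<in> F" "\<And>x. x \<in> F \<Longrightarrow> - x \<in> F" "F \<subseteq> gen V"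
    and VV: "V + V \<subseteq> V + F"
  shows "gen V = (\<Union>k. V + spow k F)"
    and "\<And>x y k l. x \<in> V + spow k F \<Longrightarrow> y \<in> V + spow l F \<Longrightarrow> x + y \<in> V + spow (Suc (k + l)) F"
    and "\<And>x k. x \<in> V + spow k F \<Longrightarrow> - x \<in> V + spow k F"
proof -
  show add: "x + y \<in> V + spow (Suc (k + l)) F" if "x \<in> V + spow k F" "y \<in> V + spow l F" for x y k l
  proof -
    have "x + y \<in> (V + spow k F) + (V + spow l F)" using that by auto
    also have "\<dots> = (V + V) + spow (k + l) F" by (simp add: spow_add add_ac)
    also have "\<dots> \<subseteq> (V + F) + spow (k + l) F" by (intro set_plus_mono2 VV) auto
    finally show ?thesis by (simp add: add_ac)
  qed
  show minus: "- x \<in> V + spow k F" if x: "x \<in> V + spow k F" for x k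
  proof -
    obtain v y where "x = v + y" "v \<in> V" "y \<in> spow k F" using x by (rule set_plus_elim)
    then have "- x = - v + - y" "- v \<in> V" "- y \<in> spow k F" using V spow_minus[of F y k] F(2) by auto
    then show ?thesis by (metis set_plus_intro)
  qed
  show "gen V = (\<Union>k. V + spow k F)"
  proof
    have "subgrp (\<Union>k. V + spow k F)"
      unfolding subgrp_def
    proof (intro conjI ballI)
      have "0 + 0 \<in> V + spow 0 F" using V by (intro set_plus_intro) auto
      then show "0 \<in> (\<Union>k. V + spow k F)" by (metis UNIV_I UN_I add_0)
      fix x y assume "x \<in> (\<Union>k. V + spow k F)" "y \<in> (\<Union>k. V + spow k F)"
      then obtain k l where "x \<in> V + spow k F" "y \<in> V + spow l F" by auto
      then have "x + - y \<in> V + spow (Suc (k + l)) F" by (intro add minus)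
      then show "x - y \<in> (\<Union>k. V + spow k F)" by (metis UNIV_I UN_I add_uminus_conv_diff)
    qed
    moreover have "V \<subseteq> (\<Union>k. V + spow k F)" using subset_plus1[of "spow 0 F" V] by fastforce
    ultimately show "gen V \<subseteq> (\<Union>k. V + spow k F)" by (rule gen_least)
    show "(\<Union>k. V + spow k F) \<subseteq> gen V"
      using gen_incl[of V] F(3) by (intro UN_least subgrp_plus_least spow_subset subgrp_gen)
  qed
qed

text \<open>Word length with respect to \<open>V\<close> is subadditive up to 1. The crucial bound
  is \<open>half\<close>: \<open>len (x + x)\<close> is at least \<open>2 * len x\<close> up to a
  constant, because the odd part left by \<open>spow_parity\<close> is bounded and doubling is
  proper. Homogenising by \<open>doubling_limit\<close> then changes the length only by a bounded
  amount.\<close>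

theorem gnorm_exists:
  assumes Y: "closedin T Y" "subgrp Y" and V: "compactin T V" "V \<subseteq> Y" "nb Y V" "0 \<in> V" "\<And>x. x \<in> V \<Longrightarrow> - x \<in> V"
  obtains \<rho> where "gnorm Y (gen V) \<rho>"
proof -
  let ?G = "gen V"
  have GY: "?G \<subseteq> Y" using V Y by (intro gen_least)
  have "V + V \<subseteq> Y" using V(2) Y(2) by (intro subgrp_plus_least)
  then obtain F0 where F0: "finite F0" "F0 \<subseteq> V + V" "V + V \<subseteq> F0 + V"
    using compact_cover_nb[OF compact_plus[OF V(1) V(1)] _ Y(2) V(3)] by metis
  have "V + V \<subseteq> ?G" using gen_incl[of V] by (intro subgrp_plus_least subgrp_gen)
  then have F0G: "F0 \<subseteq> ?G" using F0(2) by auto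
  define F where "F = insert 0 (F0 \<union> uminus ` F0)"
  have F: "finite F" "0 \<in> F" "\<And>x. x \<in> F \<Longrightarrow> - x \<in> F" "F \<subseteq> ?G"
    using F0(1) F0G subgrp_0[OF subgrp_gen] subgrp_minus[OF subgrp_gen] by (auto simp: F_def)
  have VV: "V + V \<subseteq> V + F"
  proof -
    have "F0 + V \<subseteq> F + V" by (intro set_plus_mono2) (auto simp: F_def)
    then show ?thesis using F0(3) by (simp add: add.commute)
  qed
  note gen = spow_gen[OF V(4,5) F(2,3,4) VV]
  define E where "E k = V + spow k F" for k
  have E_mono: "E k \<subseteq> E l" if "k \<le> l" for k l
    unfolding E_def using spow_mono[OF F(2) that] by (intro set_plus_mono2) auto
  have E_add: "x + y \<in> E (Suc (k + l))" if "x \<in> E k" "y \<in> E l" for x y k l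
    using gen(2) that unfolding E_def by blast
  have G_eq: "?G = (\<Union>k. E k)" unfolding E_def by (rule gen(1))
  have half: "\<exists>c. \<forall>x\<in>?G. \<forall>k. x + x \<in> E k \<longrightarrow> x \<in> E (c + k div 2)"
  proof -
    \<comment> \<open>The possible odd parts. Together with \<open>V\<close> they form the bounded
      set whose halves are controlled by \<open>doubling_proper\<close>.\<close>
    define S where "S = sum id ` Pow F"
    have "finite S" using F(1) by (simp add: S_def)
    then have bS: "bounded_set (V + S)"
      by (rule bounded_plus[OF compact_bounded[OF V(1) order_refl] bounded_finite])
    obtain fs where fs: "set fs = F" using F(1) finite_list by auto
    have genF: "?G \<subseteq> V + ({0} + gen (set fs))"
    proof -
      have "E k \<subseteq> V + gen F" for k
        unfolding E_def by (intro set_plus_mono2 spow_subset subgrp_gen gen_incl order_refl)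
      then show ?thesis using G_eq fs by auto
    qed
    have s0: "subgrp {0 :: 'f}" by (simp add: subgrp_def)
    have "set fs \<subseteq> Y" using fs F(4) GY by auto
    from doubling_proper[OF Y s0 _ this compact_bounded[OF V(1) order_refl] genF bS]
    obtain C where C: "bounded_set C" "\<And>z. z \<in> ?G \<Longrightarrow> z + z \<in> V + S \<Longrightarrow> z \<in> C"
      using subgrp_0[OF Y(2)] by auto
    have "bounded_set (C \<inter> Y)" using C(1) bounded_subset by blast
    then obtain Ph where Ph: "finite Ph" "C \<inter> Y \<subseteq> Ph + V"
      using bounded_cover_nb[OF _ Int_lower2 Y V(3), of C] by metis
    have "\<exists>k. f \<in> E k" if "f \<in> Ph \<inter> ?G" for f using that G_eq by auto
    then obtain \<kappa> where k: "\<And>f. f \<in> Ph \<inter> ?G \<Longrightarrow> f \<in> E (\<kappa> f)" by metis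
    \<comment> \<open>Each use of \<open>E_add\<close> costs one more letter: one for
      \<open>z = f + v\<close>, one for \<open>x = (x - y) + y\<close>.\<close>
    define c where "c = Suc (Suc (Max (insert 0 (\<kappa> ` (Ph \<inter> ?G)))))"
    have CE: "z \<in> E (c - 1)" if z: "z \<in> ?G" "z \<in> C" for z
    proof -
      obtain f v where f: "z = f + v" "f \<in> Ph" "v \<in> V" using Ph(2) z GY by (metis IntI set_plus_elim subsetD)
      then have "f \<in> ?G" using z(1) gen_incl[of V] subgrp_add_iff2[OF subgrp_gen] by blast
      then have "f \<in> E (\<kappa> f)" and "\<kappa> f \<le> Max (insert 0 (\<kappa> ` (Ph \<inter> ?G)))" using k f Ph(1) by (auto intro: Max_ge)
      moreover have "v \<in> E 0" using f by (auto simp: E_def)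
      ultimately have "z \<in> E (Suc (\<kappa> f + 0))" using E_add f by blast
      then show ?thesis using E_mono[of "Suc (\<kappa> f + 0)" "c - 1"] \<open>\<kappa> f \<le> _\<close> by (auto simp: c_def)
    qed
    have "x \<in> E (c + k div 2)" if x: "x \<in> ?G" "x + x \<in> E k" for x k
    proof -
      obtain v w where v: "x + x = v + w" "v \<in> V" "w \<in> spow k F" using x(2) unfolding E_def by (rule set_plus_elim)
      obtain R j y where R: "R \<subseteq> F" "y \<in> spow j F" "w = \<Sum>R + (y + y)" "card R + 2 * j \<le> k"
        using spow_parity[OF F(1) v(3)] by auto
      have yE: "y \<in> E j" unfolding E_def using R(2) V(4) subset_plus2[of V "spow j F"] by auto
      then have yG: "y \<in> ?G" using G_eq by auto
      have "(x - y) + (x - y) = (x + x) - (y + y)" by simp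
      also have "\<dots> = v + \<Sum>R" unfolding v(1) R(3) by simp
      finally have "(x - y) + (x - y) \<in> V + S"
        using v(2) R(1) by (auto simp: S_def intro!: set_plus_intro)
      then have "x - y \<in> E (c - 1)" using C(2) CE x(1) yG subgrp_diff[OF subgrp_gen] by blast
      from E_add[OF this yE] have "x \<in> E (Suc (c - 1 + j))" by simp
      moreover have "Suc (c - 1 + j) \<le> c + k div 2" using R(4) by (simp add: c_def)
      ultimately show ?thesis using E_mono by blast
    qed
    then show ?thesis by blast
  qed
  then obtain c where c: "\<And>x k. x \<in> ?G \<Longrightarrow> x + x \<in> E k \<Longrightarrow> x \<in> E (c + k div 2)" by blast
  define len where "len x = real (LEAST k. x \<in> E k)" for x
  have lenE: "x \<in> E (LEAST k. x \<in> E k)" if "x \<in> ?G" for x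
    using that G_eq by (auto intro: LeastI)
  have len_le: "len x \<le> real k" if "x \<in> E k" for x k
    using Least_le[of "\<lambda>k. x \<in> E k", OF that] by (simp add: len_def)
  have len_0: "0 \<le> len x" for x by (simp add: len_def)
  have len_add: "len (x + y) \<le> len x + len y + 1" if "x \<in> ?G" "y \<in> ?G" for x y
    using len_le[OF E_add[OF lenE[OF that(1)] lenE[OF that(2)]]] by (simp add: len_def)
  have len_minus: "len (- x) = len x" for x
  proof -
    have "- x \<in> E k \<longleftrightarrow> x \<in> E k" for k using gen(3)[of x k] gen(3)[of "- x" k] unfolding E_def by auto
    then show ?thesis by (simp add: len_def)
  qed
  have len_half: "\<bar>len (x + x) - 2 * len x\<bar> \<le> 2 * real c + 1" if x: "x \<in> ?G" for x
  proof -
    have "x + x \<in> ?G" using subgrp_add[OF subgrp_gen x x] .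
    from len_le[OF c[OF x lenE[OF this]]]
    have "len x \<le> real c + real ((LEAST k. x + x \<in> E k) div 2)" by simp
    moreover have "2 * real ((LEAST k. x + x \<in> E k) div 2) \<le> len (x + x)" unfolding len_def by linarith
    ultimately show ?thesis using len_add[OF x x] by linarith
  qed
  obtain \<rho> where rho': "\<forall>x\<in>?G. (\<lambda>n. len (nmul (2 ^ n) x) / 2 ^ n) \<longlonglongrightarrow> \<rho> x \<and>
      \<bar>\<rho> x - len x\<bar> \<le> 2 * real c + 1"
    using doubling_limit[OF subgrp_gen, of V len "2 * real c + 1", OF len_half, simplified] by (elim exE)
  have rho: "(\<lambda>n. len (nmul (2 ^ n) x) / 2 ^ n) \<longlonglongrightarrow> \<rho> x" "\<bar>\<rho> x - len x\<bar> \<le> 2 * real c + 1" if "x \<in> ?G" for x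
    using rho' that by auto
  note Gnm = subgrp_nmul[OF subgrp_gen, of _ V]
  have r0: "0 \<le> \<rho> x" if "x \<in> ?G" for x
    using rho(1)[OF that] by (rule LIMSEQ_le_const) (auto simp: len_0)
  have radd: "\<rho> (x + y) \<le> \<rho> x + \<rho> y" if x: "x \<in> ?G" "y \<in> ?G" for x y
  proof -
    have "(\<lambda>n. len (nmul (2 ^ n) x) / 2 ^ n + len (nmul (2 ^ n) y) / 2 ^ n + (1/2) ^ n) \<longlonglongrightarrow> \<rho> x + \<rho> y + 0"
      using x by (intro tendsto_add rho LIMSEQ_power_zero) auto
    moreover have "len (nmul (2 ^ n) (x + y)) / 2 ^ n \<le> len (nmul (2 ^ n) x) / 2 ^ n + len (nmul (2 ^ n) y) / 2 ^ n + (1/2) ^ n" for n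
      using len_add[OF Gnm[OF x(1), of "2 ^ n"] Gnm[OF x(2), of "2 ^ n"]]
      by (simp add: nmul_distrib power_one_over field_simps)
    ultimately have "\<rho> (x + y) \<le> \<rho> x + \<rho> y + 0"
      using x by (intro LIMSEQ_le[OF rho(1)[OF subgrp_add[OF subgrp_gen x]]]) auto
    then show ?thesis by simp
  qed
  have rminus: "\<rho> (- x) = \<rho> x" if x: "x \<in> ?G" for x
    using rho(1)[OF subgrp_minus[OF subgrp_gen x]] rho(1)[OF x]
    by (simp add: nmul_minus len_minus LIMSEQ_unique)
  have rdouble: "\<rho> (nmul (2 ^ k) x) = 2 ^ k * \<rho> x" if x: "x \<in> ?G" for x k
  proof -
    have "(\<lambda>n. 2 ^ k * (len (nmul (2 ^ (n + k)) x) / 2 ^ (n + k))) \<longlonglongrightarrow> 2 ^ k * \<rho> x"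
      using LIMSEQ_ignore_initial_segment[OF rho(1)[OF x], of k] by (intro tendsto_mult) auto
    moreover have "2 ^ k * (len (nmul (2 ^ (n + k)) x) / 2 ^ (n + k)) = len (nmul (2 ^ n) (nmul (2 ^ k) x)) / 2 ^ n" for n
      by (simp add: power_add nmul_mult[symmetric])
    ultimately show ?thesis using rho(1)[OF Gnm[OF x, of "2 ^ k"]] by (simp add: LIMSEQ_unique)
  qed
  have rle: "\<rho> (nmul n x) \<le> real n * \<rho> x" if x: "x \<in> ?G" for x n
  proof (induct n)
    case 0
    have "\<rho> (nmul (2 ^ 1) 0) = 2 ^ 1 * \<rho> 0" by (rule rdouble[OF subgrp_0[OF subgrp_gen]])
    then show ?case by simp
  next
    case (Suc n)
    then show ?case using radd[OF x Gnm[OF x, of n]] by (simp add: algebra_simps)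
  qed
  have rmult: "\<rho> (nmul n x) = real n * \<rho> x" if x: "x \<in> ?G" for x n
  proof -
    obtain k where k: "n < 2 ^ k" using less_exp by blast
    \<comment> \<open>The inequality opposite to \<open>rle\<close>: \<open>2^k x\<close> is split
      as \<open>n x + (2^k - n) x\<close>, and homogeneity is already known for powers of 2.\<close>
    have "2 ^ k * \<rho> x = \<rho> (nmul n x + nmul (2 ^ k - n) x)"
      using k rdouble[OF x, of k] by (simp flip: nmul_add)
    also have "\<dots> \<le> \<rho> (nmul n x) + real (2 ^ k - n) * \<rho> x"
      using radd[OF Gnm[OF x] Gnm[OF x]] rle[OF x, of "2 ^ k - n"] by (meson add_left_mono order.trans)
    also have "real (2 ^ k - n) = 2 ^ k - real n" using k by (simp add: of_nat_diff)
    finally show ?thesis using rle[OF x, of n] by (simp add: algebra_simps)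
  qed
  have bdd: "bounded_set {x \<in> ?G. \<rho> x \<le> b}" for b
  proof -
    obtain k where k: "b + (2 * real c + 1) \<le> real k" using real_arch_simple by blast
    have "{x \<in> ?G. \<rho> x \<le> b} \<subseteq> E k"
    proof
      fix x assume x: "x \<in> {x \<in> ?G. \<rho> x \<le> b}"
      then have "len x \<le> real k" using rho(2)[of x] k by auto
      then have "(LEAST k. x \<in> E k) \<le> k" by (simp add: len_def)
      then show "x \<in> E k" using E_mono lenE x by blast
    qed
    moreover have "finite (spow k F)" using F(1) by (induct k) (auto intro: finite_plus)
    then have "bounded_set (E k)"
      unfolding E_def by (rule bounded_plus[OF compact_bounded[OF V(1) order_refl] bounded_finite])
    ultimately show ?thesis using bounded_subset by blast
  qed
  have sm: "nb Y {x \<in> ?G. \<rho> x < \<epsilon>}" if e: "\<epsilon> > 0" for \<epsilon>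
  proof -
    \<comment> \<open>Elements of \<open>V\<close> have length 0, hence seminorm at most
      \<open>2 c + 1\<close>. If \<open>n x\<close> still lies in \<open>V\<close>, homogeneity
      divides this bound by \<open>n\<close>.\<close>
    obtain n where n: "(2 * real c + 1) / \<epsilon> < real n" using reals_Archimedean2 by blast
    have n0: "n > 0" using n e by (cases n) (auto simp: field_simps)
    obtain H where H: "small H" "Y \<inter> H \<subseteq> V" using V(3) by (rule nbE)
    obtain U where U: "small U" "\<forall>x\<in>U. \<forall>k\<le>n. nmul k x \<in> H" using small_nmul[OF H(1)] by blast
    have "Y \<inter> U \<subseteq> {x \<in> ?G. \<rho> x < \<epsilon>}"
    proof
      fix x assume x: "x \<in> Y \<inter> U"
      have "nmul k x \<in> V" if "k \<le> n" for k
        using U(2) H(2) x that subgrp_nmul[OF Y(2)] by blast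
      from this[of 1] this[of n] have xV: "x \<in> V" "nmul n x \<in> V" using n0 by auto
      then have xG: "x \<in> ?G" using gen_incl[of V] by auto
      have "nmul n x \<in> E 0" using xV by (simp add: E_def)
      then have "\<rho> (nmul n x) \<le> 2 * real c + 1" using len_le[of _ 0] rho(2)[OF Gnm[OF xG, of n]] by fastforce
      then have "real n * \<rho> x \<le> 2 * real c + 1" using rmult[OF xG] by simp
      also have "\<dots> < real n * \<epsilon>" using n e by (simp add: field_simps)
      finally have "\<rho> x < \<epsilon>" using n0 by simp
      then show "x \<in> {x \<in> ?G. \<rho> x < \<epsilon>}" using xG by simp
    qed
    then show ?thesis using U(1) by (auto simp: nb_def)
  qed
  have "gnorm Y ?G \<rho>"
    unfolding gnorm_def using subgrp_gen GY r0 radd rminus rmult bdd sm by auto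
  then show ?thesis by (rule that)
qed

end

lemma gen_as_sum:
  assumes S: "\<forall>x\<in>S. - x \<in> S" and x: "x \<in> gen S"
  shows "\<exists>(I :: nat set) s. finite I \<and> (\<forall>i\<in>I. s i \<in> S) \<and> x = sum s I"
proof -
  define H where "H = {x. \<exists>(n::nat) s. (\<forall>i<n. s i \<in> S) \<and> x = sum s {..<n}}"
  have "subgrp H"
    unfolding subgrp_def
  proof (intro conjI ballI)
    show "0 \<in> H" unfolding H_def by (auto intro!: exI[of _ 0])
    fix x y assume "x \<in> H" "y \<in> H"
    then obtain m n and s t :: "nat \<Rightarrow> 'a" where s: "\<forall>i<m. s i \<in> S" "x = sum s {..<m}"
      and t: "\<forall>i<n. t i \<in> S" "y = sum t {..<n}" unfolding H_def by blast
    define r where "r i = (if i < m then s i else - t (i - m))" for i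
    have "sum r {..<m + n} = sum r {..<m} + (\<Sum>i<n. r (m + i))"
      by (induct n) (simp_all add: add.assoc)
    then have "x - y = sum r {..<m + n}" by (simp add: r_def s t sum_negf)
    moreover have "\<forall>i<m + n. r i \<in> S" using s t S by (auto simp: r_def)
    ultimately show "x - y \<in> H" unfolding H_def by blast
  qed
  moreover have "S \<subseteq> H"
  proof
    fix x assume "x \<in> S"
    then show "x \<in> H" unfolding H_def by (intro CollectI exI[of _ 1] exI[of _ "\<lambda>_. x"]) auto
  qed
  ultimately have "x \<in> H" using gen_least x by blast
  then show ?thesis unfolding H_def using finite_lessThan lessThan_iff by blast
qed

section \<open>Divisibility up to the kernel of the seminorm\<close>

context lc_ab_group
begin

lemma gnorm_0: "gnorm Y G \<rho> \<Longrightarrow> \<rho> 0 = 0"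
  using gnormD(6)[of Y G \<rho> 0 0] gnormD(1)[of Y G \<rho>] subgrp_0[of G] by simp

lemma gnorm_diff: "gnorm Y G \<rho> \<Longrightarrow> x \<in> G \<Longrightarrow> y \<in> G \<Longrightarrow> \<rho> (x - y) \<le> \<rho> x + \<rho> y"
  using gnormD(4)[of Y G \<rho> x "- y"] gnormD(5)[of Y G \<rho> y] subgrp_minus[OF gnormD(1)] by simp

lemma gnorm_commute: "gnorm Y G \<rho> \<Longrightarrow> x \<in> G \<Longrightarrow> y \<in> G \<Longrightarrow> \<rho> (x - y) = \<rho> (y - x)"
  using gnormD(5)[of Y G \<rho> "x - y"] subgrp_diff[OF gnormD(1)] by simp

lemma gnorm_sum:
  assumes \<rho>: "gnorm Y G \<rho>" and "finite I" "\<And>i. i \<in> I \<Longrightarrow> s i \<in> G \<and> \<rho> (s i) \<le> \<eta>"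
  shows "\<rho> (sum s I) \<le> real (card I) * \<eta>"
  using assms(2,3)
proof (induct I rule: finite_induct)
  case empty
  then show ?case using gnorm_0[OF \<rho>] by simp
next
  case (insert i I)
  have "sum s I \<in> G" using insert by (intro subgrp_sum gnormD[OF \<rho>]) auto
  then have "\<rho> (s i + sum s I) \<le> \<eta> + real (card I) * \<eta>"
    using gnormD(4)[OF \<rho>, of "s i" "sum s I"] insert by fastforce
  then show ?case using insert by (simp add: algebra_simps)
qed

definition separated :: "'f set \<Rightarrow> ('f \<Rightarrow> real) \<Rightarrow> real \<Rightarrow> 'f set \<Rightarrow> bool" where
  "separated G \<rho> \<eta> S \<longleftrightarrow> S \<subseteq> G \<and> (\<forall>x\<in>S. \<rho> x \<le> \<eta>) \<and> (\<forall>x\<in>S. \<forall>y\<in>S. x \<noteq> y \<longrightarrow> \<rho> (x - y) \<ge> \<eta> / 2)"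

text \<open>Homogeneity rescales a separated subset of a small ball to a separated subset of a fixed ball,
  so that the cardinality bound does not depend on the scale.\<close>

lemma separated_bound:
  assumes Y: "closedin T Y" "subgrp Y" and \<rho>: "gnorm Y G \<rho>"
  shows "\<exists>L. \<forall>\<eta> S. 0 < \<eta> \<longrightarrow> \<eta> \<le> 1 \<longrightarrow> separated G \<rho> \<eta> S \<longrightarrow> card S \<le> L"
proof -
  let ?C = "{x \<in> G. \<rho> x \<le> 2}" and ?U = "{x \<in> G. \<rho> x < 1/4}"
  have CY: "?C \<subseteq> Y" using gnormD(2)[OF \<rho>] by auto
  have U: "nb Y ?U" by (rule gnormD(8)[OF \<rho>]) simp
  obtain F where F: "finite F" "?C \<subseteq> F + ?U"
    using bounded_cover_nb[OF gnormD(7)[OF \<rho>, of 2] CY Y U] by metis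
  have "card S \<le> card F" if S: "0 < \<eta>" "\<eta> \<le> 1" "S \<subseteq> G" "\<forall>x\<in>S. \<rho> x \<le> \<eta>"
    "\<forall>x\<in>S. \<forall>y\<in>S. x \<noteq> y \<longrightarrow> \<rho> (x - y) \<ge> \<eta> / 2" for \<eta> S
  proof -
    \<comment> \<open>\<open>n * \<eta>\<close> lies between 1 and 2: multiplied by
      \<open>n\<close>, points of \<open>S\<close> stay in the ball of radius 2 and become at least
      1/2 apart, so no two of them share a translate of the ball of radius 1/4.\<close>
    define n where "n = nat \<lceil>1 / \<eta>\<rceil>"
    have "real n \<ge> 1 / \<eta>" unfolding n_def by linarith
    then have n1: "real n * \<eta> \<ge> 1" using S by (simp add: field_simps)
    have "real n \<le> 1 / \<eta> + 1" unfolding n_def using S(1)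
      by (smt (verit) divide_nonneg_nonneg of_int_ceiling_le_add_one of_nat_nat zero_le_ceiling)
    then have "real n * \<eta> \<le> (1 / \<eta> + 1) * \<eta>" using S by (intro mult_right_mono) auto
    also have "\<dots> = 1 + \<eta>" using S(1) by (simp add: distrib_right)
    finally have n2: "real n * \<eta> \<le> 2" using S by simp
    have ex: "\<exists>f. f \<in> F \<and> (\<exists>u\<in>?U. nmul n x = f + u)" if "x \<in> S" for x
    proof -
      have "x \<in> G" using S that by auto
      then have "\<rho> (nmul n x) = real n * \<rho> x" by (rule gnormD(6)[OF \<rho>])
      also have "\<dots> \<le> real n * \<eta>" using S that by (intro mult_left_mono) auto
      finally have "nmul n x \<in> ?C" using n2 S that subgrp_nmul[OF gnormD(1)[OF \<rho>]] by auto
      then have "nmul n x \<in> F + ?U" using F(2) by blast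
      then show ?thesis by (rule set_plus_elim) blast
    qed
    define \<phi> where "\<phi> x = (SOME f. f \<in> F \<and> (\<exists>u\<in>?U. nmul n x = f + u))" for x
    have phi: "\<phi> x \<in> F \<and> (\<exists>u\<in>?U. nmul n x = \<phi> x + u)" if "x \<in> S" for x
      unfolding \<phi>_def by (rule someI_ex[OF ex[OF that]])
    have "inj_on \<phi> S"
    proof (rule inj_onI, rule ccontr)
      fix x y assume xy: "x \<in> S" "y \<in> S" "\<phi> x = \<phi> y" "x \<noteq> y"
      obtain u v where uv: "u \<in> ?U" "v \<in> ?U" "nmul n x = \<phi> x + u" "nmul n y = \<phi> x + v"
        using phi[OF xy(1)] phi[OF xy(2)] xy(3) by auto
      have "nmul n (x - y) = u - v" using uv by (simp add: nmul_diff)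
      then have "\<rho> (nmul n (x - y)) < 1/2" using gnorm_diff[OF \<rho>, of u v] uv by auto
      moreover have "\<rho> (nmul n (x - y)) = real n * \<rho> (x - y)"
        using xy S(3) subgrp_diff[OF gnormD(1)[OF \<rho>]] by (intro gnormD(6)[OF \<rho>]) blast
      moreover have "real n * \<rho> (x - y) \<ge> real n * (\<eta> / 2)" using S xy by (intro mult_left_mono) auto
      ultimately show False using n1 by simp
    qed
    then show ?thesis using phi F(1) by (intro card_inj_on_le[of \<phi> S F]) auto
  qed
  then show ?thesis unfolding separated_def by blast
qed

text \<open>A maximal separated set of values has at most \<open>L\<close> points, and by maximality
  every value is within \<eta>/2 of one of them; with more than \<open>L * n\<close> indices, one
  point is near \<open>n\<close> of them.\<close>

lemma cluster_of_small:
  assumes \<rho>: "gnorm Y G \<rho>" and \<eta>: "0 < \<eta>"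
    and L: "\<forall>S. separated G \<rho> \<eta> S \<longrightarrow> card S \<le> L"
    and I: "finite I" "\<And>i. i \<in> I \<Longrightarrow> s i \<in> G \<and> \<rho> (s i) \<le> \<eta>" "card I > L * n"
  shows "\<exists>i0\<in>I. \<exists>J\<subseteq>I. card J = n \<and> (\<forall>j\<in>J. \<rho> (s j - s i0) \<le> \<eta> / 2)"
proof -
  define sep where "sep S \<longleftrightarrow> S \<subseteq> s ` I \<and> (\<forall>x\<in>S. \<forall>y\<in>S. x \<noteq> y \<longrightarrow> \<rho> (x - y) \<ge> \<eta> / 2)" for S
  have "finite {S. sep S}" using I(1) by (auto simp: sep_def intro: finite_subset[of _ "Pow (s ` I)"])
  moreover have "sep {}" by (simp add: sep_def)
  ultimately obtain S where S: "sep S" "\<And>R. sep R \<Longrightarrow> S \<subseteq> R \<Longrightarrow> R = S"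
    using finite_has_maximal[of "{S. sep S}"] by auto
  have SI: "S \<subseteq> s ` I" using S by (simp add: sep_def)
  have finS: "finite S" using SI I(1) finite_surj by blast
  have SG: "S \<subseteq> G" using SI I by auto
  have cardS: "card S \<le> L" using S(1) SI I(2) SG by (intro L[rule_format]) (auto simp: sep_def separated_def)
  have near: "\<exists>y\<in>S. \<rho> (s i - y) \<le> \<eta> / 2" if i: "i \<in> I" for i
  proof (rule ccontr)
    assume "\<not> ?thesis"
    then have far: "\<And>y. y \<in> S \<Longrightarrow> \<rho> (s i - y) > \<eta> / 2" by auto
    then have "s i \<notin> S" using gnorm_0[OF \<rho>] \<eta> by fastforce
    moreover have "sep (insert (s i) S)"
      unfolding sep_def
    proof (intro conjI ballI impI)
      show "insert (s i) S \<subseteq> s ` I" using SI i by auto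
      fix x y assume xy: "x \<in> insert (s i) S" "y \<in> insert (s i) S" "x \<noteq> y"
      then show "\<rho> (x - y) \<ge> \<eta> / 2"
        using far[of x] far[of y] S(1) SG I(2)[OF i] gnorm_commute[OF \<rho>, of "s i" x] unfolding sep_def by fastforce
    qed
    ultimately show False using S(2)[of "insert (s i) S"] by auto
  qed
  have "\<exists>y\<in>S. card {i\<in>I. \<rho> (s i - y) \<le> \<eta> / 2} \<ge> n"
  proof (rule ccontr)
    assume "\<not> ?thesis"
    then have lt: "\<And>y. y \<in> S \<Longrightarrow> card {i\<in>I. \<rho> (s i - y) \<le> \<eta> / 2} \<le> n" by force
    have "I \<subseteq> (\<Union>y\<in>S. {i\<in>I. \<rho> (s i - y) \<le> \<eta> / 2})" using near by auto
    moreover have "finite (\<Union>y\<in>S. {i\<in>I. \<rho> (s i - y) \<le> \<eta> / 2})" using finS I(1) by auto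
    ultimately have "card I \<le> card (\<Union>y\<in>S. {i\<in>I. \<rho> (s i - y) \<le> \<eta> / 2})" by (rule card_mono[rotated])
    also have "\<dots> \<le> (\<Sum>y\<in>S. card {i\<in>I. \<rho> (s i - y) \<le> \<eta> / 2})" by (rule card_UN_le[OF finS])
    also have "\<dots> \<le> (\<Sum>y\<in>S. n)" by (intro sum_mono lt)
    also have "\<dots> \<le> L * n" using cardS by simp
    finally show False using I(3) by simp
  qed
  then obtain y where y: "y \<in> S" "card {i\<in>I. \<rho> (s i - y) \<le> \<eta> / 2} \<ge> n" by auto
  obtain i0 where i0: "i0 \<in> I" "y = s i0" using y SI by auto
  obtain J where "J \<subseteq> {i\<in>I. \<rho> (s i - y) \<le> \<eta> / 2}" "card J = n"
    using obtain_subset_with_card_n[OF y(2)] by metis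
  then show ?thesis using i0 by (intro bexI[of _ i0] exI[of _ J]) auto
qed

text \<open>\<open>n\<close> summands close to one \<open>s i0\<close> add up to
  \<open>nmul n (s i0)\<close> plus \<open>n\<close> summands of half the size. Removing such
  clusters until at most \<open>L * n\<close> summands are left separates an exact multiple of
  \<open>n\<close> from a sum of smaller terms.\<close>

lemma group_summands:
  assumes \<rho>: "gnorm Y G \<rho>" and \<eta>: "0 < \<eta>" and \<Gamma>: "subgrp \<Gamma>" "\<Gamma> \<subseteq> G" and n: "n \<ge> 1"
    and L: "\<forall>S. separated G \<rho> \<eta> S \<longrightarrow> card S \<le> L"
  shows "finite I \<Longrightarrow> (\<And>i. i \<in> I \<Longrightarrow> s i \<in> \<Gamma> \<and> \<rho> (s i) \<le> \<eta>) \<Longrightarrow>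
    \<exists>z\<in>\<Gamma>. \<exists>I'\<subseteq>I. \<exists>s'. (\<forall>i\<in>I'. s' i \<in> \<Gamma> \<and> \<rho> (s' i) \<le> \<eta> / 2) \<and> card (I - I') \<le> L * n \<and>
      sum s I = nmul n z + sum s' I' + sum s (I - I')"
proof (induct "card I" arbitrary: I rule: less_induct)
  case less
  show ?case
  proof (cases "card I \<le> L * n")
    case True
    then show ?thesis using subgrp_0[OF \<Gamma>(1)] by (intro bexI[of _ 0] exI[of _ "{}"]) auto
  next
    case False
    then obtain i0 J where J: "i0 \<in> I" "J \<subseteq> I" "card J = n" "\<forall>j\<in>J. \<rho> (s j - s i0) \<le> \<eta> / 2"
      using cluster_of_small[OF \<rho> \<eta> L less.prems(1), of s n] less.prems(2) \<Gamma>(2) by (metis linorder_not_less subsetD)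
    have finJ: "finite J" using J less.prems finite_subset by blast
    have "card (I - J) < card I"
      using J n less.prems(1) by (metis card_Diff_subset card_gt_0_iff diff_less emptyE finJ less_le_trans zero_less_one)
    then obtain z I1 s1 where z: "z \<in> \<Gamma>" "I1 \<subseteq> I - J" "\<forall>i\<in>I1. s1 i \<in> \<Gamma> \<and> \<rho> (s1 i) \<le> \<eta> / 2"
      "card (I - J - I1) \<le> L * n" "sum s (I - J) = nmul n z + sum s1 I1 + sum s (I - J - I1)"
      using less.hyps[of "I - J"] less.prems by (metis (no_types, lifting) Diff_iff finite_Diff)
    define s' where "s' i = (if i \<in> J then s i - s i0 else s1 i)" for i
    let ?I' = "I1 \<union> J"
    have finI1: "finite I1" using z less.prems finite_subset by blast
    have diff: "I - ?I' = I - J - I1" by auto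
    have sI: "sum s I = sum s J + sum s (I - J)"
      using sum.subset_diff[OF J(2) less.prems(1), of s] by (simp add: add.commute)
    have sJ: "sum s J = (\<Sum>j\<in>J. s j - s i0) + nmul n (s i0)"
      using J(3) nmul_const[of "s i0" J] by (simp add: sum_subtractf)
    have sI': "sum s' ?I' = sum s1 I1 + (\<Sum>j\<in>J. s j - s i0)"
    proof -
      have "I1 \<inter> J = {}" using z by auto
      then have "sum s' ?I' = sum s' I1 + sum s' J" using finI1 finJ by (simp add: sum.union_disjoint)
      moreover have "sum s' I1 = sum s1 I1" using \<open>I1 \<inter> J = {}\<close> by (intro sum.cong) (auto simp: s'_def)
      ultimately show ?thesis by (simp add: s'_def)
    qed
    have "sum s I = ((\<Sum>j\<in>J. s j - s i0) + nmul n (s i0)) + (nmul n z + sum s1 I1 + sum s (I - ?I'))"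
      unfolding sI sJ z(5) diff ..
    then have "sum s I = nmul n (z + s i0) + sum s' ?I' + sum s (I - ?I')"
      unfolding sI' nmul_distrib by (simp add: algebra_simps)
    moreover have "z + s i0 \<in> \<Gamma>" using z J less.prems \<Gamma> subgrp_add by blast
    moreover have "\<forall>i\<in>?I'. s' i \<in> \<Gamma> \<and> \<rho> (s' i) \<le> \<eta> / 2"
    proof -
      have "s i - s i0 \<in> \<Gamma>" if "i \<in> J" for i
        using J that less.prems(2) by (intro subgrp_diff[OF \<Gamma>(1)]) auto
      then show ?thesis using z(3) J(4) by (auto simp: s'_def)
    qed
    moreover have "?I' \<subseteq> I" using z J by auto
    ultimately show ?thesis using z(4) diff by (intro bexI[of _ "z + s i0"] exI[of _ ?I'] exI[of _ s']) auto
  qed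
qed

text \<open>Grouping is repeated on the summands of half size. Each round leaves at most
  \<open>L * n\<close> summands ungrouped, and their sizes halve from round to round, so all rounds
  together cost at most \<open>2 L n \<eta>\<close>; the last term is what is left after
  \<open>j\<close> rounds.\<close>

lemma approx_divide_sum:
  assumes \<rho>: "gnorm Y G \<rho>" and \<Gamma>: "subgrp \<Gamma>" "\<Gamma> \<subseteq> G" and n: "n \<ge> 1"
    and L: "\<forall>\<eta> S. 0 < \<eta> \<longrightarrow> \<eta> \<le> 1 \<longrightarrow> separated G \<rho> \<eta> S \<longrightarrow> card S \<le> L"
  shows "0 < \<eta> \<Longrightarrow> \<eta> \<le> 1 \<Longrightarrow> finite I \<Longrightarrow> (\<And>i. i \<in> I \<Longrightarrow> s i \<in> \<Gamma> \<and> \<rho> (s i) \<le> \<eta>) \<Longrightarrow>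
    \<exists>z\<in>\<Gamma>. \<rho> (sum s I - nmul n z) \<le> 2 * real (L * n) * \<eta> + real (card I) * \<eta> / 2 ^ j"
proof (induct j arbitrary: \<eta> I s)
  case 0
  have "\<rho> (sum s I) \<le> real (card I) * \<eta>"
    using 0 \<Gamma>(2) by (intro gnorm_sum[OF \<rho>]) auto
  then show ?case using 0 subgrp_0[OF \<Gamma>(1)]
    by (intro bexI[of _ 0]) (auto intro: order_trans)
next
  case (Suc j)
  have L': "\<forall>S. separated G \<rho> \<eta> S \<longrightarrow> card S \<le> L" using L Suc.prems(1,2) by blast
  obtain z I' s' where z: "z \<in> \<Gamma>" "I' \<subseteq> I" "\<forall>i\<in>I'. s' i \<in> \<Gamma> \<and> \<rho> (s' i) \<le> \<eta> / 2" "card (I - I') \<le> L * n"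
    "sum s I = nmul n z + sum s' I' + sum s (I - I')"
    using group_summands[OF \<rho> Suc.prems(1) \<Gamma> n L' Suc.prems(3), of s] Suc.prems(4) by (metis (no_types, lifting))
  have finI': "finite I'" using z Suc.prems finite_subset by blast
  obtain w where w: "w \<in> \<Gamma>" "\<rho> (sum s' I' - nmul n w) \<le> 2 * real (L * n) * (\<eta> / 2) + real (card I') * (\<eta> / 2) / 2 ^ j"
    using Suc.hyps[of "\<eta> / 2" I' s'] Suc.prems z finI' by auto
  have t1: "sum s' I' - nmul n w \<in> G" "sum s (I - I') \<in> G"
    using z w \<Gamma> Suc.prems by (auto intro!: subgrp_diff subgrp_sum subgrp_nmul gnormD(1)[OF \<rho>])
  have "sum s I - nmul n (z + w) = (sum s' I' - nmul n w) + sum s (I - I')"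
    unfolding z(5) by (simp add: nmul_distrib)
  then have "\<rho> (sum s I - nmul n (z + w)) \<le> \<rho> (sum s' I' - nmul n w) + \<rho> (sum s (I - I'))"
    using gnormD(4)[OF \<rho> t1] by simp
  also have "\<rho> (sum s (I - I')) \<le> real (card (I - I')) * \<eta>"
    using Suc.prems \<Gamma>(2) by (intro gnorm_sum[OF \<rho>]) auto
  also have "\<dots> \<le> real (L * n) * \<eta>" using z(4) Suc.prems(1) by (intro mult_right_mono) (simp_all only: of_nat_le_iff less_imp_le)
  finally have **: "\<rho> (sum s I - nmul n (z + w)) \<le> \<rho> (sum s' I' - nmul n w) + real (L * n) * \<eta>" by simp
  have *: "real (card I') * (\<eta> / 2) / 2 ^ j \<le> real (card I) * \<eta> / 2 ^ Suc j"
    using card_mono[OF Suc.prems(3) z(2)] Suc.prems(1) by (simp add: field_simps)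
  have "\<rho> (sum s I - nmul n (z + w)) \<le> 2 * real (L * n) * \<eta> + real (card I) * \<eta> / 2 ^ Suc j"
  proof -
    have "2 * real (L * n) * (\<eta> / 2) = real (L * n) * \<eta>" by simp
    then show ?thesis using w(2) * ** by linarith
  qed
  then show ?case using subgrp_add[OF \<Gamma>(1) z(1) w(1)] by blast
qed

text \<open>Some multiple \<open>q \<gamma>\<close> is a sum of tiny elements. That sum is
  approximated by \<open>(n q) z\<close> with an error proportional to \<open>n q\<close>, and
  homogeneity divides by \<open>q\<close>. There is no control over the number of tiny summands, so
  it has to drop out of the estimate.\<close>

lemma approx_divide:
  assumes Y: "closedin T Y" "subgrp Y" and \<rho>: "gnorm Y G \<rho>" and \<Gamma>: "subgrp \<Gamma>" "\<Gamma> \<subseteq> G"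
    and tors: "\<And>\<epsilon> \<gamma>. \<epsilon> > 0 \<Longrightarrow> \<gamma> \<in> \<Gamma> \<Longrightarrow> \<exists>q\<ge>1. nmul q \<gamma> \<in> gen {x\<in>\<Gamma>. \<rho> x < \<epsilon>}"
    and "\<gamma> \<in> \<Gamma>" "n \<ge> 1" "\<epsilon> > 0"
  shows "\<exists>z\<in>\<Gamma>. \<rho> (nmul n z - \<gamma>) \<le> real n * \<epsilon>"
proof -
  obtain L where L: "\<forall>\<eta> S. 0 < \<eta> \<longrightarrow> \<eta> \<le> 1 \<longrightarrow> separated G \<rho> \<eta> S \<longrightarrow> card S \<le> L"
    using separated_bound[OF Y \<rho>] by blast
  \<comment> \<open>Makes the error \<open>(2 L + 1) \<eta>\<close> per unit of \<open>n q\<close>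
    at most \<epsilon>; the 1 accounts for the remainder after the last round.\<close>
  define \<eta> where "\<eta> = min 1 (\<epsilon> / (2 * real L + 1))"
  have eta: "0 < \<eta>" "\<eta> \<le> 1" using assms(9) by (auto simp: \<eta>_def)
  have "\<eta> \<le> \<epsilon> / (2 * real L + 1)" by (simp add: \<eta>_def)
  then have eta': "(2 * real L + 1) * \<eta> \<le> \<epsilon>" by (simp add: field_simps)
  obtain q where q: "q \<ge> 1" "nmul q \<gamma> \<in> gen {x\<in>\<Gamma>. \<rho> x < \<eta>}" using tors[OF eta(1) assms(7)] by auto
  have "\<forall>x\<in>{x\<in>\<Gamma>. \<rho> x < \<eta>}. - x \<in> {x\<in>\<Gamma>. \<rho> x < \<eta>}"
    using gnormD(5)[OF \<rho>] \<Gamma> subgrp_minus[OF \<Gamma>(1)] by auto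
  from gen_as_sum[OF this q(2)]
  obtain I :: "nat set" and s where I: "finite I" "\<forall>i\<in>I. s i \<in> {x\<in>\<Gamma>. \<rho> x < \<eta>}" "nmul q \<gamma> = sum s I"
    by (elim exE conjE)
  have nq: "n * q \<ge> 1" using q assms(8) by simp
  \<comment> \<open>\<open>card I\<close> rounds are enough: as
    \<open>card I \<le> 2 ^ card I\<close>, the remainder is at most \<eta>.\<close>
  obtain z where z: "z \<in> \<Gamma>" "\<rho> (sum s I - nmul (n * q) z) \<le> 2 * real (L * (n * q)) * \<eta> + real (card I) * \<eta> / 2 ^ card I"
    using approx_divide_sum[OF \<rho> \<Gamma> nq L eta I(1), of s "card I"] I(2) by force
  have "real (card I) \<le> 2 ^ card I" using less_exp[of "card I"] by (metis less_imp_le of_nat_le_iff of_nat_numeral of_nat_power)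
  then have "real (card I) * \<eta> / 2 ^ card I \<le> \<eta>" using eta by (simp add: field_simps)
  also have "\<dots> \<le> real (n * q) * \<eta>" using nq eta by (metis less_imp_le mult_1 mult_right_mono of_nat_1 of_nat_le_iff)
  finally have "\<rho> (sum s I - nmul (n * q) z) \<le> real (n * q) * ((2 * real L + 1) * \<eta>)" using z(2) by (simp add: algebra_simps)
  also have "\<dots> \<le> real (n * q) * \<epsilon>" using eta' by (intro mult_left_mono) auto
  finally have "\<rho> (sum s I - nmul (n * q) z) \<le> real (n * q) * \<epsilon>" .
  moreover have "sum s I - nmul (n * q) z = nmul q (\<gamma> - nmul n z)"
    unfolding I(3)[symmetric] by (simp add: nmul_diff nmul_mult mult.commute[of n q])
  moreover have g: "\<gamma> - nmul n z \<in> G" using \<Gamma> assms(7) z(1) by (auto intro: subgrp_diff subgrp_nmul)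
  ultimately have "real q * \<rho> (\<gamma> - nmul n z) \<le> real q * (real n * \<epsilon>)" using gnormD(6)[OF \<rho> g] by (simp add: algebra_simps)
  then have "\<rho> (\<gamma> - nmul n z) \<le> real n * \<epsilon>" using q(1) by simp
  moreover have "\<rho> (\<gamma> - nmul n z) = \<rho> (nmul n z - \<gamma>)" using gnormD(5)[OF \<rho> g] by simp
  ultimately show ?thesis using z(1) by auto
qed

text \<open>Solutions up to an error form a decreasing family of closed sets, and the one for error
  1 lies in a ball, so compactness yields a common point.\<close>

lemma gnorm_attained:
  assumes Y: "closedin T Y" "subgrp Y" and \<rho>: "gnorm Y G \<rho>" and \<Gamma>: "closedin T \<Gamma>" "\<Gamma> \<subseteq> G" and g: "g \<in> G" and n: "n \<ge> 1"
    and ex: "\<And>\<epsilon>. \<epsilon> > 0 \<Longrightarrow> \<exists>z\<in>\<Gamma>. \<rho> (nmul n z - g) \<le> \<epsilon>"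
  shows "\<exists>z\<in>\<Gamma>. \<rho> (nmul n z - g) = 0"
proof -
  note G = gnormD(1)[OF \<rho>]
  define S where "S \<epsilon> = {z\<in>\<Gamma>. \<rho> (nmul n z - g) \<le> \<epsilon>}" for \<epsilon>
  have inG: "nmul n z - g \<in> G" if "z \<in> G" for z using that G g by (intro subgrp_diff subgrp_nmul)
  have cl: "closedin T (S \<epsilon>)" for \<epsilon>
  proof (rule closedI)
    fix x assume x: "x \<notin> S \<epsilon>"
    show "\<exists>V. small V \<and> (\<forall>v\<in>V. x + v \<notin> S \<epsilon>)"
    proof (cases "x \<in> \<Gamma>")
      case False
      then obtain V where "small V" "\<forall>v\<in>V. x + v \<notin> \<Gamma>" using closed_separate[OF \<Gamma>(1)] by auto
      then show ?thesis by (intro exI[of _ V]) (auto simp: S_def)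
    next
      case True
      then have gt: "\<rho> (nmul n x - g) > \<epsilon>" using x by (auto simp: S_def)
      define \<delta> where "\<delta> = (\<rho> (nmul n x - g) - \<epsilon>) / real n"
      have d: "\<delta> > 0" using gt n by (simp add: \<delta>_def)
      obtain H where H: "small H" "Y \<inter> H \<subseteq> {x\<in>G. \<rho> x < \<delta>}" using gnormD(8)[OF \<rho> d] by (rule nbE)
      have "x + v \<notin> S \<epsilon>" if v: "v \<in> H" for v
      proof
        assume xv: "x + v \<in> S \<epsilon>"
        then have "x + v \<in> \<Gamma>" by (simp add: S_def)
        then have vG: "v \<in> G" using True \<Gamma>(2) subgrp_add_iff1[OF G] by blast
        then have vd: "\<rho> v < \<delta>" using H(2) v gnormD(2)[OF \<rho>] by auto
        have eq: "nmul n x - g = (nmul n (x + v) - g) - nmul n v" by (simp add: nmul_distrib)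
        have "x + v \<in> G" using \<open>x + v \<in> \<Gamma>\<close> \<Gamma>(2) by auto
        then have "\<rho> (nmul n x - g) \<le> \<rho> (nmul n (x + v) - g) + \<rho> (nmul n v)"
          unfolding eq by (intro gnorm_diff[OF \<rho>] inG subgrp_nmul[OF G vG])
        also have "\<rho> (nmul n v) = real n * \<rho> v" by (rule gnormD(6)[OF \<rho> vG])
        finally have "\<rho> (nmul n x - g) \<le> \<rho> (nmul n (x + v) - g) + real n * \<rho> v" .
        also have "\<dots> \<le> \<epsilon> + real n * \<rho> v" using xv by (simp add: S_def)
        also have "\<dots> < \<epsilon> + real n * \<delta>" using vd n by simp
        also have "\<dots> = \<rho> (nmul n x - g)" using n by (simp add: \<delta>_def)
        finally show False by simp
      qed
      then show ?thesis using H(1) by blast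
    qed
  qed
  have "S 1 \<subseteq> {x\<in>G. \<rho> x \<le> 1 + \<rho> g}"
  proof
    fix z assume z: "z \<in> S 1"
    then have zG: "z \<in> G" using \<Gamma> by (auto simp: S_def)
    have "nmul n z = (nmul n z - g) + g" by simp
    then have "\<rho> (nmul n z) \<le> \<rho> (nmul n z - g) + \<rho> g" using gnormD(4)[OF \<rho> inG[OF zG] g] by simp
    then have "real n * \<rho> z \<le> 1 + \<rho> g" using z gnormD(6)[OF \<rho> zG] by (simp add: S_def)
    moreover have "\<rho> z \<le> real n * \<rho> z" using n gnormD(3)[OF \<rho> zG] by (simp add: mult_le_cancel_right1)
    ultimately show "z \<in> {x\<in>G. \<rho> x \<le> 1 + \<rho> g}" using zG by simp
  qed
  then have comp: "compactin T (S 1)"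
    using bounded_closed_compact[OF bounded_subset[OF gnormD(7)[OF \<rho>]] cl] by metis
  have "\<exists>z. z \<in> S 1 \<inter> \<Inter>(S ` {0<..})"
  proof (rule ccontr)
    assume "\<not> ?thesis"
    then have empty: "S 1 \<inter> \<Inter>(S ` {0<..}) \<subseteq> {}" by auto
    have dir: "\<exists>D\<in>S ` {0<..}. D \<subseteq> A \<inter> B" if AB: "A \<in> S ` {0<..}" "B \<in> S ` {0<..}" for A B
    proof -
      obtain a b where "A = S a" "B = S b" "a > 0" "b > 0" using AB by auto
      moreover from this have "S (min a b) \<in> S ` {0<..}" by (intro imageI) simp
      ultimately show ?thesis by (intro bexI[of _ "S (min a b)"]) (auto simp: S_def)
    qed
    have "S ` {0<..} \<noteq> {}" by auto
    moreover have "closedin T A" if "A \<in> S ` {0<..}" for A using that cl by auto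
    ultimately have "\<exists>A\<in>S ` {0<..}. S 1 \<inter> A \<subseteq> {}"
      using dir by (rule compact_directed[OF comp _ _ _ openin_empty empty])
    then obtain a where "a > 0" "S 1 \<inter> S a = {}" by auto
    moreover obtain z where "z \<in> \<Gamma>" "\<rho> (nmul n z - g) \<le> min 1 a" using ex[of "min 1 a"] \<open>a > 0\<close> by auto
    ultimately show False by (auto simp: S_def)
  qed
  then obtain z where z: "z \<in> \<Gamma>" "\<And>\<epsilon>. \<epsilon> > 0 \<Longrightarrow> \<rho> (nmul n z - g) \<le> \<epsilon>" by (auto simp: S_def)
  then have "\<rho> (nmul n z - g) \<le> 0" using field_le_epsilon[of "\<rho> (nmul n z - g)" 0] by simp
  then show ?thesis using z(1) gnormD(3)[OF \<rho> inG, of z] \<Gamma>(2) by force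
qed

lemma exact_divide:
  assumes Y: "closedin T Y" "subgrp Y" and \<rho>: "gnorm Y G \<rho>" and \<Gamma>: "closedin T \<Gamma>" "subgrp \<Gamma>" "\<Gamma> \<subseteq> G"
    and tors: "\<And>\<epsilon> \<gamma>. \<epsilon> > 0 \<Longrightarrow> \<gamma> \<in> \<Gamma> \<Longrightarrow> \<exists>q\<ge>1. nmul q \<gamma> \<in> gen {x\<in>\<Gamma>. \<rho> x < \<epsilon>}"
    and g: "\<gamma> \<in> \<Gamma>" "n \<ge> 1"
  shows "\<exists>z\<in>\<Gamma>. \<rho> (nmul n z - \<gamma>) = 0"
proof (rule gnorm_attained[OF Y \<rho> \<Gamma>(1,3) _ g(2)])
  show "\<gamma> \<in> G" using g \<Gamma> by auto
  fix \<epsilon> :: real assume "\<epsilon> > 0"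
  then obtain z where "z \<in> \<Gamma>" "\<rho> (nmul n z - \<gamma>) \<le> real n * (\<epsilon> / real n)"
    using approx_divide[OF Y \<rho> \<Gamma>(2,3) tors g, of "\<epsilon> / real n"] g(2) by auto
  then show "\<exists>z\<in>\<Gamma>. \<rho> (nmul n z - \<gamma>) \<le> \<epsilon>" using g(2) by auto
qed

end

section \<open>Modules\<close>

definition isolator :: "'f::ab_group_add set \<Rightarrow> 'f set" where
  "isolator H = {x. \<exists>n\<ge>1. nmul n x \<in> H}"

lemma isolatorI: "n \<ge> 1 \<Longrightarrow> nmul n x \<in> H \<Longrightarrow> x \<in> isolator H"
  by (auto simp: isolator_def)

lemma isolatorE:
  assumes "x \<in> isolator H" obtains n where "n \<ge> 1" "nmul n x \<in> H"
  using assms by (auto simp: isolator_def)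

lemma isolator_mono: "H \<subseteq> K \<Longrightarrow> isolator H \<subseteq> isolator K"
  by (auto simp: isolator_def)

lemma subset_isolator: "H \<subseteq> isolator H"
proof
  fix x assume "x \<in> H" then show "x \<in> isolator H" by (intro isolatorI[of 1]) auto
qed

lemma isolator_idem: "isolator (isolator H) = isolator H"
proof
  show "isolator (isolator H) \<subseteq> isolator H"
  proof
    fix x assume "x \<in> isolator (isolator H)"
    then obtain n m where "n \<ge> 1" "m \<ge> 1" "nmul m (nmul n x) \<in> H" by (auto simp: isolator_def)
    then show "x \<in> isolator H" by (intro isolatorI[of "m * n"]) (auto simp: nmul_mult)
  qed
qed (rule subset_isolator)

lemma subgrp_isolator:
  assumes "subgrp H" shows "subgrp (isolator H)"
  unfolding subgrp_def
proof (intro conjI ballI)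
  show "0 \<in> isolator H" using subset_isolator subgrp_0[OF assms] by auto
  fix x y assume "x \<in> isolator H" "y \<in> isolator H"
  then obtain n m where nm: "n \<ge> 1" "nmul n x \<in> H" "m \<ge> 1" "nmul m y \<in> H" by (auto simp: isolator_def)
  have "nmul (m * n) (x - y) = nmul m (nmul n x) - nmul n (nmul m y)"
    by (simp add: nmul_diff nmul_mult[symmetric] mult.commute)
  then have "nmul (m * n) (x - y) \<in> H" using nm assms by (simp add: subgrp_diff subgrp_nmul)
  then show "x - y \<in> isolator H" using nm by (intro isolatorI[of "m * n"]) auto
qed

lemma finite_index_torsion:
  assumes "finite_index S H" "subgrp S" "subgrp H" "x \<in> S"
  shows "x \<in> isolator H"
proof -
  obtain F where F: "finite F" "S \<subseteq> F + H" using assms(1) by (auto simp: finite_index_def)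
  have "\<exists>f. f \<in> F \<and> nmul n x - f \<in> H" for n
  proof -
    have "nmul n x \<in> F + H" using F(2) subgrp_nmul[OF assms(2,4)] by auto
    then show ?thesis by (rule set_plus_elim) auto
  qed
  then obtain \<phi> where phi: "\<And>n. \<phi> n \<in> F \<and> nmul n x - \<phi> n \<in> H" by metis
  have "\<not> inj \<phi>" using F(1) phi by (metis finite_subset image_subsetI infinite_UNIV_nat finite_imageD)
  then obtain m n where mn: "m < n" "\<phi> m = \<phi> n" unfolding inj_def by (metis linorder_neqE_nat)
  have "nmul (n - m) x = (nmul n x - \<phi> n) - (nmul m x - \<phi> m)"
    using mn by (simp add: nmul_le_diff)
  then have "nmul (n - m) x \<in> H" using phi assms(3) by (simp add: subgrp_diff)
  then show ?thesis using mn by (intro isolatorI[of "n - m"]) auto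
qed

text \<open>Steinitz exchange for rational dependence modulo \<open>P\<close>: an \<open>x\<close>
  depending on \<open>fs\<close> but not on \<open>P\<close> alone replaces one member of the list.
  The induction moves the leading \<open>f\<close> into \<open>P\<close> as long as \<open>x\<close>
  stays independent.\<close>

lemma isolator_exchange:
  "subgrp P \<Longrightarrow> x \<notin> isolator P \<Longrightarrow> x \<in> isolator (P + gen (set fs)) \<Longrightarrow>
    \<exists>gs. Suc (length gs) = length fs \<and> set gs \<subseteq> set fs \<and>
      isolator (P + gen (set fs)) \<subseteq> isolator ((P + gen {x}) + gen (set gs))"
proof (induct fs arbitrary: P)
  case Nil
  then show ?case by simp
next
  case (Cons f fs)
  have gfs: "gen (set (f # fs)) = gen {f} + gen (set fs)" using gen_insert[of f "set fs"] by simp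
  show ?case
  proof (cases "x \<in> isolator (P + gen {f})")
    case True
    then obtain n where n: "n \<ge> 1" "nmul n x \<in> P + gen {f}" by (rule isolatorE)
    then obtain p g where p: "nmul n x = p + g" "p \<in> P" "g \<in> gen {f}" by (metis set_plus_elim)
    obtain m where m: "g = nmul m f \<or> g = - nmul m f" using p(3) by (rule gen_singletonE)
    have m1: "m \<ge> 1"
    proof (rule ccontr)
      assume "\<not> m \<ge> 1"
      then have "g = 0" using m by (cases m) auto
      then show False using p Cons.prems(2) isolatorI[OF n(1), of x P] by simp
    qed
    let ?H = "(P + gen {x}) + gen (set fs)"
    have H: "subgrp ?H" by (intro subgrp_plus subgrp_gen Cons.prems(1))
    have PxH: "P + gen {x} \<subseteq> ?H" by (rule subset_plus1[OF subgrp_0[OF subgrp_gen]])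
    have gx: "g \<in> P + gen {x}"
    proof -
      have "g = - p + nmul n x" using p(1) by simp
      then show ?thesis using subgrp_minus[OF Cons.prems(1) p(2)] subgrp_nmul[OF subgrp_gen, of x "{x}" n] gen_incl[of "{x}"]
        by (metis insert_subset set_plus_intro)
    qed
    have "nmul m f \<in> ?H"
    proof -
      have "g \<in> ?H" "- g \<in> ?H" using gx PxH subgrp_minus[OF H] by blast+
      then show ?thesis using m by auto
    qed
    then have "f \<in> isolator ?H" by (rule isolatorI[OF m1])
    moreover have "P \<subseteq> isolator ?H" "set fs \<subseteq> isolator ?H"
      using subset_isolator[of ?H] PxH subset_plus1[OF subgrp_0[OF subgrp_gen[of "{x}"]], of P] gen_incl[of "set fs"]
        subset_plus2[OF subgrp_0[OF subgrp_plus[OF Cons.prems(1) subgrp_gen[of "{x}"]]], of "gen (set fs)"] by blast+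
    ultimately have "P + gen (set (f # fs)) \<subseteq> isolator ?H"
      by (intro subgrp_plus_least gen_least subgrp_isolator H) auto
    then have "isolator (P + gen (set (f # fs))) \<subseteq> isolator ?H"
      using isolator_mono isolator_idem by metis
    then show ?thesis by (intro exI[of _ fs]) auto
  next
    case False
    have P': "subgrp (P + gen {f})" by (intro subgrp_plus subgrp_gen Cons.prems(1))
    have eq: "P + gen (set (f # fs)) = (P + gen {f}) + gen (set fs)" by (simp only: gfs add.assoc)
    then have "x \<in> isolator ((P + gen {f}) + gen (set fs))" using Cons.prems(3) by simp
    from Cons.hyps[OF P' False this]
    obtain gs where gs: "Suc (length gs) = length fs" "set gs \<subseteq> set fs"
      "isolator ((P + gen {f}) + gen (set fs)) \<subseteq> isolator (((P + gen {f}) + gen {x}) + gen (set gs))" by auto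
    have "((P + gen {f}) + gen {x}) + gen (set gs) = (P + gen {x}) + gen (set (f # gs))"
      using gen_insert[of f "set gs"] by (simp add: add_ac)
    then show ?thesis using gs eq by (intro exI[of _ "f # gs"]) auto
  qed
qed

context lc_ab_group
begin

lemma gen_compact_subset:
  assumes Y: "closedin T Y" "subgrp Y" and V: "compactin T V" "V \<subseteq> Y" "nb Y V" "0 \<in> V" "\<And>x. x \<in> V \<Longrightarrow> - x \<in> V"
  shows "\<exists>F. finite F \<and> F \<subseteq> gen V \<and> gen V \<subseteq> V + gen F"
proof -
  have VV: "V + V \<subseteq> Y" using V(2) Y(2) by (intro subgrp_plus_least)
  obtain F0 where F0: "finite F0" "F0 \<subseteq> V + V" "V + V \<subseteq> F0 + V"
    using compact_cover_nb[OF compact_plus[OF V(1) V(1)] VV Y(2) V(3)] by metis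
  have "V + V \<subseteq> gen V" using gen_incl[of V] by (intro subgrp_plus_least subgrp_gen)
  then have F0G: "F0 \<subseteq> gen V" using F0(2) by auto
  define F where "F = insert 0 (F0 \<union> uminus ` F0)"
  have F: "finite F" "0 \<in> F" "\<And>x. x \<in> F \<Longrightarrow> - x \<in> F" "F \<subseteq> gen V"
    using F0(1) F0G subgrp_0[OF subgrp_gen] subgrp_minus[OF subgrp_gen] by (auto simp: F_def)
  have "F0 + V \<subseteq> F + V" by (intro set_plus_mono2) (auto simp: F_def)
  then have VF: "V + V \<subseteq> V + F" using F0(3) by (simp add: add.commute)
  have "gen V = (\<Union>k. V + spow k F)" by (rule spow_gen(1)[OF V(4,5) F(2,3,4) VF])
  moreover have "V + spow k F \<subseteq> V + gen F" for k
    by (intro set_plus_mono2 spow_subset subgrp_gen gen_incl order_refl)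
  ultimately have "gen V \<subseteq> V + gen F" by auto
  then show ?thesis using F by auto
qed

text \<open>The list is found before \<open>P\<close> is given, so it bounds the rational rank of
  \<open>gen V\<close> modulo every open subgroup at once.\<close>

lemma compactly_gen_index:
  assumes Y: "closedin T Y" "subgrp Y" and V: "compactin T V" "V \<subseteq> Y" "nb Y V" "0 \<in> V" "\<And>x. x \<in> V \<Longrightarrow> - x \<in> V"
  shows "\<exists>fs. set fs \<subseteq> gen V \<and> (\<forall>P. subgrp P \<longrightarrow> nb Y P \<longrightarrow> finite_index (gen V) (P + gen (set fs)))"
proof -
  obtain F where F: "finite F" "F \<subseteq> gen V" and VgF: "gen V \<subseteq> V + gen F"
    using gen_compact_subset[OF Y V] by auto
  obtain fs where fs: "set fs = F" using F(1) finite_list by auto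
  have "finite_index (gen V) (P + gen (set fs))" if P: "subgrp P" "nb Y P" for P
  proof -
    obtain Ph where Ph: "finite Ph" "V \<subseteq> Ph + P" using compact_cover_nb[OF V(1,2) Y(2) P(2)] by metis
    have "gen V \<subseteq> (Ph + P) + gen F" using VgF set_plus_mono2[OF Ph(2) order_refl[of "gen F"]] by simp
    then show ?thesis using Ph(1) fs unfolding finite_index_def by (metis add.assoc)
  qed
  then show ?thesis using fs F(2) by (intro exI[of _ fs]) auto
qed

end

section \<open>Submodules, and generation of the acting group over open subgroups\<close>

locale lc_mod = lc_ab_group T for T :: "'f::ab_group_add topology" +
  fixes A :: "'g tmonoid" and ac :: "'g \<Rightarrow> 'f \<Rightarrow> 'f"
  assumes A_top: "topological_group A" and A_comm: "comm_group A" and A_gen: "compactly_generated A"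
    and ac_add: "\<And>a x y. a \<in> carrier A \<Longrightarrow> ac a (x + y) = ac a x + ac a y"
    and ac_one: "\<And>x. ac \<one>\<^bsub>A\<^esub> x = x"
    and ac_mult: "\<And>a b x. a \<in> carrier A \<Longrightarrow> b \<in> carrier A \<Longrightarrow> ac (a \<otimes>\<^bsub>A\<^esub> b) x = ac a (ac b x)"
    and ac_open: "\<And>U a x. openin T U \<Longrightarrow> a \<in> carrier A \<Longrightarrow> ac a x \<in> U \<Longrightarrow>
      \<exists>P V. openin (topo A) P \<and> a \<in> P \<and> openin T V \<and> x \<in> V \<and> (\<forall>b\<in>P. \<forall>v\<in>V. ac b v \<in> U)"
begin

lemma A_group: "group A"
  using A_top by (simp add: topological_group_def)

lemma A_space: "topspace (topo A) = carrier A"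
  using A_top by (simp add: topological_group_def)

lemma A_one: "\<one>\<^bsub>A\<^esub> \<in> carrier A"
  using group.is_monoid[OF A_group] by (rule monoid.one_closed)

lemma A_inv: "a \<in> carrier A \<Longrightarrow> inv\<^bsub>A\<^esub> a \<in> carrier A"
  by (rule group.inv_closed[OF A_group])

lemma A_mult: "a \<in> carrier A \<Longrightarrow> b \<in> carrier A \<Longrightarrow> a \<otimes>\<^bsub>A\<^esub> b \<in> carrier A"
  using group.is_monoid[OF A_group] by (rule monoid.m_closed)

lemma ac_inv: "a \<in> carrier A \<Longrightarrow> ac a (ac (inv\<^bsub>A\<^esub> a) x) = x" "a \<in> carrier A \<Longrightarrow> ac (inv\<^bsub>A\<^esub> a) (ac a x) = x"
  using ac_mult[of a "inv\<^bsub>A\<^esub> a" x] ac_mult[of "inv\<^bsub>A\<^esub> a" a x] ac_one A_inv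
  by (simp_all add: group.r_inv[OF A_group] group.l_inv[OF A_group])

lemma ac_commute: "a \<in> carrier A \<Longrightarrow> b \<in> carrier A \<Longrightarrow> ac a (ac b x) = ac b (ac a x)"
  using ac_mult[of a b x] ac_mult[of b a x] comm_monoid.m_comm[OF comm_group.axioms(1)[OF A_comm], of a b] by simp

lemma ac_0: "a \<in> carrier A \<Longrightarrow> ac a 0 = 0"
  using ac_add[of a 0 0] by simp

lemma ac_diff: "a \<in> carrier A \<Longrightarrow> ac a (x - y) = ac a x - ac a y"
  using ac_add[of a "x - y" y] by (simp add: algebra_simps)

lemma ac_nmul: "a \<in> carrier A \<Longrightarrow> ac a (nmul n x) = nmul n (ac a x)"
  by (rule nmul_hom) (rule ac_add)

lemma ac_cont: "a \<in> carrier A \<Longrightarrow> continuous_map T T (ac a)"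
  unfolding continuous_map
proof (intro conjI allI impI)
  fix U assume a: "a \<in> carrier A" and U: "openin T U"
  show "openin T {x \<in> topspace T. ac a x \<in> U}"
  proof (subst openin_subopen, intro ballI)
    fix x assume "x \<in> {x \<in> topspace T. ac a x \<in> U}"
    then have "ac a x \<in> U" by simp
    from ac_open[OF U a this] obtain P V where "a \<in> P" "openin T V" "x \<in> V" "\<forall>b\<in>P. \<forall>v\<in>V. ac b v \<in> U"
      by (elim exE conjE)
    then show "\<exists>V. openin T V \<and> x \<in> V \<and> V \<subseteq> {x \<in> topspace T. ac a x \<in> U}" by (intro exI[of _ V]) auto
  qed
qed simp

lemma ac_image:
  assumes "a \<in> carrier A"
  shows "ac a ` S = {x. ac (inv\<^bsub>A\<^esub> a) x \<in> S}"
proof (intro equalityI subsetI)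
  fix x assume "x \<in> {x. ac (inv\<^bsub>A\<^esub> a) x \<in> S}"
  then have "ac a (ac (inv\<^bsub>A\<^esub> a) x) \<in> ac a ` S" by blast
  then show "x \<in> ac a ` S" using ac_inv(1)[OF assms] by simp
qed (auto simp: ac_inv(2)[OF assms])

lemma subgrp_ac_image: "a \<in> carrier A \<Longrightarrow> subgrp S \<Longrightarrow> subgrp (ac a ` S)"
  by (rule subgrp_image) (auto simp: ac_add)

definition smod :: "'f set \<Rightarrow> bool" where
  "smod S \<longleftrightarrow> subgrp S \<and> (\<forall>a\<in>carrier A. \<forall>x\<in>S. ac a x \<in> S)"

lemma smod_subgrp: "smod S \<Longrightarrow> subgrp S"
  and smod_ac: "smod S \<Longrightarrow> a \<in> carrier A \<Longrightarrow> x \<in> S \<Longrightarrow> ac a x \<in> S"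
  by (auto simp: smod_def)

lemma smod_ac_iff: "smod S \<Longrightarrow> a \<in> carrier A \<Longrightarrow> ac a x \<in> S \<longleftrightarrow> x \<in> S"
  using smod_ac[of S "inv\<^bsub>A\<^esub> a" "ac a x"] smod_ac[of S a x] ac_inv A_inv by auto

lemma smod_ac_image: "smod S \<Longrightarrow> a \<in> carrier A \<Longrightarrow> ac a ` S = S"
  using ac_image[of a S] smod_ac_iff[of S "inv\<^bsub>A\<^esub> a"] A_inv by auto

lemma smod_UNIV: "smod UNIV"
  by (simp add: smod_def)

lemma smod_Int: "smod S \<Longrightarrow> smod R \<Longrightarrow> smod (S \<inter> R)"
  by (auto simp: smod_def intro: subgrp_Int)

lemma smod_Inter: "(\<And>S. S \<in> \<S> \<Longrightarrow> smod S) \<Longrightarrow> smod (\<Inter>\<S>)"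
  unfolding smod_def by (auto intro!: subgrp_Inter)

lemma smod_plus:
  assumes "smod S" "smod R"
  shows "smod (S + R)"
  unfolding smod_def
proof (intro conjI ballI)
  show "subgrp (S + R)" using assms by (intro subgrp_plus smod_subgrp)
  fix a x assume a: "a \<in> carrier A" and "x \<in> S + R"
  then obtain s r where "x = s + r" "s \<in> S" "r \<in> R" by (auto elim: set_plus_elim)
  then show "ac a x \<in> S + R" using a assms by (auto simp: ac_add smod_ac)
qed

lemma smod_closure:
  assumes "smod S"
  shows "smod (T closure_of S)"
  unfolding smod_def
proof (intro conjI ballI)
  show "subgrp (T closure_of S)" using assms by (intro subgrp_closure smod_subgrp)
  fix a x assume a: "a \<in> carrier A" and x: "x \<in> T closure_of S"
  have "ac a ` (T closure_of S) \<subseteq> T closure_of (ac a ` S)"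
    using ac_cont[OF a] unfolding continuous_map_eq_image_closure_subset by auto
  then show "ac a x \<in> T closure_of S" using x smod_ac_image[OF assms a] by auto
qed

lemma smod_zcl: "smod zcl"
proof -
  have "smod {0}" by (auto simp: smod_def subgrp_def ac_0)
  then show ?thesis unfolding zcl_def by (rule smod_closure)
qed

lemma nb_ac_image:
  assumes a: "a \<in> carrier A" and "smod Y" "nb Y U"
  shows "nb Y (ac a ` U)"
  unfolding ac_image[OF a]
  by (rule nb_vimage[OF assms(3) ac_cont[OF A_inv[OF a]]])
    (use smod_ac[OF assms(2) A_inv[OF a]] ac_0[OF A_inv[OF a]] in auto)

lemma A_translate:
  assumes "openin (topo A) P" "k \<in> carrier A"
  shows "openin (topo A) {x \<in> carrier A. inv\<^bsub>A\<^esub> k \<otimes>\<^bsub>A\<^esub> x \<in> P}"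
proof -
  have "continuous_map (topo A) (prod_topology (topo A) (topo A)) (\<lambda>x. (inv\<^bsub>A\<^esub> k, x))"
    using A_inv[OF assms(2)] by (simp add: continuous_map_pairwise o_def A_space)
  moreover have "continuous_map (prod_topology (topo A) (topo A)) (topo A) (\<lambda>(x, y). x \<otimes>\<^bsub>A\<^esub> y)"
    using A_top by (simp add: topological_group_def)
  ultimately have "continuous_map (topo A) (topo A) ((\<lambda>(x, y). x \<otimes>\<^bsub>A\<^esub> y) \<circ> (\<lambda>x. (inv\<^bsub>A\<^esub> k, x)))"
    by (rule continuous_map_compose)
  then show ?thesis using assms(1) by (simp add: continuous_map A_space o_def)
qed

text \<open>\<open>\<Phi>\<close> and the elements satisfying \<open>p\<close> together generate
  \<open>A\<close>, phrased as an induction over products without inverses: the sets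
  \<open>B\<close> of interest, such as the operators mapping a subgroup into itself, need not be
  closed under inverses.\<close>

definition generates :: "('g \<Rightarrow> bool) \<Rightarrow> 'g set \<Rightarrow> bool" where
  "generates p \<Phi> \<longleftrightarrow> finite \<Phi> \<and> \<Phi> \<subseteq> carrier A \<and>
    (\<forall>B. (\<forall>a\<in>carrier A. p a \<longrightarrow> a \<in> B) \<longrightarrow> \<Phi> \<subseteq> B \<longrightarrow>
      (\<forall>a\<in>carrier A \<inter> B. \<forall>b\<in>carrier A \<inter> B. a \<otimes>\<^bsub>A\<^esub> b \<in> B) \<longrightarrow> carrier A \<subseteq> B)"

lemma generates_induct:
  assumes "generates p \<Phi>" "a \<in> carrier A"
    and "\<And>a. a \<in> carrier A \<Longrightarrow> p a \<Longrightarrow> q a" "\<And>a. a \<in> \<Phi> \<Longrightarrow> q a"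
    and "\<And>a b. a \<in> carrier A \<Longrightarrow> b \<in> carrier A \<Longrightarrow> q a \<Longrightarrow> q b \<Longrightarrow> q (a \<otimes>\<^bsub>A\<^esub> b)"
  shows "q a"
proof -
  have "(\<forall>a\<in>carrier A. p a \<longrightarrow> a \<in> Collect q) \<longrightarrow> \<Phi> \<subseteq> Collect q \<longrightarrow>
      (\<forall>a\<in>carrier A \<inter> Collect q. \<forall>b\<in>carrier A \<inter> Collect q. a \<otimes>\<^bsub>A\<^esub> b \<in> Collect q) \<longrightarrow> carrier A \<subseteq> Collect q"
    using assms(1) unfolding generates_def by blast
  then have "carrier A \<subseteq> Collect q" using assms(3-5) by auto
  then show ?thesis using assms(2) by auto
qed

text \<open>Finitely many translates of the open set \<open>P\<close> cover the compact generating
  set, so \<open>T0\<close> and the centres of these translates generate \<open>A\<close>. The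
  inverses of the centres are put into \<open>\<Phi>\<close> as well.\<close>

lemma A_finitely_generated_over:
  assumes T0: "subgroup T0 A" and P: "openin (topo A) P" "\<one>\<^bsub>A\<^esub> \<in> P" "P \<subseteq> T0"
    and p: "\<And>a. a \<in> T0 \<Longrightarrow> p a"
  shows "\<exists>\<Phi>. generates p \<Phi>"
proof -
  obtain K where K: "compactin (topo A) K" "generate A K = carrier A"
    using A_gen by (auto simp: compactly_generated_def)
  have KA: "K \<subseteq> carrier A" using compactin_subset_topspace[OF K(1)] A_space by simp
  let ?U = "\<lambda>k. {x \<in> carrier A. inv\<^bsub>A\<^esub> k \<otimes>\<^bsub>A\<^esub> x \<in> P}"
  have 1: "\<forall>U\<in>?U ` K. openin (topo A) U" using A_translate[OF P(1)] KA by auto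
  have "k \<in> ?U k" if "k \<in> K" for k
    using subsetD[OF KA that] P(2) by (simp add: group.l_inv[OF A_group])
  then have 2: "K \<subseteq> \<Union>(?U ` K)" by blast
  obtain \<F> where \<F>: "finite \<F>" "\<F> \<subseteq> ?U ` K" "K \<subseteq> \<Union>\<F>"
    using K(1) 1 2 unfolding compactin_def by meson
  obtain F where F: "finite F" "F \<subseteq> K" "\<F> = ?U ` F"
    using finite_subset_image[OF \<F>(1,2)] by auto
  define \<Phi> where "\<Phi> = F \<union> (\<lambda>k. inv\<^bsub>A\<^esub> k) ` F"
  have Phi: "finite \<Phi>" "\<Phi> \<subseteq> carrier A" using F KA A_inv by (auto simp: \<Phi>_def)
  have "carrier A \<subseteq> B" if B': "\<forall>a\<in>carrier A. p a \<longrightarrow> a \<in> B" and B: "\<Phi> \<subseteq> B" "\<forall>a\<in>carrier A \<inter> B. \<forall>b\<in>carrier A \<inter> B. a \<otimes>\<^bsub>A\<^esub> b \<in> B" for B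
  proof
    have T0A: "T0 \<subseteq> carrier A" using T0 by (rule subgroup.subset)
    have T0B: "T0 \<subseteq> B" using B' p T0A by auto
    have mB: "x \<otimes>\<^bsub>A\<^esub> y \<in> carrier A \<inter> B" if "x \<in> carrier A \<inter> B" "y \<in> carrier A \<inter> B" for x y
      using B(2) A_mult that by blast
    have dec: "\<exists>k\<in>F. \<exists>t\<in>T0. h = k \<otimes>\<^bsub>A\<^esub> t" if h: "h \<in> K" for h
    proof -
      obtain k where k: "k \<in> F" "inv\<^bsub>A\<^esub> k \<otimes>\<^bsub>A\<^esub> h \<in> P" using h \<F>(3) F(3) by auto
      have kA: "k \<in> carrier A" "h \<in> carrier A" using k F KA h by auto
      have "h = k \<otimes>\<^bsub>A\<^esub> (inv\<^bsub>A\<^esub> k \<otimes>\<^bsub>A\<^esub> h)"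
        using kA A_inv by (simp add: monoid.m_assoc[OF group.is_monoid[OF A_group], symmetric] group.r_inv[OF A_group]
            monoid.l_one[OF group.is_monoid[OF A_group]])
      then show ?thesis using k P(3) by blast
    qed
    fix a assume "a \<in> carrier A"
    then have "a \<in> generate A K" using K(2) by simp
    then have "a \<in> carrier A \<inter> B"
    proof (induct rule: generate.induct)
      case one
      then show ?case using subgroup.one_closed[OF T0] T0B A_one by auto
    next
      case (incl h)
      then obtain k t where "k \<in> F" "t \<in> T0" "h = k \<otimes>\<^bsub>A\<^esub> t" using dec by metis
      moreover have "k \<in> carrier A \<inter> B" using \<open>k \<in> F\<close> F(2) KA B(1) by (auto simp: \<Phi>_def)
      moreover have "t \<in> carrier A \<inter> B" using \<open>t \<in> T0\<close> T0A T0B by auto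
      ultimately show ?case using B(2) A_mult by blast
    next
      case (inv h)
      then obtain k t where kt: "k \<in> F" "t \<in> T0" "h = k \<otimes>\<^bsub>A\<^esub> t" using dec by metis
      have kA: "k \<in> carrier A" "t \<in> carrier A" using kt F KA T0A by auto
      have eq: "inv\<^bsub>A\<^esub> h = inv\<^bsub>A\<^esub> t \<otimes>\<^bsub>A\<^esub> inv\<^bsub>A\<^esub> k"
        unfolding kt(3) by (rule group.inv_mult_group[OF A_group kA])
      have "inv\<^bsub>A\<^esub> t \<in> carrier A \<inter> B"
        using subgroup.m_inv_closed[OF T0 kt(2)] T0A T0B by auto
      moreover have "inv\<^bsub>A\<^esub> k \<in> carrier A \<inter> B" using kt(1) A_inv[OF kA(1)] B(1) by (auto simp: \<Phi>_def)
      ultimately show ?case unfolding eq by (rule mB)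
    next
      case (eng h1 h2)
      then show ?case using B(2) A_mult by blast
    qed
    then show "a \<in> B" by simp
  qed
  then show ?thesis unfolding generates_def using Phi by (intro exI[of _ \<Phi>]) auto
qed

lemma A_subgroupI:
  assumes "T0 \<subseteq> carrier A" "\<one>\<^bsub>A\<^esub> \<in> T0" "\<And>a b. a \<in> T0 \<Longrightarrow> b \<in> T0 \<Longrightarrow> a \<otimes>\<^bsub>A\<^esub> b \<in> T0" "\<And>a. a \<in> T0 \<Longrightarrow> inv\<^bsub>A\<^esub> a \<in> T0"
  shows "subgroup T0 A"
  using assms by (intro group.subgroupI[OF A_group]) auto

text \<open>\<open>W + G\<close> is open and meets \<open>Y\<close> only in \<open>W\<close>, which
  turns invariance of \<open>W\<close> into an open condition near the identity of \<open>A\<close>;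
  compactness of \<open>W\<close> lets one neighbourhood of the identity serve all its
  points.\<close>

lemma generated_over_stabilizer:
  assumes Y: "smod Y" and W: "subgrp W" "W \<subseteq> Y" "nb Y W" "compactin T W"
  shows "\<exists>\<Phi>. generates (\<lambda>a. ac a ` W \<subseteq> W) \<Phi>"
proof -
  obtain G where G: "small G" "Y \<inter> G \<subseteq> W" using W(3) by (rule nbE)
  have WG: "openin T (W + G)" by (rule open_plus[OF smallD(1)[OF G(1)]])
  have WGY: "Y \<inter> (W + G) \<subseteq> W"
  proof
    fix x assume x: "x \<in> Y \<inter> (W + G)"
    then obtain w g where wg: "x = w + g" "w \<in> W" "g \<in> G" by (meson IntD2 set_plus_elim)
    then have "g \<in> Y" using x W(2) subgrp_add_iff1[OF smod_subgrp[OF Y]] by blast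
    then show "x \<in> W" using wg G subgrp_add[OF W(1)] by blast
  qed
  have "\<exists>P V. openin (topo A) P \<and> \<one>\<^bsub>A\<^esub> \<in> P \<and> small V \<and> (\<forall>b\<in>P. \<forall>v\<in>V. ac b (w + v) \<in> W + G)" if w: "w \<in> W" for w
  proof -
    have "ac \<one>\<^bsub>A\<^esub> w \<in> W + G" using w ac_one smallD(2)[OF G(1)] subset_plus1[of G W] by auto
    from ac_open[OF WG A_one this] obtain P V where P: "openin (topo A) P" "\<one>\<^bsub>A\<^esub> \<in> P" "openin T V" "w \<in> V"
      "\<forall>b\<in>P. \<forall>v\<in>V. ac b v \<in> W + G" by auto
    show ?thesis
      by (rule exI[of _ P], rule exI[of _ "{v. w + v \<in> V}"]) (use P small_open_translate in auto)
  qed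
  then obtain P V where PV: "\<And>w. w \<in> W \<Longrightarrow> openin (topo A) (P w) \<and> \<one>\<^bsub>A\<^esub> \<in> P w \<and> small (V w) \<and> (\<forall>b\<in>P w. \<forall>v\<in>V w. ac b (w + v) \<in> W + G)"
    by metis
  obtain F where F: "finite F" "F \<subseteq> W" "\<And>x. x \<in> W \<Longrightarrow> \<exists>c\<in>F. x - c \<in> V c"
    using compact_cover_gen[OF W(4), of V] PV by metis
  define Q where "Q = topspace (topo A) \<inter> \<Inter>(P ` F)"
  have Q: "openin (topo A) Q" "\<one>\<^bsub>A\<^esub> \<in> Q"
    unfolding Q_def using F(1,2) PV A_one A_space openin_topspace[of "topo A"] by (auto intro!: openin_Int_Inter)
  have QW: "\<forall>w\<in>W. ac b w \<in> W" if b: "b \<in> Q" for b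
  proof
    fix w assume w: "w \<in> W"
    obtain c where c: "c \<in> F" "w - c \<in> V c" using F(3)[OF w] by auto
    have "ac b (c + (w - c)) \<in> W + G" using PV[of c] F(2) c b unfolding Q_def by blast
    moreover have "b \<in> carrier A" using b A_space by (auto simp: Q_def)
    ultimately show "ac b w \<in> W" using WGY w W(2) smod_ac[OF Y] by auto
  qed
  define T0 where "T0 = {a \<in> carrier A. (\<forall>w\<in>W. ac a w \<in> W) \<and> (\<forall>w\<in>W. ac (inv\<^bsub>A\<^esub> a) w \<in> W)}"
  have T0: "subgroup T0 A"
  proof (rule A_subgroupI)
    show "\<one>\<^bsub>A\<^esub> \<in> T0" using A_one ac_one by (auto simp: T0_def monoid.inv_one[OF group.is_monoid[OF A_group]])
    fix a b assume ab: "a \<in> T0" "b \<in> T0"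
    then have "ac (inv\<^bsub>A\<^esub> (a \<otimes>\<^bsub>A\<^esub> b)) x = ac (inv\<^bsub>A\<^esub> b) (ac (inv\<^bsub>A\<^esub> a) x)" for x
      by (simp add: T0_def group.inv_mult_group[OF A_group] ac_mult A_inv)
    then show "a \<otimes>\<^bsub>A\<^esub> b \<in> T0" using ab by (auto simp: T0_def A_mult ac_mult)
  next
    fix a assume "a \<in> T0"
    then show "inv\<^bsub>A\<^esub> a \<in> T0" by (auto simp: T0_def A_inv group.inv_inv[OF A_group])
  qed (auto simp: T0_def)
  define R where "R = Q \<inter> {a \<in> topspace (topo A). inv\<^bsub>A\<^esub> a \<in> Q}"
  have "continuous_map (topo A) (topo A) (\<lambda>x. inv\<^bsub>A\<^esub> x)" using A_top by (simp add: topological_group_def)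
  then have R: "openin (topo A) R" "\<one>\<^bsub>A\<^esub> \<in> R"
    using Q A_one A_space by (auto simp: R_def continuous_map monoid.inv_one[OF group.is_monoid[OF A_group]])
  have "R \<subseteq> T0" using QW A_space by (auto simp: R_def T0_def)
  then show ?thesis
    by (rule A_finitely_generated_over[OF T0 R]) (auto simp: T0_def)
qed

section \<open>Locally finite quotients and the sharp radical\<close>

definition locfin :: "'f set \<Rightarrow> 'f set \<Rightarrow> bool" where
  "locfin Y U \<longleftrightarrow> (\<forall>x\<in>Y. \<exists>S. smod S \<and> U \<subseteq> S \<and> S \<subseteq> Y \<and> x \<in> S \<and> finite_index S U)"

text \<open>For \<open>U\<close> in \<open>Y\<close>: the module \<open>Y / U\<close> has no nonzero
  finite submodule, whereas \<open>locfin Y U\<close> says that \<open>Y / U\<close> is the union of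
  its finite submodules.\<close>

definition pure :: "'f set \<Rightarrow> 'f set \<Rightarrow> bool" where
  "pure Y U \<longleftrightarrow> (\<forall>S. smod S \<and> U \<subseteq> S \<and> S \<subseteq> Y \<and> finite_index S U \<longrightarrow> S = U)"

text \<open>For closed Y this encodes that the sharp radical Omega-sharp(Y) of the paper is all of Y.\<close>

definition sharp_full :: "'f set \<Rightarrow> bool" where
  "sharp_full Y \<longleftrightarrow> (\<forall>U. smod U \<and> U \<subseteq> Y \<and> nb Y U \<and> pure Y U \<longrightarrow> U = Y)"

lemma locfin_imp_sharp_full:
  assumes "\<And>U. smod U \<Longrightarrow> U \<subseteq> Y \<Longrightarrow> nb Y U \<Longrightarrow> locfin Y U"
  shows "sharp_full Y"
  unfolding sharp_full_def
proof (intro allI impI equalityI)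
  fix U assume U: "smod U \<and> U \<subseteq> Y \<and> nb Y U \<and> pure Y U"
  show "Y \<subseteq> U"
  proof
    fix x assume "x \<in> Y"
    then obtain S where "smod S" "U \<subseteq> S" "S \<subseteq> Y" "x \<in> S" "finite_index S U"
      using assms U unfolding locfin_def by metis
    then show "x \<in> U" using U unfolding pure_def by metis
  qed
qed auto

text \<open>Modulo the open \<open>U\<close> each of the finitely many \<open>f\<close> is fixed by
  a neighbourhood of the identity, and the elements fixing all of them modulo \<open>U\<close> form
  a subgroup because \<open>U\<close> is a submodule.\<close>

lemma generated_over_fixer:
  assumes Y: "smod Y" and U: "smod U" "nb Y U" and F: "finite F" "F \<subseteq> Y"
  shows "\<exists>\<Phi>. generates (\<lambda>a. \<forall>f\<in>F. ac a f - f \<in> U) \<Phi>"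
proof -
  obtain G where G: "small G" "Y \<inter> G \<subseteq> U" using U(2) by (rule nbE)
  have "\<exists>P. openin (topo A) P \<and> \<one>\<^bsub>A\<^esub> \<in> P \<and> (\<forall>b\<in>P. ac b f - f \<in> G)" for f
  proof -
    have "openin T {x. x - f \<in> G}" by (rule open_translate'[OF smallD(1)[OF G(1)]])
    moreover have "ac \<one>\<^bsub>A\<^esub> f \<in> {x. x - f \<in> G}" using ac_one smallD(2)[OF G(1)] by simp
    ultimately obtain P V where "openin (topo A) P" "\<one>\<^bsub>A\<^esub> \<in> P" "f \<in> V" "\<forall>b\<in>P. \<forall>v\<in>V. ac b v \<in> {x. x - f \<in> G}"
      using ac_open[OF _ A_one] by metis
    then show ?thesis by (intro exI[of _ P]) auto
  qed
  then obtain P where P: "\<And>f. openin (topo A) (P f) \<and> \<one>\<^bsub>A\<^esub> \<in> P f \<and> (\<forall>b\<in>P f. ac b f - f \<in> G)" by metis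
  define Q where "Q = topspace (topo A) \<inter> \<Inter>(P ` F)"
  have Q: "openin (topo A) Q" "\<one>\<^bsub>A\<^esub> \<in> Q"
    unfolding Q_def using F(1,2) P A_one A_space openin_topspace[of "topo A"] by (auto intro!: openin_Int_Inter)
  define T0 where "T0 = {a \<in> carrier A. \<forall>f\<in>F. ac a f - f \<in> U}"
  have QT: "Q \<subseteq> T0"
  proof
    fix a assume a: "a \<in> Q"
    then have aA: "a \<in> carrier A" using A_space by (auto simp: Q_def)
    have "ac a f - f \<in> U" if "f \<in> F" for f
    proof -
      have "ac a f - f \<in> G" using P a that by (auto simp: Q_def)
      moreover have "ac a f - f \<in> Y" using that F(2) smod_ac[OF Y aA] by (intro subgrp_diff[OF smod_subgrp[OF Y]]) auto
      ultimately show ?thesis using G(2) by auto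
    qed
    then show "a \<in> T0" using aA by (simp add: T0_def)
  qed
  have T0: "subgroup T0 A"
  proof (rule A_subgroupI)
    show "\<one>\<^bsub>A\<^esub> \<in> T0" using A_one ac_one subgrp_0[OF smod_subgrp[OF U(1)]] by (auto simp: T0_def)
    fix a b assume ab: "a \<in> T0" "b \<in> T0"
    have "ac (a \<otimes>\<^bsub>A\<^esub> b) f - f \<in> U" if f: "f \<in> F" for f
    proof -
      have abA: "a \<in> carrier A" "b \<in> carrier A" using ab by (auto simp: T0_def)
      have eq: "ac (a \<otimes>\<^bsub>A\<^esub> b) f - f = ac a (ac b f - f) + (ac a f - f)"
        using abA by (simp add: ac_mult ac_diff)
      have "ac a (ac b f - f) \<in> U" using ab abA f by (intro smod_ac[OF U(1)]) (auto simp: T0_def)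
      moreover have "ac a f - f \<in> U" using ab f by (auto simp: T0_def)
      ultimately show ?thesis unfolding eq by (rule subgrp_add[OF smod_subgrp[OF U(1)]])
    qed
    then show "a \<otimes>\<^bsub>A\<^esub> b \<in> T0" using ab A_mult by (auto simp: T0_def)
  next
    fix a assume a: "a \<in> T0"
    then have aA: "a \<in> carrier A" by (simp add: T0_def)
    have "ac (inv\<^bsub>A\<^esub> a) f - f \<in> U" if f: "f \<in> F" for f
    proof -
      have "ac (inv\<^bsub>A\<^esub> a) f - f = - ac (inv\<^bsub>A\<^esub> a) (ac a f - f)" using aA by (simp add: ac_diff A_inv ac_inv)
      moreover have "ac (inv\<^bsub>A\<^esub> a) (ac a f - f) \<in> U" using a f A_inv[OF aA] by (intro smod_ac[OF U(1)]) (auto simp: T0_def)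
      ultimately show ?thesis using subgrp_minus[OF smod_subgrp[OF U(1)]] by simp
    qed
    then show "inv\<^bsub>A\<^esub> a \<in> T0" using A_inv[OF aA] by (simp add: T0_def)
  qed (auto simp: T0_def)
  show ?thesis
    by (rule A_finitely_generated_over[OF T0 Q QT]) (simp add: T0_def)
qed

lemma finite_union_finite_index:
  assumes "finite R" "smod U" "U \<subseteq> Y" "subgrp Y"
    "\<And>r. r \<in> R \<Longrightarrow> \<exists>S. smod S \<and> U \<subseteq> S \<and> S \<subseteq> Y \<and> finite_index S U \<and> r \<in> S"
  shows "\<exists>S. smod S \<and> U \<subseteq> S \<and> S \<subseteq> Y \<and> finite_index S U \<and> R \<subseteq> S"
  using assms(1,5)
proof (induct R rule: finite_induct)
  case empty
  then show ?case using assms(2,3) finite_index_refl by blast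
next
  case (insert r R)
  then obtain S where S: "smod S" "U \<subseteq> S" "S \<subseteq> Y" "finite_index S U" "R \<subseteq> S" by auto
  obtain S' where S': "smod S'" "U \<subseteq> S'" "S' \<subseteq> Y" "finite_index S' U" "r \<in> S'" using insert by blast
  have "S \<subseteq> S + S'" "S' \<subseteq> S + S'"
    using subset_plus1[OF subgrp_0[OF smod_subgrp[OF S'(1)]], of S]
      subset_plus2[OF subgrp_0[OF smod_subgrp[OF S(1)]], of S'] by auto
  moreover have "S + S' \<subseteq> Y" using S S' assms(4) by (intro subgrp_plus_least)
  moreover have "finite_index (S + S') U" using S S' smod_subgrp[OF assms(2)] by (intro finite_index_plus)
  ultimately show ?case using S S' smod_plus by (intro exI[of _ "S + S'"]) auto
qed

text \<open>Because A is compactly generated, an extension of a locally finite discrete module by a finite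
  one is again locally finite.\<close>

theorem sharp_full_locfin:
  assumes Y: "smod Y" "sharp_full Y" and U: "smod U" "U \<subseteq> Y" "nb Y U"
  shows "locfin Y U"
proof -
  note Yg = smod_subgrp[OF Y(1)] and Ug = smod_subgrp[OF U(1)]
  define fin where "fin S \<longleftrightarrow> smod S \<and> U \<subseteq> S \<and> S \<subseteq> Y \<and> finite_index S U" for S
  \<comment> \<open>\<open>N / U\<close> is the largest locally finite submodule of
    \<open>Y / U\<close>; the task is to see that \<open>N\<close> is pure.\<close>
  define N where "N = \<Union>{S. fin S}"
  have finU: "fin U" using U finite_index_refl by (auto simp: fin_def)
  have finite_N: "\<exists>S. fin S \<and> R \<subseteq> S" if R: "finite R" "R \<subseteq> N" for R
  proof -
    have "\<exists>S. smod S \<and> U \<subseteq> S \<and> S \<subseteq> Y \<and> finite_index S U \<and> r \<in> S" if "r \<in> R" for r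
    proof -
      have "r \<in> N" using that R(2) by auto
      then show ?thesis by (auto simp: N_def fin_def)
    qed
    from finite_union_finite_index[OF R(1) U(1,2) Yg this] show ?thesis by (auto simp: fin_def)
  qed
  have N: "smod N"
    unfolding smod_def subgrp_def
  proof (intro conjI ballI)
    show "0 \<in> N" using finU subgrp_0[OF Ug] by (auto simp: N_def)
    fix x y assume "x \<in> N" "y \<in> N"
    then obtain S where "fin S" "{x, y} \<subseteq> S" using finite_N[of "{x, y}"] by auto
    then show "x - y \<in> N" using subgrp_diff[OF smod_subgrp, of S x y] by (auto simp: N_def fin_def)
  next
    fix a x assume a: "a \<in> carrier A" and "x \<in> N"
    then obtain S where "fin S" "x \<in> S" by (auto simp: N_def)
    then show "ac a x \<in> N" using smod_ac[of S a x] a by (auto simp: N_def fin_def)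
  qed
  have NY: "N \<subseteq> Y" "U \<subseteq> N" using finU by (auto simp: N_def fin_def)
  have "pure Y N"
    unfolding pure_def
  proof (intro allI impI)
    fix S assume S: "smod S \<and> N \<subseteq> S \<and> S \<subseteq> Y \<and> finite_index S N"
    note Sg = smod_subgrp[OF conjunct1[OF S]]
    obtain F where F: "finite F" "0 \<in> F" "F \<subseteq> S" "S = F + N"
      using finite_index_reps[of S N] S Sg smod_subgrp[OF N] by metis
    have "F \<subseteq> Y" using F(3) S by auto
    then obtain \<Phi> where gen: "generates (\<lambda>a. \<forall>f\<in>F. ac a f - f \<in> U) \<Phi>"
      using generated_over_fixer[OF Y(1) U(1,3) F(1)] by auto
    then have Phi: "finite \<Phi>" "\<Phi> \<subseteq> carrier A" by (auto simp: generates_def)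
    \<comment> \<open>The structure constants of \<open>S / N\<close>: differences of
      representatives and their images under the generators. Their finitely many deviations from
      representatives lie in \<open>N\<close>, hence in a single \<open>S1\<close> finite over
      \<open>U\<close>, and \<open>F + S1\<close> is then already a submodule finite over
      \<open>U\<close>.\<close>
    define R where "R = (\<lambda>(f, g). f - g) ` (F \<times> F) \<union> (\<lambda>(a, f). ac a f) ` (\<Phi> \<times> F)"
    have finR: "finite R" using F(1) Phi(1) by (simp add: R_def)
    have RS: "R \<subseteq> S" using F(3) Phi(2)
      by (auto simp: R_def intro!: subgrp_diff[OF Sg] smod_ac[OF conjunct1[OF S]])
    have "\<exists>f. f \<in> F \<and> r - f \<in> N" if "r \<in> R" for r
    proof -
      have "r \<in> F + N" using that RS F(4) by auto
      then show ?thesis by (rule set_plus_elim) auto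
    qed
    then obtain \<phi> where phi: "\<And>r. r \<in> R \<Longrightarrow> \<phi> r \<in> F \<and> r - \<phi> r \<in> N" by metis
    have "finite ((\<lambda>r. r - \<phi> r) ` R)" "(\<lambda>r. r - \<phi> r) ` R \<subseteq> N" using finR phi by auto
    from finite_N[OF this] obtain S1 where S1: "fin S1" "(\<lambda>r. r - \<phi> r) ` R \<subseteq> S1" by auto
    have S1m: "smod S1" "U \<subseteq> S1" "S1 \<subseteq> Y" "finite_index S1 U" using S1(1) by (auto simp: fin_def)
    note S1g = smod_subgrp[OF S1m(1)]
    have RF: "r \<in> F + S1" if "r \<in> R" for r
    proof -
      have "\<phi> r + (r - \<phi> r) \<in> F + S1" using phi[OF that] S1(2) that by (intro set_plus_intro) auto
      then show ?thesis by simp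
    qed
    have FS1: "subgrp (F + S1)"
      unfolding subgrp_def
    proof (intro conjI ballI)
      show "0 \<in> F + S1" using set_plus_intro[OF F(2) subgrp_0[OF S1g]] by simp
      fix x y assume "x \<in> F + S1" "y \<in> F + S1"
      then obtain f s g t where *: "x = f + s" "y = g + t" "f \<in> F" "g \<in> F" "s \<in> S1" "t \<in> S1" by (metis set_plus_elim)
      have "f - g \<in> R" using * by (auto simp: R_def)
      then obtain h u where h: "f - g = h + u" "h \<in> F" "u \<in> S1" using RF by (metis set_plus_elim)
      have "x - y = (f - g) + (s - t)" using * by simp
      also have "\<dots> = h + (u + (s - t))" using h by (simp add: add.assoc)
      finally show "x - y \<in> F + S1" using h * subgrp_add[OF S1g h(3) subgrp_diff[OF S1g *(5,6)]] by (metis set_plus_intro)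
    qed
    have inv: "ac a x \<in> F + S1" if a: "a \<in> carrier A" "ac a ` F \<subseteq> F + S1" and x: "x \<in> F + S1" for a x
    proof -
      obtain f s where f: "x = f + s" "f \<in> F" "s \<in> S1" using x by (rule set_plus_elim)
      have "ac a f \<in> F + S1" using a f by auto
      moreover have "ac a s \<in> F + S1" using smod_ac[OF S1m(1) a(1) f(3)] subset_plus2[OF F(2), of S1] by auto
      ultimately show ?thesis using f(1) a(1) subgrp_add[OF FS1] by (simp add: ac_add)
    qed
    have "\<forall>x\<in>F + S1. ac a x \<in> F + S1" if "a \<in> carrier A" for a
      using gen that
    proof (rule generates_induct)
      fix a assume a: "a \<in> carrier A" "\<forall>f\<in>F. ac a f - f \<in> U"
      have "ac a ` F \<subseteq> F + S1"
      proof
        fix y assume "y \<in> ac a ` F"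
        then obtain f where f: "f \<in> F" "y = ac a f" by auto
        have "f + (ac a f - f) \<in> F + S1" using f a S1m(2) by (intro set_plus_intro) auto
        then show "y \<in> F + S1" using f by simp
      qed
      then show "\<forall>x\<in>F + S1. ac a x \<in> F + S1" using inv[OF a(1)] by blast
    next
      fix a assume a: "a \<in> \<Phi>"
      have "ac a ` F \<subseteq> F + S1" using RF a by (auto simp: R_def)
      then show "\<forall>x\<in>F + S1. ac a x \<in> F + S1" using inv[of a] a Phi(2) by blast
    qed (simp add: ac_mult)
    then have "smod (F + S1)" using FS1 by (simp add: smod_def)
    moreover have "F + S1 \<subseteq> Y" using F(3) S S1m(3) by (intro subgrp_plus_least Yg) auto
    moreover have "S1 \<subseteq> F + S1" by (rule subset_plus2[OF F(2)])
    moreover have "finite_index (F + S1) U"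
    proof -
      obtain F' where F': "finite F'" "S1 \<subseteq> F' + U" using S1m(4) by (auto simp: finite_index_def)
      then have "F + S1 \<subseteq> F + (F' + U)" by (intro set_plus_mono2) auto
      then show ?thesis using finite_plus[OF F(1) F'(1)] unfolding finite_index_def by (metis add.assoc)
    qed
    ultimately have "fin (F + S1)" using S1m(2) by (auto simp: fin_def)
    then have "F + S1 \<subseteq> N" by (auto simp: N_def)
    then have "F \<subseteq> N" using subset_plus1[OF subgrp_0[OF S1g], of F] by auto
    then have "S \<subseteq> N" unfolding F(4) by (intro subgrp_plus_least smod_subgrp[OF N]) auto
    then show "S = N" using S by auto
  qed
  moreover have "nb Y N" using nb_mono[OF U(3) NY(2)] .
  ultimately have "N = Y" using Y(2) N NY unfolding sharp_full_def by blast
  then show ?thesis unfolding locfin_def N_def fin_def by auto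
qed

end

section \<open>Compact elements and compact open subgroups\<close>

context lc_ab_group
begin

text \<open>For closed \<open>Y\<close> these are the elements contained in compact subgroups of
  \<open>Y\<close>.\<close>

definition compt :: "'f set \<Rightarrow> 'f set" where
  "compt Y = {x\<in>Y. bounded_set (range (\<lambda>n. nmul n x))}"

lemma compt_subset: "compt Y \<subseteq> Y"
  by (auto simp: compt_def)

lemma compt_mono: "Y \<subseteq> Z \<Longrightarrow> compt Y = Y \<inter> compt Z"
  by (auto simp: compt_def)

lemma subgrp_compt:
  assumes "subgrp Y" shows "subgrp (compt Y)"
  unfolding subgrp_def
proof (intro conjI ballI)
  show "0 \<in> compt Y" using subgrp_0[OF assms] bounded_finite[of "{0}"] by (simp add: compt_def image_def)
  fix x y assume xy: "x \<in> compt Y" "y \<in> compt Y"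
  have "range (\<lambda>n. nmul n (x - y)) \<subseteq> range (\<lambda>n. nmul n x) + uminus ` range (\<lambda>n. nmul n y)"
  proof
    fix z assume "z \<in> range (\<lambda>n. nmul n (x - y))"
    then obtain n where "z = nmul n x + - nmul n y" by (auto simp: nmul_diff)
    then show "z \<in> range (\<lambda>n. nmul n x) + uminus ` range (\<lambda>n. nmul n y)" by (metis imageI rangeI set_plus_intro)
  qed
  moreover have "bounded_set (range (\<lambda>n. nmul n x) + uminus ` range (\<lambda>n. nmul n y))"
    using xy by (intro bounded_plus bounded_uminus) (auto simp: compt_def)
  ultimately show "x - y \<in> compt Y"
    using xy subgrp_diff[OF assms] bounded_subset by (auto simp: compt_def)
qed

lemma compt_isolated:
  assumes "n \<ge> 1" "nmul n x \<in> compt Y" "x \<in> Y"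
  shows "x \<in> compt Y"
proof -
  have "range (\<lambda>k. nmul k x) \<subseteq> range (\<lambda>k. nmul k (nmul n x)) + (\<lambda>r. nmul r x) ` {..n}"
  proof
    fix z assume "z \<in> range (\<lambda>k. nmul k x)"
    then obtain k where "z = nmul ((k div n) * n + k mod n) x" by auto
    then have "z = nmul (k div n) (nmul n x) + nmul (k mod n) x" by (simp only: nmul_add nmul_mult)
    moreover have "k mod n \<le> n" using assms(1) by simp
    ultimately show "z \<in> range (\<lambda>k. nmul k (nmul n x)) + (\<lambda>r. nmul r x) ` {..n}" by blast
  qed
  moreover have "bounded_set (range (\<lambda>k. nmul k (nmul n x)) + (\<lambda>r. nmul r x) ` {..n})"
    by (rule bounded_plus[OF _ bounded_finite]) (use assms in \<open>auto simp: compt_def\<close>)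
  ultimately show ?thesis using assms(3) bounded_subset by (auto simp: compt_def)
qed

lemma bounded_subgrp_compt: "subgrp J \<Longrightarrow> bounded_set J \<Longrightarrow> J \<subseteq> Y \<Longrightarrow> J \<subseteq> compt Y"
  unfolding compt_def using subgrp_nmul[of J] by (auto intro: bounded_subset[of J])

lemma gnorm_closed:
  assumes Y: "closedin T Y" "subgrp Y" and \<rho>: "gnorm Y G \<rho>"
  shows "nb Y G" "closedin T G" "closedin T {x\<in>G. \<rho> x \<le> c}"
proof -
  show nbG: "nb Y G" using nb_mono[OF gnormD(8)[OF \<rho>, of 1]] by auto
  show clG: "closedin T G" by (rule closed_nb_subgrp[OF gnormD(1)[OF \<rho>] nbG gnormD(2)[OF \<rho>] Y])
  show "closedin T {x\<in>G. \<rho> x \<le> c}"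
  proof (rule closedI)
    fix x assume x: "x \<notin> {x\<in>G. \<rho> x \<le> c}"
    show "\<exists>V. small V \<and> (\<forall>v\<in>V. x + v \<notin> {x\<in>G. \<rho> x \<le> c})"
    proof (cases "x \<in> G")
      case False
      from closed_separate[OF clG this] show ?thesis by auto
    next
      case True
      then have d: "\<rho> x - c > 0" using x by auto
      obtain H where H: "small H" "Y \<inter> H \<subseteq> {y\<in>G. \<rho> y < \<rho> x - c}" using gnormD(8)[OF \<rho> d] by (rule nbE)
      have "x + v \<notin> {x\<in>G. \<rho> x \<le> c}" if v: "v \<in> H" for v
      proof
        assume xv: "x + v \<in> {x\<in>G. \<rho> x \<le> c}"
        then have vG: "v \<in> G" using True subgrp_add_iff1[OF gnormD(1)[OF \<rho>]] by blast
        then have "\<rho> v < \<rho> x - c" using H v gnormD(2)[OF \<rho>] by auto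
        moreover have "\<rho> ((x + v) - v) \<le> \<rho> (x + v) + \<rho> v" using xv vG by (intro gnorm_diff[OF \<rho>]) auto
        ultimately show False using xv by auto
      qed
      then show ?thesis using H(1) by auto
    qed
  qed
qed

text \<open>Relatively compact multiples are covered by finitely many translates of the unit ball,
  so \<open>n * \<rho> x\<close> is bounded and \<rho> vanishes at \<open>x\<close>; conversely, the
  ball of radius 0 is itself relatively compact.\<close>

lemma gnorm_kernel:
  assumes Y: "closedin T Y" "subgrp Y" and \<rho>: "gnorm Y G \<rho>"
  shows "G \<inter> compt Y = {x\<in>G. \<rho> x = 0}"
proof (intro equalityI subsetI)
  fix x assume x: "x \<in> {x\<in>G. \<rho> x = 0}"
  then have "range (\<lambda>n. nmul n x) \<subseteq> {x\<in>G. \<rho> x \<le> 0}"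
    using gnormD(6)[OF \<rho>] subgrp_nmul[OF gnormD(1)[OF \<rho>]] by auto
  then show "x \<in> G \<inter> compt Y"
    using x bounded_subset[OF gnormD(7)[OF \<rho>, of 0]] gnormD(2)[OF \<rho>] by (auto simp: compt_def)
next
  fix x assume x: "x \<in> G \<inter> compt Y"
  let ?R = "range (\<lambda>n. nmul n x)"
  have RG: "?R \<subseteq> G" using x subgrp_nmul[OF gnormD(1)[OF \<rho>]] by auto
  have R: "bounded_set ?R" "?R \<subseteq> Y" using x RG gnormD(2)[OF \<rho>] by (auto simp: compt_def)
  have n1: "nb Y {x\<in>G. \<rho> x < 1}" by (rule gnormD(8)[OF \<rho>]) simp
  obtain F where F: "finite F" "?R \<subseteq> F + {x\<in>G. \<rho> x < 1}"
    using bounded_cover_nb[OF R Y n1] by metis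
  define b where "b = Max (insert 0 (\<rho> ` (F \<inter> G))) + 1"
  have le: "real n * \<rho> x \<le> b" for n
  proof -
    have "nmul n x \<in> F + {x\<in>G. \<rho> x < 1}" using F(2) by auto
    then obtain f u where fu: "nmul n x = f + u" "f \<in> F" "u \<in> G" "\<rho> u < 1"
      by (metis (mono_tags, lifting) mem_Collect_eq set_plus_elim)
    have fG: "f \<in> G" using fu RG subgrp_add_iff2[OF gnormD(1)[OF \<rho>] fu(3), of f] by (metis rangeI subsetD)
    then have "\<rho> f \<le> Max (insert 0 (\<rho> ` (F \<inter> G)))" using F(1) fu by (intro Max_ge) auto
    moreover have "\<rho> (nmul n x) \<le> \<rho> f + \<rho> u" unfolding fu(1) by (rule gnormD(4)[OF \<rho> fG fu(3)])
    moreover have "\<rho> (nmul n x) = real n * \<rho> x" using x by (intro gnormD(6)[OF \<rho>]) auto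
    ultimately show ?thesis using fu(4) by (simp add: b_def)
  qed
  have "\<rho> x \<le> 0"
  proof (rule ccontr)
    assume "\<not> \<rho> x \<le> 0"
    then obtain n where "b < real n * \<rho> x" using reals_Archimedean3[of "\<rho> x"] by auto
    then show False using le[of n] by simp
  qed
  then show "x \<in> {x\<in>G. \<rho> x = 0}" using x gnormD(3)[OF \<rho>, of x] by auto
qed

text \<open>The closed balls are compact and shrink to the kernel, so some ball lies in any
  prescribed neighbourhood of it.\<close>

lemma gnorm_near_kernel:
  assumes Y: "closedin T Y" "subgrp Y" and \<rho>: "gnorm Y G \<rho>" and H: "small H"
  shows "\<exists>\<epsilon>>0. \<forall>x\<in>G. \<rho> x \<le> \<epsilon> \<longrightarrow> x \<in> {x\<in>G. \<rho> x = 0} + H"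
proof -
  define S where "S \<epsilon> = {x\<in>G. \<rho> x \<le> \<epsilon>}" for \<epsilon>
  let ?K = "{x\<in>G. \<rho> x = 0}"
  have cl: "closedin T (S \<epsilon>)" for \<epsilon> unfolding S_def by (rule gnorm_closed(3)[OF Y \<rho>])
  have comp: "compactin T (S 1)" using bounded_closed_compact[OF _ cl] gnormD(7)[OF \<rho>] by (simp add: S_def)
  have dir: "\<exists>D\<in>S ` {0<..}. D \<subseteq> A \<inter> B" if AB: "A \<in> S ` {0<..}" "B \<in> S ` {0<..}" for A B
  proof -
    obtain a b where "A = S a" "B = S b" "a > 0" "b > 0" using AB by auto
    moreover from this have "S (min a b) \<in> S ` {0<..}" by (intro imageI) simp
    ultimately show ?thesis by (intro bexI[of _ "S (min a b)"]) (auto simp: S_def)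
  qed
  have "S 1 \<inter> \<Inter>(S ` {0<..}) \<subseteq> ?K + H"
  proof
    fix x assume "x \<in> S 1 \<inter> \<Inter>(S ` {0<..})"
    then have x: "x \<in> G" "\<And>\<epsilon>. \<epsilon> > 0 \<Longrightarrow> \<rho> x \<le> \<epsilon>" by (auto simp: S_def)
    then have "\<rho> x \<le> 0" using field_le_epsilon[of "\<rho> x" 0] by simp
    then have "x \<in> ?K" using x gnormD(3)[OF \<rho>, of x] by auto
    then show "x \<in> ?K + H" using subset_plus1[OF smallD(2)[OF H], of ?K] by blast
  qed
  moreover have "S ` {0<..} \<noteq> {}" by auto
  moreover have "closedin T A" if "A \<in> S ` {0<..}" for A using that cl by auto
  ultimately have "\<exists>A\<in>S ` {0<..}. S 1 \<inter> A \<subseteq> ?K + H"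
    using dir by (intro compact_directed[OF comp _ _ _ open_plus[OF smallD(1)[OF H]]])
  then obtain a where a: "a > 0" "S 1 \<inter> S a \<subseteq> ?K + H" by auto
  show ?thesis
    by (rule exI[of _ "min 1 a"]) (use a in \<open>auto simp: S_def\<close>)
qed

lemma gnorm_compact_kernel:
  assumes Y: "closedin T Y" "subgrp Y" and \<rho>: "gnorm Y G \<rho>"
  shows "compactin T (G \<inter> compt Y)" "closedin T (G \<inter> compt Y)"
proof -
  have "G \<inter> compt Y = {x\<in>G. \<rho> x \<le> 0}"
    unfolding gnorm_kernel[OF Y \<rho>] using gnormD(3)[OF \<rho>] by force
  then show "closedin T (G \<inter> compt Y)" "compactin T (G \<inter> compt Y)"
    using gnorm_closed(3)[OF Y \<rho>, of 0] bounded_closed_compact[OF gnormD(7)[OF \<rho>, of 0]] by auto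
qed

lemma closed_locally:
  assumes Y: "closedin T Y" "subgrp Y" and C: "subgrp C" "C \<subseteq> Y" and G: "subgrp G" "nb Y G" and CG: "closedin T (C \<inter> G)"
  shows "closedin T C"
proof (rule closedI)
  fix x assume x: "x \<notin> C"
  obtain H where H: "small H" "Y \<inter> H \<subseteq> G" using G(2) by (rule nbE)
  show "\<exists>V. small V \<and> (\<forall>v\<in>V. x + v \<notin> C)"
  proof (cases "\<exists>h\<in>H. x + h \<in> C \<and> x \<in> Y")
    case False
    show ?thesis
    proof (cases "x \<in> Y")
      case True
      then show ?thesis using False H(1) by auto
    next
      case nY: False
      then show ?thesis using closed_separate[OF Y(1) nY] C(2) by auto
    qed
  next
    case True
    then obtain h where h: "h \<in> H" "x + h \<in> C" "x \<in> Y" by auto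
    have hY: "h \<in> Y" using h C(2) subgrp_add_iff1[OF Y(2) h(3)] by auto
    then have hG: "h \<in> G" using H h by auto
    have "- h \<notin> C \<inter> G"
    proof
      assume "- h \<in> C \<inter> G"
      then have "(x + h) + - h \<in> C" using h subgrp_add[OF C(1)] by blast
      then show False using x by simp
    qed
    then obtain V where V: "small V" "\<forall>v\<in>V. - h + v \<notin> C \<inter> G" using closed_separate[OF CG, of "- h"] by blast
    have "x + v \<notin> C" if v: "v \<in> V \<inter> H" for v
    proof
      assume xv: "x + v \<in> C"
      then have "v \<in> Y" using C(2) subgrp_add_iff1[OF Y(2) h(3)] by auto
      then have "v \<in> G" using v H by auto
      then have "- h + v \<in> G" using hG G(1) by (intro subgrp_add subgrp_minus)
      moreover have "- h + v = (x + v) - (x + h)" by simp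
      then have "- h + v \<in> C" using subgrp_diff[OF C(1) xv h(2)] by simp
      ultimately show False using V v by auto
    qed
    then show ?thesis using small_Int[OF V(1) H(1)] by auto
  qed
qed

lemma gnorm_setup:
  assumes Y: "closedin T Y" "subgrp Y"
  obtains V \<rho> where "compactin T V" "V \<subseteq> Y" "nb Y V" "0 \<in> V" "\<And>x. x \<in> V \<Longrightarrow> - x \<in> V" "gnorm Y (gen V) \<rho>"
proof -
  obtain V where V: "compactin T V" "V \<subseteq> Y" "nb Y V" "0 \<in> V" "\<And>x. x \<in> V \<Longrightarrow> - x \<in> V"
    using compact_nb[OF Y] by metis
  obtain \<rho> where "gnorm Y (gen V) \<rho>" using gnorm_exists[OF Y V] by metis
  then show ?thesis using that V by metis
qed

text \<open>Closedness can be tested inside the open subgroup \<open>gen V\<close>, where the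
  compact elements form the kernel of the seminorm.\<close>

theorem closed_compt:
  assumes Y: "closedin T Y" "subgrp Y"
  shows "closedin T (compt Y)"
proof -
  obtain V \<rho> where \<rho>: "gnorm Y (gen V) \<rho>" using gnorm_setup[OF Y] by metis
  have "closedin T (compt Y \<inter> gen V)" using gnorm_compact_kernel(2)[OF Y \<rho>] by (simp add: Int_commute)
  then show ?thesis
    by (rule closed_locally[OF Y subgrp_compt[OF Y(2)] compt_subset subgrp_gen gnorm_closed(1)[OF Y \<rho>]])
qed

definition CO :: "'f set \<Rightarrow> 'f set set" where
  "CO Y = {J. subgrp J \<and> J \<subseteq> Y \<and> nb Y J \<and> compactin T J}"

lemma CO_D: "J \<in> CO Y \<Longrightarrow> subgrp J" "J \<in> CO Y \<Longrightarrow> J \<subseteq> Y" "J \<in> CO Y \<Longrightarrow> nb Y J" "J \<in> CO Y \<Longrightarrow> compactin T J"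
  by (auto simp: CO_def)

lemma bounded_gen_finite:
  assumes "finite F" "F \<subseteq> compt Y"
  shows "bounded_set (gen F)"
  using assms
proof (induct F rule: finite_induct)
  case empty
  then show ?case by (simp add: bounded_finite)
next
  case (insert f F)
  have bf: "bounded_set (range (\<lambda>n. nmul n f))" using insert by (auto simp: compt_def)
  have "gen {f} \<subseteq> range (\<lambda>n. nmul n f) + uminus ` range (\<lambda>n. nmul n f)"
  proof
    fix x assume "x \<in> gen {f}"
    then obtain m n where "x = nmul m f + - nmul n f" by (auto simp: gen_singleton)
    then show "x \<in> range (\<lambda>n. nmul n f) + uminus ` range (\<lambda>n. nmul n f)" by (metis imageI rangeI set_plus_intro)
  qed
  then have "bounded_set (gen {f})" using bounded_subset bounded_plus[OF bf bounded_uminus[OF bf]] by blast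
  then show ?case using insert gen_insert[of f F] bounded_plus by simp
qed

text \<open>A compact symmetric neighbourhood containing \<open>D\<close> generates a bounded
  subgroup: it is covered by \<open>V\<close> plus a finitely generated group, and the generators of
  the latter are compact elements.\<close>

lemma compt_CO:
  assumes Y: "closedin T Y" "subgrp Y" and D: "bounded_set D" "D \<subseteq> compt Y"
  shows "\<exists>J\<in>CO (compt Y). D \<subseteq> J"
proof -
  let ?C = "compt Y"
  have C: "closedin T ?C" "subgrp ?C" using closed_compt[OF Y] subgrp_compt[OF Y(2)] .
  obtain V0 where V0: "compactin T V0" "V0 \<subseteq> ?C" "nb ?C V0" "0 \<in> V0" "\<And>x. x \<in> V0 \<Longrightarrow> - x \<in> V0"
    using compact_nb[OF C] by metis
  obtain D1 where D1: "compactin T D1" "closedin T D1" "D \<subseteq> D1" using D(1) by (rule bounded_setE)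
  define D2 where "D2 = D1 \<inter> ?C"
  have D2: "compactin T D2" "D2 \<subseteq> ?C" "D \<subseteq> D2"
    using D1 C(1) D(2) by (auto simp: D2_def intro: closed_compactin)
  define V where "V = V0 \<union> (D2 \<union> uminus ` D2)"
  have V: "compactin T V" "V \<subseteq> ?C" "nb ?C V" "0 \<in> V" "x \<in> V \<Longrightarrow> - x \<in> V" for x
    using V0 D2 image_compactin[OF D2(1) cont_minus] subgrp_minus[OF C(2)] nb_mono[OF V0(3), of V]
    by (auto simp: V_def intro!: compactin_Un)
  obtain F where F: "finite F" "F \<subseteq> gen V" "gen V \<subseteq> V + gen F" using gen_compact_subset[OF C V] by auto
  have GC: "gen V \<subseteq> ?C" by (rule gen_least[OF C(2) V(2)])
  then have "bounded_set (gen F)" using F by (intro bounded_gen_finite[of F Y]) auto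
  then have "bounded_set (V + gen F)" by (rule bounded_plus[OF compact_bounded[OF V(1) order_refl]])
  then have "bounded_set (gen V)" using F(3) bounded_subset by blast
  moreover have nbG: "nb ?C (gen V)" by (rule nb_mono[OF V(3) gen_incl])
  moreover have "closedin T (gen V)" by (rule closed_nb_subgrp[OF subgrp_gen nbG GC C])
  ultimately have "gen V \<in> CO ?C" using bounded_closed_compact subgrp_gen GC by (auto simp: CO_def)
  moreover have "D \<subseteq> gen V" using D2(3) gen_incl[of V] by (auto simp: V_def)
  ultimately show ?thesis by blast
qed

end

section \<open>Torsion and compact elements under full sharp radical\<close>

context lc_mod
begin

lemma smod_compt:
  assumes "smod Y" shows "smod (compt Y)"
  unfolding smod_def
proof (intro conjI ballI)
  show "subgrp (compt Y)" using subgrp_compt smod_subgrp[OF assms] by blast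
  fix a x assume a: "a \<in> carrier A" and x: "x \<in> compt Y"
  have "range (\<lambda>n. nmul n (ac a x)) = ac a ` range (\<lambda>n. nmul n x)" using ac_nmul[OF a] by (auto simp: image_image)
  then show "ac a x \<in> compt Y"
    using x bounded_image[OF _ ac_cont[OF a]] smod_ac[OF assms a] by (auto simp: compt_def)
qed

lemma locfin_restrict:
  assumes "locfin Y P" "smod P" "smod C" "C \<subseteq> Y" "U = P \<inter> C"
  shows "locfin C U"
  unfolding locfin_def
proof
  fix x assume x: "x \<in> C"
  then obtain S where S: "smod S" "P \<subseteq> S" "S \<subseteq> Y" "x \<in> S" "finite_index S P"
    using assms(1,4) unfolding locfin_def by blast
  have "finite_index (S \<inter> C) U" unfolding assms(5) by (rule finite_index_Int[OF S(5) smod_subgrp smod_subgrp]) (rule assms)+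
  then show "\<exists>S. smod S \<and> U \<subseteq> S \<and> S \<subseteq> C \<and> x \<in> S \<and> finite_index S U"
    using S x assms smod_Int[OF S(1) assms(3)] by (intro exI[of _ "S \<inter> C"]) auto
qed

text \<open>The isolators of the open subgroups stabilize because the ranks of the discrete quotients of a
  compactly generated group are bounded; the stable value is a submodule with torsion-free quotient.\<close>

theorem sharp_full_torsion:
  assumes Y: "closedin T Y" "smod Y" "sharp_full Y" and P: "subgrp P" "nb Y P"
  shows "Y \<subseteq> isolator P"
proof -
  note Yg = smod_subgrp[OF Y(2)]
  obtain V where V: "compactin T V" "V \<subseteq> Y" "nb Y V" "0 \<in> V" "\<And>x. x \<in> V \<Longrightarrow> - x \<in> V"
    using compact_nb[OF Y(1) Yg] by metis
  let ?G = "gen V"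
  obtain fs0 where fs0: "set fs0 \<subseteq> ?G" "\<And>P. subgrp P \<Longrightarrow> nb Y P \<Longrightarrow> finite_index ?G (P + gen (set fs0))"
    using compactly_gen_index[OF Y(1) Yg V] by auto
  define spans where "spans P fs \<longleftrightarrow> set fs \<subseteq> ?G \<and> ?G \<subseteq> isolator (P + gen (set fs))" for P fs
  \<comment> \<open>The rational rank of \<open>?G\<close> modulo \<open>P\<close>. It does not
    decrease as \<open>P\<close> shrinks and never exceeds the length of \<open>fs0\<close>, so it
    is maximal at some \<open>Q\<close>.\<close>
  define d where "d P = (LEAST k. \<exists>fs. length fs = k \<and> spans P fs)" for P
  have sp0: "spans P fs0" if "subgrp P" "nb Y P" for P
    unfolding spans_def
    using fs0(1) finite_index_torsion[OF fs0(2)[OF that] subgrp_gen subgrp_plus[OF that(1) subgrp_gen]] by auto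
  have d_ex: "\<exists>fs. length fs = d P \<and> spans P fs" if "spans P fs" for P fs
    unfolding d_def by (rule LeastI[of _ "length fs"]) (use that in blast)
  have d_le: "d P \<le> length fs" if "spans P fs" for P fs
    unfolding d_def by (rule Least_le) (use that in blast)
  define good where "good P \<longleftrightarrow> subgrp P \<and> nb Y P \<and> P \<subseteq> ?G" for P
  have "good ?G" using subgrp_gen nb_mono[OF V(3) gen_incl] by (auto simp: good_def)
  moreover have "\<forall>P. good P \<longrightarrow> d P \<le> length fs0" using d_le sp0 by (auto simp: good_def)
  ultimately obtain Q where Q: "good Q" "\<And>P. good P \<Longrightarrow> d P \<le> d Q"
    using ex_has_greatest_nat[of good ?G d "Suc (length fs0)"] by (metis le_imp_less_Suc)
  have Qg: "subgrp Q" "nb Y Q" "Q \<subseteq> ?G" using Q(1) by (auto simp: good_def)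
  have stable: "Q \<subseteq> isolator P" if P: "subgrp P" "nb Y P" "P \<subseteq> Q" for P
  proof (rule ccontr)
    assume "\<not> Q \<subseteq> isolator P"
    then obtain x where x: "x \<in> Q" "x \<notin> isolator P" by auto
    have gP: "good P" using P Qg by (auto simp: good_def)
    obtain fs where fs: "length fs = d P" "spans P fs" using d_ex[OF sp0[OF P(1,2)]] by auto
    have "x \<in> isolator (P + gen (set fs))" using fs(2) x(1) Qg(3) by (auto simp: spans_def)
    from isolator_exchange[OF P(1) x(2) this]
    obtain gs where gs: "Suc (length gs) = length fs" "set gs \<subseteq> set fs"
      "isolator (P + gen (set fs)) \<subseteq> isolator ((P + gen {x}) + gen (set gs))" by auto
    have "P + gen {x} \<subseteq> Q" using P(3) x(1) Qg(1) by (intro subgrp_plus_least gen_least) auto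
    then have "(P + gen {x}) + gen (set gs) \<subseteq> Q + gen (set gs)" by (intro set_plus_mono2) auto
    \<comment> \<open>Since \<open>x\<close> lies in \<open>Q\<close>, it is absorbed when
      \<open>P + gen {x}\<close> is enlarged to \<open>Q\<close>, and \<open>gs\<close> spans with
      one element fewer than \<open>d P\<close>, against \<open>d P \<le> d Q\<close>.\<close>
    then have "spans Q gs" using gs(2,3) fs(2) isolator_mono unfolding spans_def by (meson order.trans)
    then have "d Q \<le> length gs" by (rule d_le)
    then show False using Q(2)[OF gP] gs(1) fs(1) by simp
  qed
  have stable': "Q \<subseteq> isolator P" if P: "subgrp P" "nb Y P" for P
  proof -
    have "Q \<subseteq> isolator (P \<inter> Q)" using P Qg by (intro stable subgrp_Int nb_Int) auto
    then show ?thesis using isolator_mono[of "P \<inter> Q" P] by auto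
  qed
  \<comment> \<open>\<open>Q\<close> is torsion modulo every open subgroup, in particular modulo its
    own images under \<open>A\<close>, so its isolator in \<open>Y\<close> is invariant. The
    quotient by it is torsion-free and therefore without finite submodules.\<close>
  define H where "H = Y \<inter> isolator Q"
  have H: "smod H"
    unfolding smod_def
  proof (intro conjI ballI)
    show "subgrp H" unfolding H_def by (intro subgrp_Int Yg subgrp_isolator Qg(1))
    fix a x assume a: "a \<in> carrier A" and x: "x \<in> H"
    let ?b = "inv\<^bsub>A\<^esub> a"
    have b: "?b \<in> carrier A" by (rule A_inv[OF a])
    have "Q \<subseteq> isolator (ac ?b ` Q)"
      using b Qg Y(2) by (intro stable' subgrp_ac_image nb_ac_image)
    then have "isolator Q \<subseteq> isolator (ac ?b ` Q)" using isolator_mono isolator_idem by metis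
    then have "x \<in> isolator (ac ?b ` Q)" using x by (auto simp: H_def)
    then obtain n where n: "n \<ge> 1" "nmul n x \<in> ac ?b ` Q" by (rule isolatorE)
    then have "ac a (nmul n x) \<in> Q" using ac_inv[OF a] by auto
    then have "ac a x \<in> isolator Q" using n(1) ac_nmul[OF a] by (intro isolatorI[of n]) auto
    then show "ac a x \<in> H" using x smod_ac[OF Y(2) a] by (auto simp: H_def)
  qed
  have QH: "Q \<subseteq> H" using Qg(3) gen_least[OF Yg V(2)] subset_isolator[of Q] by (auto simp: H_def)
  have "pure Y H"
    unfolding pure_def
  proof (intro allI impI)
    fix S assume S: "smod S \<and> H \<subseteq> S \<and> S \<subseteq> Y \<and> finite_index S H"
    have "S \<subseteq> isolator H" using S finite_index_torsion[of S H] smod_subgrp[OF H] smod_subgrp[of S] by auto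
    also have "\<dots> \<subseteq> isolator (isolator Q)" by (rule isolator_mono) (auto simp: H_def)
    finally show "S = H" using S isolator_idem[of Q] by (auto simp: H_def)
  qed
  then have "H = Y" using Y(3) H nb_mono[OF Qg(2) QH] unfolding sharp_full_def by (auto simp: H_def)
  then have "Y \<subseteq> isolator Q" by (auto simp: H_def)
  also have "\<dots> \<subseteq> isolator (isolator P)" by (rule isolator_mono[OF stable'[OF P]])
  finally show ?thesis by (simp add: isolator_idem)
qed

text \<open>The small elements of \<open>G \<inter> N\<close> generate an open subgroup of
  \<open>N\<close>, modulo which \<open>N\<close> is torsion. This is the hypothesis
  \<open>tors\<close> of \<open>approx_divide\<close>.\<close>

lemma sharp_full_small_gen:
  assumes N: "closedin T N" "smod N" "sharp_full N" "N \<subseteq> Y" and \<rho>: "gnorm Y G \<rho>" and e: "\<epsilon> > 0" and g: "\<gamma> \<in> G \<inter> N"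
  shows "\<exists>q\<ge>1. nmul q \<gamma> \<in> gen {x\<in>G \<inter> N. \<rho> x < \<epsilon>}"
proof -
  have "nb N ({x\<in>G. \<rho> x < \<epsilon>} \<inter> N)" by (rule nb_sub[OF gnormD(8)[OF \<rho> e] N(4)])
  then have "nb N (gen {x\<in>G \<inter> N. \<rho> x < \<epsilon>})"
    by (rule nb_mono) (use gen_incl[of "{x\<in>G \<inter> N. \<rho> x < \<epsilon>}"] in auto)
  then have "N \<subseteq> isolator (gen {x\<in>G \<inter> N. \<rho> x < \<epsilon>})"
    by (rule sharp_full_torsion[OF N(1,2,3) subgrp_gen])
  then show ?thesis using g by (auto simp: isolator_def)
qed

lemma sharp_full_divide:
  assumes Q: "closedin T Q" "subgrp Q" and N: "closedin T N" "smod N" "sharp_full N" "N \<subseteq> Q"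
    and \<rho>: "gnorm Q G \<rho>" and g: "\<gamma> \<in> G \<inter> N" "n \<ge> 1"
  shows "\<exists>z\<in>G \<inter> N. \<rho> (nmul n z - \<gamma>) = 0"
proof (rule exact_divide[OF Q \<rho> _ _ _ _ g])
  show "closedin T (G \<inter> N)" using gnorm_closed(2)[OF Q \<rho>] N(1) by (rule closedin_Int)
  show "subgrp (G \<inter> N)" using gnormD(1)[OF \<rho>] smod_subgrp[OF N(2)] by (rule subgrp_Int)
qed (use sharp_full_small_gen[OF N \<rho>] in auto)

lemma uniform_torsion:
  assumes "compactin T K" "K \<subseteq> Y" "subgrp Y" "subgrp U" "nb Y U" "Y \<subseteq> isolator U"
  shows "\<exists>n\<ge>1. \<forall>x\<in>K. nmul n x \<in> U"
proof -
  obtain F where F: "finite F" "F \<subseteq> K" "K \<subseteq> F + U" using compact_cover_nb[OF assms(1,2,3,5)] by metis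
  have "\<exists>n\<ge>1. \<forall>f\<in>F. nmul n f \<in> U"
    using F(1,2)
  proof (induct F rule: finite_induct)
    case empty
    then show ?case by auto
  next
    case (insert f F)
    then obtain n where n: "n \<ge> 1" "\<forall>f\<in>F. nmul n f \<in> U" by auto
    have "f \<in> isolator U" using insert assms(2,6) by auto
    then obtain m where m: "m \<ge> 1" "nmul m f \<in> U" by (rule isolatorE)
    have "nmul (m * n) g \<in> U" if "g \<in> F" for g using n(2) that subgrp_nmul[OF assms(4)] by (simp add: nmul_mult)
    moreover have "nmul (m * n) f \<in> U" using m(2) subgrp_nmul[OF assms(4)] by (simp add: nmul_mult mult.commute[of m n])
    ultimately show ?case using n(1) m(1) by (intro exI[of _ "m * n"]) auto
  qed
  then obtain n where n: "n \<ge> 1" "\<forall>f\<in>F. nmul n f \<in> U" by auto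
  have "nmul n x \<in> U" if "x \<in> K" for x
  proof -
    have "x \<in> F + U" using F(3) that by auto
    then obtain f u where "x = f + u" "f \<in> F" "u \<in> U" by (metis set_plus_elim)
    then show ?thesis using n(2) subgrp_nmul[OF assms(4)] subgrp_add[OF assms(4)] by (simp add: nmul_distrib)
  qed
  then show ?thesis using n(1) by auto
qed

text \<open>An open \<open>U\<close> of \<open>compt Y\<close> is extended to an open submodule
  \<open>P = U + n G\<close> of \<open>Y\<close> with trace \<open>U\<close>, and local finiteness
  over \<open>P\<close> restricts. Here \<open>G\<close> is a compactly generated open subgroup and
  \<open>n\<close> kills its compact elements modulo \<open>U\<close>.\<close>

theorem sharp_full_compt:
  assumes Y: "closedin T Y" "smod Y" "sharp_full Y"
  shows "sharp_full (compt Y)"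
proof (rule locfin_imp_sharp_full)
  let ?C = "compt Y"
  fix U assume U: "smod U" "U \<subseteq> ?C" "nb ?C U"
  note Yg = smod_subgrp[OF Y(2)] and Ug = smod_subgrp[OF U(1)]
  have Cg: "subgrp ?C" by (rule subgrp_compt[OF Yg])
  obtain V \<rho> where V: "compactin T V" "V \<subseteq> Y" and \<rho>: "gnorm Y (gen V) \<rho>" using gnorm_setup[OF Y(1) Yg] by metis
  let ?G = "gen V"
  note G = gnormD(1)[OF \<rho>] and GY = gnormD(2)[OF \<rho>]
  let ?K = "?G \<inter> ?C"
  have K: "?K = {x\<in>?G. \<rho> x = 0}" by (rule gnorm_kernel[OF Y(1) Yg \<rho>])
  have div: "\<exists>z\<in>?G. nmul n z - g \<in> ?K" if g: "g \<in> ?G" "n \<ge> 1" for g n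
  proof -
    have "\<exists>z\<in>?G \<inter> Y. \<rho> (nmul n z - g) = 0"
      using sharp_full_divide[OF Y(1) Yg Y order_refl \<rho>, of g n] g GY by auto
    then obtain z where z: "z \<in> ?G" "\<rho> (nmul n z - g) = 0" by auto
    then have "nmul n z - g \<in> ?G" using g(1) G by (intro subgrp_diff subgrp_nmul)
    then show ?thesis using z unfolding K by auto
  qed
  have "\<exists>n\<ge>1. \<forall>x\<in>?K. nmul n x \<in> U \<inter> ?G"
  proof (rule uniform_torsion[OF gnorm_compact_kernel(1)[OF Y(1) Yg \<rho>] order_refl])
    show "subgrp ?K" by (rule subgrp_Int[OF G Cg])
    show "subgrp (U \<inter> ?G)" by (rule subgrp_Int[OF Ug G])
    have "nb ?K (U \<inter> ?K)" by (rule nb_sub[OF U(3)]) auto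
    then show nbK: "nb ?K (U \<inter> ?G)" by (rule nb_mono) auto
    have "?K \<subseteq> ?K" by simp
    from compact_cover_nb[OF gnorm_compact_kernel(1)[OF Y(1) Yg \<rho>] this subgrp_Int[OF G Cg] nbK]
    have "finite_index ?K (U \<inter> ?G)" unfolding finite_index_def by metis
    then show "?K \<subseteq> isolator (U \<inter> ?G)"
      using finite_index_torsion[OF _ subgrp_Int[OF G Cg] subgrp_Int[OF Ug G]] by auto
  qed
  then obtain n where n: "n \<ge> 1" "\<And>x. x \<in> ?K \<Longrightarrow> nmul n x \<in> U" by auto
  define P where "P = U + nmul n ` ?G"
  have sub: "subgrp (nmul n ` ?G)" by (rule subgrp_image[OF G]) (rule nmul_distrib)
  have P: "subgrp P" unfolding P_def by (rule subgrp_plus[OF Ug sub])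
  have UP: "U \<subseteq> P" unfolding P_def by (rule subset_plus1[OF subgrp_0[OF sub]])
  have nGP: "nmul n ` ?G \<subseteq> P" unfolding P_def by (rule subset_plus2[OF subgrp_0[OF Ug]])
  have PY: "P \<subseteq> Y"
    unfolding P_def using U(2) compt_subset[of Y] subgrp_nmul[OF G] GY by (intro subgrp_plus_least[OF Yg]) auto
  have "smod P"
    unfolding smod_def
  proof (intro conjI ballI P)
    fix b x assume b: "b \<in> carrier A" and x: "x \<in> P"
    obtain u y where uy: "x = u + y" "u \<in> U" "y \<in> nmul n ` ?G" using x unfolding P_def by (rule set_plus_elim)
    obtain g where g: "g \<in> ?G" "y = nmul n g" using uy(3) by auto
    have bV: "compactin T (ac b ` V)" "ac b ` V \<subseteq> Y"
      using image_compactin[OF V(1) ac_cont[OF b]] V(2) smod_ac[OF Y(2) b] by auto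
    have "Y \<subseteq> isolator ?G" by (rule sharp_full_torsion[OF Y G gnorm_closed(1)[OF Y(1) Yg \<rho>]])
    then obtain m where m: "m \<ge> 1" "\<forall>x\<in>ac b ` V. nmul m x \<in> ?G"
      using uniform_torsion[OF bV Yg G gnorm_closed(1)[OF Y(1) Yg \<rho>]] by auto
    have "?G \<subseteq> {x. nmul m (ac b x) \<in> ?G}"
    proof (rule gen_least)
      show "subgrp {x. nmul m (ac b x) \<in> ?G}"
        unfolding subgrp_def using subgrp_0[OF G] subgrp_diff[OF G] by (auto simp: ac_0[OF b] ac_diff[OF b] nmul_diff)
    qed (use m in auto)
    note mb = this
    \<comment> \<open>\<open>b\<close> need not preserve \<open>G\<close>, but \<open>m\<close>
      times the image of \<open>G\<close> lies in \<open>G\<close>. Dividing \<open>g\<close> by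
      \<open>m\<close> up to compact elements, \<open>b\<close> applied to \<open>n g\<close>
      becomes \<open>n\<close> times an element of \<open>G\<close> minus an element of
      \<open>U\<close>.\<close>
    obtain z where z: "z \<in> ?G" "nmul m z - g \<in> ?K" using div[OF g(1) m(1)] by auto
    have "ac b y = nmul n (nmul m (ac b z)) - ac b (nmul n (nmul m z - g))"
      by (simp add: g(2) ac_nmul[OF b] ac_diff[OF b] nmul_diff)
    moreover have "nmul n (nmul m (ac b z)) \<in> P" using mb z(1) nGP by auto
    moreover have "ac b (nmul n (nmul m z - g)) \<in> P" using smod_ac[OF U(1) b n(2)[OF z(2)]] UP by auto
    ultimately have "ac b y \<in> P" using subgrp_diff[OF P] by simp
    moreover have "ac b u \<in> P" using smod_ac[OF U(1) b uy(2)] UP by auto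
    ultimately show "ac b x \<in> P" using uy(1) subgrp_add[OF P] by (simp add: ac_add[OF b])
  qed
  moreover have "nb Y P"
  proof -
    \<comment> \<open>A small \<open>x\<close> is \<open>n z\<close> up to compact elements, with
      \<open>z\<close> of small seminorm, so \<open>z = k + h\<close> with \<open>k\<close> compact
      and \<open>h\<close> tiny. Then \<open>x - n h\<close> is a compact element so close to 0 that
      it lies in \<open>U\<close>.\<close>
    obtain H1 where H1: "small H1" "?C \<inter> H1 \<subseteq> U" using U(3) by (rule nbE)
    obtain H2 where H2: "small H2" "\<And>x y. x \<in> H2 \<Longrightarrow> y \<in> H2 \<Longrightarrow> x + y \<in> H1" "\<And>x. x \<in> H2 \<Longrightarrow> - x \<in> H2"
      using small_half[OF H1(1)] by metis
    obtain H3 where H3: "small H3" "\<forall>x\<in>H3. \<forall>k\<le>n. nmul k x \<in> H2" using small_nmul[OF H2(1)] by metis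
    obtain \<epsilon> where e: "\<epsilon> > 0" "\<forall>x\<in>?G. \<rho> x \<le> \<epsilon> \<longrightarrow> x \<in> {x\<in>?G. \<rho> x = 0} + H3"
      using gnorm_near_kernel[OF Y(1) Yg \<rho> H3(1)] by auto
    have "real n * \<epsilon> > 0" using n(1) e(1) by simp
    then obtain H4 where H4: "small H4" "Y \<inter> H4 \<subseteq> {x\<in>?G. \<rho> x < real n * \<epsilon>}" using gnormD(8)[OF \<rho>] by (metis nbE)
    have "Y \<inter> (H2 \<inter> H4) \<subseteq> P"
    proof
      fix x assume x: "x \<in> Y \<inter> (H2 \<inter> H4)"
      then have xG: "x \<in> ?G" "\<rho> x < real n * \<epsilon>" using H4 by auto
      obtain z where z: "z \<in> ?G" "nmul n z - x \<in> ?K" using div[OF xG(1) n(1)] by auto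
      have "nmul n z = (nmul n z - x) + x" by simp
      moreover have "\<rho> ((nmul n z - x) + x) \<le> \<rho> (nmul n z - x) + \<rho> x" using z(2) xG by (intro gnormD(4)[OF \<rho>]) auto
      ultimately have "\<rho> (nmul n z) \<le> \<rho> x" using z(2) unfolding K by simp
      then have "real n * \<rho> z < real n * \<epsilon>" using gnormD(6)[OF \<rho> z(1)] xG(2) by simp
      then have "\<rho> z \<le> \<epsilon>" using n(1) by simp
      then have "z \<in> {x\<in>?G. \<rho> x = 0} + H3" using e(2) z(1) by auto
      then obtain k h where kh: "z = k + h" "k \<in> ?K" "h \<in> H3" unfolding K[symmetric] by (rule set_plus_elim)
      have hG: "h \<in> ?G" using kh z(1) subgrp_add_iff1[OF G, of k h] by auto
      have eq: "x - nmul n h = nmul n k - (nmul n z - x)" by (simp add: kh(1) nmul_distrib)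
      have "x - nmul n h \<in> ?C"
        unfolding eq using kh(2) z(2) by (auto intro!: subgrp_diff[OF Cg] subgrp_nmul[OF Cg])
      moreover have "x + - nmul n h \<in> H1" using x H3(2) kh(3) by (intro H2) auto
      then have "x - nmul n h \<in> H1" by simp
      ultimately have "x - nmul n h \<in> U" using H1(2) by blast
      then have "(x - nmul n h) + nmul n h \<in> P" unfolding P_def using hG by (intro set_plus_intro) auto
      then show "x \<in> P" by simp
    qed
    then show ?thesis by (rule nbI[OF small_Int[OF H2(1) H4(1)]])
  qed
  ultimately have lf: "locfin Y P" using sharp_full_locfin[OF Y(2,3) _ PY] by simp
  \<comment> \<open>\<open>compt Y\<close> is isolated: if \<open>n g\<close> is compact then so is
    \<open>g\<close>, and \<open>n\<close> brings it into \<open>U\<close>.\<close>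
  have "P \<inter> ?C \<subseteq> U"
  proof
    fix x assume x: "x \<in> P \<inter> ?C"
    then obtain u y where uy: "x = u + y" "u \<in> U" "y \<in> nmul n ` ?G" unfolding P_def by (meson IntD1 set_plus_elim)
    obtain g where g: "g \<in> ?G" "y = nmul n g" using uy(3) by auto
    have "y \<in> ?C" using uy x U(2) subgrp_add_iff1[OF Cg, of u y] by auto
    then have "g \<in> ?C" using compt_isolated[OF n(1), of g Y] g GY by auto
    then have "y \<in> U" using n(2) g by auto
    then show "x \<in> U" using uy subgrp_add[OF Ug] by auto
  qed
  then have "U = P \<inter> ?C" using UP U(2) by auto
  then show "locfin ?C U" by (rule locfin_restrict[OF lf \<open>smod P\<close> smod_compt[OF Y(2)] compt_subset])
qed

text \<open>By cocompactness, every point of the open subgroup \<open>G\<close> is within a fixed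
  seminorm distance \<open>b\<close> of \<open>G \<inter> N\<close>. As \<open>G \<inter> N\<close>
  is divisible up to the kernel, applying this to \<open>n y\<close> and dividing by
  \<open>n\<close> brings the distance down to 0, so the difference can be taken among the compact
  elements.\<close>

theorem cocompact_compt:
  assumes Q: "closedin T Q" "smod Q" and N: "closedin T N" "smod N" "sharp_full N" "N \<subseteq> Q"
    and C: "bounded_set C" "Q \<subseteq> C + N"
  shows "\<exists>C'. bounded_set C' \<and> C' \<subseteq> compt Q \<and> Q \<subseteq> C' + N"
proof -
  note Qg = smod_subgrp[OF Q(2)] and Ng = smod_subgrp[OF N(2)]
  obtain V \<rho> where \<rho>: "gnorm Q (gen V) \<rho>" using gnorm_setup[OF Q(1) Qg] by metis
  let ?G = "gen V"
  note G = gnormD(1)[OF \<rho>] and GQ = gnormD(2)[OF \<rho>]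
  let ?K = "?G \<inter> compt Q" and ?\<Gamma> = "?G \<inter> N"
  have K: "?K = {x\<in>?G. \<rho> x = 0}" by (rule gnorm_kernel[OF Q(1) Qg \<rho>])
  have \<Gamma>: "closedin T ?\<Gamma>" "subgrp ?\<Gamma>" "?\<Gamma> \<subseteq> ?G"
    using closedin_Int[OF gnorm_closed(2)[OF Q(1) Qg \<rho>] N(1)] subgrp_Int[OF G Ng] by auto
  have nb1: "nb Q {x\<in>?G. \<rho> x < 1}" by (rule gnormD(8)[OF \<rho>]) simp
  have CQ: "bounded_set (C \<inter> Q)" using C(1) bounded_subset by blast
  obtain F where F: "finite F" "F \<subseteq> Q" "C \<inter> Q \<subseteq> F + {x\<in>?G. \<rho> x < 1}"
    using bounded_cover_nb[OF CQ Int_lower2 Q(1) Qg nb1] by metis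
  have dec: "\<exists>f\<in>F. \<exists>w\<in>?G. \<exists>\<nu>\<in>N. \<rho> w < 1 \<and> x = f + w + \<nu>" if x: "x \<in> Q" for x
  proof -
    obtain c \<nu> where c: "x = c + \<nu>" "c \<in> C" "\<nu> \<in> N" using C(2) x by (meson set_plus_elim subsetD)
    have "c \<in> Q" using c x N(4) subgrp_add_iff2[OF Qg, of \<nu> c] by auto
    then have "c \<in> F + {x\<in>?G. \<rho> x < 1}" using c F(3) by auto
    then obtain f w where "c = f + w" "f \<in> F" "w \<in> {x\<in>?G. \<rho> x < 1}" by (rule set_plus_elim)
    then show ?thesis using c by blast
  qed
  \<comment> \<open>A representative in \<open>G\<close> of the class of \<open>f\<close> modulo
    \<open>N\<close>, for those \<open>f\<close> whose class meets \<open>G\<close>. The 1 in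
    \<open>b\<close> allows for the seminorm of \<open>w\<close>.\<close>
  define gam where "gam f = (SOME g. g \<in> ?G \<and> f - g \<in> N)" for f
  define b where "b = Max (insert 0 ((\<lambda>f. \<rho> (gam f)) ` F)) + 1"
  have near: "\<exists>\<gamma>\<in>?\<Gamma>. \<rho> (x - \<gamma>) \<le> b" if x: "x \<in> ?G" for x
  proof -
    obtain f w \<nu> where f: "f \<in> F" "w \<in> ?G" "\<nu> \<in> N" "\<rho> w < 1" "x = f + w + \<nu>" using dec[of x] x GQ by auto
    have "f - (x - w) = - \<nu>" using f(5) by simp
    then have "f - (x - w) \<in> N" using subgrp_minus[OF Ng f(3)] by simp
    then have "\<exists>g. g \<in> ?G \<and> f - g \<in> N" using subgrp_diff[OF G x f(2)] by (intro exI[of _ "x - w"] conjI)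
    then have gf: "gam f \<in> ?G \<and> f - gam f \<in> N" unfolding gam_def by (rule someI_ex)
    let ?\<gamma> = "x - (gam f + w)"
    have eq: "?\<gamma> = (f - gam f) + \<nu>" using f(5) by simp
    have "?\<gamma> \<in> N" unfolding eq using gf f(3) by (intro subgrp_add[OF Ng]) auto
    moreover have "?\<gamma> \<in> ?G" using gf f(2) x G by (intro subgrp_diff subgrp_add) auto
    moreover have "\<rho> (gam f + w) \<le> \<rho> (gam f) + \<rho> w" using gf f(2) by (intro gnormD(4)[OF \<rho>]) auto
    moreover have "\<rho> (gam f) \<le> Max (insert 0 ((\<lambda>f. \<rho> (gam f)) ` F))" using F(1) f(1) by (intro Max_ge) auto
    moreover have "x - ?\<gamma> = gam f + w" by simp
    ultimately show ?thesis using f(4) by (intro bexI[of _ ?\<gamma>]) (auto simp only: b_def Int_iff)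
  qed
  have b0: "b \<ge> 0" unfolding b_def using F(1) by (smt (verit) Max_ge finite.insertI finite_imageI insertI1)
  have onto: "\<exists>z\<in>?\<Gamma>. \<rho> (z - y) = 0" if y: "y \<in> ?G" for y
  proof -
    have "\<exists>z\<in>?\<Gamma>. \<rho> (nmul 1 z - y) = 0"
    proof (rule gnorm_attained[OF Q(1) Qg \<rho> \<Gamma>(1,3) y])
      fix \<epsilon> :: real assume e: "\<epsilon> > 0"
      \<comment> \<open>Half of \<epsilon> pays for the distance \<open>b / n\<close>, the other
        half for the approximate division.\<close>
      obtain n where n: "b / (\<epsilon> / 2) < real n" using reals_Archimedean2 by blast
      have n0: "n \<ge> 1"
      proof (rule ccontr)
        assume "\<not> n \<ge> 1"
        then have "real n = 0" by simp
        then show False using n e b0 by (simp add: divide_less_0_iff)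
      qed
      have bn: "b \<le> real n * (\<epsilon> / 2)" using n e by (simp add: field_simps)
      have ny: "nmul n y \<in> ?G" by (rule subgrp_nmul[OF G y])
      obtain \<gamma> where g: "\<gamma> \<in> ?\<Gamma>" "\<rho> (nmul n y - \<gamma>) \<le> b" using near[OF ny] by auto
      have tors: "\<exists>q\<ge>1. nmul q \<gamma> \<in> gen {x\<in>?\<Gamma>. \<rho> x < \<epsilon>}" if "\<epsilon> > 0" "\<gamma> \<in> ?\<Gamma>" for \<epsilon> \<gamma>
        using sharp_full_small_gen[OF N \<rho> that] .
      have e2: "\<epsilon> / 2 > 0" using e by simp
      obtain z where z: "z \<in> ?\<Gamma>" "\<rho> (nmul n z - \<gamma>) \<le> real n * (\<epsilon> / 2)"
        using approx_divide[OF Q(1) Qg \<rho> \<Gamma>(2,3) tors g(1) n0 e2] by auto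
      have zG: "z \<in> ?G" "\<gamma> \<in> ?G" using z g by auto
      have eq: "nmul n (z - y) = (nmul n z - \<gamma>) - (nmul n y - \<gamma>)" by (simp add: nmul_diff)
      have "\<rho> (nmul n (z - y)) \<le> \<rho> (nmul n z - \<gamma>) + \<rho> (nmul n y - \<gamma>)"
        unfolding eq using zG ny subgrp_nmul[OF G zG(1)] by (intro gnorm_diff[OF \<rho>] subgrp_diff[OF G]) auto
      moreover have "\<rho> (nmul n (z - y)) = real n * \<rho> (z - y)" using zG y G by (intro gnormD(6)[OF \<rho>] subgrp_diff)
      ultimately have "real n * \<rho> (z - y) \<le> real n * (\<epsilon> / 2) + real n * (\<epsilon> / 2)" using z(2) g(2) bn by linarith
      then have "real n * \<rho> (z - y) \<le> real n * \<epsilon>" by (simp add: field_simps)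
      then have "\<rho> (z - y) \<le> \<epsilon>" using n0 by simp
      then show "\<exists>z\<in>?\<Gamma>. \<rho> (nmul 1 z - y) \<le> \<epsilon>" using z(1) by auto
    qed simp
    then show ?thesis by simp
  qed
  have KI: "x \<in> compt Q" if "x \<in> ?G" "\<rho> x = 0" for x using K that by auto
  have tors: "\<exists>m\<ge>1. nmul m x \<in> ?G" if x: "x \<in> Q" for x
  proof -
    have "Q \<subseteq> F + (?G + N)"
    proof
      fix y assume "y \<in> Q"
      then obtain f w \<nu> where "f \<in> F" "w \<in> ?G" "\<nu> \<in> N" "y = f + (w + \<nu>)" using dec[of y] by (auto simp: add.assoc)
      then show "y \<in> F + (?G + N)" by auto
    qed
    then have "finite_index Q (?G + N)" using F(1) by (auto simp: finite_index_def)
    then have "x \<in> isolator (?G + N)" by (rule finite_index_torsion[OF _ Qg subgrp_plus[OF G Ng] x])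
    then obtain m where m: "m \<ge> 1" "nmul m x \<in> ?G + N" by (rule isolatorE)
    then obtain g \<nu> where g: "nmul m x = g + \<nu>" "g \<in> ?G" "\<nu> \<in> N" by (metis set_plus_elim)
    have "nb N (?G \<inter> N)" by (rule nb_sub[OF gnorm_closed(1)[OF Q(1) Qg \<rho>] N(4)])
    then have "N \<subseteq> isolator ?\<Gamma>" using sharp_full_torsion[OF N(1,2,3) \<Gamma>(2)] by simp
    then obtain k where k: "k \<ge> 1" "nmul k \<nu> \<in> ?\<Gamma>" using g(3) by (auto simp: isolator_def)
    have "nmul (k * m) x = nmul k g + nmul k \<nu>" by (simp add: nmul_mult g(1) nmul_distrib)
    then have "nmul (k * m) x \<in> ?G" using k(2) subgrp_add[OF G subgrp_nmul[OF G g(2)]] by auto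
    then show ?thesis using m(1) k(1) by (intro exI[of _ "k * m"]) auto
  qed
  \<comment> \<open>Outside \<open>G\<close> a multiple \<open>m x\<close> is treated first.
    Dividing the element of \<open>N\<close> found for it by \<open>m\<close> gives \<open>z\<close>
    with \<open>m (z - x)\<close> compact, and then \<open>z - x\<close> is compact.\<close>
  have split: "\<exists>z\<in>N. x - z \<in> compt Q" if x: "x \<in> Q" for x
  proof -
    obtain m where m: "m \<ge> 1" "nmul m x \<in> ?G" using tors[OF x] by auto
    obtain z1 where z1: "z1 \<in> ?\<Gamma>" "\<rho> (z1 - nmul m x) = 0" using onto[OF m(2)] by auto
    obtain z where z: "z \<in> ?\<Gamma>" "\<rho> (nmul m z - z1) = 0"
      using sharp_full_divide[OF Q(1) Qg N \<rho> z1(1) m(1)] by auto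
    have "nmul m z - z1 \<in> compt Q" "z1 - nmul m x \<in> compt Q"
      using z z1 m G by (auto intro!: KI subgrp_diff subgrp_nmul)
    then have "(nmul m z - z1) + (z1 - nmul m x) \<in> compt Q" by (rule subgrp_add[OF subgrp_compt[OF Qg]])
    then have "nmul m (z - x) \<in> compt Q" by (simp add: nmul_diff)
    moreover have "z - x \<in> Q" using x z(1) N(4) by (intro subgrp_diff[OF Qg]) auto
    ultimately have "z - x \<in> compt Q" by (rule compt_isolated[OF m(1)])
    then have "- (z - x) \<in> compt Q" by (rule subgrp_minus[OF subgrp_compt[OF Qg]])
    then show ?thesis using z(1) by (intro bexI[of _ z]) auto
  qed
  then obtain \<zeta> where zeta: "\<And>x. x \<in> Q \<Longrightarrow> \<zeta> x \<in> N \<and> x - \<zeta> x \<in> compt Q" by metis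
  define C' where "C' = (\<lambda>f. f - \<zeta> f) ` F + ?K"
  have "bounded_set C'"
    unfolding C'_def using F(1) compact_bounded[OF gnorm_compact_kernel(1)[OF Q(1) Qg \<rho>] order_refl]
    by (intro bounded_plus[OF bounded_finite]) auto
  moreover have "C' \<subseteq> compt Q"
    unfolding C'_def using zeta F(2) by (intro subgrp_plus_least[OF subgrp_compt[OF Qg]]) auto
  moreover have "Q \<subseteq> C' + N"
  proof
    fix x assume x: "x \<in> Q"
    obtain f w \<nu> where f: "f \<in> F" "w \<in> ?G" "\<nu> \<in> N" "x = f + w + \<nu>" using dec[OF x] by auto
    obtain z where z: "z \<in> ?\<Gamma>" "\<rho> (z - w) = 0" using onto[OF f(2)] by auto
    have "w - z \<in> ?G" using z f(2) G by (intro subgrp_diff) auto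
    moreover have "\<rho> (w - z) = 0" using gnorm_commute[OF \<rho>, of w z] z f(2) by auto
    ultimately have "w - z \<in> ?K" using KI by auto
    then have "(f - \<zeta> f) + (w - z) \<in> C'" unfolding C'_def using f(1) by (intro set_plus_intro) auto
    moreover have "\<zeta> f + z + \<nu> \<in> N" using zeta[of f] f F(2) z by (auto intro!: subgrp_add[OF Ng])
    moreover have "x = ((f - \<zeta> f) + (w - z)) + (\<zeta> f + z + \<nu>)" using f(4) by (simp add: algebra_simps)
    ultimately show "x \<in> C' + N" by (metis set_plus_intro)
  qed
  ultimately show ?thesis by blast
qed

text \<open>Up to compact elements, a multiple of \<open>b\<close> equals \<open>(n + 1) z\<close>
  with \<open>z\<close> of arbitrarily small seminorm, and isolation puts \<open>z\<close> into
  \<open>B\<close>. So \<open>z\<close> is a compact element plus an element of the bounded subgroup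
  \<open>J\<close>, hence compact, and so is \<open>b\<close>. The application is to the preimage
  \<open>B\<close> of the compact elements of a quotient.\<close>

lemma isolated_subset_compt:
  assumes Y: "closedin T Y" "smod Y" "sharp_full Y" and B: "closedin T B" "subgrp B" "B \<subseteq> Y" "compt Y \<subseteq> B"
    and iso: "\<And>x n. x \<in> Y \<Longrightarrow> n \<ge> 1 \<Longrightarrow> nmul n x \<in> B \<Longrightarrow> x \<in> B"
    and J: "subgrp J" "nb B J" "bounded_set J" "J \<subseteq> Y"
  shows "B \<subseteq> compt Y"
proof
  note Yg = smod_subgrp[OF Y(2)]
  obtain V \<rho> where \<rho>: "gnorm Y (gen V) \<rho>" using gnorm_setup[OF Y(1) Yg] by metis
  let ?G = "gen V"
  note G = gnormD(1)[OF \<rho>] and GY = gnormD(2)[OF \<rho>]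
  have K: "?G \<inter> compt Y = {x\<in>?G. \<rho> x = 0}" by (rule gnorm_kernel[OF Y(1) Yg \<rho>])
  fix b assume b: "b \<in> B"
  have "Y \<subseteq> isolator ?G" by (rule sharp_full_torsion[OF Y G gnorm_closed(1)[OF Y(1) Yg \<rho>]])
  then obtain q where q: "q \<ge> 1" "nmul q b \<in> ?G" using b B(3) by (auto simp: isolator_def)
  let ?b = "nmul q b"
  obtain H where H: "small H" "B \<inter> H \<subseteq> J" using J(2) by (rule nbE)
  obtain \<epsilon> where e: "\<epsilon> > 0" "\<forall>x\<in>?G. \<rho> x \<le> \<epsilon> \<longrightarrow> x \<in> {x\<in>?G. \<rho> x = 0} + H"
    using gnorm_near_kernel[OF Y(1) Yg \<rho> H(1)] by auto
  obtain n where n: "\<rho> ?b / \<epsilon> < real n" using reals_Archimedean2 by blast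
  then have n': "\<rho> ?b \<le> real (Suc n) * \<epsilon>" using e(1) by (simp add: field_simps)
  obtain z where z: "z \<in> ?G" "\<rho> (nmul (Suc n) z - ?b) = 0"
    using sharp_full_divide[OF Y(1) Yg Y order_refl \<rho>, of ?b "Suc n"] q GY by auto
  let ?d = "nmul (Suc n) z - ?b"
  have dG: "?d \<in> ?G" by (rule subgrp_diff[OF G subgrp_nmul[OF G z(1)] q(2)])
  then have dK: "?d \<in> compt Y" using z(2) K by auto
  have "nmul (Suc n) z = ?d + ?b" by simp
  moreover have "?d + ?b \<in> B" using dK B(4) subgrp_nmul[OF B(2) b] by (intro subgrp_add[OF B(2)]) auto
  ultimately have zB: "z \<in> B" using iso[of z "Suc n"] z(1) GY by auto
  have "\<rho> (?d + ?b) \<le> \<rho> ?d + \<rho> ?b" by (rule gnormD(4)[OF \<rho> dG q(2)])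
  then have "\<rho> (nmul (Suc n) z) \<le> \<rho> ?b" using z(2) by simp
  then have le: "real (Suc n) * \<rho> z \<le> real (Suc n) * \<epsilon>" using gnormD(6)[OF \<rho> z(1), of "Suc n"] n' by linarith
  have "\<rho> z \<le> \<epsilon>" using mult_left_le_imp_le[OF le] by simp
  then have "z \<in> (?G \<inter> compt Y) + H" using e(2) z(1) K by auto
  then obtain k h where kh: "z = k + h" "k \<in> ?G \<inter> compt Y" "h \<in> H" by (rule set_plus_elim)
  have "h \<in> B" using kh zB B(4) subgrp_add_iff1[OF B(2), of k h] by auto
  then have "h \<in> J" using kh H by auto
  then have "h \<in> compt Y" using bounded_subgrp_compt[OF J(1,3,4)] by auto
  then have "z \<in> compt Y" using kh subgrp_add[OF subgrp_compt[OF Yg]] by auto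
  then have "nmul (Suc n) z - ?d \<in> compt Y"
    using subgrp_diff[OF subgrp_compt[OF Yg] subgrp_nmul[OF subgrp_compt[OF Yg]] dK] by blast
  then have "?b \<in> compt Y" by simp
  then show "b \<in> compt Y" using compt_isolated[OF q(1)] b B(3) by auto
qed

section \<open>Parafinite submodules and totally disconnected modules\<close>

definition parafin :: "'f set \<Rightarrow> bool" where
  "parafin K \<longleftrightarrow> (\<forall>L. smod L \<and> closedin T L \<and> L \<subseteq> K \<and> finite_index K L \<longrightarrow> L = K)"

text \<open>Encodes that \<open>W_flat\<close> is zero. Compactness and closedness are both asked
  for because no separation axiom is available, and lying in \<open>zcl\<close> means being zero in
  the Hausdorff quotient.\<close>

definition flat_zero :: "'f set \<Rightarrow> bool" where
  "flat_zero Y \<longleftrightarrow> (\<forall>K. smod K \<and> K \<subseteq> Y \<and> compactin T K \<and> closedin T K \<and> parafin K \<longrightarrow> K \<subseteq> zcl)"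

text \<open>Up to the closure of zero: a totally disconnected module that is the union of its
  compact open subgroups.\<close>

definition td :: "'f set \<Rightarrow> bool" where
  "td Y \<longleftrightarrow> closedin T Y \<and> smod Y \<and> (\<forall>x\<in>Y. \<exists>J\<in>CO Y. x \<in> J) \<and> (\<forall>U. small U \<longrightarrow> (\<exists>J\<in>CO Y. J \<subseteq> U))"

lemma CO_closed: "closedin T Y \<Longrightarrow> subgrp Y \<Longrightarrow> J \<in> CO Y \<Longrightarrow> closedin T J"
  using closed_nb_subgrp CO_D by metis

lemma CO_Int: "closedin T Y \<Longrightarrow> subgrp Y \<Longrightarrow> J \<in> CO Y \<Longrightarrow> J' \<in> CO Y \<Longrightarrow> J \<inter> J' \<in> CO Y"
  using closed_compactin[OF CO_D(4), of J Y "J \<inter> J'"] closedin_Int[OF CO_closed CO_closed]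
  by (auto simp: CO_def intro!: subgrp_Int nb_Int)

lemma CO_plus: "subgrp Y \<Longrightarrow> J \<in> CO Y \<Longrightarrow> J' \<in> CO Y \<Longrightarrow> J + J' \<in> CO Y"
  using subset_plus1[of J' J] subgrp_0[of J'] nb_mono[of Y J "J + J'"]
  by (auto simp: CO_def intro!: subgrp_plus compact_plus dest: subgrp_plus_least[of Y J J'])

lemma CO_ac:
  assumes "smod Y" "J \<in> CO Y" "a \<in> carrier A"
  shows "ac a ` J \<in> CO Y"
  using assms subgrp_ac_image[OF assms(3)] nb_ac_image[OF assms(3,1)] image_compactin[OF _ ac_cont[OF assms(3)]] smod_ac[OF assms(1,3)]
  by (auto simp: CO_def)

lemma closed_finite_index_nb:
  assumes "closedin T L" "subgrp L" "subgrp K" "L \<subseteq> K" "finite_index K L"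
  shows "nb K L"
proof -
  obtain F where F: "finite F" "K = F + L" using finite_index_reps[OF assms(5,3,2,4)] by metis
  have "\<exists>V. small V \<and> (\<forall>v\<in>V. - f + v \<notin> L)" if "f \<in> F - L" for f
  proof -
    have "- f \<notin> L" using that subgrp_minus[OF assms(2), of "- f"] by auto
    then show ?thesis by (rule closed_separate[OF assms(1)])
  qed
  then obtain V where V: "\<And>f. f \<in> F - L \<Longrightarrow> small (V f) \<and> (\<forall>v\<in>V f. - f + v \<notin> L)" by metis
  have "small (\<Inter>f\<in>F - L. V f)" using F(1) V by (intro small_Inter) auto
  moreover have "K \<inter> (\<Inter>f\<in>F - L. V f) \<subseteq> L"
  proof
    fix x assume x: "x \<in> K \<inter> (\<Inter>f\<in>F - L. V f)"
    then obtain f l where fl: "x = f + l" "f \<in> F" "l \<in> L" using F(2) by (metis IntD1 set_plus_elim)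
    have "f \<in> L"
    proof (rule ccontr)
      assume nf: "f \<notin> L"
      then have "- f + x \<notin> L" using V[of f] x fl(2) by blast
      then show False using fl by simp
    qed
    then show "x \<in> L" using fl subgrp_add[OF assms(2)] by auto
  qed
  ultimately show ?thesis by (rule nbI)
qed

text \<open>The intersection of all compact open subgroups is a compact submodule, and a finite quotient of it
  would extend to a smaller open subgroup.\<close>

theorem flat_zero_td:
  assumes Y: "closedin T Y" "smod Y" "flat_zero Y" and ex: "\<And>x. x \<in> Y \<Longrightarrow> \<exists>J\<in>CO Y. x \<in> J"
  shows "td Y"
proof -
  note Yg = smod_subgrp[OF Y(2)]
  note COI = CO_Int[OF Y(1) Yg] and COC = CO_closed[OF Y(1) Yg]
  obtain J1 where J1: "J1 \<in> CO Y" using ex[OF subgrp_0[OF Yg]] by auto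
  define K where "K = \<Inter>(CO Y)"
  have near: "\<exists>J\<in>CO Y. J \<subseteq> U" if U: "openin T U" "K \<subseteq> U" for U
  proof -
    have "\<exists>J\<in>CO Y. J1 \<inter> J \<subseteq> U"
    proof (rule compact_directed[OF CO_D(4)[OF J1] _ COC _ U(1)])
      show "CO Y \<noteq> {}" using J1 by auto
      show "\<exists>D\<in>CO Y. D \<subseteq> A \<inter> B" if "A \<in> CO Y" "B \<in> CO Y" for A B using COI[OF that] by blast
      show "J1 \<inter> \<Inter>(CO Y) \<subseteq> U" using U(2) by (auto simp: K_def)
    qed
    then show ?thesis using COI[OF J1] by blast
  qed
  have KJ: "K \<subseteq> J" if "J \<in> CO Y" for J using that by (auto simp: K_def)
  have clK: "closedin T K" unfolding K_def using J1 COC by (intro closedin_Inter) auto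
  have cK: "compactin T K" by (rule closed_compactin[OF CO_D(4)[OF J1] KJ[OF J1] clK])
  have mK: "smod K"
    unfolding smod_def
  proof (intro conjI ballI)
    show "subgrp K" unfolding K_def by (rule subgrp_Inter) (rule CO_D(1))
    fix a x assume a: "a \<in> carrier A" and x: "x \<in> K"
    show "ac a x \<in> K"
      unfolding K_def
    proof
      fix J assume J: "J \<in> CO Y"
      have "x \<in> ac (inv\<^bsub>A\<^esub> a) ` J" using KJ[OF CO_ac[OF Y(2) J A_inv[OF a]]] x by auto
      then show "ac a x \<in> J" using ac_inv(1)[OF a] by auto
    qed
  qed
  note Kg = smod_subgrp[OF mK]
  have "parafin K"
    unfolding parafin_def
  proof (intro allI impI)
    fix L assume L: "smod L \<and> closedin T L \<and> L \<subseteq> K \<and> finite_index K L"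
    then have Lg: "subgrp L" using smod_subgrp by auto
    have "nb K L" using L Lg Kg by (intro closed_finite_index_nb) auto
    then obtain B0 where B0: "small B0" "K \<inter> B0 \<subseteq> L" by (rule nbE)
    obtain B where B: "small B" "\<And>x y z w. x \<in> B \<Longrightarrow> y \<in> B \<Longrightarrow> z \<in> B \<Longrightarrow> w \<in> B \<Longrightarrow> x + y + z + w \<in> B0"
      "\<And>x. x \<in> B \<Longrightarrow> - x \<in> B" using small_quarter[OF B0(1)] by metis
    have z0: "0 \<in> B" by (rule smallD(2)[OF B(1)])
    obtain J where J: "J \<in> CO Y" "J \<subseteq> K + B"
      using near[OF open_plus[OF smallD(1)[OF B(1)]] subset_plus1[OF z0]] by auto
    \<comment> \<open>\<open>L + B\<close> is not a group, but its part in \<open>J\<close> is: the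
      \<open>K\<close>-component of a difference is within \<open>B0\<close> of \<open>L\<close>,
      and elements of \<open>K\<close> in \<open>B0\<close> belong to \<open>L\<close>. Being
      compact and open, \<open>H\<close> contains \<open>K\<close>, which forces
      \<open>K \<subseteq> L\<close>.\<close>
    define H where "H = J \<inter> (L + B)"
    have H: "subgrp H"
      unfolding subgrp_def
    proof (intro conjI ballI)
      show "0 \<in> H" unfolding H_def using subgrp_0[OF CO_D(1)[OF J(1)]] set_plus_intro[OF subgrp_0[OF Lg] z0] by simp
      fix x y assume xy: "x \<in> H" "y \<in> H"
      then have xyJ: "x - y \<in> J" using subgrp_diff[OF CO_D(1)[OF J(1)]] by (auto simp: H_def)
      obtain l b l' b' where lb: "x = l + b" "l \<in> L" "b \<in> B" "y = l' + b'" "l' \<in> L" "b' \<in> B"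
        using xy unfolding H_def by (metis IntD2 set_plus_elim)
      obtain k c where kc: "x - y = k + c" "k \<in> K" "c \<in> B" using xyJ J(2) by (meson set_plus_elim subsetD)
      have eq: "k - (l - l') = b + - b' + - c + 0"
      proof -
        have "k = x - y - c" using kc(1) by simp
        then show ?thesis using lb by simp
      qed
      have "k - (l - l') \<in> B0" unfolding eq using lb kc z0 B(3) by (intro B(2)) auto
      moreover have "l - l' \<in> L" by (rule subgrp_diff[OF Lg lb(2,5)])
      moreover from this have "k - (l - l') \<in> K" using subgrp_diff[OF Kg kc(2), of "l - l'"] L by auto
      ultimately have "(k - (l - l')) + (l - l') \<in> L" using B0(2) subgrp_add[OF Lg] by blast
      then have "k \<in> L" by simp
      then have "x - y \<in> L + B" using kc by auto
      then show "x - y \<in> H" using xyJ by (simp add: H_def)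
    qed
    have "nb Y H"
    proof -
      obtain G where G: "small G" "Y \<inter> G \<subseteq> J" using CO_D(3)[OF J(1)] by (rule nbE)
      have "Y \<inter> (G \<inter> B) \<subseteq> H" unfolding H_def using G subset_plus2[OF subgrp_0[OF Lg], of B] by auto
      then show ?thesis by (rule nbI[OF small_Int[OF G(1) B(1)]])
    qed
    moreover have HJ: "H \<subseteq> J" by (simp add: H_def)
    moreover have HY: "H \<subseteq> Y" using HJ CO_D(2)[OF J(1)] by auto
    moreover have "compactin T H"
      using closed_compactin[OF CO_D(4)[OF J(1)] HJ] closed_nb_subgrp[OF H \<open>nb Y H\<close> HY Y(1) Yg] by simp
    ultimately have "H \<in> CO Y" using H by (auto simp: CO_def)
    then have KH: "K \<subseteq> H" by (rule KJ)
    have "K \<subseteq> L"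
    proof
      fix k assume k: "k \<in> K"
      then have "k \<in> L + B" using KH by (auto simp: H_def)
      then obtain l b where lb: "k = l + b" "l \<in> L" "b \<in> B" by (rule set_plus_elim)
      have "b + 0 + 0 + 0 \<in> B0" using lb z0 by (intro B(2)) auto
      moreover have "b \<in> K" using lb k L subgrp_add_iff1[OF Kg, of l b] by auto
      ultimately have "b \<in> L" using B0(2) by auto
      then show "k \<in> L" using lb subgrp_add[OF Lg] by auto
    qed
    then show "L = K" using L by auto
  qed
  then have "K \<subseteq> zcl" using Y(3) mK cK clK KJ[OF J1] CO_D(2)[OF J1] unfolding flat_zero_def by blast
  then have "\<exists>J\<in>CO Y. J \<subseteq> U" if U: "small U" for U
    using near[of U] U zcl_open[OF smallD(1)[OF U]] subset_plus2[OF smallD(2)[OF U], of zcl] by (auto simp: smallD)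
  then show ?thesis unfolding td_def using Y ex by auto
qed

lemma td_sub:
  assumes "td Y" "closedin T Z" "smod Z" "Z \<subseteq> Y"
  shows "td Z" "\<And>J. J \<in> CO Y \<Longrightarrow> J \<inter> Z \<in> CO Z"
proof -
  have Y: "closedin T Y" "smod Y" "\<And>x. x \<in> Y \<Longrightarrow> \<exists>J\<in>CO Y. x \<in> J" "\<And>U. small U \<Longrightarrow> \<exists>J\<in>CO Y. J \<subseteq> U"
    using assms(1) by (auto simp: td_def)
  show *: "J \<inter> Z \<in> CO Z" if J: "J \<in> CO Y" for J
  proof -
    have "closedin T (J \<inter> Z)" using CO_closed[OF Y(1) smod_subgrp[OF Y(2)] J] assms(2) by (rule closedin_Int)
    then have "compactin T (J \<inter> Z)" by (rule closed_compactin[OF CO_D(4)[OF J] Int_lower1])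
    then show ?thesis
      using subgrp_Int[OF CO_D(1)[OF J] smod_subgrp[OF assms(3)]] nb_sub[OF CO_D(3)[OF J] assms(4)] by (auto simp: CO_def)
  qed
  have "\<exists>J\<in>CO Z. x \<in> J" if "x \<in> Z" for x
    using Y(3)[of x] assms(4) that * by blast
  moreover have "\<exists>J\<in>CO Z. J \<subseteq> U" if "small U" for U
    using Y(4)[OF that] * by blast
  ultimately show "td Z" using assms(2,3) by (auto simp: td_def)
qed

end

section \<open>Totally disconnected modules\<close>

context lc_mod
begin

section \<open>Orbits under the powers of one operator\<close>

abbreviation ap :: "'g \<Rightarrow> nat \<Rightarrow> 'g" where
  "ap a n \<equiv> a [^]\<^bsub>A\<^esub> n"

abbreviation iv :: "'g \<Rightarrow> 'g" where
  "iv a \<equiv> inv\<^bsub>A\<^esub> a"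

declare ac_one [simp] nat_pow_Suc [simp del]

lemma ap_in: "a \<in> carrier A \<Longrightarrow> ap a n \<in> carrier A"
  by (rule monoid.nat_pow_closed[OF group.is_monoid[OF A_group]])

lemma iv_iv: "a \<in> carrier A \<Longrightarrow> iv (iv a) = a"
  by (rule group.inv_inv[OF A_group])

lemma ac_ap_0: "ac (ap a 0) x = x"
  by (simp add: monoid.nat_pow_0[OF group.is_monoid[OF A_group]] ac_one)

lemma ac_ap_Suc: "a \<in> carrier A \<Longrightarrow> ac (ap a (Suc n)) x = ac (ap a n) (ac a x)"
  by (simp add: monoid.nat_pow_Suc[OF group.is_monoid[OF A_group]] ac_mult ap_in)

lemma ac_ap_Suc': "a \<in> carrier A \<Longrightarrow> ac (ap a (Suc n)) x = ac a (ac (ap a n) x)"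
  by (simp add: ac_ap_Suc ac_commute ap_in)

lemma ac_ap_add: "a \<in> carrier A \<Longrightarrow> ac (ap a (m + n)) x = ac (ap a m) (ac (ap a n) x)"
  by (simp add: monoid.nat_pow_mult[OF group.is_monoid[OF A_group], symmetric] ac_mult ap_in)

lemma ac_ap_iv: "a \<in> carrier A \<Longrightarrow> ac (ap (iv a) n) (ac (ap a n) x) = x"
proof (induct n arbitrary: x)
  case (Suc n)
  then show ?case
    by (simp only: ac_ap_Suc'[OF Suc.prems] ac_ap_Suc[OF A_inv[OF Suc.prems]] ac_inv(2)[OF Suc.prems])
qed (simp only: ac_ap_0)

lemma ac_ap_iv': "a \<in> carrier A \<Longrightarrow> ac (ap a n) (ac (ap (iv a) n) x) = x"
  using ac_ap_iv[of "iv a" n x] A_inv[of a] iv_iv[of a] by simp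

lemma ac_ap_cancel: "a \<in> carrier A \<Longrightarrow> m \<le> n \<Longrightarrow> ac (ap (iv a) m) (ac (ap a n) x) = ac (ap a (n - m)) x"
  using ac_ap_add[of a m "n - m" x] ac_ap_iv[of a m] by simp

text \<open>In the theory of tidy subgroups, one of the two parts of \<open>J\<close>: the points
  whose forward orbit under \<open>a\<close> never leaves \<open>J\<close>. The other part is the
  same set for \<open>iv a\<close>.\<close>

definition Pst :: "'g \<Rightarrow> 'f set \<Rightarrow> 'f set" where
  "Pst a J = {x. \<forall>n. ac (ap a n) x \<in> J}"

lemma Pst_subset: "Pst a J \<subseteq> J"
  using ac_ap_0 by (auto simp: Pst_def dest: spec[of _ 0])

lemma PstD: "x \<in> Pst a J \<Longrightarrow> ac (ap a n) x \<in> J"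
  by (simp add: Pst_def)

lemma Pst_ap: "a \<in> carrier A \<Longrightarrow> x \<in> Pst a J \<Longrightarrow> ac (ap a n) x \<in> Pst a J"
  using ac_ap_add[of a _ n x] by (auto simp: Pst_def dest: spec[of _ "_ + n"])

lemma Pst_ac: "a \<in> carrier A \<Longrightarrow> x \<in> Pst a J \<Longrightarrow> ac a x \<in> Pst a J"
  using Pst_ap[of a x J 1] by (simp only: One_nat_def ac_ap_Suc ac_ap_0)

lemma Pst_mono: "J \<subseteq> J' \<Longrightarrow> Pst a J \<subseteq> Pst a J'"
  by (auto simp: Pst_def)

lemma subgrp_Pst: "a \<in> carrier A \<Longrightarrow> subgrp J \<Longrightarrow> subgrp (Pst a J)"
  unfolding subgrp_def[of "Pst a J"] using subgrp_0[of J] subgrp_diff[of J]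
  by (auto simp: Pst_def ac_0 ac_diff ap_in)

lemma closed_Pst:
  assumes "a \<in> carrier A" "closedin T J"
  shows "closedin T (Pst a J)"
proof -
  have "Pst a J = (\<Inter>n. {x. ac (ap a n) x \<in> J})" by (auto simp: Pst_def)
  moreover have "closedin T (\<Inter>n. {x. ac (ap a n) x \<in> J})"
    using closed_vimage[OF ac_cont[OF ap_in[OF assms(1)]] assms(2)] by (intro closedin_Inter) auto
  ultimately show ?thesis by simp
qed

lemma compact_Pst: "a \<in> carrier A \<Longrightarrow> closedin T J \<Longrightarrow> compactin T J \<Longrightarrow> compactin T (Pst a J)"
  using closed_compactin[OF _ Pst_subset closed_Pst] by blast

definition fwd :: "'g \<Rightarrow> 'f set \<Rightarrow> 'f set" where
  "fwd a Y = {x\<in>Y. \<exists>J\<in>CO Y. x \<in> Pst a J}"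

definition bd :: "'g \<Rightarrow> 'f set \<Rightarrow> 'f set" where
  "bd a Y = fwd a Y \<inter> fwd (iv a) Y"

lemma tdD:
  assumes "td Y"
  shows "closedin T Y" "smod Y" "subgrp Y" "\<And>x. x \<in> Y \<Longrightarrow> \<exists>J\<in>CO Y. x \<in> J" "\<And>U. small U \<Longrightarrow> \<exists>J\<in>CO Y. J \<subseteq> U"
    "CO Y \<noteq> {}" "\<And>J. J \<in> CO Y \<Longrightarrow> closedin T J"
proof -
  show *: "closedin T Y" "smod Y" "\<And>x. x \<in> Y \<Longrightarrow> \<exists>J\<in>CO Y. x \<in> J" "\<And>U. small U \<Longrightarrow> \<exists>J\<in>CO Y. J \<subseteq> U"
    using assms by (auto simp: td_def)
  show g: "subgrp Y" by (rule smod_subgrp[OF *(2)])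
  show "CO Y \<noteq> {}" using *(3)[OF subgrp_0[OF g]] by auto
  show "\<And>J. J \<in> CO Y \<Longrightarrow> closedin T J" by (rule CO_closed[OF *(1) g])
qed

lemma CO_finite_union:
  assumes "td Y" "finite I" "\<And>i. i \<in> I \<Longrightarrow> J i \<in> CO Y"
  shows "\<exists>J'\<in>CO Y. \<forall>i\<in>I. J i \<subseteq> J'"
  using assms(2,3)
proof (induct I rule: finite_induct)
  case empty
  then show ?case using tdD(6)[OF assms(1)] by auto
next
  case (insert i I)
  then obtain J' where J': "J' \<in> CO Y" "\<forall>i\<in>I. J i \<subseteq> J'" by auto
  have Ji: "J i \<in> CO Y" using insert by auto
  have "J i \<subseteq> J i + J'" by (rule subset_plus1[OF subgrp_0[OF CO_D(1)[OF J'(1)]]])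
  moreover have "J' \<subseteq> J i + J'" by (rule subset_plus2[OF subgrp_0[OF CO_D(1)[OF Ji]]])
  ultimately show ?case using J' CO_plus[OF tdD(3)[OF assms(1)] Ji J'(1)] by (intro bexI[of _ "J i + J'"]) auto
qed

lemma td_bounded:
  assumes Y: "td Y" and C: "bounded_set C" "C \<subseteq> Y"
  shows "\<exists>J\<in>CO Y. C \<subseteq> J"
proof -
  obtain V where V: "V \<in> CO Y" using tdD(6)[OF Y] by auto
  obtain F where F: "finite F" "F \<subseteq> Y" "C \<subseteq> F + V"
    using bounded_cover_nb[OF C tdD(1,3)[OF Y] CO_D(3)[OF V]] by metis
  have "\<exists>J. J \<in> CO Y \<and> f \<in> J" if "f \<in> F" for f using tdD(4)[OF Y] F(2) that by blast
  then obtain J where J: "\<And>f. f \<in> F \<Longrightarrow> J f \<in> CO Y \<and> f \<in> J f" by metis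
  obtain J' where J': "J' \<in> CO Y" "\<forall>f\<in>F. J f \<subseteq> J'" using CO_finite_union[OF Y F(1), of J] J by auto
  have "F + V \<subseteq> J' + V" using J J' by (intro set_plus_mono2) auto
  then show ?thesis using F(3) CO_plus[OF tdD(3)[OF Y] J'(1) V] by (intro bexI[of _ "J' + V"]) auto
qed

lemma fwd_subset: "fwd a Y \<subseteq> Y"
  by (auto simp: fwd_def)

lemma fwd_finite:
  assumes Y: "td Y" and F: "finite F" "F \<subseteq> fwd a Y"
  shows "\<exists>J\<in>CO Y. F \<subseteq> Pst a J"
proof -
  have "\<exists>J. J \<in> CO Y \<and> f \<in> Pst a J" if "f \<in> F" for f using F(2) that by (auto simp: fwd_def)
  then obtain J where J: "\<And>f. f \<in> F \<Longrightarrow> J f \<in> CO Y \<and> f \<in> Pst a (J f)" by metis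
  obtain J' where J': "J' \<in> CO Y" "\<forall>f\<in>F. J f \<subseteq> J'" using CO_finite_union[OF Y F(1), of J] J by auto
  have "F \<subseteq> Pst a J'" using J J' Pst_mono by blast
  then show ?thesis using J'(1) by auto
qed

lemma Pst_fwd: "J \<in> CO Y \<Longrightarrow> Pst a J \<subseteq> fwd a Y"
  using Pst_subset[of a J] CO_D(2)[of J Y] by (auto simp: fwd_def)

text \<open>Invariance under all of \<open>A\<close>, not just under \<open>a\<close>, comes from
  commutativity: the forward orbit of \<open>ac b x\<close> is the image of that of
  \<open>x\<close>.\<close>

lemma smod_fwd:
  assumes Y: "td Y" and a: "a \<in> carrier A"
  shows "smod (fwd a Y)"
  unfolding smod_def subgrp_def
proof (intro conjI ballI)
  show "0 \<in> fwd a Y"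
    using tdD(6)[OF Y] subgrp_0[OF subgrp_Pst[OF a CO_D(1)]] Pst_fwd by blast
  fix x y assume "x \<in> fwd a Y" "y \<in> fwd a Y"
  then obtain J where J: "J \<in> CO Y" "{x, y} \<subseteq> Pst a J" using fwd_finite[OF Y, of "{x, y}" a] by auto
  then show "x - y \<in> fwd a Y" using subgrp_diff[OF subgrp_Pst[OF a CO_D(1)[OF J(1)]], of x y] Pst_fwd[OF J(1), of a] by auto
next
  fix b x assume b: "b \<in> carrier A" and "x \<in> fwd a Y"
  then obtain J where J: "J \<in> CO Y" "x \<in> Pst a J" by (auto simp: fwd_def)
  have "ac b x \<in> Pst a (ac b ` J)"
    using J(2) by (auto simp: Pst_def ac_commute[OF ap_in[OF a] b])
  then show "ac b x \<in> fwd a Y" using Pst_fwd[OF CO_ac[OF tdD(2)[OF Y] J(1) b]] by auto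
qed

lemma smod_bd: "td Y \<Longrightarrow> a \<in> carrier A \<Longrightarrow> smod (bd a Y)"
  unfolding bd_def by (intro smod_Int smod_fwd A_inv)

lemma bd_iv: "a \<in> carrier A \<Longrightarrow> bd (iv a) Y = bd a Y"
  by (auto simp: bd_def iv_iv)

lemma fwd_sub:
  assumes Y: "td Y" and Z: "closedin T Z" "smod Z" "Z \<subseteq> Y" and a: "a \<in> carrier A"
  shows "fwd a Z = Z \<inter> fwd a Y"
proof (intro equalityI subsetI)
  fix x assume "x \<in> fwd a Z"
  then obtain J where J: "J \<in> CO Z" "x \<in> Pst a J" "x \<in> Z" by (auto simp: fwd_def)
  have "J \<subseteq> Y" using CO_D(2)[OF J(1)] Z(3) by auto
  then obtain J' where "J' \<in> CO Y" "J \<subseteq> J'"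
    using td_bounded[OF Y compact_bounded[OF CO_D(4)[OF J(1)] order_refl]] by auto
  then show "x \<in> Z \<inter> fwd a Y" using J Z(3) Pst_mono[of J J' a] by (auto simp: fwd_def)
next
  fix x assume x: "x \<in> Z \<inter> fwd a Y"
  then obtain J where J: "J \<in> CO Y" "x \<in> Pst a J" by (auto simp: fwd_def)
  have "x \<in> Pst a (J \<inter> Z)" using J(2) x smod_ac[OF Z(2) ap_in[OF a]] by (auto simp: Pst_def)
  then show "x \<in> fwd a Z" using x td_sub(2)[OF Y Z J(1)] by (auto simp: fwd_def)
qed

lemma bd_sub:
  assumes "td Y" "closedin T Z" "smod Z" "Z \<subseteq> Y" "a \<in> carrier A"
  shows "bd a Z = Z \<inter> bd a Y"
  using fwd_sub[OF assms] fwd_sub[OF assms(1-4) A_inv[OF assms(5)]] by (auto simp: bd_def)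

lemma compact_decreasing:
  fixes S :: "nat \<Rightarrow> 'f set"
  assumes "\<And>n. closedin T (S n)" "\<And>n. S (Suc n) \<subseteq> S n" "compactin T (S 0)"
  shows "openin T G \<Longrightarrow> (\<Inter>n. S n) \<subseteq> G \<Longrightarrow> \<exists>n. S n \<subseteq> G" "(\<And>n. S n \<noteq> {}) \<Longrightarrow> (\<Inter>n. S n) \<noteq> {}"
proof -
  have mono: "S n \<subseteq> S m" if "m \<le> n" for m n using that assms(2) by (rule lift_Suc_antimono_le[rotated])
  show *: "\<exists>n. S n \<subseteq> G" if G: "openin T G" "(\<Inter>n. S n) \<subseteq> G" for G
  proof -
    have "\<exists>A\<in>range S. S 0 \<inter> A \<subseteq> G"
    proof (rule compact_directed[OF assms(3) _ _ _ G(1)])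
      show "\<exists>D\<in>range S. D \<subseteq> A \<inter> B" if AB: "A \<in> range S" "B \<in> range S" for A B
      proof -
        obtain m n where "A = S m" "B = S n" using AB by auto
        then show ?thesis using mono[of m "max m n"] mono[of n "max m n"] by (intro bexI[of _ "S (max m n)"]) auto
      qed
    qed (use assms(1) G(2) in auto)
    then obtain n where "S 0 \<inter> S n \<subseteq> G" by auto
    then show ?thesis using mono[of 0 n] by auto
  qed
  show "(\<Inter>n. S n) \<noteq> {}" if "\<And>n. S n \<noteq> {}"
    using *[of "{}"] that by auto
qed

text \<open>Willis's construction of a subgroup tidy above: \<open>V\<close> is intersected with
  finitely many images of itself under powers of \<open>a\<close> until, by compactness, each point
  of the intersection \<open>W\<close> is a point with backward orbit in \<open>V\<close> plus one
  so small that \<open>a\<close> keeps it in \<open>V\<close>.\<close>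

lemma tidy:
  assumes Y: "td Y" and a: "a \<in> carrier A" and U: "small U"
  shows "\<exists>W\<in>CO Y. W \<subseteq> U \<and> W \<subseteq> Pst a W + Pst (iv a) W"
proof -
  let ?b = "iv a"
  have b: "?b \<in> carrier A" by (rule A_inv[OF a])
  note Yg = tdD(3)[OF Y] and Ym = tdD(2)[OF Y]
  obtain V where V: "V \<in> CO Y" "V \<subseteq> U" using tdD(5)[OF Y U] by auto
  note Vg = CO_D(1)[OF V(1)] and VY = CO_D(2)[OF V(1)] and Vcl = tdD(7)[OF Y V(1)]
  define Wn where "Wn n = {x. \<forall>i\<le>n. ac (ap ?b i) x \<in> V}" for n
  have WnV: "Wn n \<subseteq> V" for n unfolding Wn_def using ac_ap_0 by (auto dest: spec[of _ 0])
  have Wn_g: "subgrp (Wn n)" for n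
    unfolding subgrp_def[of "Wn n"] using subgrp_0[OF Vg] subgrp_diff[OF Vg] by (auto simp: Wn_def ac_0 ac_diff ap_in b)
  have Wn_cl: "closedin T (Wn n)" for n
  proof -
    have "Wn n = (\<Inter>i\<in>{..n}. {x. ac (ap ?b i) x \<in> V})" by (auto simp: Wn_def)
    moreover have "closedin T (\<Inter>i\<in>{..n}. {x. ac (ap ?b i) x \<in> V})"
      using closed_vimage[OF ac_cont[OF ap_in[OF b]] Vcl] by (intro closedin_Inter) auto
    ultimately show ?thesis by simp
  qed
  have nbv: "nb Y {x. ac c x \<in> V}" if c: "c \<in> carrier A" for c
    by (rule nb_vimage[OF CO_D(3)[OF V(1)] ac_cont[OF c] ac_0[OF c]]) (use smod_ac[OF Ym c] in auto)
  have Wn_nb: "nb Y (Wn n)" for n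
  proof (induct n)
    case 0
    then show ?case using CO_D(3)[OF V(1)] by (simp add: Wn_def ac_one)
  next
    case (Suc n)
    have "Wn (Suc n) = Wn n \<inter> {x. ac (ap ?b (Suc n)) x \<in> V}" unfolding Wn_def by (auto simp: le_Suc_eq)
    then show ?case using nb_Int[OF Suc nbv[OF ap_in[OF b]]] by (simp only:)
  qed
  have Wn_CO: "Wn n \<in> CO Y" for n
    using Wn_g Wn_nb WnV[of n] VY closed_compactin[OF CO_D(4)[OF V(1)] WnV Wn_cl] by (auto simp: CO_def)
  have PW: "(\<Inter>n. Wn n) = Pst ?b V" by (auto simp: Wn_def Pst_def)
  define V1 where "V1 = V \<inter> {x. ac a x \<in> V}"
  have "nb Y V1" unfolding V1_def by (rule nb_Int[OF CO_D(3)[OF V(1)] nbv[OF a]])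
  then obtain G where G: "small G" "Y \<inter> G \<subseteq> V1" by (rule nbE)
  have "\<exists>n. Wn n \<subseteq> Pst ?b V + G"
  proof (rule compact_decreasing(1)[OF Wn_cl])
    show "Wn (Suc n) \<subseteq> Wn n" for n by (auto simp: Wn_def)
    show "compactin T (Wn 0)" by (rule CO_D(4)[OF Wn_CO])
    show "openin T (Pst ?b V + G)" by (rule open_plus[OF smallD(1)[OF G(1)]])
    show "(\<Inter>n. Wn n) \<subseteq> Pst ?b V + G" unfolding PW by (rule subset_plus1[OF smallD(2)[OF G(1)]])
  qed
  then obtain n where n: "Wn n \<subseteq> Pst ?b V + G" by auto
  define W where "W = Wn n"
  have W: "W \<in> CO Y" "W \<subseteq> V" using Wn_CO WnV by (auto simp: W_def)
  note Wg = CO_D(1)[OF W(1)] and Wcl = tdD(7)[OF Y W(1)]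
  have PVW: "Pst ?b V \<subseteq> W" using PW by (auto simp: W_def)
  have PVPW: "Pst ?b V \<subseteq> Pst ?b W" using Pst_ap[OF b, of _ V] PVW by (fastforce simp: Pst_def[of ?b W])
  have stepA: "\<exists>v u. x = v + u \<and> v \<in> Pst ?b V \<and> u \<in> W \<and> ac a u \<in> W" if x: "x \<in> W" for x
  proof -
    obtain v u where vu: "x = v + u" "v \<in> Pst ?b V" "u \<in> G" using n x unfolding W_def by (meson set_plus_elim subsetD)
    have vW: "v \<in> W" using vu PVW by auto
    then have uW: "u \<in> W" using vu x subgrp_add_iff1[OF Wg, of v u] by auto
    then have "u \<in> V1" using vu G CO_D(2)[OF W(1)] by auto
    then have au: "ac a u \<in> V" by (simp add: V1_def)
    have "ac (ap ?b i) (ac a u) \<in> V" if "i \<le> n" for i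
    proof (cases i)
      case 0
      then show ?thesis using au by (simp add: ac_ap_0)
    next
      case (Suc j)
      have "ac (ap ?b (Suc j)) (ac a u) = ac (ap ?b j) u" using ac_inv(2)[OF a] by (simp add: ac_ap_Suc[OF b])
      then show ?thesis using uW Suc that by (auto simp: W_def Wn_def)
    qed
    then have "ac a u \<in> W" by (simp add: W_def Wn_def)
    then show ?thesis using vu uW by blast
  qed
  define Rk where "Rk k = {u. \<forall>i\<le>k. ac (ap a i) u \<in> W}" for k
  have stepB: "\<exists>v u. x = v + u \<and> v \<in> Pst ?b V \<and> u \<in> Rk k" if x: "x \<in> W" for x k
  proof (induct k)
    case 0
    then show ?case using x subgrp_0[OF subgrp_Pst[OF b Vg]] by (intro exI[of _ 0] exI[of _ x]) (auto simp: Rk_def ac_ap_0)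
  next
    case (Suc k)
    then obtain v u where vu: "x = v + u" "v \<in> Pst ?b V" "u \<in> Rk k" by auto
    have "ac (ap a k) u \<in> W" using vu(3) by (auto simp: Rk_def)
    from stepA[OF this] obtain v' u' where v': "ac (ap a k) u = v' + u'" "v' \<in> Pst ?b V" "u' \<in> W" "ac a u' \<in> W" by auto
    \<comment> \<open>The correction \<open>v'\<close> found at time \<open>k\<close> is carried
      back to time 0. Its backward orbit lies in \<open>V\<close>, so it moves each of the points
      \<open>a^i u\<close> with \<open>i \<le> k\<close> only by an element of
      \<open>W\<close>.\<close>
    define v2 where "v2 = ac (ap ?b k) v'"
    define u2 where "u2 = ac (ap ?b k) u'"
    have "u = ac (ap ?b k) (ac (ap a k) u)" by (simp add: ac_ap_iv[OF a])
    then have u: "u = v2 + u2" unfolding v'(1) v2_def u2_def by (simp add: ac_add[OF ap_in[OF b]])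
    have v2: "v2 \<in> Pst ?b V" unfolding v2_def by (rule Pst_ap[OF b v'(2)])
    have "ac (ap a i) u2 \<in> W" if i: "i \<le> Suc k" for i
    proof (cases "i = Suc k")
      case True
      have "ac (ap a (Suc k)) u2 = ac a u'" by (simp add: u2_def ac_ap_Suc'[OF a] ac_ap_iv'[OF a])
      then show ?thesis using v'(4) True by simp
    next
      case False
      then have ik: "i \<le> k" using i by simp
      have "u2 = u - v2" using u by simp
      then have "ac (ap a i) u2 = ac (ap a i) u - ac (ap a i) v2" by (simp add: ac_diff[OF ap_in[OF a]])
      moreover have "ac (ap a i) v2 = ac (ap ?b (k - i)) v'"
        using ac_ap_cancel[OF b ik, of v'] iv_iv[OF a] by (simp add: v2_def)
      moreover have "ac (ap ?b (k - i)) v' \<in> W" using Pst_ap[OF b v'(2)] PVW by auto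
      moreover have "ac (ap a i) u \<in> W" using vu(3) ik by (auto simp: Rk_def)
      ultimately show ?thesis using subgrp_diff[OF Wg] by simp
    qed
    then have "u2 \<in> Rk (Suc k)" by (simp add: Rk_def)
    moreover have "x = (v + v2) + u2" using vu(1) u by (simp add: add.assoc)
    moreover have "v + v2 \<in> Pst ?b V" by (rule subgrp_add[OF subgrp_Pst[OF b Vg] vu(2) v2])
    ultimately show ?case by blast
  qed
  have "W \<subseteq> Pst a W + Pst ?b W"
  proof
    fix x assume x: "x \<in> W"
    \<comment> \<open>\<open>stepB\<close> decomposes \<open>x\<close> well for \<open>k\<close>
      steps; the compact sets of possible \<open>v\<close> decrease with \<open>k\<close>, and a
      common point works for all times.\<close>
    define S where "S k = Pst ?b V \<inter> {v. x - v \<in> Rk k}" for k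
    have Rk_cl: "closedin T (Rk k)" for k
    proof -
      have "Rk k = (\<Inter>i\<in>{..k}. {x. ac (ap a i) x \<in> W})" by (auto simp: Rk_def)
      moreover have "closedin T (\<Inter>i\<in>{..k}. {x. ac (ap a i) x \<in> W})"
        using closed_vimage[OF ac_cont[OF ap_in[OF a]] Wcl] by (intro closedin_Inter) auto
      ultimately show ?thesis by simp
    qed
    have S_cl: "closedin T (S k)" for k
      unfolding S_def by (intro closedin_Int closed_Pst b Vcl closed_reflect Rk_cl)
    have "(\<Inter>k. S k) \<noteq> {}"
    proof (rule compact_decreasing(2)[OF S_cl])
      show "S (Suc k) \<subseteq> S k" for k by (auto simp: S_def Rk_def)
      show "compactin T (S 0)"
        by (rule closed_compactin[OF compact_Pst[OF b Vcl CO_D(4)[OF V(1)]] _ S_cl]) (auto simp: S_def)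
      show "S k \<noteq> {}" for k
      proof -
        obtain v u where "x = v + u" "v \<in> Pst ?b V" "u \<in> Rk k" using stepB[OF x] by blast
        then have "v \<in> S k" by (simp add: S_def)
        then show ?thesis by auto
      qed
    qed
    then obtain v where v: "\<And>k. v \<in> S k" by auto
    have "x - v \<in> Pst a W" using v by (auto simp: S_def Rk_def Pst_def)
    moreover have "v \<in> Pst ?b W" using v[of 0] PVPW by (auto simp: S_def)
    ultimately have "(x - v) + v \<in> Pst a W + Pst ?b W" by (rule set_plus_intro)
    then show "x \<in> Pst a W + Pst ?b W" by simp
  qed
  then show ?thesis using W V(2) by (intro bexI[of _ W]) auto
qed

lemma nb_fwd_bwd:
  assumes Y: "td Y" and a: "a \<in> carrier A"
  shows "nb Y (fwd a Y + fwd (iv a) Y)"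
proof -
  obtain W where W: "W \<in> CO Y" "W \<subseteq> Pst a W + Pst (iv a) W" using tidy[OF Y a small_UNIV] by auto
  have "Pst a W + Pst (iv a) W \<subseteq> fwd a Y + fwd (iv a) Y" using Pst_fwd[OF W(1)] by (intro set_plus_mono2)
  then show ?thesis using nb_mono[OF CO_D(3)[OF W(1)]] W(2) by auto
qed

section \<open>Splitting into parts with bounded forward and backward orbits\<close>

lemma cont_ac_diff: "g \<in> carrier A \<Longrightarrow> continuous_map T T (\<lambda>r. ac g r - r)"
proof -
  assume g: "g \<in> carrier A"
  have "continuous_map T (prod_topology T T) (\<lambda>r. (ac g r, - r))"
    using ac_cont[OF g] cont_minus by (simp add: continuous_map_pairwise o_def)
  from continuous_map_compose[OF this cont_add] show ?thesis by (simp add: o_def)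
qed

text \<open>Formally \<open>r\<close> is the sum of all \<open>a^(-k i) v\<close> with
  \<open>i \<ge> 1\<close>, which solves \<open>a^k r - r = v\<close>. The series need not converge;
  its partial sums leave the remainder \<open>a^(-k n) v\<close>, and compactness picks an
  \<open>r\<close> whose remainder has its forward orbit in \<open>J\<close>.\<close>

lemma cohomological_solve:
  assumes Y: "td Y" and a: "a \<in> carrier A" and J: "J \<in> CO Y" and v: "v \<in> Pst (iv a) J" and k: "k \<ge> 1"
  shows "\<exists>r\<in>Pst (iv a) J. v - (ac (ap a k) r - r) \<in> Pst a J"
proof -
  let ?b = "iv a" and ?g = "ap a k" and ?h = "ap (iv a) k" and ?R = "Pst (iv a) J"
  have b: "?b \<in> carrier A" by (rule A_inv[OF a])
  have g: "?g \<in> carrier A" and h: "?h \<in> carrier A" using ap_in a b by auto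
  note Jcl = tdD(7)[OF Y J]
  have R: "subgrp ?R" "closedin T ?R" "compactin T ?R"
    using subgrp_Pst[OF b CO_D(1)[OF J]] closed_Pst[OF b Jcl] compact_Pst[OF b Jcl CO_D(4)[OF J]] .
  \<comment> \<open>The remainder is to be \<open>a^(-k n)\<close> applied to a point with backward
    orbit in \<open>J\<close>; then its forward images up to time \<open>k n\<close> all lie in
    \<open>J\<close>.\<close>
  define S where "S n = ?R \<inter> {r. ac (ap a (k * n)) (v - (ac ?g r - r)) \<in> ?R}" for n
  have S_cl: "closedin T (S n)" for n
  proof -
    have "closedin T {x. ac (ap a (k * n)) x \<in> ?R}" by (rule closed_vimage[OF ac_cont[OF ap_in[OF a]] R(2)])
    from closed_vimage[OF cont_ac_diff[OF g] closed_reflect[OF this, of v]]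
    show ?thesis unfolding S_def using R(2) by (intro closedin_Int) auto
  qed
  have "(\<Inter>n. S n) \<noteq> {}"
  proof (rule compact_decreasing(2)[OF S_cl])
    show "S (Suc n) \<subseteq> S n" for n
    proof
      fix r assume r: "r \<in> S (Suc n)"
      let ?y = "v - (ac ?g r - r)"
      have "ac (ap ?b k) (ac (ap a (k * Suc n)) ?y) \<in> ?R" using r by (intro Pst_ap[OF b]) (simp add: S_def)
      moreover have "ac (ap ?b k) (ac (ap a (k * Suc n)) ?y) = ac (ap a (k * n)) ?y"
        using ac_ap_cancel[OF a, of k "k * Suc n" ?y] by simp
      ultimately show "r \<in> S n" using r by (simp add: S_def)
    qed
    show "compactin T (S 0)" by (rule closed_compactin[OF R(3) _ S_cl]) (auto simp: S_def)
    show "S n \<noteq> {}" for n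
    proof -
      have "\<exists>r\<in>?R. v - (ac ?g r - r) = ac (ap ?b (k * n)) v"
      proof (induct n)
        case 0
        show ?case using subgrp_0[OF R(1)] by (intro bexI[of _ 0]) (simp_all add: ac_0[OF g])
      next
        case (Suc n)
        then obtain r where r: "r \<in> ?R" "v - (ac ?g r - r) = ac (ap ?b (k * n)) v" by auto
        have "ac ?h (r + v) \<in> ?R" by (rule Pst_ap[OF b subgrp_add[OF R(1) r(1) v]])
        moreover have "v - (ac ?g (ac ?h (r + v)) - ac ?h (r + v)) = ac ?h (r + v) - r"
          using ac_ap_iv'[OF a, of k "r + v"] by (simp add: algebra_simps)
        moreover have "ac ?h (r + v) - r = ac ?h (v - (ac ?g r - r))"
          using ac_ap_iv[OF a, of k r] by (simp add: ac_add[OF h] ac_diff[OF h] algebra_simps)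
        moreover have "ac ?h (ac (ap ?b (k * n)) v) = ac (ap ?b (k * Suc n)) v"
          using ac_ap_add[OF b, of k "k * n" v] by simp
        ultimately show ?case using r(2) by (intro bexI[of _ "ac ?h (r + v)"]) simp_all
      qed
      then obtain r where r: "r \<in> ?R" "v - (ac ?g r - r) = ac (ap ?b (k * n)) v" by auto
      then have "r \<in> S n" using v ac_ap_iv'[OF a, of "k * n" v] by (simp add: S_def)
      then show ?thesis by auto
    qed
  qed
  then obtain r where r: "\<And>n. r \<in> S n" by auto
  let ?y = "v - (ac ?g r - r)"
  have "ac (ap a m) ?y \<in> J" for m
  proof -
    have "m \<le> k * m" using k by simp
    have "ac (ap a (k * m)) ?y \<in> ?R" using r[of m] by (simp add: S_def)
    from PstD[OF this, of "k * m - m"]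
    have "ac (ap ?b (k * m - m)) (ac (ap a (k * m)) ?y) \<in> J" .
    moreover have "ac (ap ?b (k * m - m)) (ac (ap a (k * m)) ?y) = ac (ap a m) ?y"
      using ac_ap_cancel[OF a, of "k * m - m" "k * m" ?y] \<open>m \<le> k * m\<close> by simp
    ultimately show ?thesis by simp
  qed
  then have "?y \<in> Pst a J" by (simp add: Pst_def)
  then show ?thesis using r[of 0] by (intro bexI[of _ r]) (auto simp: S_def)
qed

text \<open>Along the multiples of \<open>k\<close> the orbit of \<open>z\<close> is
  \<open>z\<close> plus sums of points from the orbit of \<open>a^k z - z\<close>, which stay in the
  compact subgroup \<open>J\<close>; finitely many images cover the remaining exponents.\<close>

lemma fwd_of_coboundary:
  assumes Y: "td Y" and a: "a \<in> carrier A" and k: "k \<ge> 1" and z: "z \<in> Y" and u: "ac (ap a k) z - z \<in> fwd a Y"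
  shows "z \<in> fwd a Y"
proof -
  let ?u = "ac (ap a k) z - z"
  obtain J where J: "J \<in> CO Y" "?u \<in> Pst a J" using u by (auto simp: fwd_def)
  obtain Jz where Jz: "Jz \<in> CO Y" "z \<in> Jz" using tdD(4)[OF Y z] by auto
  define J1 where "J1 = Jz + J"
  have J1: "J1 \<in> CO Y" unfolding J1_def by (rule CO_plus[OF tdD(3)[OF Y] Jz(1) J(1)])
  have orb: "ac (ap a (k * n)) z \<in> J1" for n
  proof -
    have "\<exists>s\<in>J. ac (ap a (k * n)) z = z + s"
    proof (induct n)
      case 0
      then show ?case using subgrp_0[OF CO_D(1)[OF J(1)]] by (intro bexI[of _ 0]) simp_all
    next
      case (Suc n)
      then obtain s where s: "s \<in> J" "ac (ap a (k * n)) z = z + s" by auto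
      have "ac (ap a (k * Suc n)) z = ac (ap a (k * n)) (ac (ap a k) z)"
        using ac_ap_add[OF a, of "k * n" k z] by (simp add: add.commute)
      also have "\<dots> = ac (ap a (k * n)) (z + ?u)" by simp
      also have "\<dots> = z + (s + ac (ap a (k * n)) ?u)" by (simp only: ac_add[OF ap_in[OF a]] s(2) add.assoc)
      finally have "ac (ap a (k * Suc n)) z = z + (s + ac (ap a (k * n)) ?u)" .
      moreover have "s + ac (ap a (k * n)) ?u \<in> J" by (rule subgrp_add[OF CO_D(1)[OF J(1)] s(1) PstD[OF J(2)]])
      ultimately show ?case by (intro bexI[of _ "s + ac (ap a (k * n)) ?u"])
    qed
    then show ?thesis unfolding J1_def using Jz(2) by auto
  qed
  obtain J2 where J2: "J2 \<in> CO Y" "\<forall>r\<in>{..k}. ac (ap a r) ` J1 \<subseteq> J2"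
    using CO_finite_union[OF Y finite_atMost[of k], of "\<lambda>r. ac (ap a r) ` J1"] CO_ac[OF tdD(2)[OF Y] J1 ap_in[OF a]] by auto
  have "ac (ap a m) z \<in> J2" for m
  proof -
    have "m = m mod k + k * (m div k)" by simp
    then have "ac (ap a m) z = ac (ap a (m mod k)) (ac (ap a (k * (m div k))) z)" using ac_ap_add[OF a] by metis
    moreover have "m mod k \<in> {..k}" using k by simp
    ultimately show ?thesis using J2(2) orb by auto
  qed
  then show ?thesis using J2(1) z by (auto simp: fwd_def Pst_def)
qed

text \<open>The sum of the two parts is an open submodule, so \<open>Y\<close> is locally finite
  over it and \<open>a^k x - x\<close> lies in it for some \<open>k \<ge> 1\<close>. Its backward
  component is a coboundary up to a forward bounded term; subtracting the solution \<open>r\<close>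
  from \<open>x\<close> leaves a point with bounded forward orbit.\<close>

theorem fwd_bwd_decomposition:
  assumes Y: "td Y" "sharp_full Y" and a: "a \<in> carrier A"
  shows "Y \<subseteq> fwd a Y + fwd (iv a) Y"
proof
  let ?b = "iv a" and ?P = "fwd a Y + fwd (iv a) Y"
  have b: "?b \<in> carrier A" by (rule A_inv[OF a])
  note Yg = tdD(3)[OF Y(1)]
  have P: "smod ?P" by (intro smod_plus smod_fwd Y(1) a b)
  note Pg = smod_subgrp[OF P]
  have PY: "?P \<subseteq> Y" by (intro subgrp_plus_least[OF Yg] fwd_subset)
  have lf: "locfin Y ?P" by (rule sharp_full_locfin[OF tdD(2)[OF Y(1)] Y(2) P PY nb_fwd_bwd[OF Y(1) a]])
  fix x assume x: "x \<in> Y"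
  obtain S where S: "smod S" "x \<in> S" "finite_index S ?P" using lf x unfolding locfin_def by blast
  obtain F where F: "finite F" "S \<subseteq> F + ?P" using S(3) by (auto simp: finite_index_def)
  have "\<exists>f. f \<in> F \<and> ac (ap a n) x - f \<in> ?P" for n
  proof -
    have "ac (ap a n) x \<in> F + ?P" using F(2) smod_ac[OF S(1) ap_in[OF a] S(2)] by auto
    then show ?thesis by (rule set_plus_elim) auto
  qed
  then obtain \<phi> where phi: "\<And>n. \<phi> n \<in> F \<and> ac (ap a n) x - \<phi> n \<in> ?P" by metis
  have "\<not> inj \<phi>" using F(1) phi by (metis finite_subset image_subsetI infinite_UNIV_nat finite_imageD)
  then obtain i j where ij: "i < j" "\<phi> i = \<phi> j" unfolding inj_def by (metis linorder_neqE_nat)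
  define k where "k = j - i"
  have k: "k \<ge> 1" using ij by (simp add: k_def)
  have "(ac (ap a j) x - \<phi> j) - (ac (ap a i) x - \<phi> i) \<in> ?P" by (rule subgrp_diff[OF Pg]) (use phi in auto)
  then have "ac (ap a j) x - ac (ap a i) x \<in> ?P" using ij(2) by simp
  then have "ac (ap ?b i) (ac (ap a j) x - ac (ap a i) x) \<in> ?P" by (rule smod_ac[OF P ap_in[OF b]])
  moreover have "ac (ap ?b i) (ac (ap a j) x - ac (ap a i) x) = ac (ap a k) x - x"
    using ac_ap_cancel[OF a, of i j x] ac_ap_iv[OF a, of i x] ij(1) by (simp add: ac_diff[OF ap_in[OF b]] k_def)
  ultimately have "ac (ap a k) x - x \<in> ?P" by simp
  then obtain u v where uv: "ac (ap a k) x - x = u + v" "u \<in> fwd a Y" "v \<in> fwd ?b Y" by (rule set_plus_elim)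
  obtain J where J: "J \<in> CO Y" "v \<in> Pst ?b J" using uv(3) by (auto simp: fwd_def)
  obtain r where r: "r \<in> Pst ?b J" "v - (ac (ap a k) r - r) \<in> Pst a J"
    using cohomological_solve[OF Y(1) a J k] by auto
  have rb: "r \<in> fwd ?b Y" using r(1) Pst_fwd[OF J(1)] by auto
  have eq: "ac (ap a k) (x - r) - (x - r) = u + (v - (ac (ap a k) r - r))"
    using uv(1) by (simp add: ac_diff[OF ap_in[OF a]] algebra_simps)
  have cob: "ac (ap a k) (x - r) - (x - r) \<in> fwd a Y"
    unfolding eq using uv(2) r(2) Pst_fwd[OF J(1), of a] by (intro subgrp_add[OF smod_subgrp[OF smod_fwd[OF Y(1) a]]]) auto
  have "x - r \<in> Y" using x rb fwd_subset[of ?b Y] by (intro subgrp_diff[OF Yg]) auto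
  then have "x - r \<in> fwd a Y" using cob by (rule fwd_of_coboundary[OF Y(1) a k])
  then have "(x - r) + r \<in> ?P" using rb by (rule set_plus_intro)
  then show "x \<in> ?P" by simp
qed

text \<open>A tidy \<open>W\<close> decomposes by itself and finitely many translates of it cover
  \<open>C\<close>, so one \<open>J\<close> serves all points.\<close>

lemma bounded_decomposition:
  assumes Y: "td Y" "sharp_full Y" and a: "a \<in> carrier A" and C: "bounded_set C" "C \<subseteq> Y"
  shows "\<exists>J\<in>CO Y. C \<subseteq> Pst a J + Pst (iv a) J"
proof -
  let ?b = "iv a"
  have b: "?b \<in> carrier A" by (rule A_inv[OF a])
  obtain W where W: "W \<in> CO Y" "W \<subseteq> Pst a W + Pst ?b W" using tidy[OF Y(1) a small_UNIV] by auto
  obtain F where F: "finite F" "F \<subseteq> Y" "C \<subseteq> F + W"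
    using bounded_cover_nb[OF C tdD(1,3)[OF Y(1)] CO_D(3)[OF W(1)]] by metis
  have "\<exists>u. u \<in> fwd a Y \<and> f - u \<in> fwd ?b Y" if f: "f \<in> F" for f
  proof -
    have "f \<in> fwd a Y + fwd ?b Y" using fwd_bwd_decomposition[OF Y a] F(2) f by auto
    then show ?thesis by (rule set_plus_elim) auto
  qed
  then obtain \<upsilon> where ups: "\<And>f. f \<in> F \<Longrightarrow> \<upsilon> f \<in> fwd a Y \<and> f - \<upsilon> f \<in> fwd ?b Y" by metis
  obtain J1 where J1: "J1 \<in> CO Y" "\<upsilon> ` F \<subseteq> Pst a J1" using fwd_finite[OF Y(1), of "\<upsilon> ` F" a] F(1) ups by auto
  obtain J2 where J2: "J2 \<in> CO Y" "(\<lambda>f. f - \<upsilon> f) ` F \<subseteq> Pst ?b J2" using fwd_finite[OF Y(1), of "(\<lambda>f. f - \<upsilon> f) ` F" ?b] F(1) ups by auto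
  define J where "J = W + (J1 + J2)"
  have J12: "J1 + J2 \<in> CO Y" by (rule CO_plus[OF tdD(3)[OF Y(1)] J1(1) J2(1)])
  have J: "J \<in> CO Y" unfolding J_def by (rule CO_plus[OF tdD(3)[OF Y(1)] W(1) J12])
  have sub: "W \<subseteq> J" "J1 \<subseteq> J" "J2 \<subseteq> J"
    unfolding J_def
    using subset_plus1[OF subgrp_0[OF CO_D(1)[OF J12]], of W] subset_plus2[OF subgrp_0[OF CO_D(1)[OF W(1)]], of "J1 + J2"]
      subset_plus1[OF subgrp_0[OF CO_D(1)[OF J2(1)]], of J1] subset_plus2[OF subgrp_0[OF CO_D(1)[OF J1(1)]], of J2] by auto
  have g: "subgrp (Pst a J + Pst ?b J)" by (intro subgrp_plus subgrp_Pst a b CO_D(1)[OF J])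
  have "W \<subseteq> Pst a J + Pst ?b J"
    using W(2) set_plus_mono2[OF Pst_mono[OF sub(1), of a] Pst_mono[OF sub(1), of ?b]] by auto
  moreover have "F \<subseteq> Pst a J + Pst ?b J"
  proof
    fix f assume f: "f \<in> F"
    have "\<upsilon> f \<in> Pst a J" "f - \<upsilon> f \<in> Pst ?b J" using f J1(2) J2(2) Pst_mono[OF sub(2), of a] Pst_mono[OF sub(3), of ?b] by auto
    then have "\<upsilon> f + (f - \<upsilon> f) \<in> Pst a J + Pst ?b J" by (rule set_plus_intro)
    then show "f \<in> Pst a J + Pst ?b J" by simp
  qed
  ultimately have "F + W \<subseteq> Pst a J + Pst ?b J" by (intro subgrp_plus_least[OF g])
  then show ?thesis using J F(3) by auto
qed

text \<open>By density the compact image of \<open>Pst (iv a) W\<close> under \<open>a\<close> is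
  covered by finitely many translates of \<open>Pst (iv a) W\<close> by points with bounded orbits.
  Hence \<open>a\<close> preserves \<open>Pst (iv a) W\<close> up to some \<open>Pst a J1\<close>,
  and iteration keeps all forward orbits in \<open>J1 + W\<close>.\<close>

lemma expanding_part_bounded:
  assumes Y: "td Y" and a: "a \<in> carrier A" and dense: "\<And>y G. y \<in> Y \<Longrightarrow> small G \<Longrightarrow> \<exists>b\<in>bd a Y. y - b \<in> G"
    and W: "W \<in> CO Y" "W \<subseteq> Pst a W + Pst (iv a) W"
  shows "Pst (iv a) W \<subseteq> bd a Y"
proof -
  let ?b = "iv a" and ?B = "bd a Y" and ?W = "Pst (iv a) W"
  have b: "?b \<in> carrier A" by (rule A_inv[OF a])
  note Ym = tdD(2)[OF Y] and Yg = tdD(3)[OF Y]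
  have B: "smod ?B" by (rule smod_bd[OF Y a])
  have fb: "smod (fwd ?b Y)" by (rule smod_fwd[OF Y b])
  note fbg = smod_subgrp[OF fb]
  have BY: "?B \<subseteq> Y" using fwd_subset by (auto simp: bd_def)
  have Wfb: "?W \<subseteq> fwd ?b Y" by (rule Pst_fwd[OF W(1)])
  have Wg: "subgrp ?W" by (rule subgrp_Pst[OF b CO_D(1)[OF W(1)]])
  have WY: "?W \<subseteq> Y" using Pst_subset CO_D(2)[OF W(1)] by blast
  obtain G where G: "small G" "Y \<inter> G \<subseteq> W" using CO_D(3)[OF W(1)] by (rule nbE)
  have split: "\<exists>\<beta>\<in>?B. y - \<beta> \<in> ?W" if y: "y \<in> ac a ` ?W" for y
  proof -
    have yf: "y \<in> fwd ?b Y" using y Wfb smod_ac[OF fb a] by auto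
    then have yY: "y \<in> Y" using fwd_subset by auto
    obtain \<beta> where \<beta>: "\<beta> \<in> ?B" "y - \<beta> \<in> G" using dense[OF yY G(1)] by auto
    have "y - \<beta> \<in> Y" using yY \<beta>(1) BY by (intro subgrp_diff[OF Yg]) auto
    then have "y - \<beta> \<in> W" using \<beta>(2) G(2) by auto
    then obtain p q where pq: "y - \<beta> = p + q" "p \<in> Pst a W" "q \<in> ?W" using W(2) by (meson set_plus_elim subsetD)
    have "p = y - \<beta> - q" using pq(1) by simp
    moreover have "y - \<beta> - q \<in> fwd ?b Y" using yf \<beta>(1) pq(3) Wfb by (intro subgrp_diff[OF fbg]) (auto simp: bd_def)
    ultimately have "p \<in> ?B" using pq(2) Pst_fwd[OF W(1), of a] by (auto simp: bd_def)
    then have "\<beta> + p \<in> ?B" by (rule subgrp_add[OF smod_subgrp[OF B] \<beta>(1)])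
    moreover have "y - (\<beta> + p) = q" using pq(1) by (simp add: algebra_simps)
    ultimately show ?thesis using pq(3) by (intro bexI[of _ "\<beta> + p"]) auto
  qed
  have aW: "compactin T (ac a ` ?W)" "ac a ` ?W \<subseteq> Y" "subgrp (ac a ` ?W)"
    using image_compactin[OF compact_Pst[OF b tdD(7)[OF Y W(1)] CO_D(4)[OF W(1)]] ac_cont[OF a]]
      smod_ac[OF Ym a] WY subgrp_ac_image[OF a Wg] by auto
  obtain F where F: "finite F" "F \<subseteq> ac a ` ?W" "ac a ` ?W \<subseteq> F + W"
    using compact_cover_nb[OF aW(1,2) Yg CO_D(3)[OF W(1)]] by metis
  have inter: "w \<in> ?W" if w: "w \<in> ac a ` ?W" "w \<in> W" for w
  proof -
    obtain w' where w': "w = ac a w'" "w' \<in> ?W" using w(1) by auto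
    have "ac (ap ?b n) w \<in> W" for n
    proof (cases n)
      case 0
      then show ?thesis using w(2) by simp
    next
      case (Suc m)
      have "ac (ap ?b (Suc m)) w = ac (ap ?b m) w'" using ac_inv(2)[OF a] by (simp add: w'(1) ac_ap_Suc[OF b])
      then show ?thesis using PstD[OF w'(2)] Suc by simp
    qed
    then show ?thesis by (simp add: Pst_def)
  qed
  obtain \<beta> where \<beta>: "\<And>f. f \<in> F \<Longrightarrow> \<beta> f \<in> ?B \<and> f - \<beta> f \<in> ?W" using split F(2) by (metis subsetD)
  obtain J1 where J1: "J1 \<in> CO Y" "\<beta> ` F \<subseteq> Pst a J1" using fwd_finite[OF Y, of "\<beta> ` F" a] F(1) \<beta> by (auto simp: bd_def)
  have PJ1: "subgrp (Pst a J1)" by (rule subgrp_Pst[OF a CO_D(1)[OF J1(1)]])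
  have step: "ac a w \<in> Pst a J1 + ?W" if w: "w \<in> ?W" for w
  proof -
    have aw: "ac a w \<in> ac a ` ?W" using w by auto
    then obtain f v where fv: "ac a w = f + v" "f \<in> F" "v \<in> W" using F(3) by (meson set_plus_elim subsetD)
    have "v = ac a w - f" using fv(1) by simp
    then have "v \<in> ac a ` ?W" using subgrp_diff[OF aW(3) aw, of f] F(2) fv(2) by auto
    then have "v \<in> ?W" using inter fv(3) by auto
    then have "(f - \<beta> f) + v \<in> ?W" using \<beta>[OF fv(2)] subgrp_add[OF Wg] by auto
    moreover have "\<beta> f \<in> Pst a J1" using J1(2) fv(2) by auto
    moreover have "ac a w = \<beta> f + ((f - \<beta> f) + v)" using fv(1) by simp
    ultimately show ?thesis by (metis set_plus_intro)
  qed
  have orb: "ac (ap a n) w \<in> Pst a J1 + ?W" if w: "w \<in> ?W" for w n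
  proof (induct n)
    case 0
    then show ?case using w subset_plus2[OF subgrp_0[OF PJ1], of ?W] by auto
  next
    case (Suc n)
    then obtain p q where pq: "ac (ap a n) w = p + q" "p \<in> Pst a J1" "q \<in> ?W" by (rule set_plus_elim)
    obtain p' q' where p': "ac a q = p' + q'" "p' \<in> Pst a J1" "q' \<in> ?W" using step[OF pq(3)] by (rule set_plus_elim)
    have "ac (ap a (Suc n)) w = (ac a p + p') + q'" by (simp add: ac_ap_Suc'[OF a] pq(1) ac_add[OF a] p'(1) add.assoc)
    moreover have "ac a p + p' \<in> Pst a J1" using Pst_ac[OF a pq(2)] p'(2) by (rule subgrp_add[OF PJ1])
    ultimately show ?case using p'(3) by (metis set_plus_intro)
  qed
  have "Pst a J1 + ?W \<subseteq> J1 + W" using Pst_subset by (intro set_plus_mono2)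
  then have "?W \<subseteq> Pst a (J1 + W)" using orb by (auto simp: Pst_def)
  then have "?W \<subseteq> fwd a Y" using Pst_fwd[OF CO_plus[OF Yg J1(1) W(1)], of a] by auto
  then show ?thesis using Wfb by (auto simp: bd_def)
qed

text \<open>In the closure of \<open>bd a Y\<close> the points with bounded orbits are dense, so
  both halves of a tidy \<open>W\<close> consist of such points. Thus \<open>bd a Y\<close> contains
  an open subgroup of its closure and equals it.\<close>

theorem closed_bd:
  assumes Y: "td Y" and a: "a \<in> carrier A"
  shows "closedin T (bd a Y)"
proof -
  let ?b = "iv a" and ?B = "bd a Y"
  have b: "?b \<in> carrier A" by (rule A_inv[OF a])
  have B: "smod ?B" by (rule smod_bd[OF Y a])
  define Z where "Z = T closure_of ?B"
  have BY: "?B \<subseteq> Y" using fwd_subset by (auto simp: bd_def)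
  have Z: "closedin T Z" "smod Z" "Z \<subseteq> Y" "?B \<subseteq> Z"
    using smod_closure[OF B] closure_of_minimal[OF BY tdD(1)[OF Y]] closure_of_subset[of ?B T] by (auto simp: Z_def)
  have tZ: "td Z" by (rule td_sub(1)[OF Y Z(1,2,3)])
  have bdZ: "bd a Z = ?B" using bd_sub[OF Y Z(1,2,3) a] Z(4) by auto
  have dense: "\<exists>\<beta>\<in>?B. y - \<beta> \<in> G" if y: "y \<in> Z" and G: "small G" for y G
  proof -
    have "openin T {x. y - x \<in> G}" "y \<in> {x. y - x \<in> G}" using open_reflect[OF smallD(1)[OF G]] smallD(2)[OF G] by auto
    then obtain \<beta> where "\<beta> \<in> ?B" "\<beta> \<in> {x. y - x \<in> G}" using y unfolding Z_def in_closure_of by metis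
    then show ?thesis by auto
  qed
  obtain W where W: "W \<in> CO Z" "W \<subseteq> Pst a W + Pst ?b W" using tidy[OF tZ a small_UNIV] by auto
  have "Pst ?b W \<subseteq> ?B" using expanding_part_bounded[OF tZ a _ W] dense bdZ by auto
  moreover have "Pst a W \<subseteq> ?B"
  proof -
    have W': "W \<subseteq> Pst ?b W + Pst (iv ?b) W" using W(2) by (simp add: iv_iv[OF a] add.commute)
    have "bd ?b Z = ?B" using bdZ bd_iv[OF a] by simp
    then show ?thesis using expanding_part_bounded[OF tZ b _ W(1) W'] dense iv_iv[OF a] by auto
  qed
  ultimately have WB: "W \<subseteq> ?B" using W(2) subgrp_plus_least[OF smod_subgrp[OF B], of "Pst a W" "Pst ?b W"] by auto
  obtain G where G: "small G" "Z \<inter> G \<subseteq> W" using CO_D(3)[OF W(1)] by (rule nbE)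
  have "Z \<subseteq> ?B"
  proof
    fix y assume y: "y \<in> Z"
    obtain \<beta> where \<beta>: "\<beta> \<in> ?B" "y - \<beta> \<in> G" using dense[OF y G(1)] by auto
    have "y - \<beta> \<in> Z" using y \<beta>(1) Z(4) by (intro subgrp_diff[OF smod_subgrp[OF Z(2)]]) auto
    then have "y - \<beta> \<in> ?B" using \<beta>(2) G(2) WB by auto
    then have "(y - \<beta>) + \<beta> \<in> ?B" using \<beta>(1) by (rule subgrp_add[OF smod_subgrp[OF B]])
    then show "y \<in> ?B" by simp
  qed
  then show ?thesis using Z(1,4) by (metis equalityI)
qed

text \<open>An open \<open>U\<close> of \<open>B\<close> is extended to an open submodule of
  \<open>Y\<close> with trace \<open>U\<close> by adding the points whose forward or backward orbit
  converges to \<open>U\<close>. The hypothesis \<open>sum\<close> ensures that when two added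
  points sum into \<open>B\<close>, each lies in \<open>B\<close>; in this form \<open>B\<close> may
  also come from bounded orbits in a coarser topology.\<close>

theorem sharp_full_restrict:
  assumes Y: "td Y" "sharp_full Y" and a: "a \<in> carrier A" and B: "smod B" "bd a Y \<subseteq> B" "B \<subseteq> Y"
    and sum: "\<And>u v. u \<in> fwd a Y \<Longrightarrow> v \<in> fwd (iv a) Y \<Longrightarrow> u + v \<in> B \<Longrightarrow> u \<in> B"
  shows "sharp_full B"
proof (rule locfin_imp_sharp_full)
  let ?b = "iv a"
  have b: "?b \<in> carrier A" by (rule A_inv[OF a])
  note Ym = tdD(2)[OF Y(1)] and Yg = tdD(3)[OF Y(1)] and Bg = smod_subgrp[OF B(1)]
  fix U assume U: "smod U" "U \<subseteq> B" "nb B U"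
  note Ug = smod_subgrp[OF U(1)]
  obtain G where G: "small G" "B \<inter> G \<subseteq> U" using U(3) by (rule nbE)
  \<comment> \<open>Convergence to \<open>U\<close> is tested modulo every compact open subgroup of
    \<open>Y\<close>; since \<open>A\<close> permutes these, it preserves
    \<open>Zm c\<close>.\<close>
  define Zm where "Zm c = {x\<in>fwd c Y. \<forall>J\<in>CO Y. \<exists>m. \<forall>n\<ge>m. ac (ap c n) x \<in> U + J}" for c
  have Zm_sm: "smod (Zm c)" if c: "c \<in> carrier A" for c
    unfolding smod_def subgrp_def
  proof (intro conjI ballI)
    have fc: "smod (fwd c Y)" by (rule smod_fwd[OF Y(1) c])
    have "0 \<in> U + J" if "J \<in> CO Y" for J
      using set_plus_intro[OF subgrp_0[OF Ug] subgrp_0[OF CO_D(1)[OF that]]] by simp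
    then show "0 \<in> Zm c" using subgrp_0[OF smod_subgrp[OF fc]] by (auto simp: Zm_def ac_0[OF ap_in[OF c]])
    fix x y assume xy: "x \<in> Zm c" "y \<in> Zm c"
    have "\<exists>m. \<forall>n\<ge>m. ac (ap c n) (x - y) \<in> U + J" if J: "J \<in> CO Y" for J
    proof -
      have "\<exists>m. \<forall>n\<ge>m. ac (ap c n) x \<in> U + J" "\<exists>m. \<forall>n\<ge>m. ac (ap c n) y \<in> U + J"
        using xy J unfolding Zm_def by blast+
      then obtain m m' where m: "\<forall>n\<ge>m. ac (ap c n) x \<in> U + J" "\<forall>n\<ge>m'. ac (ap c n) y \<in> U + J" by auto
      have UJ: "subgrp (U + J)" by (rule subgrp_plus[OF Ug CO_D(1)[OF J]])
      have "ac (ap c n) (x - y) \<in> U + J" if "n \<ge> max m m'" for n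
        using m that subgrp_diff[OF UJ] by (simp add: ac_diff[OF ap_in[OF c]])
      then show ?thesis by blast
    qed
    then show "x - y \<in> Zm c" using xy subgrp_diff[OF smod_subgrp[OF fc]] by (auto simp: Zm_def)
  next
    fix d x assume d: "d \<in> carrier A" and x: "x \<in> Zm c"
    have "\<exists>m. \<forall>n\<ge>m. ac (ap c n) (ac d x) \<in> U + J" if J: "J \<in> CO Y" for J
    proof -
      have "ac (iv d) ` J \<in> CO Y" by (rule CO_ac[OF Ym J A_inv[OF d]])
      then obtain m where m: "\<forall>n\<ge>m. ac (ap c n) x \<in> U + ac (iv d) ` J" using x by (auto simp: Zm_def)
      have "ac (ap c n) (ac d x) \<in> U + J" if n: "n \<ge> m" for n
      proof -
        have "ac (ap c n) x \<in> U + ac (iv d) ` J" using m n by auto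
        then obtain u y where u: "ac (ap c n) x = u + y" "u \<in> U" "y \<in> ac (iv d) ` J" by (rule set_plus_elim)
        obtain j where j: "j \<in> J" "y = ac (iv d) j" using u(3) by auto
        have "ac (ap c n) (ac d x) = ac d u + j"
          by (simp add: ac_commute[OF ap_in[OF c] d] u(1) ac_add[OF d] j(2) ac_inv(1)[OF d])
        then show ?thesis using smod_ac[OF U(1) d u(2)] j(1) by auto
      qed
      then show ?thesis by blast
    qed
    then show "ac d x \<in> Zm c" using x smod_ac[OF smod_fwd[OF Y(1) c] d] by (auto simp: Zm_def)
  qed
  obtain W where W: "W \<in> CO Y" "W \<subseteq> G" "W \<subseteq> Pst a W + Pst ?b W" using tidy[OF Y(1) a G(1)] by auto
  have WU: "B \<inter> W \<subseteq> U" using W(2) G(2) by auto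
  have WZ: "Pst c W \<subseteq> Zm c" if c: "c = a \<or> c = ?b" for c
  proof
    have cA: "c \<in> carrier A" using c a b by auto
    have ivc: "iv c = a \<or> iv c = ?b" using c iv_iv[OF a] by auto
    fix x assume x: "x \<in> Pst c W"
    have "\<exists>m. \<forall>n\<ge>m. ac (ap c n) x \<in> U + J" if J: "J \<in> CO Y" for J
    proof -
      \<comment> \<open>\<open>S n\<close> is the image of \<open>Pst c W\<close> under the
        \<open>n\<close>-th power of \<open>c\<close>. A point in all of them has its whole orbit in
        \<open>W\<close>, so lies in \<open>bd\<close>, hence in \<open>B \<inter> W\<close> and in
        \<open>U\<close>; by compactness the images are eventually close to
        \<open>U\<close>.\<close>
      define S where "S n = {y. ac (ap (iv c) n) y \<in> Pst c W}" for n
      have S_cl: "closedin T (S n)" for n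
        unfolding S_def by (rule closed_vimage[OF ac_cont[OF ap_in[OF A_inv[OF cA]]] closed_Pst[OF cA tdD(7)[OF Y(1) W(1)]]])
      obtain H where H: "small H" "Y \<inter> H \<subseteq> J" using CO_D(3)[OF J] by (rule nbE)
      have "\<exists>n. S n \<subseteq> U + H"
      proof (rule compact_decreasing(1)[OF S_cl])
        show "S (Suc n) \<subseteq> S n" for n
        proof
          fix y assume "y \<in> S (Suc n)"
          then have "ac c (ac (iv c) (ac (ap (iv c) n) y)) \<in> Pst c W"
            by (intro Pst_ac[OF cA]) (simp add: S_def ac_ap_Suc'[OF A_inv[OF cA]])
          then show "y \<in> S n" by (simp add: S_def ac_inv(1)[OF cA])
        qed
        have "S 0 = Pst c W" by (simp add: S_def)
        then show "compactin T (S 0)" using compact_Pst[OF cA tdD(7)[OF Y(1) W(1)] CO_D(4)[OF W(1)]] by simp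
        show "openin T (U + H)" by (rule open_plus[OF smallD(1)[OF H(1)]])
        have "(\<Inter>n. S n) \<subseteq> U"
        proof
          fix y assume y: "y \<in> (\<Inter>n. S n)"
          then have "y \<in> Pst c W" using \<open>S 0 = Pst c W\<close> by auto
          moreover have "y \<in> Pst (iv c) W" using y Pst_subset[of c W] by (auto simp: S_def Pst_def[of "iv c"])
          ultimately have "y \<in> bd c Y" using Pst_fwd[OF W(1)] by (auto simp: bd_def)
          then have "y \<in> B" using c B(2) bd_iv[OF a] by auto
          then show "y \<in> U" using WU \<open>y \<in> Pst c W\<close> Pst_subset by auto
        qed
        then show "(\<Inter>n. S n) \<subseteq> U + H" using subset_plus1[OF smallD(2)[OF H(1)], of U] by auto
      qed
      then obtain m where m: "S m \<subseteq> U + H" by auto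
      have "ac (ap c n) x \<in> U + J" if n: "n \<ge> m" for n
      proof -
        have "ac (ap (iv c) m) (ac (ap c n) x) \<in> Pst c W"
          using ac_ap_cancel[OF cA n, of x] Pst_ap[OF cA x, of "n - m"] by simp
        then have "ac (ap c n) x \<in> U + H" using m by (auto simp: S_def)
        then obtain u h where u: "ac (ap c n) x = u + h" "u \<in> U" "h \<in> H" by (rule set_plus_elim)
        have "ac (ap c n) x \<in> Y" using PstD[OF x] CO_D(2)[OF W(1)] by auto
        then have "h \<in> Y" using u U(2) B(3) subgrp_add_iff1[OF Yg, of u h] by auto
        then show ?thesis using u H(2) by auto
      qed
      then show ?thesis by blast
    qed
    then show "x \<in> Zm c" using x Pst_fwd[OF W(1), of c] by (auto simp: Zm_def)
  qed
  \<comment> \<open>An orbit in \<open>B\<close> that converges to \<open>U\<close> enters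
    \<open>U + W\<close>, hence \<open>U\<close>, because \<open>B \<inter> W \<subseteq> U\<close>.
    As \<open>U\<close> is a submodule, it contained the starting point already.\<close>
  have ZU: "z \<in> U" if z: "z \<in> Zm c" "z \<in> B" and c: "c \<in> carrier A" for c z
  proof -
    obtain n where "ac (ap c n) z \<in> U + W" using z(1) W(1) by (auto simp: Zm_def)
    then obtain u w where u: "ac (ap c n) z = u + w" "u \<in> U" "w \<in> W" by (rule set_plus_elim)
    have "ac (ap c n) z \<in> B" by (rule smod_ac[OF B(1) ap_in[OF c] z(2)])
    then have "w \<in> B" using u U(2) subgrp_add_iff1[OF Bg, of u w] by auto
    then have "w \<in> U" using u WU by auto
    then have "ac (ap c n) z \<in> U" using u subgrp_add[OF Ug] by auto
    then show ?thesis using smod_ac_iff[OF U(1) ap_in[OF c]] by auto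
  qed
  define P where "P = U + (Zm a + Zm ?b)"
  have P: "smod P" unfolding P_def by (intro smod_plus U(1) Zm_sm a b)
  have ZP: "Zm a + Zm ?b \<subseteq> P" unfolding P_def by (rule subset_plus2[OF subgrp_0[OF Ug]])
  have UP: "U \<subseteq> P" unfolding P_def by (rule subset_plus1[OF subgrp_0[OF smod_subgrp[OF smod_plus[OF Zm_sm[OF a] Zm_sm[OF b]]]]])
  have PY: "P \<subseteq> Y"
    unfolding P_def using U(2) B(3) fwd_subset[of a Y] fwd_subset[of ?b Y]
    by (intro subgrp_plus_least[OF Yg]) (auto simp: Zm_def)
  have "Pst a W + Pst ?b W \<subseteq> Zm a + Zm ?b" using WZ by (intro set_plus_mono2) auto
  then have "W \<subseteq> P" using W(3) ZP by auto
  then have "nb Y P" by (rule nb_mono[OF CO_D(3)[OF W(1)]])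
  then have lf: "locfin Y P" by (rule sharp_full_locfin[OF Ym Y(2) P PY])
  have "P \<inter> B \<subseteq> U"
  proof
    fix x assume x: "x \<in> P \<inter> B"
    then obtain u z where uz: "x = u + z" "u \<in> U" "z \<in> Zm a + Zm ?b" unfolding P_def by (meson IntD1 set_plus_elim)
    obtain p q where pq: "z = p + q" "p \<in> Zm a" "q \<in> Zm ?b" using uz(3) by (rule set_plus_elim)
    have "p + q \<in> B" using x uz pq U(2) subgrp_add_iff1[OF Bg, of u z] by auto
    moreover from this have pB: "p \<in> B" using sum[of p q] pq by (auto simp: Zm_def)
    ultimately have qB: "q \<in> B" using subgrp_add_iff1[OF Bg, of p q] by auto
    have "p \<in> U" "q \<in> U" using ZU[OF pq(2) pB a] ZU[OF pq(3) qB b] .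
    then show "x \<in> U" unfolding uz(1) pq(1) using uz(2) by (intro subgrp_add[OF Ug])
  qed
  then have "U = P \<inter> B" using UP U(2) by auto
  then show "locfin B U" by (rule locfin_restrict[OF lf P B(1,3)])
qed

text \<open>Every class modulo \<open>N\<close> is represented by a point whose whole orbit stays in
  one compact subgroup. The orbit is corrected step by step by elements of \<open>N\<close>, which
  \<open>bounded_decomposition\<close> splits into parts with bounded forward and with bounded
  backward orbits.\<close>

theorem cocompact_bd:
  assumes Q: "td Q" and N: "closedin T N" "smod N" "N \<subseteq> Q" "sharp_full N" and a: "a \<in> carrier A"
    and C: "bounded_set C" "C \<subseteq> Q" "Q \<subseteq> C + N"
  shows "\<exists>C'. bounded_set C' \<and> C' \<subseteq> bd a Q \<and> Q \<subseteq> C' + N"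
proof -
  let ?b = "iv a"
  have b: "?b \<in> carrier A" by (rule A_inv[OF a])
  note Qm = tdD(2)[OF Q] and Qg = tdD(3)[OF Q] and Ng = smod_subgrp[OF N(2)]
  have tN: "td N" by (rule td_sub(1)[OF Q N(1,2,3)])
  obtain D where D: "D \<in> CO Q" "C \<subseteq> D" using td_bounded[OF Q C(1,2)] by auto
  note Dg = CO_D(1)[OF D(1)]
  have DN: "Q \<subseteq> D + N" using C(3) set_plus_mono2[OF D(2) order_refl[of N]] by auto
  have "D + ac a ` D \<in> CO Q" by (rule CO_plus[OF Qg D(1) CO_ac[OF Qm D(1) a]])
  then have K: "(D + ac a ` D) \<inter> N \<in> CO N" by (rule td_sub(2)[OF Q N(1,2,3)])
  obtain J where J: "J \<in> CO N" "(D + ac a ` D) \<inter> N \<subseteq> Pst a J + Pst ?b J"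
    using bounded_decomposition[OF tN N(4) a compact_bounded[OF CO_D(4)[OF K] order_refl] CO_D(2)[OF K]] by auto
  have JN: "J \<subseteq> N" by (rule CO_D(2)[OF J(1)])
  note Jg = CO_D(1)[OF J(1)] and PJg = subgrp_Pst[OF a CO_D(1)[OF J(1)]]
  define E where "E = D + J"
  have Eg: "subgrp E" unfolding E_def by (rule subgrp_plus[OF Dg Jg])
  have DE: "D \<subseteq> E" "J \<subseteq> E" unfolding E_def by (rule subset_plus1[OF subgrp_0[OF Jg]], rule subset_plus2[OF subgrp_0[OF Dg]])
  have EQ: "E \<subseteq> Q" unfolding E_def using CO_D(2)[OF D(1)] JN N(3) by (intro subgrp_plus_least[OF Qg]) auto
  have Ecl: "closedin T E" unfolding E_def by (rule closed_plus_compact[OF tdD(7)[OF Q D(1)] CO_D(4)[OF J(1)]])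
  have Ec: "compactin T E" unfolding E_def by (rule compact_plus[OF CO_D(4)[OF D(1)] CO_D(4)[OF J(1)]])
  \<comment> \<open>The last clause lets the induction continue: the summand in
    \<open>Pst a J\<close> stays bounded at all later times, so only the summand in \<open>D\<close>
    needs a new correction.\<close>
  have window: "\<exists>z. z - x \<in> N \<and> (\<forall>n\<le>m. ac (ap a n) z \<in> E) \<and> ac (ap a m) z \<in> D + Pst a J" if x: "x \<in> Q" for x m
  proof (induct m)
    case 0
    obtain d \<nu> where d: "x = d + \<nu>" "d \<in> D" "\<nu> \<in> N" using DN x by (meson set_plus_elim subsetD)
    have "d - x = - \<nu>" using d(1) by simp
    then have "d - x \<in> N" using subgrp_minus[OF Ng d(3)] by simp
    moreover have "d \<in> D + Pst a J" using d(2) subset_plus1[OF subgrp_0[OF PJg], of D] by auto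
    ultimately show ?case using d(2) DE by (intro exI[of _ d]) auto
  next
    case (Suc m)
    then obtain z where z: "z - x \<in> N" "\<forall>n\<le>m. ac (ap a n) z \<in> E" "ac (ap a m) z \<in> D + Pst a J" by auto
    obtain d p where dp: "ac (ap a m) z = d + p" "d \<in> D" "p \<in> Pst a J" using z(3) by (rule set_plus_elim)
    have "ac a d \<in> Q" using dp(2) CO_D(2)[OF D(1)] smod_ac[OF Qm a] by auto
    then obtain d' k where d': "ac a d = d' + k" "d' \<in> D" "k \<in> N" using DN by (meson set_plus_elim subsetD)
    have "k = - d' + ac a d" using d'(1) by simp
    then have "k \<in> (D + ac a ` D) \<inter> N" using d' dp(2) subgrp_minus[OF Dg d'(2)] by (metis IntI imageI set_plus_intro)
    then obtain k1 k2 where k: "k = k1 + k2" "k1 \<in> Pst a J" "k2 \<in> Pst ?b J" using J(2) by (meson set_plus_elim subsetD)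
    \<comment> \<open>Only the backward bounded part \<open>k2\<close> of the discrepancy is
      removed, after being carried back to time 0. At earlier times this changes the orbit by
      elements of \<open>J\<close>, while \<open>k1\<close> joins the forward bounded
      summand.\<close>
    define z' where "z' = z - ac (ap ?b (Suc m)) k2"
    have "ac (ap ?b (Suc m)) k2 \<in> N" using PstD[OF k(3)] JN by auto
    then have "(z - x) - ac (ap ?b (Suc m)) k2 \<in> N" by (rule subgrp_diff[OF Ng z(1)])
    then have 1: "z' - x \<in> N" by (simp add: z'_def algebra_simps)
    have "ac (ap a (Suc m)) z' = ac a (d + p) - k2"
      by (simp add: z'_def ac_diff[OF ap_in[OF a]] ac_ap_iv'[OF a] ac_ap_Suc'[OF a, of m z] dp(1))
    also have "\<dots> = d' + (k1 + ac a p)" by (simp add: ac_add[OF a] d'(1) k(1) algebra_simps)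
    finally have 2: "ac (ap a (Suc m)) z' \<in> D + Pst a J"
      using d'(2) subgrp_add[OF PJg k(2) Pst_ac[OF a dp(3)]] by auto
    moreover have "D + Pst a J \<subseteq> E" unfolding E_def using Pst_subset by (intro set_plus_mono2) auto
    ultimately have 3: "ac (ap a (Suc m)) z' \<in> E" by auto
    have "ac (ap a n) z' \<in> E" if n: "n \<le> m" for n
    proof -
      have eq: "ac (ap a n) z' = ac (ap a n) z - ac (ap ?b (Suc m - n)) k2"
        using ac_ap_cancel[OF b, of n "Suc m" k2] iv_iv[OF a] n by (simp add: z'_def ac_diff[OF ap_in[OF a]])
      show ?thesis unfolding eq using z(2) n subsetD[OF DE(2) PstD[OF k(3)]] by (intro subgrp_diff[OF Eg]) auto
    qed
    then show ?case using 1 2 3 by (intro exI[of _ z']) (auto simp: le_Suc_eq)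
  qed
  have lift: "\<exists>z. z - x \<in> N \<and> z \<in> Pst a E \<inter> Pst ?b E" if x: "x \<in> Q" for x
  proof -
    define S where "S m = {z. z - x \<in> N} \<inter> {z. \<forall>n\<le>m. ac (ap a n) z \<in> E \<and> ac (ap ?b n) z \<in> E}" for m
    have S_cl: "closedin T (S m)" for m
    proof -
      have "{z. \<forall>n\<le>m. ac (ap a n) z \<in> E \<and> ac (ap ?b n) z \<in> E} =
          (\<Inter>n\<in>{..m}. {z. ac (ap a n) z \<in> E} \<inter> {z. ac (ap ?b n) z \<in> E})" by auto
      moreover have "closedin T (\<Inter>n\<in>{..m}. {z. ac (ap a n) z \<in> E} \<inter> {z. ac (ap ?b n) z \<in> E})"
        using closed_vimage[OF ac_cont[OF ap_in[OF a]] Ecl] closed_vimage[OF ac_cont[OF ap_in[OF b]] Ecl]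
        by (intro closedin_Inter) auto
      ultimately show ?thesis unfolding S_def using closed_translate'[OF N(1)] by (intro closedin_Int) auto
    qed
    have "(\<Inter>m. S m) \<noteq> {}"
    proof (rule compact_decreasing(2)[OF S_cl])
      show "S (Suc m) \<subseteq> S m" for m by (auto simp: S_def)
      show "compactin T (S 0)" by (rule closed_compactin[OF Ec _ S_cl]) (auto simp: S_def)
      show "S m \<noteq> {}" for m
      proof -
        \<comment> \<open>The window from 0 to \<open>2 m\<close> is applied to
          \<open>a^(-m) x\<close> and then recentred, which controls the times from
          \<open>- m\<close> to \<open>m\<close>.\<close>
        have "ac (ap ?b m) x \<in> Q" by (rule smod_ac[OF Qm ap_in[OF b] x])
        from window[OF this, of "m + m"] obtain w where w: "w - ac (ap ?b m) x \<in> N" "\<forall>n\<le>m + m. ac (ap a n) w \<in> E" by auto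
        let ?z = "ac (ap a m) w"
        have "ac (ap a m) (w - ac (ap ?b m) x) \<in> N" by (rule smod_ac[OF N(2) ap_in[OF a] w(1)])
        then have "?z - x \<in> N" by (simp add: ac_diff[OF ap_in[OF a]] ac_ap_iv'[OF a])
        moreover have "ac (ap a n) ?z \<in> E" if "n \<le> m" for n
          using w(2)[rule_format, of "n + m"] that ac_ap_add[OF a, of n m w] by simp
        moreover have "ac (ap ?b n) ?z \<in> E" if "n \<le> m" for n
          using w(2)[rule_format, of "m - n"] ac_ap_cancel[OF a that, of w] by simp
        ultimately have "?z \<in> S m" by (simp add: S_def)
        then show ?thesis by auto
      qed
    qed
    then obtain z where "\<And>m. z \<in> S m" by auto
    then show ?thesis by (intro exI[of _ z]) (auto simp: S_def Pst_def)
  qed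
  define C' where "C' = Pst a E \<inter> Pst ?b E"
  obtain E' where E': "E' \<in> CO Q" "E \<subseteq> E'" using td_bounded[OF Q compact_bounded[OF Ec order_refl] EQ] by auto
  have "C' \<subseteq> bd a Q"
    unfolding C'_def bd_def using Pst_mono[OF E'(2)] Pst_fwd[OF E'(1)] by blast
  moreover have "bounded_set C'" using compact_bounded[OF Ec, of C'] Pst_subset by (auto simp: C'_def)
  moreover have "Q \<subseteq> C' + N"
  proof
    fix x assume "x \<in> Q"
    then obtain z where z: "z - x \<in> N" "z \<in> C'" using lift unfolding C'_def by blast
    have "z + - (z - x) \<in> C' + N" using z(2) subgrp_minus[OF Ng z(1)] by (rule set_plus_intro)
    then show "x \<in> C' + N" by simp
  qed
  ultimately show ?thesis by blast
qed

text \<open>The hull is generated by the forward translates of \<open>D\<close>; it is bounded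
  because \<open>a\<close> maps \<open>D\<close> into \<open>F + D\<close> with \<open>F\<close>
  finite and of bounded forward orbit. By commutativity, operators preserving \<open>D\<close>
  preserve the hull, so further operators can be treated in turn.\<close>

lemma invariant_hull:
  assumes Y: "td Y" and a: "a \<in> carrier A" and D: "D \<in> CO Y" and bd: "Y \<subseteq> bd a Y"
  shows "\<exists>D'\<in>CO Y. ac a ` D' \<subseteq> D' \<and> (\<forall>c\<in>carrier A. ac c ` D \<subseteq> D \<longrightarrow> ac c ` D' \<subseteq> D')"
proof -
  let ?b = "iv a"
  have b: "?b \<in> carrier A" by (rule A_inv[OF a])
  note Ym = tdD(2)[OF Y] and Yg = tdD(3)[OF Y] and Dg = CO_D(1)[OF D]
  have aD: "ac a ` D \<in> CO Y" by (rule CO_ac[OF Ym D a])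
  obtain F where F: "finite F" "F \<subseteq> ac a ` D" "ac a ` D \<subseteq> F + D"
    using compact_cover_nb[OF CO_D(4)[OF aD] CO_D(2)[OF aD] Yg CO_D(3)[OF D]] by metis
  have "F \<subseteq> fwd a Y" using F(2) CO_D(2)[OF aD] bd by (auto simp: bd_def)
  then obtain J where J: "J \<in> CO Y" "F \<subseteq> Pst a J" using fwd_finite[OF Y F(1), of a] by auto
  have PJg: "subgrp (Pst a J)" by (rule subgrp_Pst[OF a CO_D(1)[OF J(1)]])
  define D' where "D' = gen (\<Union>n. ac (ap a n) ` D)"
  have orb: "ac (ap a n) ` D \<subseteq> Pst a J + D" for n
  proof (induct n)
    case 0
    then show ?case using subset_plus2[OF subgrp_0[OF PJg], of D] by auto
  next
    case (Suc n)
    show ?case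
    proof
      fix y assume "y \<in> ac (ap a (Suc n)) ` D"
      then obtain d where d: "d \<in> D" "y = ac a (ac (ap a n) d)" by (auto simp: ac_ap_Suc'[OF a])
      obtain p e where pe: "ac (ap a n) d = p + e" "p \<in> Pst a J" "e \<in> D" using Suc d(1) by (meson imageI set_plus_elim subsetD)
      obtain f e' where fe: "ac a e = f + e'" "f \<in> F" "e' \<in> D" using F(3) pe(3) by (meson imageI set_plus_elim subsetD)
      have "y = (ac a p + f) + e'" by (simp add: d(2) pe(1) ac_add[OF a] fe(1) add.assoc)
      moreover have "ac a p + f \<in> Pst a J" using Pst_ac[OF a pe(2)] J(2) fe(2) by (intro subgrp_add[OF PJg]) auto
      ultimately show "y \<in> Pst a J + D" using fe(3) by (metis set_plus_intro)
    qed
  qed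
  have "D' \<subseteq> Pst a J + D" unfolding D'_def using orb by (intro gen_least subgrp_plus PJg Dg) auto
  moreover have "Pst a J + D \<subseteq> J + D" using Pst_subset by (intro set_plus_mono2) auto
  ultimately have D'J: "D' \<subseteq> J + D" by auto
  have JD: "J + D \<in> CO Y" by (rule CO_plus[OF Yg J(1) D])
  have DD': "D \<subseteq> D'"
  proof -
    have "ac (ap a 0) ` D = D" by simp
    then have "D \<subseteq> (\<Union>n. ac (ap a n) ` D)" by (metis UN_upper UNIV_I)
    then show ?thesis unfolding D'_def using gen_incl by blast
  qed
  have D'g: "subgrp D'" unfolding D'_def by (rule subgrp_gen)
  have D'Y: "D' \<subseteq> Y" using D'J CO_D(2)[OF JD] by auto
  have nbD': "nb Y D'" by (rule nb_mono[OF CO_D(3)[OF D] DD'])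
  have "closedin T D'" by (rule closed_nb_subgrp[OF D'g nbD' D'Y tdD(1)[OF Y] Yg])
  then have "compactin T D'" by (rule closed_compactin[OF CO_D(4)[OF JD] D'J])
  then have D'CO: "D' \<in> CO Y" using D'g D'Y nbD' by (auto simp: CO_def)
  have inv: "ac c ` D' \<subseteq> D'" if c: "c \<in> carrier A" and cU: "\<And>n. ac c ` (ac (ap a n) ` D) \<subseteq> D'" for c
  proof -
    have "D' \<subseteq> {x. ac c x \<in> D'}"
      unfolding D'_def
    proof (rule gen_least)
      show "subgrp {x. ac c x \<in> gen (\<Union>n. ac (ap a n) ` D)}"
        unfolding subgrp_def using subgrp_0[OF subgrp_gen] subgrp_diff[OF subgrp_gen]
        by (auto simp: ac_0[OF c] ac_diff[OF c])
    qed (use cU in \<open>auto simp: D'_def\<close>)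
    then show ?thesis by auto
  qed
  have incl: "ac (ap a m) ` D \<subseteq> D'" for m
  proof -
    have "ac (ap a m) ` D \<subseteq> (\<Union>n. ac (ap a n) ` D)" by (rule UN_upper) simp
    then show ?thesis unfolding D'_def using gen_incl[of "\<Union>n. ac (ap a n) ` D"] by (rule order_trans)
  qed
  have "ac a ` D' \<subseteq> D'"
  proof (rule inv[OF a])
    fix n
    have "ac a ` ac (ap a n) ` D = ac (ap a (Suc n)) ` D" by (simp add: image_image ac_ap_Suc'[OF a])
    then show "ac a ` ac (ap a n) ` D \<subseteq> D'" using incl by simp
  qed
  moreover have "ac c ` D' \<subseteq> D'" if c: "c \<in> carrier A" "ac c ` D \<subseteq> D" for c
  proof (rule inv[OF c(1)])
    fix n
    have "ac c ` ac (ap a n) ` D = ac (ap a n) ` ac c ` D" by (simp add: image_image ac_commute[OF c(1) ap_in[OF a]])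
    also have "\<dots> \<subseteq> ac (ap a n) ` D" using c(2) by (rule image_mono)
    finally show "ac c ` ac (ap a n) ` D \<subseteq> D'" using incl by auto
  qed
  ultimately show ?thesis using D'CO by (intro bexI[of _ D']) auto
qed

section \<open>Open submodules and parafinite quotients\<close>

lemma nb_Inter: "finite I \<Longrightarrow> (\<And>i. i \<in> I \<Longrightarrow> nb Y (U i)) \<Longrightarrow> nb Y {x. \<forall>i\<in>I. x \<in> U i}"
proof (induct I rule: finite_induct)
  case empty
  then show ?case using nbI[OF small_UNIV, of Y UNIV] by simp
next
  case (insert i I)
  have "nb Y (U i \<inter> {x. \<forall>i\<in>I. x \<in> U i})" by (rule nb_Int) (use insert in auto)
  then show ?case by (rule nb_mono) auto
qed

lemma nb_common_vimage:
  assumes "smod Y" "nb Y V" "finite \<Phi>" "\<Phi> \<subseteq> carrier A"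
  shows "nb Y (V \<inter> {x. \<forall>\<phi>\<in>\<Phi>. ac \<phi> x \<in> V})"
proof (rule nb_Int[OF assms(2)])
  have "nb Y {x. ac \<phi> x \<in> V}" if "\<phi> \<in> \<Phi>" for \<phi>
  proof (rule nb_vimage[OF assms(2)])
    have p: "\<phi> \<in> carrier A" using that assms(4) by auto
    show "continuous_map T T (ac \<phi>)" "ac \<phi> 0 = 0" by (rule ac_cont[OF p], rule ac_0[OF p])
    show "ac \<phi> ` Y \<subseteq> Y" using smod_ac[OF assms(1) p] by auto
  qed
  then have "nb Y {x. \<forall>\<phi>\<in>\<Phi>. x \<in> {x. ac \<phi> x \<in> V}}" by (intro nb_Inter assms(3)) auto
  then show "nb Y {x. \<forall>\<phi>\<in>\<Phi>. ac \<phi> x \<in> V}" by simp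
qed

lemma generates_smod:
  assumes g: "generates (\<lambda>a. ac a ` V \<subseteq> V) \<Phi>" and H: "subgrp H"
    and p: "\<And>a. a \<in> carrier A \<Longrightarrow> ac a ` V \<subseteq> V \<Longrightarrow> ac a ` H \<subseteq> H" and f: "\<And>a. a \<in> \<Phi> \<Longrightarrow> ac a ` H \<subseteq> H"
  shows "smod H"
proof -
  have "ac a ` H \<subseteq> H" if "a \<in> carrier A" for a
  proof (rule generates_induct[OF g that])
    show "ac (b \<otimes>\<^bsub>A\<^esub> c) ` H \<subseteq> H" if "b \<in> carrier A" "c \<in> carrier A" "ac b ` H \<subseteq> H" "ac c ` H \<subseteq> H" for b c
      using that by (auto simp: ac_mult)
  qed (use p f in auto)
  then show ?thesis using H by (auto simp: smod_def)
qed

text \<open>The intersection \<open>K0\<close> of all open submodules is parafinite, hence zero, and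
  compactness puts an open submodule into \<open>U\<close>. For a closed \<open>L\<close> of finite
  index in \<open>K0\<close> there is a compact open subgroup \<open>V\<close> meeting
  \<open>K0\<close> in \<open>L\<close>; as \<open>A\<close> is finitely generated over the
  stabilizer of \<open>V\<close>, some open submodule lies in \<open>V\<close>, which forces
  \<open>L = K0\<close>.\<close>

lemma small_open_smod:
  assumes K: "td K" "compactin T K" "flat_zero K" and U: "small U"
  shows "\<exists>S. smod S \<and> S \<subseteq> K \<and> nb K S \<and> S \<subseteq> U"
proof -
  note Kc = tdD(1)[OF K(1)] and Km = tdD(2)[OF K(1)] and Kg = tdD(3)[OF K(1)]
  define \<O> where "\<O> = {S. smod S \<and> S \<subseteq> K \<and> nb K S}"
  have cl: "closedin T S" if "S \<in> \<O>" for S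
    using that smod_subgrp by (intro closed_nb_subgrp[OF _ _ _ Kc Kg]) (auto simp: \<O>_def)
  have KO: "K \<in> \<O>" using Km nb_self by (auto simp: \<O>_def)
  have dir: "\<exists>D\<in>\<O>. D \<subseteq> S \<inter> R" if "S \<in> \<O>" "R \<in> \<O>" for S R
    using that smod_Int nb_Int by (intro bexI[of _ "S \<inter> R"]) (auto simp: \<O>_def)
  define K0 where "K0 = \<Inter>\<O>"
  have K0K: "K0 \<subseteq> K" using KO by (auto simp: K0_def)
  have K0m: "smod K0" unfolding K0_def by (rule smod_Inter) (auto simp: \<O>_def)
  have K0c: "closedin T K0" unfolding K0_def using KO cl by (intro closedin_Inter) auto
  have K0k: "compactin T K0" by (rule closed_compactin[OF K(2) K0K K0c])
  have K0min: "K0 \<subseteq> S" if "S \<in> \<O>" for S using that by (auto simp: K0_def)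
  have "L = K0" if L: "smod L" "closedin T L" "L \<subseteq> K0" "finite_index K0 L" for L
  proof -
    note Lg = smod_subgrp[OF L(1)]
    have "nb K0 L" by (rule closed_finite_index_nb[OF L(2) Lg smod_subgrp[OF K0m] L(3,4)])
    then obtain G where G: "small G" "K0 \<inter> G \<subseteq> L" by (rule nbE)
    obtain U0 where U0: "U0 \<in> CO K" "U0 \<subseteq> G" using tdD(5)[OF K(1) G(1)] by auto
    define V where "V = U0 + L"
    have LV: "L \<subseteq> V" unfolding V_def by (rule subset_plus2[OF subgrp_0[OF CO_D(1)[OF U0(1)]]])
    have Vg: "subgrp V" unfolding V_def by (rule subgrp_plus[OF CO_D(1)[OF U0(1)] Lg])
    have VK: "V \<subseteq> K" unfolding V_def using CO_D(2)[OF U0(1)] L(3) K0K by (intro subgrp_plus_least[OF Kg]) auto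
    have "U0 \<subseteq> V" unfolding V_def by (rule subset_plus1[OF subgrp_0[OF Lg]])
    then have nbV: "nb K V" by (rule nb_mono[OF CO_D(3)[OF U0(1)]])
    have "compactin T L" by (rule closed_compactin[OF K0k L(3,2)])
    then have Vk: "compactin T V" unfolding V_def by (rule compact_plus[OF CO_D(4)[OF U0(1)]])
    have VL: "x \<in> L" if x: "x \<in> V" "x \<in> K0" for x
    proof -
      obtain u l where ul: "x = u + l" "u \<in> U0" "l \<in> L" using x(1) unfolding V_def by (rule set_plus_elim)
      have "x - l \<in> K0" using x(2) ul(3) L(3) by (intro subgrp_diff[OF smod_subgrp[OF K0m]]) auto
      then have "u \<in> L" using ul G(2) U0(2) by auto
      then show ?thesis using ul subgrp_add[OF Lg] by simp
    qed
    obtain \<Phi> where \<Phi>: "generates (\<lambda>a. ac a ` V \<subseteq> V) \<Phi>" using generated_over_stabilizer[OF Km Vg VK nbV Vk] by auto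
    have fin: "finite \<Phi>" "\<Phi> \<subseteq> carrier A" using \<Phi> by (auto simp: generates_def)
    define W where "W = V \<inter> {x. \<forall>\<phi>\<in>\<Phi>. ac \<phi> x \<in> V}"
    have "nb K W" unfolding W_def by (rule nb_common_vimage[OF Km nbV fin])
    then obtain H where H: "small H" "K \<inter> H \<subseteq> W" by (rule nbE)
    have "openin T (K0 + H)" by (rule open_plus[OF smallD(1)[OF H(1)]])
    moreover have "K \<inter> \<Inter>\<O> \<subseteq> K0 + H" using subset_plus1[OF smallD(2)[OF H(1)]] by (auto simp: K0_def)
    ultimately obtain S where S: "S \<in> \<O>" "K \<inter> S \<subseteq> K0 + H"
      using compact_directed[where \<U>=\<O>, OF K(2) _ cl dir] KO by (metis empty_iff)
    have Sm: "smod S" and SK: "S \<subseteq> K" and nbS: "nb K S" using S(1) by (auto simp: \<O>_def)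
    \<comment> \<open>\<open>S\<close> is so close to \<open>K0\<close> that each of its points in
      \<open>V\<close> is an element of \<open>L\<close> plus a point that the finitely many
      generators keep in \<open>V\<close>.\<close>
    have SV: "ac \<phi> x \<in> V" if x: "x \<in> S" "x \<in> V" and p: "\<phi> \<in> \<Phi>" for x \<phi>
    proof -
      have "x \<in> K0 + H" using S(2) x SK by auto
      then obtain k h where kh: "x = k + h" "k \<in> K0" "h \<in> H" by (rule set_plus_elim)
      have "h = x - k" using kh by simp
      then have "h \<in> K" using subgrp_diff[OF Kg, of x k] x SK kh K0K by auto
      then have h: "h \<in> W" using H(2) kh by auto
      then have "k \<in> V" using subgrp_diff[OF Vg x(2), of h] kh(1) by (auto simp: W_def)
      then have kL: "k \<in> L" using VL kh by auto
      have pA: "\<phi> \<in> carrier A" using p fin by auto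
      have "ac \<phi> k \<in> V" using smod_ac[OF L(1) pA kL] LV by auto
      moreover have "ac \<phi> h \<in> V" using h p by (auto simp: W_def)
      ultimately show ?thesis using subgrp_add[OF Vg] by (simp add: kh(1) ac_add[OF pA])
    qed
    have "smod (S \<inter> V)"
    proof (rule generates_smod[OF \<Phi>])
      show "subgrp (S \<inter> V)" by (rule subgrp_Int[OF smod_subgrp[OF Sm] Vg])
    qed (use SV smod_ac[OF Sm] fin in auto)
    then have "S \<inter> V \<in> \<O>" using SK nb_Int[OF nbS nbV] by (auto simp: \<O>_def)
    then have "K0 \<subseteq> V" using K0min by auto
    then show ?thesis using VL L(3) by auto
  qed
  then have "parafin K0" by (auto simp: parafin_def)
  then have "K0 \<subseteq> zcl" using K(3) K0K K0m K0c K0k by (auto simp: flat_zero_def)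
  also have "zcl \<subseteq> U" using zcl_open[OF smallD(1)[OF U]] subset_plus2[OF smallD(2)[OF U], of zcl] by simp
  finally have "K \<inter> \<Inter>\<O> \<subseteq> U" by (auto simp: K0_def)
  then obtain S where S: "S \<in> \<O>" "K \<inter> S \<subseteq> U"
    using compact_directed[where \<U>=\<O>, OF K(2) _ cl dir smallD(1)[OF U]] KO by (metis empty_iff)
  then show ?thesis by (intro exI[of _ S]) (auto simp: \<O>_def)
qed

text \<open>Boundedness under operators already treated survives, since \<open>bd\<close> of a
  closed submodule is the trace of the larger \<open>bd\<close>; fullness of
  \<open>N \<inter> R\<close> survives by \<open>sharp_full_restrict\<close>.\<close>

lemma cocompact_bd_finite:
  assumes Q: "td Q" and N: "closedin T N" "smod N" "N \<subseteq> Q" "sharp_full N"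
    and C: "bounded_set C" "C \<subseteq> Q" "Q \<subseteq> C + N" and fin: "finite \<Phi>" "\<Phi> \<subseteq> carrier A"
  shows "\<exists>R C'. td R \<and> R \<subseteq> Q \<and> (\<forall>\<phi>\<in>\<Phi>. R \<subseteq> bd \<phi> R) \<and> sharp_full (N \<inter> R) \<and>
    bounded_set C' \<and> C' \<subseteq> R \<and> Q \<subseteq> C' + N"
  using fin
proof (induct \<Phi> rule: finite_induct)
  case empty
  have "N \<inter> Q = N" using N by auto
  then show ?case using assms by (intro exI[of _ Q] exI[of _ C]) auto
next
  case (insert a \<Phi>)
  then obtain R C1 where R: "td R" "R \<subseteq> Q" "\<And>\<phi>. \<phi> \<in> \<Phi> \<Longrightarrow> R \<subseteq> bd \<phi> R" "sharp_full (N \<inter> R)"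
    and C1: "bounded_set C1" "C1 \<subseteq> R" "Q \<subseteq> C1 + N" by auto
  have a: "a \<in> carrier A" and sub: "\<Phi> \<subseteq> carrier A" using insert by auto
  note Rg = tdD(3)[OF R(1)]
  have NRc: "closedin T (N \<inter> R)" using N(1) tdD(1)[OF R(1)] by auto
  have NRm: "smod (N \<inter> R)" by (rule smod_Int[OF N(2) tdD(2)[OF R(1)]])
  have NRtd: "td (N \<inter> R)" by (rule td_sub(1)[OF R(1) NRc NRm]) auto
  have RC: "R \<subseteq> C1 + (N \<inter> R)"
  proof
    fix x assume x: "x \<in> R"
    then have "x \<in> C1 + N" using R(2) C1(3) by auto
    then obtain c n where cn: "x = c + n" "c \<in> C1" "n \<in> N" by (rule set_plus_elim)
    have "x - c \<in> R" using x cn C1(2) by (intro subgrp_diff[OF Rg]) auto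
    then show "x \<in> C1 + (N \<inter> R)" using cn by auto
  qed
  obtain C2 where C2: "bounded_set C2" "C2 \<subseteq> bd a R" "R \<subseteq> C2 + (N \<inter> R)"
    using cocompact_bd[OF R(1) NRc NRm _ R(4) a C1(1,2) RC] by auto
  let ?R = "bd a R"
  have c: "closedin T ?R" by (rule closed_bd[OF R(1) a])
  have m: "smod ?R" by (rule smod_bd[OF R(1) a])
  have s: "?R \<subseteq> R" using fwd_subset by (auto simp: bd_def)
  have "td ?R" by (rule td_sub(1)[OF R(1) c m s])
  moreover have "?R \<subseteq> bd \<phi> ?R" if "\<phi> \<in> insert a \<Phi>" for \<phi>
    using bd_sub[OF R(1) c m s, of \<phi>] that R(3) s a sub by auto
  moreover have "sharp_full (N \<inter> ?R)"
  proof -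
    have eq: "bd a (N \<inter> R) = N \<inter> ?R" using bd_sub[OF R(1) NRc NRm _ a] s by auto
    have "sharp_full (bd a (N \<inter> R))"
    proof (rule sharp_full_restrict[OF NRtd R(4) a smod_bd[OF NRtd a] order_refl])
      show "bd a (N \<inter> R) \<subseteq> N \<inter> R" using eq s by auto
      fix u v assume uv: "u \<in> fwd a (N \<inter> R)" "v \<in> fwd (iv a) (N \<inter> R)" "u + v \<in> bd a (N \<inter> R)"
      have "(u + v) - v \<in> fwd (iv a) (N \<inter> R)"
        by (rule subgrp_diff[OF smod_subgrp[OF smod_fwd[OF NRtd A_inv[OF a]]]]) (use uv in \<open>auto simp: bd_def\<close>)
      then show "u \<in> bd a (N \<inter> R)" using uv(1) by (auto simp: bd_def)
    qed
    then show ?thesis by (simp add: eq)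
  qed
  moreover have "Q \<subseteq> C2 + N"
  proof -
    have "Q \<subseteq> C1 + N" by (rule C1)
    also have "\<dots> \<subseteq> (C2 + N) + N" using C1(2) C2(3) by (intro set_plus_mono2 order_refl) (blast intro: set_plus_intro elim: set_plus_elim)
    also have "\<dots> = C2 + N" by (simp add: add.assoc subgrp_plus_idem[OF smod_subgrp[OF N(2)]])
    finally show ?thesis .
  qed
  ultimately show ?case using C2 s R(2) by (intro exI[of _ ?R] exI[of _ C2]) auto
qed

lemma invariant_hull_finite:
  assumes Y: "td Y" and D: "D \<in> CO Y" and fin: "finite \<Phi>" "\<Phi> \<subseteq> carrier A" and bd: "\<And>\<phi>. \<phi> \<in> \<Phi> \<Longrightarrow> Y \<subseteq> bd \<phi> Y"
  shows "\<exists>D'\<in>CO Y. (\<forall>\<phi>\<in>\<Phi>. ac \<phi> ` D' \<subseteq> D') \<and> (\<forall>c\<in>carrier A. ac c ` D \<subseteq> D \<longrightarrow> ac c ` D' \<subseteq> D')"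
  using fin bd
proof (induct \<Phi> rule: finite_induct)
  case empty
  then show ?case using D by auto
next
  case (insert a \<Phi>)
  then obtain D1 where D1: "D1 \<in> CO Y" "\<forall>\<phi>\<in>\<Phi>. ac \<phi> ` D1 \<subseteq> D1" "\<forall>c\<in>carrier A. ac c ` D \<subseteq> D \<longrightarrow> ac c ` D1 \<subseteq> D1" by auto
  obtain D2 where D2: "D2 \<in> CO Y" "ac a ` D2 \<subseteq> D2" "\<forall>c\<in>carrier A. ac c ` D1 \<subseteq> D1 \<longrightarrow> ac c ` D2 \<subseteq> D2"
    using invariant_hull[OF Y _ D1(1), of a] insert by auto
  have "ac \<phi> ` D2 \<subseteq> D2" if "\<phi> \<in> insert a \<Phi>" for \<phi>
  proof (cases "\<phi> = a")
    case False
    then have "\<phi> \<in> \<Phi>" "\<phi> \<in> carrier A" using that insert(4) by auto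
    then show ?thesis using D1(2) D2(3) by simp
  qed (use D2(2) in simp)
  then show ?case using D1(3) D2(1,3) by (intro bexI[of _ D2]) auto
qed

lemma compact_open_smod:
  assumes Y: "td Y" and Z: "closedin T Z" "smod Z" "Z \<subseteq> Y" and D: "D \<in> CO Y"
    and \<Phi>: "generates (\<lambda>a. ac a ` D \<subseteq> D) \<Phi>" and bd: "\<And>\<phi>. \<phi> \<in> \<Phi> \<Longrightarrow> Z \<subseteq> bd \<phi> Z"
  shows "\<exists>D'\<in>CO Z. smod D'"
proof -
  have DZ: "D \<inter> Z \<in> CO Z" by (rule td_sub(2)[OF Y Z D])
  have fin: "finite \<Phi>" "\<Phi> \<subseteq> carrier A" using \<Phi> by (auto simp: generates_def)
  obtain D' where D': "D' \<in> CO Z" "\<forall>\<phi>\<in>\<Phi>. ac \<phi> ` D' \<subseteq> D'" "\<forall>c\<in>carrier A. ac c ` (D \<inter> Z) \<subseteq> D \<inter> Z \<longrightarrow> ac c ` D' \<subseteq> D'"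
    using invariant_hull_finite[OF td_sub(1)[OF Y Z] DZ fin bd] by auto
  have "smod D'"
  proof (rule generates_smod[OF \<Phi> CO_D(1)[OF D'(1)]])
    fix a assume a: "a \<in> carrier A" "ac a ` D \<subseteq> D"
    then have "ac a ` (D \<inter> Z) \<subseteq> D \<inter> Z" using smod_ac[OF Z(2)] by auto
    then show "ac a ` D' \<subseteq> D'" using D'(3) a by auto
  qed (use D' in auto)
  then show ?thesis using D'(1) by auto
qed

text \<open>Every open submodule \<open>H\<close> of the compact module \<open>D'\<close> gives a
  closed \<open>H + N\<close> of finite index in \<open>Q\<close>, so \<open>H + N = Q\<close> by
  \<open>pf\<close>. As \<open>H\<close> can be arbitrarily small, every point of \<open>Q\<close>
  is arbitrarily close to the closed \<open>N\<close>.\<close>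

theorem parafinite_quotient_trivial:
  assumes Q: "closedin T Q" "smod Q" "flat_zero Q" and N: "closedin T N" "smod N" "sharp_full N" "N \<subseteq> Q"
    and C: "bounded_set C" "Q \<subseteq> C + N"
    and pf: "\<And>U. closedin T U \<Longrightarrow> smod U \<Longrightarrow> N \<subseteq> U \<Longrightarrow> U \<subseteq> Q \<Longrightarrow> finite_index Q U \<Longrightarrow> U = Q"
  shows "Q = N"
proof -
  note Qg = smod_subgrp[OF Q(2)] and Ng = smod_subgrp[OF N(2)]
  obtain C1 where C1: "bounded_set C1" "C1 \<subseteq> compt Q" "Q \<subseteq> C1 + N"
    using cocompact_compt[OF Q(1,2) N C] by auto
  define Q1 where "Q1 = compt Q"
  have Q1c: "closedin T Q1" unfolding Q1_def by (rule closed_compt[OF Q(1) Qg])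
  have Q1m: "smod Q1" unfolding Q1_def by (rule smod_compt[OF Q(2)])
  have Q1Q: "Q1 \<subseteq> Q" unfolding Q1_def by (rule compt_subset)
  have N1: "compt N = N \<inter> Q1" unfolding Q1_def by (rule compt_mono[OF N(4)])
  have sN1: "sharp_full (N \<inter> Q1)" using sharp_full_compt[OF N(1-3)] by (simp add: N1)
  have fz: "flat_zero Z" if "Z \<subseteq> Q" for Z using Q(3) that unfolding flat_zero_def by blast
  have td1: "td Q1"
  proof (rule flat_zero_td[OF Q1c Q1m fz[OF Q1Q]])
    fix x assume "x \<in> Q1"
    then show "\<exists>J\<in>CO Q1. x \<in> J"
      using compt_CO[OF Q(1) Qg bounded_finite[of "{x}"]] by (auto simp: Q1_def)
  qed
  obtain D where D: "D \<in> CO Q1" using tdD(6)[OF td1] by auto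
  obtain \<Phi> where \<Phi>: "generates (\<lambda>a. ac a ` D \<subseteq> D) \<Phi>"
    using generated_over_stabilizer[OF Q1m CO_D[OF D]] by auto
  have fin: "finite \<Phi>" "\<Phi> \<subseteq> carrier A" using \<Phi> by (auto simp: generates_def)
  have Q1C: "Q1 \<subseteq> C1 + (N \<inter> Q1)"
  proof
    fix x assume x: "x \<in> Q1"
    then have "x \<in> C1 + N" using Q1Q C1(3) by auto
    then obtain c n where cn: "x = c + n" "c \<in> C1" "n \<in> N" by (rule set_plus_elim)
    have "x - c \<in> Q1" using x cn C1(2) by (intro subgrp_diff[OF smod_subgrp[OF Q1m]]) (auto simp: Q1_def)
    then show "x \<in> C1 + (N \<inter> Q1)" using cn by auto
  qed
  obtain R C2 where R: "td R" "R \<subseteq> Q1" "\<And>\<phi>. \<phi> \<in> \<Phi> \<Longrightarrow> R \<subseteq> bd \<phi> R"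
    and C2: "bounded_set C2" "C2 \<subseteq> R" "Q1 \<subseteq> C2 + (N \<inter> Q1)"
    using cocompact_bd_finite[OF td1 closedin_Int[OF N(1) Q1c] smod_Int[OF N(2) Q1m] Int_lower2 sN1 C1(1) _ Q1C fin] C1(2)
    unfolding Q1_def[symmetric] by blast
  obtain D' where D': "D' \<in> CO R" "smod D'"
    using compact_open_smod[OF td1 tdD(1)[OF R(1)] tdD(2)[OF R(1)] R(2) D \<Phi> R(3)] by auto
  note Rg = tdD(3)[OF R(1)]
  have D'Q: "D' \<subseteq> Q" using CO_D(2)[OF D'(1)] R(2) Q1Q by auto
  have D'c: "closedin T D'" by (rule CO_closed[OF tdD(1)[OF R(1)] Rg D'(1)])
  have QD: "Q \<subseteq> C2 + N"
  proof -
    have "C1 \<subseteq> C2 + N" using C1(2) C2(3) set_plus_mono2[of C2 C2 "N \<inter> Q1" N] by (auto simp: Q1_def)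
    then have "C1 + N \<subseteq> (C2 + N) + N" by (intro set_plus_mono2 order_refl)
    also have "\<dots> = C2 + N" by (simp add: add.assoc subgrp_plus_idem[OF Ng])
    finally show ?thesis using C1(3) by auto
  qed
  have full: "H + N = Q" if H: "smod H" "closedin T H" "H \<subseteq> D'" "finite_index Q (H + N)" for H
  proof (rule pf)
    have "compactin T H" by (rule closed_compactin[OF CO_D(4)[OF D'(1)] H(3,2)])
    then have "closedin T (N + H)" by (rule closed_plus_compact[OF N(1)])
    then show "closedin T (H + N)" by (simp add: add.commute)
    show "smod (H + N)" by (rule smod_plus[OF H(1) N(2)])
    show "N \<subseteq> H + N" by (rule subset_plus2[OF subgrp_0[OF smod_subgrp[OF H(1)]]])
    show "H + N \<subseteq> Q" using H(3) D'Q N(4) by (intro subgrp_plus_least[OF Qg]) auto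
  qed (rule H(4))
  have QD': "D' + N = Q"
  proof (rule full[OF D'(2) D'c order_refl])
    obtain F where F: "finite F" "C2 \<subseteq> F + D'"
      using bounded_cover_nb[OF C2(1,2) tdD(1)[OF R(1)] Rg CO_D(3)[OF D'(1)]] by metis
    have "C2 + N \<subseteq> (F + D') + N" by (intro set_plus_mono2 F(2) order_refl)
    then show "finite_index Q (D' + N)" using QD F(1) unfolding finite_index_def by (metis add.assoc order_trans)
  qed
  have D'td: "td D'" by (rule td_sub(1)[OF R(1) D'c D'(2) CO_D(2)[OF D'(1)]])
  have approx: "Q \<subseteq> U + N" if U: "small U" for U
  proof -
    obtain H where H: "smod H" "H \<subseteq> D'" "nb D' H" "H \<subseteq> U"
      using small_open_smod[OF D'td CO_D(4)[OF D'(1)] fz[OF D'Q] U] by auto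
    have Hc: "closedin T H" by (rule closed_nb_subgrp[OF smod_subgrp[OF H(1)] H(3,2) D'c smod_subgrp[OF D'(2)]])
    obtain F where F: "finite F" "D' \<subseteq> F + H"
      using compact_cover_nb[OF CO_D(4)[OF D'(1)] order_refl smod_subgrp[OF D'(2)] H(3)] by metis
    have "D' + N \<subseteq> (F + H) + N" by (intro set_plus_mono2 F(2) order_refl)
    then have "finite_index Q (H + N)" using QD' F(1) unfolding finite_index_def by (metis add.assoc)
    then have "H + N = Q" by (rule full[OF H(1) Hc H(2)])
    then show ?thesis using set_plus_mono2[OF H(4) order_refl, of N] by auto
  qed
  have "x \<in> N" if x: "x \<in> Q" for x
  proof (rule ccontr)
    assume "x \<notin> N"
    then obtain V where V: "small V" "\<forall>v\<in>V. x + v \<notin> N" using closed_separate[OF N(1)] by auto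
    have "small {y. 0 - y \<in> V}" using V(1) open_reflect[of V 0] by (auto simp: small_def)
    then have "x \<in> {y. 0 - y \<in> V} + N" using approx x by auto
    then obtain u n where un: "x = u + n" "0 - u \<in> V" "n \<in> N" by (auto elim!: set_plus_elim)
    have "x + (0 - u) \<notin> N" using V(2) un(2) by blast
    then show False using un by simp
  qed
  then show ?thesis using N(4) by auto
qed

end

section \<open>Quotients\<close>

text \<open>The quotient by a closed subgroup \<open>E\<close> without changing the group: open sets
  are the open \<open>E\<close>-saturated sets, and \<open>E\<close> becomes the closure of
  zero.\<close>

definition qtop :: "'f::ab_group_add topology \<Rightarrow> 'f set \<Rightarrow> 'f topology" where
  "qtop T E = topology (\<lambda>U. openin T U \<and> U + E \<subseteq> U)"

lemma openin_qtop: "openin (qtop T E) U \<longleftrightarrow> openin T U \<and> U + E \<subseteq> U"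
proof -
  have "istopology (\<lambda>U. openin T U \<and> U + E \<subseteq> U)"
    unfolding istopology_def by (fastforce elim!: set_plus_elim intro: set_plus_intro)
  then show ?thesis by (simp add: qtop_def)
qed

text \<open>The third isomorphism theorem in this encoding.\<close>

lemma qtop_qtop:
  assumes "U \<subseteq> N"
  shows "qtop (qtop T U) N = qtop T N"
proof -
  have "V + U \<subseteq> V" if "V + N \<subseteq> V" for V using set_plus_mono2[OF order_refl assms, of V] that by auto
  then show ?thesis by (auto simp: topology_eq openin_qtop)
qed

context lc_mod
begin

context
  fixes E assumes E: "closedin T E" "smod E"
begin

private lemma Eg: "subgrp E" by (rule smod_subgrp[OF E(2)])

private lemma add_E: "(S + E) + E = S + E" by (simp add: add.assoc subgrp_plus_idem[OF Eg])

lemma openin_qtop_plus: "openin T U \<Longrightarrow> openin (qtop T E) (U + E)"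
  using open_plus[of U E] add_E[of U] by (simp add: openin_qtop add.commute[of U])

lemma topspace_qtop: "topspace (qtop T E) = UNIV"
  using openin_subset[of "qtop T E" UNIV] openin_topspace[of T] by (auto simp: openin_qtop)

lemma closedin_qtop: "closedin (qtop T E) S \<longleftrightarrow> closedin T S \<and> S + E \<subseteq> S"
proof -
  have "- S + E \<subseteq> - S \<longleftrightarrow> S + E \<subseteq> S"
  proof (intro iffI subsetI; elim set_plus_elim)
    fix x a e assume "- S + E \<subseteq> - S" "x = a + e" "a \<in> S" "e \<in> E"
    then show "x \<in> S" using set_plus_intro[of x "- S" "- e" E] subgrp_minus[OF Eg] by auto
  next
    fix x a e assume "S + E \<subseteq> S" "x = a + e" "a \<in> - S" "e \<in> E"
    then show "x \<in> - S" using set_plus_intro[of x S "- e" E] subgrp_minus[OF Eg] by auto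
  qed
  then show ?thesis by (simp add: closedin_def topspace_qtop openin_qtop Compl_eq_Diff_UNIV[symmetric])
qed

lemma compactin_qtop:
  assumes "compactin T C" shows "compactin (qtop T E) (C + E)"
  unfolding compactin_def
proof (intro conjI allI impI)
  show "C + E \<subseteq> topspace (qtop T E)" by (simp add: topspace_qtop)
  fix \<U> assume U: "Ball \<U> (openin (qtop T E)) \<and> C + E \<subseteq> \<Union>\<U>"
  have "C \<subseteq> \<Union>\<U>" using U subset_plus1[OF subgrp_0[OF Eg], of C] by auto
  moreover have "\<And>V. V \<in> \<U> \<Longrightarrow> openin T V" using U by (auto simp: openin_qtop)
  ultimately obtain \<F> where F: "finite \<F>" "\<F> \<subseteq> \<U>" "C \<subseteq> \<Union>\<F>" using compactinD[OF assms, of \<U>] by auto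
  have "C + E \<subseteq> \<Union>\<F>"
  proof
    fix x assume "x \<in> C + E"
    then obtain c e where ce: "x = c + e" "c \<in> C" "e \<in> E" by (rule set_plus_elim)
    then obtain V where V: "V \<in> \<F>" "c \<in> V" using F(3) by auto
    then have "V + E \<subseteq> V" using U F(2) by (auto simp: openin_qtop)
    then show "x \<in> \<Union>\<F>" using V ce by (auto intro: set_plus_intro)
  qed
  then show "\<exists>\<F>. finite \<F> \<and> \<F> \<subseteq> \<U> \<and> C + E \<subseteq> \<Union>\<F>" using F by auto
qed

theorem lc_mod_qtop: "lc_mod (qtop T E) A ac"
proof -
  interpret q: top_ab_group "qtop T E"
  proof
    show "topspace (qtop T E) = UNIV" by (rule topspace_qtop)
  next
    fix U x y assume U: "openin (qtop T E) U" "x + y \<in> U"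
    then obtain V W where VW: "openin T V" "openin T W" "x \<in> V" "y \<in> W" "\<forall>v\<in>V. \<forall>w\<in>W. v + w \<in> U"
      using add_open[of U x y] by (auto simp: openin_qtop)
    have "v + w \<in> U" if vw: "v \<in> V + E" "w \<in> W + E" for v w
    proof -
      obtain v' e where v: "v = v' + e" "v' \<in> V" "e \<in> E" using vw(1) by (rule set_plus_elim)
      obtain w' f where w: "w = w' + f" "w' \<in> W" "f \<in> E" using vw(2) by (rule set_plus_elim)
      have "(v' + w') + (e + f) \<in> U + E" using VW(5) v w subgrp_add[OF Eg] by (intro set_plus_intro) auto
      moreover have "v + w = (v' + w') + (e + f)" by (simp add: v w algebra_simps)
      ultimately show ?thesis using U(1) by (auto simp: openin_qtop)
    qed
    then show "\<exists>V W. openin (qtop T E) V \<and> openin (qtop T E) W \<and> x \<in> V \<and> y \<in> W \<and> (\<forall>v\<in>V. \<forall>w\<in>W. v + w \<in> U)"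
      using VW(3,4) subset_plus1[OF subgrp_0[OF Eg], of V] subset_plus1[OF subgrp_0[OF Eg], of W]
        openin_qtop_plus[OF VW(1)] openin_qtop_plus[OF VW(2)] by blast
  next
    fix U assume U: "openin (qtop T E) U"
    then have "- x - e \<in> U" if "- x \<in> U" "e \<in> E" for x e
      using set_plus_intro[OF that(1) subgrp_minus[OF Eg that(2)]] by (auto simp: openin_qtop)
    then show "openin (qtop T E) (uminus -` U)"
      using U minus_open[of U] by (auto simp: openin_qtop elim!: set_plus_elim)
  qed
  show ?thesis
  proof (intro lc_mod.intro lc_ab_group.intro q.top_ab_group_axioms lc_ab_group_axioms.intro lc_mod_axioms.intro)
    obtain G C where GC: "small G" "compactin T C" "G \<subseteq> C" using locally_compact by auto
    have "q.small (G + E)"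
      using GC(1) openin_qtop_plus[of G] subset_plus1[OF subgrp_0[OF Eg], of G] by (auto simp: q.small_def small_def)
    then show "\<exists>G C. q.small G \<and> compactin (qtop T E) C \<and> G \<subseteq> C"
      using compactin_qtop[OF GC(2)] set_plus_mono2[OF GC(3) order_refl] by blast
  next
    fix U a x assume U: "openin (qtop T E) U" "a \<in> carrier A" "ac a x \<in> U"
    then obtain P V where PV: "openin (topo A) P" "a \<in> P" "openin T V" "x \<in> V" "\<forall>b\<in>P. \<forall>v\<in>V. ac b v \<in> U"
      using ac_open[of U a x] by (auto simp: openin_qtop)
    have "ac b v \<in> U" if bv: "b \<in> P" "v \<in> V + E" for b v
    proof -
      have b: "b \<in> carrier A" using openin_subset[OF PV(1)] bv(1) A_space by auto
      obtain v' e where v: "v = v' + e" "v' \<in> V" "e \<in> E" using bv(2) by (rule set_plus_elim)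
      have "ac b v' + ac b e \<in> U + E" using PV(5) bv v smod_ac[OF E(2) b] by (intro set_plus_intro) auto
      then show ?thesis using U(1) by (auto simp: openin_qtop v ac_add[OF b])
    qed
    then show "\<exists>P V. openin (topo A) P \<and> a \<in> P \<and> openin (qtop T E) V \<and> x \<in> V \<and> (\<forall>b\<in>P. \<forall>v\<in>V. ac b v \<in> U)"
      using PV(1,2,4) subset_plus1[OF subgrp_0[OF Eg], of V] openin_qtop_plus[OF PV(3)] by blast
  qed (use A_top A_comm A_gen ac_add ac_one ac_mult in auto)
qed

interpretation q: lc_mod "qtop T E" A ac by (rule lc_mod_qtop)

lemma small_qtop: "q.small U \<longleftrightarrow> small U \<and> U + E \<subseteq> U"
  by (auto simp: q.small_def small_def openin_qtop)

lemma small_qtop_plus: "small U \<Longrightarrow> q.small (U + E)"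
  using openin_qtop_plus[of U] subset_plus1[OF subgrp_0[OF Eg], of U] by (auto simp: q.small_def small_def)

lemma zcl_qtop: "q.zcl = E"
proof
  have "closedin (qtop T E) E" by (simp add: closedin_qtop E subgrp_plus_idem[OF Eg])
  then show "q.zcl \<subseteq> E" using q.zcl_subset subgrp_0[OF Eg] by blast
  have "q.zcl + E \<subseteq> q.zcl" using q.closed_zcl by (simp add: closedin_qtop)
  then show "E \<subseteq> q.zcl" using subset_plus2[OF subgrp_0[OF q.subgrp_zcl], of E] by auto
qed

lemma nb_qtop_imp: "q.nb Y U \<Longrightarrow> nb Y U"
  by (auto simp: q.nb_def nb_def small_qtop)

lemma nb_qtop:
  assumes "subgrp Y" "E \<subseteq> Y" "nb Y U" "U + E \<subseteq> U"
  shows "q.nb Y U"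
proof -
  obtain G where G: "small G" "Y \<inter> G \<subseteq> U" using assms(3) by (rule nbE)
  have "Y \<inter> (G + E) \<subseteq> U"
  proof
    fix x assume x: "x \<in> Y \<inter> (G + E)"
    then have "x \<in> G + E" by simp
    then obtain g e where ge: "x = g + e" "g \<in> G" "e \<in> E" by (rule set_plus_elim)
    have "x - e \<in> Y" using x ge assms(2) by (intro subgrp_diff[OF assms(1)]) auto
    then have "g \<in> U" using ge G(2) by auto
    then show "x \<in> U" using ge assms(4) by (auto intro: set_plus_intro)
  qed
  then show ?thesis using small_qtop_plus[OF G(1)] by (auto simp: q.nb_def)
qed

lemma bounded_qtop_plus: "bounded_set C \<Longrightarrow> q.bounded_set (C + E)"
  by (metis bounded_setE compactin_qtop order_refl q.compact_bounded set_plus_mono2)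

text \<open>Local compactness lifts relatively compact sets: a compact set of the quotient is
  covered by finitely many translates of the image of one compact neighbourhood.\<close>

lemma bounded_qtopE:
  assumes "q.bounded_set S"
  shows "\<exists>C. bounded_set C \<and> S \<subseteq> C + E"
proof -
  obtain D where D: "compactin (qtop T E) D" "S \<subseteq> D" using assms by (rule q.bounded_setE)
  obtain G C where GC: "small G" "compactin T C" "G \<subseteq> C" using locally_compact by auto
  obtain F where F: "finite F" "D \<subseteq> F + (G + E)" using q.compact_cover[OF D(1) small_qtop_plus[OF GC(1)]] by metis
  have "F + (G + E) \<subseteq> (F + C) + E" using set_plus_mono2[OF set_plus_mono2[OF order_refl GC(3), of F] order_refl, of E] by (simp add: add.assoc)
  moreover have "bounded_set (F + C)" by (intro bounded_plus bounded_finite F(1) compact_bounded[OF GC(2)] order_refl)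
  ultimately show ?thesis using D(2) F(2) by blast
qed

lemma sharp_full_qtop: "sharp_full UNIV \<Longrightarrow> q.sharp_full UNIV"
  using nb_qtop_imp by (auto simp: q.sharp_full_def sharp_full_def)

lemma CO_qtop:
  assumes "subgrp Y" "E \<subseteq> Y" "J \<in> CO Y"
  shows "J + E \<in> q.CO Y"
proof -
  have "nb Y (J + E)" by (rule nb_mono[OF CO_D(3)[OF assms(3)] subset_plus1[OF subgrp_0[OF Eg]]])
  then show ?thesis
    using subgrp_plus[OF CO_D(1)[OF assms(3)] Eg] subgrp_plus_least[OF assms(1) CO_D(2)[OF assms(3)] assms(2)]
      nb_qtop[OF assms(1,2), of "J + E"] compactin_qtop[OF CO_D(4)[OF assms(3)]] by (simp add: q.CO_def add_E)
qed

lemma fwd_qtop: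
  assumes "subgrp Y" "E \<subseteq> Y"
  shows "fwd a Y \<subseteq> q.fwd a Y"
proof
  fix x assume "x \<in> fwd a Y"
  then obtain J where J: "x \<in> Y" "J \<in> CO Y" "x \<in> Pst a J" by (auto simp: fwd_def)
  have "x \<in> Pst a (J + E)" using J(3) Pst_mono[OF subset_plus1[OF subgrp_0[OF Eg], of J]] by auto
  then show "x \<in> q.fwd a Y" using CO_qtop[OF assms J(2)] J(1) by (auto simp: q.fwd_def)
qed

lemma closedin_qtop_imp: "closedin (qtop T E) S \<Longrightarrow> 0 \<in> S \<Longrightarrow> closedin T S \<and> E \<subseteq> S"
  using subset_plus2[of S E] by (auto simp: closedin_qtop)

text \<open>A compact parafinite submodule of the quotient is a closed \<open>K\<close> containing
  \<open>E\<close> and bounded modulo \<open>E\<close>; \<open>parafinite_quotient_trivial\<close>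
  collapses it to \<open>E\<close>, the zero of the quotient.\<close>

theorem parafinite_of_quotient:
  assumes "flat_zero UNIV" "sharp_full E"
  shows "q.flat_zero UNIV"
  unfolding q.flat_zero_def
proof (intro allI impI)
  fix K assume K: "smod K \<and> K \<subseteq> UNIV \<and> compactin (qtop T E) K \<and> closedin (qtop T E) K \<and> q.parafin K"
  then have Kc: "closedin T K" "E \<subseteq> K" using closedin_qtop_imp[of K] subgrp_0[OF smod_subgrp] by blast+
  obtain C where C: "bounded_set C" "K \<subseteq> C + E" using bounded_qtopE[OF q.compact_bounded[of K K]] K by auto
  have "K = E"
  proof (rule parafinite_quotient_trivial[OF Kc(1) _ _ E assms(2) Kc(2) C])
    show "smod K" "flat_zero K" using K assms(1) by (auto simp: flat_zero_def)
    fix U assume U: "closedin T U" "smod U" "E \<subseteq> U" "U \<subseteq> K" "finite_index K U"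
    have "U + E \<subseteq> U" by (rule subgrp_plus_least[OF smod_subgrp[OF U(2)] order_refl U(3)])
    then have "closedin (qtop T E) U" using U(1) by (simp add: closedin_qtop)
    then show "U = K" using U K by (auto simp: q.parafin_def)
  qed
  then show "K \<subseteq> q.zcl" by (simp add: zcl_qtop)
qed

text \<open>A compact open subgroup of Y for the quotient topology meets a small neighbourhood of 0 in a
  subgroup, because E has no small elements.\<close>
lemma lift_CO:
  assumes Y: "q.td Y" and G: "small G" "G \<inter> E \<subseteq> zcl" and U: "small U"
  shows "\<exists>J\<in>CO Y. J \<subseteq> U"
proof -
  have Yc: "closedin T Y" and EY: "E \<subseteq> Y" using closedin_qtop_imp[OF q.tdD(1)[OF Y] subgrp_0[OF q.tdD(3)[OF Y]]] by auto
  note Yg = q.tdD(3)[OF Y]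
  obtain G1 C1 where G1: "small G1" "compactin T C1" "G1 \<subseteq> C1" using locally_compact by auto
  obtain V where V: "small V" "\<And>x y z w. x \<in> V \<Longrightarrow> y \<in> V \<Longrightarrow> z \<in> V \<Longrightarrow> w \<in> V \<Longrightarrow> x + y + z + w \<in> G" "\<And>x. x \<in> V \<Longrightarrow> - x \<in> V"
    using small_quarter[OF G(1)] by metis
  define H where "H = V \<inter> {x. 0 - x \<in> U \<inter> G1 } \<inter> (U \<inter> G1)"
  have Hs: "small H" unfolding H_def using small_Int[OF V(1)] small_Int[OF U G1(1)] open_reflect[of "U \<inter> G1" 0]
    by (intro small_Int V(1) U G1(1)) (auto simp: small_def)
  obtain J' where J': "J' \<in> q.CO Y" "J' \<subseteq> H + E" using q.tdD(5)[OF Y small_qtop_plus[OF Hs]] by auto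
  define J where "J = J' \<inter> H"
  have Jg: "subgrp J"
    unfolding subgrp_def
  proof (intro conjI ballI)
    show "0 \<in> J" using subgrp_0[OF q.CO_D(1)[OF J'(1)]] smallD(2)[OF Hs] by (simp add: J_def)
    fix x y assume xy: "x \<in> J" "y \<in> J"
    then have d: "x - y \<in> J'" using subgrp_diff[OF q.CO_D(1)[OF J'(1)]] by (auto simp: J_def)
    \<comment> \<open>The \<open>E\<close>-component of the difference is a combination of three
      elements of \<open>V\<close>, so it lies in \<open>G\<close> and hence in \<open>zcl\<close>,
      which the open set \<open>H\<close> absorbs.\<close>
    then have "x - y \<in> H + E" using J' by auto
    then obtain h e where he: "x - y = h + e" "h \<in> H" "e \<in> E" by (rule set_plus_elim)
    have "x + - y + - h + 0 \<in> G" using xy he V(3) smallD(2)[OF V(1)] by (intro V(2)) (auto simp: J_def H_def)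
    moreover have "x + - y + - h + 0 = e" using he(1) by (simp add: algebra_simps)
    ultimately have "e \<in> zcl" using he(3) G(2) by auto
    then have "h + e \<in> H + zcl" using he(2) by auto
    then have "x - y \<in> H" using zcl_open[OF smallD(1)[OF Hs]] he(1) by simp
    then show "x - y \<in> J" using d by (simp add: J_def)
  qed
  have "nb Y J'" by (rule nb_qtop_imp[OF q.CO_D(3)[OF J'(1)]])
  then have nbJ: "nb Y J" unfolding J_def using nbI[OF Hs, of Y H] by (intro nb_Int) auto
  have JY: "J \<subseteq> Y" using q.CO_D(2)[OF J'(1)] by (auto simp: J_def)
  have "closedin T J" by (rule closed_nb_subgrp[OF Jg nbJ JY Yc Yg])
  moreover have "J \<subseteq> C1" using G1(3) by (auto simp: J_def H_def)
  ultimately have "compactin T J" using closed_compactin[OF G1(2)] by auto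
  then have "J \<in> CO Y" using Jg JY nbJ by (simp add: CO_def)
  moreover have "J \<subseteq> U" by (auto simp: J_def H_def)
  ultimately show ?thesis by auto
qed

text \<open>Bounded orbits are taken in the coarser quotient topology while fullness is preserved in
  the finer one; this is why \<open>sharp_full_restrict\<close> allows a \<open>B\<close> larger
  than \<open>bd a Y\<close>.\<close>

lemma sharp_full_bd_finite:
  assumes Y: "q.td Y" "td Y" "sharp_full Y" and fin: "finite \<Phi>" "\<Phi> \<subseteq> carrier A"
  shows "\<exists>R. q.td R \<and> td R \<and> R \<subseteq> Y \<and> sharp_full R \<and> (\<forall>\<phi>\<in>\<Phi>. R \<subseteq> q.bd \<phi> R)"
  using fin
proof (induct \<Phi> rule: finite_induct)
  case empty
  then show ?case using Y by auto
next
  case (insert a \<Phi>)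
  then obtain R where R: "q.td R" "td R" "R \<subseteq> Y" "sharp_full R" "\<And>\<phi>. \<phi> \<in> \<Phi> \<Longrightarrow> R \<subseteq> q.bd \<phi> R" by auto
  have a: "a \<in> carrier A" and sub: "\<Phi> \<subseteq> carrier A" using insert by auto
  let ?R = "q.bd a R"
  note Rg = tdD(3)[OF R(2)]
  have ER: "E \<subseteq> R" using closedin_qtop_imp[OF q.tdD(1)[OF R(1)] subgrp_0[OF Rg]] by simp
  have c: "closedin (qtop T E) ?R" by (rule q.closed_bd[OF R(1) a])
  have m: "smod ?R" by (rule q.smod_bd[OF R(1) a])
  have s: "?R \<subseteq> R" using q.fwd_subset by (auto simp: q.bd_def)
  have cT: "closedin T ?R" using c by (simp add: closedin_qtop)
  have "q.td ?R" by (rule q.td_sub(1)[OF R(1) c m s])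
  moreover have "td ?R" by (rule td_sub(1)[OF R(2) cT m s])
  moreover have "?R \<subseteq> q.bd \<phi> ?R" if "\<phi> \<in> insert a \<Phi>" for \<phi>
    using q.bd_sub[OF R(1) c m s, of \<phi>] that R(5) s a sub by auto
  moreover have "sharp_full ?R"
  proof (rule sharp_full_restrict[OF R(2,4) a m _ s])
    show "bd a R \<subseteq> ?R" using fwd_qtop[OF Rg ER] by (auto simp: bd_def q.bd_def)
    fix u v assume uv: "u \<in> fwd a R" "v \<in> fwd (iv a) R" "u + v \<in> ?R"
    have "(u + v) - v \<in> q.fwd (iv a) R"
      by (rule subgrp_diff[OF smod_subgrp[OF q.smod_fwd[OF R(1) A_inv[OF a]]]])
        (use uv fwd_qtop[OF Rg ER] in \<open>auto simp: q.bd_def\<close>)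
    then show "u \<in> ?R" using uv(1) fwd_qtop[OF Rg ER] by (auto simp: q.bd_def)
  qed
  ultimately show ?case using s R(3) by (intro exI[of _ ?R]) auto
qed

text \<open>The ambient module stands for \<open>M / U\<close> and \<open>E\<close> for
  \<open>N / U\<close>, which is discrete and pure. Once some \<open>R\<close> containing
  \<open>E\<close> has an open submodule meeting \<open>E\<close> trivially, local finiteness of
  \<open>R\<close> over it puts every element of \<open>E\<close> into a finite submodule of
  \<open>E\<close>, which purity makes zero.\<close>

lemma discrete_pure_trivial:
  assumes sf: "sharp_full UNIV" and fz: "q.flat_zero UNIV" and G: "small G" "G \<inter> E \<subseteq> zcl" and pure: "pure E zcl"
  shows "E \<subseteq> zcl"
proof -
  have qfz: "q.flat_zero Z" for Z using fz by (auto simp: q.flat_zero_def)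
  define B where "B = q.compt UNIV"
  have Bq: "closedin (qtop T E) B" unfolding B_def using closedin_topspace[of "qtop T E"] by (intro q.closed_compt) auto
  have Bm: "smod B" unfolding B_def by (rule q.smod_compt[OF smod_UNIV])
  note Bg = smod_subgrp[OF Bm]
  have Bc: "closedin T B" "E \<subseteq> B" using closedin_qtop_imp[OF Bq subgrp_0[OF Bg]] by auto
  have qtdB: "q.td B"
  proof (rule q.flat_zero_td[OF Bq Bm qfz])
    fix x assume "x \<in> B"
    then show "\<exists>J\<in>q.CO B. x \<in> J"
      using q.compt_CO[OF _ _ q.bounded_finite[of "{x}"], of UNIV] closedin_topspace[of "qtop T E"] by (auto simp: B_def)
  qed
  have CO_small: "\<exists>J\<in>CO B. J \<subseteq> U" if "small U" for U by (rule lift_CO[OF qtdB G that])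
  then obtain J where J: "J \<in> CO B" using G(1) by blast
  have "compt UNIV \<subseteq> B"
  proof
    fix x assume "x \<in> compt UNIV"
    then have "bounded_set (range (\<lambda>n. nmul n x))" by (simp add: compt_def)
    then have "q.bounded_set (range (\<lambda>n. nmul n x))"
      using bounded_qtop_plus q.bounded_subset subset_plus1[OF subgrp_0[OF Eg]] by blast
    then show "x \<in> B" by (simp add: B_def q.compt_def)
  qed
  \<comment> \<open>\<open>lift_CO\<close> provides a bounded open subgroup of \<open>B\<close>, so
    elements that are compact modulo \<open>E\<close> are compact already.\<close>
  moreover have "B \<subseteq> compt UNIV"
  proof (rule isolated_subset_compt[OF _ smod_UNIV sf Bc(1) Bg _ calculation])
    show "x \<in> B" if "n \<ge> 1" "nmul n x \<in> B" for x n using q.compt_isolated[of n x UNIV] that by (simp add: B_def)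
    show "subgrp J" "nb B J" "bounded_set J" using CO_D[OF J] compact_bounded[of J J] by auto
    show "closedin T UNIV" using closedin_topspace[of T] by simp
  qed auto
  ultimately have BU: "B = compt UNIV" by simp
  have UNc: "closedin T UNIV" using closedin_topspace[of T] by simp
  have sfB: "sharp_full B" unfolding BU by (rule sharp_full_compt[OF UNc smod_UNIV sf])
  have "\<exists>J\<in>CO B. x \<in> J" if "x \<in> B" for x
    using compt_CO[OF UNc subgrp_UNIV bounded_finite[of "{x}"]] that by (auto simp: BU)
  then have tdB: "td B" using Bc(1) Bm CO_small by (simp add: td_def)
  obtain D where D: "D \<in> q.CO B" using q.tdD(6)[OF qtdB] by auto
  obtain \<Phi> where \<Phi>: "generates (\<lambda>a. ac a ` D \<subseteq> D) \<Phi>" using q.generated_over_stabilizer[OF Bm q.CO_D[OF D]] by auto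
  have fin: "finite \<Phi>" "\<Phi> \<subseteq> carrier A" using \<Phi> by (auto simp: generates_def)
  obtain R where R: "q.td R" "td R" "R \<subseteq> B" "sharp_full R" "\<And>\<phi>. \<phi> \<in> \<Phi> \<Longrightarrow> R \<subseteq> q.bd \<phi> R"
    using sharp_full_bd_finite[OF qtdB tdB sfB fin] by auto
  note Rc = tdD(1)[OF R(2)] and Rm = tdD(2)[OF R(2)] and Rg = tdD(3)[OF R(2)]
  have ER: "E \<subseteq> R" using closedin_qtop_imp[OF q.tdD(1)[OF R(1)] subgrp_0[OF Rg]] by simp
  obtain D' where D': "D' \<in> q.CO R" "smod D'"
    using q.compact_open_smod[OF qtdB q.tdD(1)[OF R(1)] Rm R(3) D \<Phi> R(5)] by auto
  have D'c: "closedin (qtop T E) D'" by (rule q.CO_closed[OF q.tdD(1)[OF R(1)] Rg D'(1)])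
  have D'td: "q.td D'" by (rule q.td_sub(1)[OF R(1) D'c D'(2) q.CO_D(2)[OF D'(1)]])
  obtain W where W: "W \<in> CO R" "W \<subseteq> G" using tdD(5)[OF R(2) G(1)] by auto
  note Wg = CO_D(1)[OF W(1)]
  have zW: "zcl \<subseteq> W" by (rule zcl_subset[OF tdD(7)[OF R(2) W(1)] subgrp_0[OF Wg]])
  have WE: "W \<inter> E \<subseteq> zcl" using W(2) G(2) by auto
  obtain \<Psi> where \<Psi>: "generates (\<lambda>a. ac a ` W \<subseteq> W) \<Psi>" using generated_over_stabilizer[OF Rm CO_D[OF W(1)]] by auto
  have finP: "finite \<Psi>" "\<Psi> \<subseteq> carrier A" using \<Psi> by (auto simp: generates_def)
  obtain G2 where G2: "small G2" "R \<inter> G2 \<subseteq> W \<inter> {x. \<forall>\<phi>\<in>\<Psi>. ac \<phi> x \<in> W}"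
    using nb_common_vimage[OF Rm CO_D(3)[OF W(1)] finP] by (rule nbE)
  obtain S where S: "smod S" "S \<subseteq> D'" "q.nb D' S" "S \<subseteq> G2 + E"
    using q.small_open_smod[OF D'td q.CO_D(4)[OF D'(1)] qfz small_qtop_plus[OF G2(1)]] by auto
  have SR: "S \<subseteq> R" using S(2) q.CO_D(2)[OF D'(1)] by auto
  have nbS: "nb R S"
  proof -
    obtain H1 H2 where "small H1" "R \<inter> H1 \<subseteq> D'" "small H2" "D' \<inter> H2 \<subseteq> S"
      using nb_qtop_imp[OF q.CO_D(3)[OF D'(1)]] nb_qtop_imp[OF S(3)] by (auto simp: nb_def)
    then show ?thesis by (intro nbI[of "H1 \<inter> H2"] small_Int) auto
  qed
  \<comment> \<open>For a point of \<open>S \<inter> W\<close>, written in \<open>G2 + E\<close>,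
    the \<open>E\<close>-component lies in \<open>W \<inter> E\<close> and so in \<open>zcl\<close>.
    The point therefore behaves like its \<open>G2\<close>-component, which the generators keep in
    \<open>W\<close>.\<close>
  have SW: "ac \<phi> x \<in> W" if x: "x \<in> S" "x \<in> W" and p: "\<phi> \<in> \<Psi>" for x \<phi>
  proof -
    have "x \<in> G2 + E" using S(4) x by auto
    then obtain g e where ge: "x = g + e" "g \<in> G2" "e \<in> E" by (rule set_plus_elim)
    have "x - e \<in> R" using x SR ge ER by (intro subgrp_diff[OF Rg]) auto
    then have g: "g \<in> W" "ac \<phi> g \<in> W" using ge G2(2) p by auto
    have "x - g \<in> W" by (rule subgrp_diff[OF Wg x(2) g(1)])
    then have e: "e \<in> zcl" using ge WE by auto
    have pA: "\<phi> \<in> carrier A" using p finP by auto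
    have "ac \<phi> e \<in> W" using smod_ac[OF smod_zcl pA e] zW by auto
    then show ?thesis using g subgrp_add[OF Wg] by (simp add: ge(1) ac_add[OF pA])
  qed
  have W'm: "smod (S \<inter> W)"
  proof (rule generates_smod[OF \<Psi>])
    show "subgrp (S \<inter> W)" by (rule subgrp_Int[OF smod_subgrp[OF S(1)] Wg])
  qed (use SW smod_ac[OF S(1)] finP in auto)
  have nbW': "nb R (S \<inter> W)" by (rule nb_Int[OF nbS CO_D(3)[OF W(1)]])
  have W'R: "S \<inter> W \<subseteq> R" using SR by auto
  have lf: "locfin R (S \<inter> W)" by (rule sharp_full_locfin[OF Rm R(4) W'm W'R nbW'])
  have zW': "zcl \<subseteq> S \<inter> W"
    by (rule zcl_subset[OF closed_nb_subgrp[OF smod_subgrp[OF W'm] nbW' W'R Rc Rg] subgrp_0[OF smod_subgrp[OF W'm]]])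
  show ?thesis
  proof
    fix e assume e: "e \<in> E"
    then obtain P where P: "smod P" "S \<inter> W \<subseteq> P" "e \<in> P" "finite_index P (S \<inter> W)"
      using lf ER unfolding locfin_def by blast
    have "finite_index (P \<inter> E) (S \<inter> W \<inter> E)" by (rule finite_index_Int[OF P(4) smod_subgrp[OF W'm] Eg])
    then have "finite_index (P \<inter> E) zcl" by (rule finite_index_mono) (use WE in auto)
    moreover have "zcl \<subseteq> P \<inter> E" using zW' P(2) zcl_subset[OF E(1) subgrp_0[OF Eg]] by auto
    ultimately have "P \<inter> E = zcl" using pure smod_Int[OF P(1) E(2)] by (auto simp: pure_def)
    then show "e \<in> zcl" using e P(3) by auto
  qed
qed

end

text \<open>For the converse the question is moved to the quotient by a pure, relatively open
  \<open>U\<close> of \<open>N\<close>, where the image of \<open>N\<close> is discrete and pure and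
  must vanish.\<close>

theorem flat_zero_quotient_iff:
  assumes M: "flat_zero UNIV" "sharp_full UNIV" and N: "closedin T N" "smod N"
  shows "lc_mod.flat_zero (qtop T N) A ac UNIV \<longleftrightarrow> sharp_full N"
proof
  show "lc_mod.flat_zero (qtop T N) A ac UNIV" if "sharp_full N" by (rule parafinite_of_quotient[OF N M(1) that])
next
  assume fz: "lc_mod.flat_zero (qtop T N) A ac UNIV"
  show "sharp_full N"
    unfolding sharp_full_def
  proof (intro allI impI, elim conjE)
    fix U assume U: "smod U" "U \<subseteq> N" "nb N U" "pure N U"
    note Ng = smod_subgrp[OF N(2)] and Ug = smod_subgrp[OF U(1)]
    have Uc: "closedin T U" by (rule closed_nb_subgrp[OF Ug U(3,2) N(1) Ng])
    interpret r: lc_mod "qtop T U" A ac by (rule lc_mod_qtop[OF Uc U(1)])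
    have rz: "r.zcl = U" by (rule zcl_qtop[OF Uc U(1)])
    have Nr: "closedin (qtop T U) N"
      using N(1) subgrp_plus_least[OF Ng order_refl U(2)] by (simp add: closedin_qtop[OF Uc U(1)])
    have "r.nb N U"
      by (rule nb_qtop[OF Uc U(1) Ng U(2,3)]) (simp add: subgrp_plus_idem[OF Ug])
    then obtain G where G: "r.small G" "N \<inter> G \<subseteq> U" by (rule r.nbE)
    have "N \<subseteq> r.zcl"
    proof (rule r.discrete_pure_trivial[OF Nr N(2) sharp_full_qtop[OF Uc U(1) M(2)] _ G(1)])
      show "lc_mod.flat_zero (qtop (qtop T U) N) A ac UNIV" using fz by (simp add: qtop_qtop[OF U(2)])
    qed (use G(2) U(4) rz in auto)
    then show "U = N" using rz U(2) by auto
  qed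
qed

end

section \<open>Presentations of modules\<close>

lemma comm_group_cong:
  assumes "comm_group G" "carrier H = carrier G" "mult H = mult G" "one H = one G"
  shows "comm_group H"
proof -
  interpret G: comm_group G by (rule assms(1))
  show ?thesis
    by (rule comm_groupI) (use G.l_inv_ex G.m_assoc G.m_comm in \<open>auto simp: assms(2-4)\<close>)
qed

text \<open>The module M is written as the image of a submodule Z of an abelian group in the sense of type
  classes, so that submodules and quotients of M become pairs of submodules of that group.\<close>
locale alg_pres = lc_mod T A ac for T :: "'f::ab_group_add topology" and A :: "'g tmonoid" and ac +
  fixes Z :: "'f set" and h :: "'f \<Rightarrow> 'b" and M :: "('g, 'b) amod"
  assumes Z_smod: "smod Z" and M_comm: "comm_group M" and h_img: "h ` Z = carrier M"
    and h_add: "\<And>x y. x \<in> Z \<Longrightarrow> y \<in> Z \<Longrightarrow> h (x + y) = h x \<otimes>\<^bsub>M\<^esub> h y"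
    and h_ac: "\<And>a x. a \<in> carrier A \<Longrightarrow> x \<in> Z \<Longrightarrow> h (ac a x) = act M a (h x)"
begin

lemma Z_subgrp: "subgrp Z" by (rule smod_subgrp[OF Z_smod])

lemma M_group: "group M" using M_comm by (simp add: comm_group_def)

lemma h_in: "x \<in> Z \<Longrightarrow> h x \<in> carrier M" using h_img by auto

lemma h_0: "h 0 = \<one>\<^bsub>M\<^esub>"
  using h_add[of 0 0] subgrp_0[OF Z_subgrp] h_in[of 0] group.l_cancel_one[OF M_group, of "h 0" "h 0"] by simp

lemma h_diff:
  assumes "x \<in> Z" "y \<in> Z"
  shows "h (x - y) = h x \<otimes>\<^bsub>M\<^esub> inv\<^bsub>M\<^esub> h y"
proof -
  interpret group M by (rule M_group)
  have "h x = h (x - y) \<otimes>\<^bsub>M\<^esub> h y" using h_add[of "x - y" y] subgrp_diff[OF Z_subgrp assms] assms by simp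
  then show ?thesis using inv_solve_right[of "h (x - y)" "h x" "h y"] h_in assms subgrp_diff[OF Z_subgrp assms] by simp
qed

lemma h_minus: "x \<in> Z \<Longrightarrow> h (- x) = inv\<^bsub>M\<^esub> h x"
  using h_diff[of 0 x] subgrp_0[OF Z_subgrp] h_0 monoid.l_one[of M "inv\<^bsub>M\<^esub> h x"] group.inv_closed[OF M_group h_in]
    group.is_monoid[OF M_group] by simp

definition pre :: "'b set \<Rightarrow> 'f set" where
  "pre S = {x\<in>Z. h x \<in> S}"

lemma pre_subset: "pre S \<subseteq> Z" by (auto simp: pre_def)

lemma pre_mono: "S \<subseteq> S' \<Longrightarrow> pre S \<subseteq> pre S'" by (auto simp: pre_def)

lemma image_pre: "S \<subseteq> carrier M \<Longrightarrow> h ` pre S = S"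
  using h_img by (auto simp: pre_def)

lemma submodule_subset: "submodule A M S \<Longrightarrow> S \<subseteq> carrier M"
  by (simp add: submodule_def subgroup.subset)

lemma one_in_submodule: "submodule A M S \<Longrightarrow> \<one>\<^bsub>M\<^esub> \<in> S"
  by (simp add: submodule_def subgroup.one_closed)

lemma smod_pre:
  assumes "submodule A M S"
  shows "smod (pre S)"
proof -
  have S: "subgroup S M" "\<And>a x. a \<in> carrier A \<Longrightarrow> x \<in> S \<Longrightarrow> act M a x \<in> S" using assms by (auto simp: submodule_def)
  have "subgrp (pre S)"
    unfolding subgrp_def using subgrp_0[OF Z_subgrp] subgrp_diff[OF Z_subgrp] subgroup.one_closed[OF S(1)]
      subgroup.m_closed[OF S(1)] subgroup.m_inv_closed[OF S(1)] by (auto simp: pre_def h_0 h_diff)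
  then show ?thesis using S(2) smod_ac[OF Z_smod] by (auto simp: smod_def pre_def h_ac)
qed

lemma submodule_image:
  assumes P: "smod P" "P \<subseteq> Z"
  shows "submodule A M (h ` P)"
  unfolding submodule_def
proof (intro conjI ballI)
  note Pg = smod_subgrp[OF P(1)]
  show "subgroup (h ` P) M"
  proof (rule group.subgroupI[OF M_group])
    show "h ` P \<subseteq> carrier M" using P(2) h_in by auto
    show "h ` P \<noteq> {}" using subgrp_0[OF Pg] by auto
    show "inv\<^bsub>M\<^esub> b \<in> h ` P" if "b \<in> h ` P" for b
      using that subgrp_minus[OF Pg] h_minus[OF subsetD[OF P(2)], symmetric] by auto
    show "b \<otimes>\<^bsub>M\<^esub> c \<in> h ` P" if "b \<in> h ` P" "c \<in> h ` P" for b c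
      using that subgrp_add[OF Pg] h_add[OF subsetD[OF P(2)] subsetD[OF P(2)], symmetric] by auto
  qed
  show "act M a x \<in> h ` P" if "a \<in> carrier A" "x \<in> h ` P" for a x
    using that smod_ac[OF P(1)] h_ac[OF _ subsetD[OF P(2)], symmetric] by auto
qed

lemma h_eq_iff: "x \<in> Z \<Longrightarrow> y \<in> Z \<Longrightarrow> h x = h y \<longleftrightarrow> x - y \<in> pre {\<one>\<^bsub>M\<^esub>}"
proof -
  assume xy: "x \<in> Z" "y \<in> Z"
  interpret group M by (rule M_group)
  show ?thesis using xy h_in[OF xy(1)] h_in[OF xy(2)] subgrp_diff[OF Z_subgrp xy] inv_solve_right'[of "\<one>\<^bsub>M\<^esub>" "h x" "h y"]
    by (auto simp: pre_def h_diff)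
qed

lemma pre_image:
  assumes "smod P" "P \<subseteq> Z" "pre {\<one>\<^bsub>M\<^esub>} \<subseteq> P"
  shows "pre (h ` P) = P"
proof
  show "P \<subseteq> pre (h ` P)" using assms(2) by (auto simp: pre_def)
  show "pre (h ` P) \<subseteq> P"
  proof
    fix x assume "x \<in> pre (h ` P)"
    then obtain p where p: "x \<in> Z" "p \<in> P" "h x = h p" by (auto simp: pre_def)
    then have "x - p \<in> P" using h_eq_iff[of x p] assms by auto
    then show "x \<in> P" using subgrp_add[OF smod_subgrp[OF assms(1)], of "x - p" p] p by simp
  qed
qed

lemma submodule_one: "submodule A M {\<one>\<^bsub>M\<^esub>}"
proof -
  have "act M a \<one>\<^bsub>M\<^esub> = \<one>\<^bsub>M\<^esub>" if "a \<in> carrier A" for a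
    using h_ac[OF that subgrp_0[OF Z_subgrp]] by (simp add: ac_0[OF that] h_0)
  then show ?thesis using group.triv_subgroup[OF M_group] by (simp add: submodule_def)
qed

lemma finite_carrier_iff: "finite (carrier M) \<longleftrightarrow> finite_index Z (pre {\<one>\<^bsub>M\<^esub>})"
proof
  assume "finite (carrier M)"
  then obtain F where F: "F \<subseteq> Z" "finite F" "carrier M = h ` F"
    using finite_subset_image[of "carrier M" h Z] h_img by auto
  have "x \<in> F + pre {\<one>\<^bsub>M\<^esub>}" if x: "x \<in> Z" for x
  proof -
    obtain f where f: "f \<in> F" "h x = h f" using h_in[OF x] F(3) by auto
    then have "x - f \<in> pre {\<one>\<^bsub>M\<^esub>}" using h_eq_iff[of x f] x F(1) by auto
    then have "f + (x - f) \<in> F + pre {\<one>\<^bsub>M\<^esub>}" using f(1) by (intro set_plus_intro)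
    then show ?thesis by simp
  qed
  then show "finite_index Z (pre {\<one>\<^bsub>M\<^esub>})" using F(2) by (auto simp: finite_index_def)
next
  assume "finite_index Z (pre {\<one>\<^bsub>M\<^esub>})"
  then obtain F where F: "finite F" "F \<subseteq> Z" "Z = F + pre {\<one>\<^bsub>M\<^esub>}"
    using finite_index_reps[OF _ Z_subgrp smod_subgrp[OF smod_pre[OF submodule_one]] pre_subset] by metis
  have "h x \<in> h ` F" if x: "x \<in> Z" for x
  proof -
    have "x \<in> F + pre {\<one>\<^bsub>M\<^esub>}" using x F(3) by simp
    then obtain f k where "x = f + k" "f \<in> F" "k \<in> pre {\<one>\<^bsub>M\<^esub>}" by (rule set_plus_elim)
    then have "h x = h f" using h_eq_iff[of x f] x F(2) by auto
    then show ?thesis using \<open>f \<in> F\<close> by auto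
  qed
  then show "finite (carrier M)" using F(1) h_img by (metis finite_imageI finite_subset image_subsetI)
qed

lemma alg_pres_submod:
  assumes "submodule A M S"
  shows "alg_pres T A ac (pre S) h (submod M S)"
proof (intro alg_pres.intro alg_pres_axioms.intro lc_mod_axioms)
  have S: "subgroup S M" using assms by (simp add: submodule_def)
  show "smod (pre S)" by (rule smod_pre[OF assms])
  have "group (M\<lparr>carrier := S\<rparr>)" by (rule group.subgroup_imp_group[OF M_group S])
  then have "comm_group (M\<lparr>carrier := S\<rparr>)"
    using subgroup.mem_carrier[OF S] comm_monoid.m_comm[of M] M_comm
    by (intro group.group_comm_groupI) (auto simp: comm_group_def)
  then show "comm_group (submod M S)" by (rule comm_group_cong) (auto simp: submod_def)
  show "h ` pre S = carrier (submod M S)" using image_pre[OF subgroup.subset[OF S]] by (simp add: submod_def)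
qed (auto simp: pre_def submod_def h_add h_ac)

lemma rcoset_eq:
  assumes U: "submodule A M U" and x: "x \<in> Z"
  shows "U #>\<^bsub>M\<^esub> h x = h ` {y\<in>Z. y - x \<in> pre U}"
proof -
  have "U #>\<^bsub>M\<^esub> h x = {u \<otimes>\<^bsub>M\<^esub> h x |u. u \<in> U}" by (auto simp: r_coset_def)
  also have "\<dots> = {h y |y. y \<in> Z \<and> y - x \<in> pre U}"
  proof (intro Set.set_eqI iffI; clarify)
    fix u assume "u \<in> U"
    then obtain v where v: "v \<in> pre U" "u = h v" using image_pre[OF submodule_subset[OF U]] by blast
    then have vZ: "v \<in> Z" using pre_subset by auto
    have "u \<otimes>\<^bsub>M\<^esub> h x = h (v + x)" using h_add[OF vZ x] v by simp
    moreover have "v + x \<in> Z" "(v + x) - x \<in> pre U" using subgrp_add[OF Z_subgrp vZ x] v by auto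
    ultimately show "\<exists>y. u \<otimes>\<^bsub>M\<^esub> h x = h y \<and> y \<in> Z \<and> y - x \<in> pre U" by blast
  next
    fix y assume y: "y \<in> Z" "y - x \<in> pre U"
    have "h y = h (y - x) \<otimes>\<^bsub>M\<^esub> h x" using h_add[of "y - x" x] subgrp_diff[OF Z_subgrp y(1) x] x by simp
    then show "\<exists>u. h y = u \<otimes>\<^bsub>M\<^esub> h x \<and> u \<in> U" using y(2) by (auto simp: pre_def)
  qed
  finally show ?thesis by auto
qed

text \<open>The group and \<open>Z\<close> stay the same; only the map changes, and its kernel grows
  to \<open>pre U\<close>.\<close>

lemma alg_pres_quotmod:
  assumes U: "submodule A M U"
  shows "alg_pres T A ac Z (\<lambda>x. U #>\<^bsub>M\<^esub> h x) (quotmod M U)"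
proof (intro alg_pres.intro alg_pres_axioms.intro lc_mod_axioms Z_smod)
  have Ug: "subgroup U M" using U by (simp add: submodule_def)
  interpret M: comm_group M by (rule M_comm)
  have n: "U \<lhd> M" by (rule M.subgroup_imp_normal[OF Ug])
  show "comm_group (quotmod M U)"
    by (rule comm_group_cong[OF M.abelian_FactGroup[OF Ug]]) (auto simp: quotmod_def FactGroup_def)
  show "(\<lambda>x. U #>\<^bsub>M\<^esub> h x) ` Z = carrier (quotmod M U)" using h_img[symmetric] by (auto simp: quotmod_def RCOSETS_def)
  show "U #>\<^bsub>M\<^esub> h (x + y) = (U #>\<^bsub>M\<^esub> h x) \<otimes>\<^bsub>quotmod M U\<^esub> (U #>\<^bsub>M\<^esub> h y)" if "x \<in> Z" "y \<in> Z" for x y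
    using normal.rcos_sum[OF n h_in[OF that(1)] h_in[OF that(2)]] by (simp add: quotmod_def h_add that)
  fix a x assume a: "a \<in> carrier A" and x: "x \<in> Z"
  have ax: "ac a x \<in> Z" by (rule smod_ac[OF Z_smod a x])
  have "{y\<in>Z. y - ac a x \<in> pre U} = ac a ` {y\<in>Z. y - x \<in> pre U}"
  proof (intro Set.set_eqI iffI)
    fix y assume y: "y \<in> {y\<in>Z. y - ac a x \<in> pre U}"
    let ?y = "ac (inv\<^bsub>A\<^esub> a) y"
    have "ac a (?y - x) = y - ac a x" by (simp add: ac_diff[OF a] ac_inv[OF a])
    then have "?y - x \<in> pre U" using y smod_ac_iff[OF smod_pre[OF U] a, of "?y - x"] by simp
    moreover have "?y \<in> Z" using y smod_ac[OF Z_smod A_inv[OF a]] by simp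
    ultimately show "y \<in> ac a ` {y\<in>Z. y - x \<in> pre U}" using ac_inv(1)[OF a, of y] by (intro image_eqI[of _ _ ?y]) auto
  next
    fix y assume "y \<in> ac a ` {y\<in>Z. y - x \<in> pre U}"
    then show "y \<in> {y\<in>Z. y - ac a x \<in> pre U}"
      using smod_ac[OF Z_smod a] smod_ac[OF smod_pre[OF U] a] by (auto simp: ac_diff[OF a, symmetric])
  qed
  then have "U #>\<^bsub>M\<^esub> h (ac a x) = (\<lambda>y. h (ac a y)) ` {y\<in>Z. y - x \<in> pre U}" by (simp add: rcoset_eq[OF U ax] image_image)
  also have "\<dots> = act M a ` (U #>\<^bsub>M\<^esub> h x)" by (simp add: rcoset_eq[OF U x] image_image h_ac[OF a] cong: image_cong_simp)
  finally show "U #>\<^bsub>M\<^esub> h (ac a x) = act (quotmod M U) a (U #>\<^bsub>M\<^esub> h x)" by (simp add: quotmod_def)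
qed

lemma rcoset_iff:
  assumes U: "submodule A M U" and xy: "x \<in> Z" "y \<in> Z"
  shows "h y \<in> U #>\<^bsub>M\<^esub> h x \<longleftrightarrow> y - x \<in> pre U"
proof
  assume "h y \<in> U #>\<^bsub>M\<^esub> h x"
  then obtain z where z: "z \<in> Z" "z - x \<in> pre U" "h y = h z" by (auto simp: rcoset_eq[OF U xy(1)])
  have "y - z \<in> pre U" using h_eq_iff[of y z] z xy one_in_submodule[OF U] pre_mono[of "{\<one>\<^bsub>M\<^esub>}" U] by auto
  then have "(y - z) + (z - x) \<in> pre U" using z(2) by (rule subgrp_add[OF smod_subgrp[OF smod_pre[OF U]]])
  then show "y - x \<in> pre U" by simp
qed (use xy in \<open>auto simp: rcoset_eq[OF U xy(1)]\<close>)

lemma rcoset_eq_iff: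
  assumes U: "submodule A M U" and xy: "x \<in> Z" "y \<in> Z"
  shows "U #>\<^bsub>M\<^esub> h y = U #>\<^bsub>M\<^esub> h x \<longleftrightarrow> y - x \<in> pre U"
proof -
  have Ug: "subgroup U M" using U by (simp add: submodule_def)
  interpret M: group M by (rule M_group)
  show ?thesis using rcoset_iff[OF U xy] M.rcos_self[OF h_in[OF xy(2)] Ug] M.repr_independence[OF _ h_in[OF xy(1)] Ug] by auto
qed

lemma pre_quotmod:
  assumes U: "submodule A M U"
  shows "alg_pres.pre Z (\<lambda>x. U #>\<^bsub>M\<^esub> h x) {\<one>\<^bsub>quotmod M U\<^esub>} = pre U"
proof -
  interpret q: alg_pres T A ac Z "\<lambda>x. U #>\<^bsub>M\<^esub> h x" "quotmod M U" by (rule alg_pres_quotmod[OF U])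
  show ?thesis using rcoset_eq_iff[OF U subgrp_0[OF Z_subgrp]] q.h_0 pre_subset[of U] by (auto simp: q.pre_def)
qed

lemma finite_quotmod_iff:
  assumes U: "submodule A M U"
  shows "finite (carrier (quotmod M U)) \<longleftrightarrow> finite_index Z (pre U)"
proof -
  interpret q: alg_pres T A ac Z "\<lambda>x. U #>\<^bsub>M\<^esub> h x" "quotmod M U" by (rule alg_pres_quotmod[OF U])
  show ?thesis using q.finite_carrier_iff by (simp add: pre_quotmod[OF U])
qed

lemma finite_submodule_iff:
  assumes S: "submodule A M S"
  shows "finite S \<longleftrightarrow> finite_index (pre S) (pre {\<one>\<^bsub>M\<^esub>})"
proof -
  interpret s: alg_pres T A ac "pre S" h "submod M S" by (rule alg_pres_submod[OF S])
  have "s.pre {\<one>\<^bsub>submod M S\<^esub>} = pre {\<one>\<^bsub>M\<^esub>}" using one_in_submodule[OF S] unfolding s.pre_def by (auto simp: pre_def submod_def)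
  then show ?thesis using s.finite_carrier_iff by (simp add: submod_def)
qed

lemma pure_iff:
  "pure Z (pre {\<one>\<^bsub>M\<^esub>}) \<longleftrightarrow> (\<forall>S. submodule A M S \<and> finite S \<longrightarrow> S = {\<one>\<^bsub>M\<^esub>})"
proof (intro iffI allI impI)
  fix S assume p: "pure Z (pre {\<one>\<^bsub>M\<^esub>})" and S: "submodule A M S \<and> finite S"
  then have "finite_index (pre S) (pre {\<one>\<^bsub>M\<^esub>})" using finite_submodule_iff by auto
  then have "pre S = pre {\<one>\<^bsub>M\<^esub>}"
    using p S smod_pre[of S] pre_mono[of "{\<one>\<^bsub>M\<^esub>}" S] one_in_submodule[of S] pre_subset by (auto simp: pure_def)
  then show "S = {\<one>\<^bsub>M\<^esub>}" using image_pre[of S] image_pre[of "{\<one>\<^bsub>M\<^esub>}"] S submodule_subset[of S] submodule_subset[OF submodule_one] by simp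
next
  assume *: "\<forall>S. submodule A M S \<and> finite S \<longrightarrow> S = {\<one>\<^bsub>M\<^esub>}"
  show "pure Z (pre {\<one>\<^bsub>M\<^esub>})"
    unfolding pure_def
  proof (intro allI impI, elim conjE)
    fix P assume P: "smod P" "pre {\<one>\<^bsub>M\<^esub>} \<subseteq> P" "P \<subseteq> Z" "finite_index P (pre {\<one>\<^bsub>M\<^esub>})"
    have e: "pre (h ` P) = P" by (rule pre_image[OF P(1,3,2)])
    have "h ` P = {\<one>\<^bsub>M\<^esub>}" using * submodule_image[OF P(1,3)] finite_submodule_iff[OF submodule_image[OF P(1,3)]] P(4) e by simp
    then show "P = pre {\<one>\<^bsub>M\<^esub>}" using e by simp
  qed
qed

lemma pure_quotmod_iff:
  assumes U: "submodule A M U"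
  shows "pure Z (pre U) \<longleftrightarrow> (\<forall>S. submodule A (quotmod M U) S \<and> finite S \<longrightarrow> S = {\<one>\<^bsub>quotmod M U\<^esub>})"
proof -
  interpret q: alg_pres T A ac Z "\<lambda>x. U #>\<^bsub>M\<^esub> h x" "quotmod M U" by (rule alg_pres_quotmod[OF U])
  show ?thesis using q.pure_iff by (simp add: pre_quotmod[OF U])
qed

text \<open>The sets in question form a topology because distinct cosets are disjoint, so that
  taking unions of families of cosets commutes with binary intersections.\<close>

lemma openin_quotmod:
  assumes U: "submodule A M U"
  shows "openin (topo (quotmod M U)) V \<longleftrightarrow> V \<subseteq> rcosets\<^bsub>M\<^esub> U \<and> openin (topo M) (\<Union>V)"
proof -
  have Ug: "subgroup U M" using U by (simp add: submodule_def)
  have disj: "C = D" if "C \<in> rcosets\<^bsub>M\<^esub> U" "D \<in> rcosets\<^bsub>M\<^esub> U" "x \<in> C" "x \<in> D" for C D x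
    using group.rcos_disjoint[OF M_group Ug] that by (auto simp: pairwise_def disjnt_def)
  have "istopology (\<lambda>V. V \<subseteq> rcosets\<^bsub>M\<^esub> U \<and> openin (topo M) (\<Union>V))"
    unfolding istopology_def
  proof (intro conjI allI impI)
    fix V W assume VW: "V \<subseteq> rcosets\<^bsub>M\<^esub> U \<and> openin (topo M) (\<Union>V)" "W \<subseteq> rcosets\<^bsub>M\<^esub> U \<and> openin (topo M) (\<Union>W)"
    have "\<Union>(V \<inter> W) = \<Union>V \<inter> \<Union>W"
    proof (intro Set.set_eqI iffI)
      fix x assume "x \<in> \<Union>V \<inter> \<Union>W"
      then obtain C D where CD: "x \<in> C" "C \<in> V" "x \<in> D" "D \<in> W" by auto
      then have "C = D" using disj[of C D x] VW by auto
      then show "x \<in> \<Union>(V \<inter> W)" using CD by auto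
    qed auto
    then show "openin (topo M) (\<Union>(V \<inter> W))" using VW openin_Int by metis
    show "V \<inter> W \<subseteq> rcosets\<^bsub>M\<^esub> U" using VW by auto
  next
    fix \<K> assume K: "\<forall>V\<in>\<K>. V \<subseteq> rcosets\<^bsub>M\<^esub> U \<and> openin (topo M) (\<Union>V)"
    have "\<Union>(\<Union>\<K>) = \<Union>(\<Union> ` \<K>)" by auto
    then show "openin (topo M) (\<Union>(\<Union>\<K>))" using K by (auto intro: openin_Union)
    show "\<Union>\<K> \<subseteq> rcosets\<^bsub>M\<^esub> U" using K by auto
  qed
  then show ?thesis by (simp add: quotmod_def)
qed

lemma pre_Union_rcosets:
  assumes U: "submodule A M U" and V: "V \<subseteq> rcosets\<^bsub>M\<^esub> U"
  shows "pre (\<Union>V) = {x\<in>Z. U #>\<^bsub>M\<^esub> h x \<in> V}"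
proof (intro Set.set_eqI iffI)
  have Ug: "subgroup U M" using U by (simp add: submodule_def)
  interpret M: group M by (rule M_group)
  fix x assume "x \<in> pre (\<Union>V)"
  then obtain C where C: "x \<in> Z" "h x \<in> C" "C \<in> V" by (auto simp: pre_def)
  then obtain y where y: "y \<in> carrier M" "C = U #>\<^bsub>M\<^esub> y" using V by (auto simp: RCOSETS_def)
  have "C = U #>\<^bsub>M\<^esub> h x" using M.repr_independence[OF _ y(1) Ug] C(2) y(2) by simp
  then show "x \<in> {x\<in>Z. U #>\<^bsub>M\<^esub> h x \<in> V}" using C by simp
next
  have Ug: "subgroup U M" using U by (simp add: submodule_def)
  fix x assume "x \<in> {x\<in>Z. U #>\<^bsub>M\<^esub> h x \<in> V}"
  then show "x \<in> pre (\<Union>V)" using group.rcos_self[OF M_group h_in Ug] by (auto simp: pre_def)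
qed

end

text \<open>\<open>kernel\<close> expresses that \<open>M\<close> is Hausdorff, and
  \<open>open_iff\<close> that \<open>M\<close> carries the quotient topology of the subspace
  \<open>Z\<close>.\<close>

locale top_pres = alg_pres +
  assumes Z_closed: "closedin T Z" and kernel: "pre {\<one>\<^bsub>M\<^esub>} = zcl"
    and open_iff: "\<And>V. openin (topo M) V \<longleftrightarrow> V \<subseteq> carrier M \<and> (\<exists>U. openin T U \<and> pre V = Z \<inter> U)"
begin

lemma topspace_M: "topspace (topo M) = carrier M"
proof
  have "openin (topo M) (carrier M)" using openin_topspace[of T] h_in by (auto simp: open_iff pre_def intro!: exI[of _ UNIV])
  then show "carrier M \<subseteq> topspace (topo M)" by (rule openin_subset)
  show "topspace (topo M) \<subseteq> carrier M" using openin_topspace[of "topo M"] open_iff by auto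
qed

lemma pre_image_open:
  assumes "openin T U"
  shows "pre (h ` (Z \<inter> U)) = Z \<inter> U" "openin (topo M) (h ` (Z \<inter> U))"
proof -
  have "x \<in> U" if x: "x \<in> Z" "y \<in> Z" "y \<in> U" "h x = h y" for x y
  proof -
    have "x - y \<in> zcl" using h_eq_iff[OF x(1,2)] x(4) kernel by simp
    then have "y + (x - y) \<in> U + zcl" using x(3) by (intro set_plus_intro)
    then show ?thesis using zcl_open[OF assms] by simp
  qed
  then show e: "pre (h ` (Z \<inter> U)) = Z \<inter> U" by (auto simp: pre_def)
  then show "openin (topo M) (h ` (Z \<inter> U))" using assms h_in by (auto simp: open_iff)
qed

lemma closed_iff:
  assumes "S \<subseteq> carrier M"
  shows "closedin (topo M) S \<longleftrightarrow> closedin T (pre S)"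
proof
  assume "closedin (topo M) S"
  then have "openin (topo M) (carrier M - S)" by (simp add: closedin_def topspace_M)
  then obtain U where U: "openin T U" "pre (carrier M - S) = Z \<inter> U" by (auto simp: open_iff)
  have "pre S = Z \<inter> (UNIV - U)" using U(2) h_in by (auto simp: pre_def)
  moreover have "closedin T (UNIV - U)" using closedin_diff[OF closedin_topspace U(1)] by simp
  ultimately show "closedin T (pre S)" using Z_closed by (simp add: closedin_Int)
next
  assume "closedin T (pre S)"
  then have "openin T (UNIV - pre S)" by (simp add: closedin_def)
  moreover have "pre (carrier M - S) = Z \<inter> (UNIV - pre S)" using h_in by (auto simp: pre_def)
  ultimately show "closedin (topo M) S" using assms by (auto simp: closedin_def topspace_M open_iff)
qed

text \<open>Relatively open subsets of \<open>Z\<close> are saturated for \<open>h\<close>, so open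
  covers can be transported in both directions.\<close>

lemma compact_iff:
  assumes S: "S \<subseteq> carrier M"
  shows "compactin (topo M) S \<longleftrightarrow> compactin T (pre S)"
proof
  assume c: "compactin (topo M) S"
  show "compactin T (pre S)"
    unfolding compactin_def
  proof (intro conjI allI impI)
    fix \<U> assume U: "Ball \<U> (openin T) \<and> pre S \<subseteq> \<Union>\<U>"
    have "S \<subseteq> \<Union>((\<lambda>U. h ` (Z \<inter> U)) ` \<U>)"
    proof
      fix s assume "s \<in> S"
      then obtain x where x: "x \<in> pre S" "s = h x" using image_pre[OF S] by blast
      then obtain W where "W \<in> \<U>" "x \<in> W" using U by auto
      then show "s \<in> \<Union>((\<lambda>U. h ` (Z \<inter> U)) ` \<U>)" using x pre_subset by auto
    qed
    then obtain \<F> where F: "finite \<F>" "\<F> \<subseteq> (\<lambda>U. h ` (Z \<inter> U)) ` \<U>" "S \<subseteq> \<Union>\<F>"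
      using compactinD[OF c, of "(\<lambda>U. h ` (Z \<inter> U)) ` \<U>"] U pre_image_open(2) by auto
    obtain \<G> where G: "\<G> \<subseteq> \<U>" "finite \<G>" "\<F> = (\<lambda>U. h ` (Z \<inter> U)) ` \<G>" using finite_subset_image[OF F(1,2)] by auto
    have "pre S \<subseteq> \<Union>\<G>"
    proof
      fix x assume x: "x \<in> pre S"
      then have "h x \<in> S" "x \<in> Z" by (auto simp: pre_def)
      then obtain W where W: "W \<in> \<G>" "h x \<in> h ` (Z \<inter> W)" using F(3) G(3) by auto
      have "openin T W" using W(1) G(1) U by auto
      then have "x \<in> Z \<inter> W" using pre_image_open(1)[of W] W(2) \<open>x \<in> Z\<close> by (auto simp: pre_def)
      then show "x \<in> \<Union>\<G>" using W(1) by auto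
    qed
    then show "\<exists>\<F>. finite \<F> \<and> \<F> \<subseteq> \<U> \<and> pre S \<subseteq> \<Union>\<F>" using G by auto
  qed simp
next
  assume c: "compactin T (pre S)"
  have "continuous_map (subtopology T Z) (topo M) h"
    unfolding continuous_map_def
  proof (intro conjI allI impI)
    show "h \<in> topspace (subtopology T Z) \<rightarrow> topspace (topo M)" using h_in by (auto simp: topspace_M)
    fix V assume "openin (topo M) V"
    then obtain U where "openin T U" "pre V = Z \<inter> U" by (auto simp: open_iff)
    moreover have "{x \<in> topspace (subtopology T Z). h x \<in> V} = pre V" by (auto simp: pre_def)
    ultimately show "openin (subtopology T Z) {x \<in> topspace (subtopology T Z). h x \<in> V}"
      by (auto simp: openin_subtopology Int_commute)
  qed
  moreover have "compactin (subtopology T Z) (pre S)" using c pre_subset by (simp add: compactin_subtopology)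
  ultimately show "compactin (topo M) S" using image_compactin[of "subtopology T Z" "pre S" "topo M" h] image_pre[OF S] by simp
qed

lemma open_submodule_iff:
  assumes U: "submodule A M U"
  shows "openin (topo M) U \<longleftrightarrow> nb Z (pre U)"
proof
  assume "openin (topo M) U"
  then obtain G where G: "openin T G" "pre U = Z \<inter> G" by (auto simp: open_iff)
  then have "small G" using subgrp_0[OF smod_subgrp[OF smod_pre[OF U]]] by (auto simp: small_def)
  then show "nb Z (pre U)" using G(2) by (intro nbI[of G]) auto
next
  note g = smod_subgrp[OF smod_pre[OF U]]
  assume "nb Z (pre U)"
  then obtain G where G: "small G" "Z \<inter> G \<subseteq> pre U" by (rule nbE)
  have "pre U = Z \<inter> (pre U + G)"
  proof
    show "pre U \<subseteq> Z \<inter> (pre U + G)" using pre_subset subset_plus1[OF smallD(2)[OF G(1)]] by auto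
    show "Z \<inter> (pre U + G) \<subseteq> pre U"
    proof
      fix x assume x: "x \<in> Z \<inter> (pre U + G)"
      then have "x \<in> pre U + G" by simp
      then obtain u v where uv: "x = u + v" "u \<in> pre U" "v \<in> G" by (rule set_plus_elim)
      have "x - u \<in> Z" using x uv pre_subset by (intro subgrp_diff[OF Z_subgrp]) auto
      then have "v \<in> pre U" using G(2) uv by auto
      then show "x \<in> pre U" using uv subgrp_add[OF g] by auto
    qed
  qed
  then show "openin (topo M) U" using open_plus[OF smallD(1)[OF G(1)], of "pre U"] submodule_subset[OF U]
    unfolding open_iff by blast
qed

lemma purely_discrete_iff:
  assumes U: "submodule A M U" "openin (topo M) U"
  shows "purely_discrete A (quotmod M U) \<longleftrightarrow> pure Z (pre U)"
proof -
  obtain G where G: "openin T G" "pre U = Z \<inter> G" using U(2) by (auto simp: open_iff)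
  have coset: "openin (topo M) C" if C: "C \<in> rcosets\<^bsub>M\<^esub> U" for C
  proof -
    obtain x where x: "x \<in> Z" "C = U #>\<^bsub>M\<^esub> h x" using C h_img[symmetric] by (auto simp: RCOSETS_def)
    have "pre C = Z \<inter> {y. y - x \<in> G}"
      using rcoset_iff[OF U(1) x(1)] subgrp_diff[OF Z_subgrp _ x(1)] x(2) G(2) by (auto simp: pre_def set_eq_iff)
    moreover have "C \<subseteq> carrier M" using x h_in by (auto simp: rcoset_eq[OF U(1)])
    ultimately show ?thesis using open_translate'[OF G(1), of x] by (auto simp: open_iff)
  qed
  have "topo (quotmod M U) = discrete_topology (carrier (quotmod M U))"
    unfolding topology_eq openin_quotmod[OF U(1)] using coset by (auto simp: quotmod_def intro!: openin_Union)
  then show ?thesis by (simp add: purely_discrete_def pure_quotmod_iff[OF U(1)])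
qed

theorem Omega_sharp_iff: "Omega_sharp A M = carrier M \<longleftrightarrow> sharp_full Z"
proof -
  define \<U> where "\<U> = {U. submodule A M U \<and> nb Z (pre U) \<and> pure Z (pre U)}"
  have O: "Omega_sharp A M = \<Inter>\<U>"
    unfolding Omega_sharp_def \<U>_def by (rule arg_cong[where f=Inter], rule Collect_cong) (use open_submodule_iff purely_discrete_iff in blast)
  have "carrier M \<in> \<U>"
  proof -
    have "submodule A M (carrier M)" using submodule_image[OF Z_smod order_refl] by (simp add: h_img)
    moreover have "pre (carrier M) = Z" using h_in by (auto simp: pre_def)
    ultimately show ?thesis using nb_self by (auto simp: \<U>_def pure_def)
  qed
  moreover have "U \<subseteq> carrier M" if "U \<in> \<U>" for U using that submodule_subset by (simp add: \<U>_def)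
  ultimately have "Omega_sharp A M = carrier M \<longleftrightarrow> (\<forall>U\<in>\<U>. U = carrier M)" unfolding O by blast
  also have "\<dots> \<longleftrightarrow> sharp_full Z"
  proof
    assume *: "\<forall>U\<in>\<U>. U = carrier M"
    show "sharp_full Z"
      unfolding sharp_full_def
    proof (intro allI impI, elim conjE)
      fix P assume P: "smod P" "P \<subseteq> Z" "nb Z P" "pure Z P"
      have "zcl \<subseteq> P" by (rule zcl_subset[OF closed_nb_subgrp[OF smod_subgrp[OF P(1)] P(3,2) Z_closed Z_subgrp] subgrp_0[OF smod_subgrp[OF P(1)]]])
      then have e: "pre (h ` P) = P" by (intro pre_image[OF P(1,2)]) (simp add: kernel)
      then have "h ` P \<in> \<U>" using P submodule_image[OF P(1,2)] by (simp add: \<U>_def)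
      then have "h ` P = carrier M" using * by auto
      then show "P = Z" using e h_in by (auto simp: pre_def)
    qed
  next
    assume *: "sharp_full Z"
    show "\<forall>U\<in>\<U>. U = carrier M"
    proof
      fix U assume U: "U \<in> \<U>"
      then have "pre U = Z" using * smod_pre pre_subset by (auto simp: \<U>_def sharp_full_def)
      then show "U = carrier M" using image_pre[of U] U submodule_subset h_img by (auto simp: \<U>_def)
    qed
  qed
  finally show ?thesis .
qed

lemma compact_parafinite_iff:
  assumes S: "submodule A M S"
  shows "compact_parafinite A (submod M S) \<longleftrightarrow> compactin T (pre S) \<and> closedin T (pre S) \<and> parafin (pre S)"
proof -
  note SM = submodule_subset[OF S]
  interpret s: alg_pres T A ac "pre S" h "submod M S" by (rule alg_pres_submod[OF S])
  have spre: "s.pre U = pre U" if "U \<subseteq> S" for U using that unfolding s.pre_def by (auto simp: pre_def)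
  have "compact_space (topo (submod M S)) \<longleftrightarrow> compactin T (pre S)"
    using compact_iff[OF SM] SM by (simp add: submod_def compact_space_subtopology compactin_subspace topspace_M)
  moreover have closed: "closedin T (pre S)" if "compactin T (pre S)"
  proof -
    have "zcl + pre S = pre S"
      using subgrp_plus_least[OF smod_subgrp[OF smod_pre[OF S]], of zcl "pre S"] pre_mono[of "{\<one>\<^bsub>M\<^esub>}" S] one_in_submodule[OF S]
        kernel subset_plus2[OF subgrp_0[OF subgrp_zcl], of "pre S"] by auto
    then show ?thesis using closed_plus_compact[OF closed_zcl that] by simp
  qed
  moreover have "(\<forall>U. closed_submodule A (submod M S) U \<and> finite (carrier (quotmod (submod M S) U)) \<longrightarrow> U = carrier (submod M S)) \<longleftrightarrow> parafin (pre S)"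
    if c: "closedin T (pre S)"
  proof -
    have cl: "closedin (topo (submod M S)) U \<longleftrightarrow> closedin T (pre U)" if "U \<subseteq> S" for U
    proof -
      have "closedin (topo M) S" using c closed_iff[OF SM] by simp
      then have "closedin (topo (submod M S)) U \<longleftrightarrow> closedin (topo M) U"
        using that by (auto simp: submod_def closedin_closed_subtopology)
      then show ?thesis using closed_iff[of U] that SM by auto
    qed
    have sub: "U \<subseteq> S" if "submodule A (submod M S) U" for U using s.submodule_subset[OF that] by (simp add: submod_def)
    show ?thesis
    proof
      assume *: "\<forall>U. closed_submodule A (submod M S) U \<and> finite (carrier (quotmod (submod M S) U)) \<longrightarrow> U = carrier (submod M S)"
      show "parafin (pre S)"
        unfolding parafin_def
      proof (intro allI impI, elim conjE)
        fix L assume L: "smod L" "closedin T L" "L \<subseteq> pre S" "finite_index (pre S) L"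
        have LS: "h ` L \<subseteq> S" using L(3) by (auto simp: pre_def)
        have "zcl \<subseteq> L" by (rule zcl_subset[OF L(2) subgrp_0[OF smod_subgrp[OF L(1)]]])
        then have e: "pre (h ` L) = L" using L(3) pre_subset[of S] by (intro pre_image[OF L(1)]) (auto simp: kernel)
        have m: "submodule A (submod M S) (h ` L)" by (rule s.submodule_image[OF L(1,3)])
        have "closed_submodule A (submod M S) (h ` L)" using m cl[OF LS] L(2) e by (simp add: closed_submodule_def)
        moreover have "finite (carrier (quotmod (submod M S) (h ` L)))"
          using s.finite_quotmod_iff[OF m] L(4) spre[OF LS] e by simp
        ultimately have "h ` L = S" using * by (auto simp: submod_def)
        then show "L = pre S" using e by simp
      qed
    next
      assume *: "parafin (pre S)"
      show "\<forall>U. closed_submodule A (submod M S) U \<and> finite (carrier (quotmod (submod M S) U)) \<longrightarrow> U = carrier (submod M S)"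
      proof (intro allI impI, elim conjE)
        fix U assume U: "closed_submodule A (submod M S) U" "finite (carrier (quotmod (submod M S) U))"
        then have m: "submodule A (submod M S) U" by (simp add: closed_submodule_def)
        note US = sub[OF m]
        have "closedin T (pre U)" using U(1) cl[OF US] by (simp add: closed_submodule_def)
        moreover have "finite_index (pre S) (pre U)" using s.finite_quotmod_iff[OF m] U(2) spre[OF US] by simp
        moreover have "smod (pre U)" using s.smod_pre[OF m] spre[OF US] by simp
        ultimately have "pre U = pre S" using * pre_mono[OF US] by (auto simp: parafin_def)
        then have "h ` pre U = S" using image_pre[OF SM] by simp
        then have "U = S" using image_pre[OF order_trans[OF US SM]] by simp
        then show "U = carrier (submod M S)" by (simp add: submod_def)
      qed
    qed
  qed
  ultimately show ?thesis unfolding compact_parafinite_def by blast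
qed

theorem W_flat_iff: "W_flat A M = {\<one>\<^bsub>M\<^esub>} \<longleftrightarrow> flat_zero Z"
proof -
  define \<S> where "\<S> = {S. submodule A M S \<and> compactin T (pre S) \<and> closedin T (pre S) \<and> parafin (pre S)}"
  have W: "W_flat A M = generate M (\<Union>\<S>)"
    unfolding W_flat_def \<S>_def by (rule arg_cong[where f="\<lambda>\<S>. generate M (\<Union>\<S>)"], rule Collect_cong) (use compact_parafinite_iff in blast)
  have "W_flat A M = {\<one>\<^bsub>M\<^esub>} \<longleftrightarrow> (\<forall>S\<in>\<S>. S \<subseteq> {\<one>\<^bsub>M\<^esub>})"
  proof
    show "\<forall>S\<in>\<S>. S \<subseteq> {\<one>\<^bsub>M\<^esub>}" if "W_flat A M = {\<one>\<^bsub>M\<^esub>}" using that generate.incl[of _ "\<Union>\<S>" M] unfolding W by blast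
    assume "\<forall>S\<in>\<S>. S \<subseteq> {\<one>\<^bsub>M\<^esub>}"
    then have "generate M (\<Union>\<S>) \<subseteq> {\<one>\<^bsub>M\<^esub>}"
      by (intro group.generate_subgroup_incl[OF M_group] group.triv_subgroup[OF M_group]) auto
    then show "W_flat A M = {\<one>\<^bsub>M\<^esub>}" unfolding W using generate.one[of M "\<Union>\<S>"] by auto
  qed
  also have "\<dots> \<longleftrightarrow> flat_zero Z"
  proof
    assume *: "\<forall>S\<in>\<S>. S \<subseteq> {\<one>\<^bsub>M\<^esub>}"
    show "flat_zero Z"
      unfolding flat_zero_def
    proof (intro allI impI, elim conjE)
      fix K assume K: "smod K" "K \<subseteq> Z" "compactin T K" "closedin T K" "parafin K"
      have "zcl \<subseteq> K" by (rule zcl_subset[OF K(4) subgrp_0[OF smod_subgrp[OF K(1)]]])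
      then have e: "pre (h ` K) = K" by (intro pre_image[OF K(1,2)]) (simp add: kernel)
      then have "h ` K \<in> \<S>" using K submodule_image[OF K(1,2)] by (simp add: \<S>_def)
      then have "pre (h ` K) \<subseteq> pre {\<one>\<^bsub>M\<^esub>}" using * by (intro pre_mono) auto
      then show "K \<subseteq> zcl" using e kernel by simp
    qed
  next
    assume *: "flat_zero Z"
    show "\<forall>S\<in>\<S>. S \<subseteq> {\<one>\<^bsub>M\<^esub>}"
    proof
      fix S assume S: "S \<in> \<S>"
      then have "pre S \<subseteq> zcl" using * smod_pre pre_subset by (auto simp: \<S>_def flat_zero_def)
      then have "h ` pre S \<subseteq> {\<one>\<^bsub>M\<^esub>}" unfolding kernel[symmetric] by (auto simp: pre_def)
      then show "S \<subseteq> {\<one>\<^bsub>M\<^esub>}" using image_pre[of S] S submodule_subset by (auto simp: \<S>_def)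
    qed
  qed
  finally show ?thesis .
qed

theorem sheer_iff: "sheer A M \<longleftrightarrow> flat_zero Z \<and> sharp_full Z"
  by (simp add: sheer_def W_flat_iff Omega_sharp_iff)

lemma top_pres_submod:
  assumes S: "submodule A M S" "closedin (topo M) S"
  shows "top_pres T A ac (pre S) h (submod M S)"
proof -
  note SM = submodule_subset[OF S(1)]
  interpret s: alg_pres T A ac "pre S" h "submod M S" by (rule alg_pres_submod[OF S(1)])
  have spre: "s.pre U = pre U" if "U \<subseteq> S" for U using that unfolding s.pre_def by (auto simp: pre_def)
  show ?thesis
  proof (intro top_pres.intro top_pres_axioms.intro s.alg_pres_axioms)
    show "closedin T (pre S)" using S(2) closed_iff[OF SM] by simp
    have "s.pre {\<one>\<^bsub>M\<^esub>} = pre {\<one>\<^bsub>M\<^esub>}" using spre[of "{\<one>\<^bsub>M\<^esub>}"] one_in_submodule[OF S(1)] by simp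
    then show "s.pre {\<one>\<^bsub>submod M S\<^esub>} = zcl" by (simp add: kernel submod_def)
    fix V
    show "openin (topo (submod M S)) V \<longleftrightarrow> V \<subseteq> carrier (submod M S) \<and> (\<exists>U. openin T U \<and> s.pre V = pre S \<inter> U)"
    proof
      assume "openin (topo (submod M S)) V"
      then obtain W where W: "openin (topo M) W" "V = W \<inter> S" by (auto simp: submod_def openin_subtopology)
      obtain U where U: "openin T U" "pre W = Z \<inter> U" using W(1) by (auto simp: open_iff)
      have "s.pre V = pre S \<inter> U" using W(2) U(2) unfolding s.pre_def by (auto simp: pre_def)
      then show "V \<subseteq> carrier (submod M S) \<and> (\<exists>U. openin T U \<and> s.pre V = pre S \<inter> U)" using U(1) W(2) by (auto simp: submod_def)
    next
      assume "V \<subseteq> carrier (submod M S) \<and> (\<exists>U. openin T U \<and> s.pre V = pre S \<inter> U)"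
      then obtain U where VS: "V \<subseteq> S" and U: "openin T U" "s.pre V = pre S \<inter> U" by (auto simp: submod_def)
      have "V = h ` (Z \<inter> U) \<inter> S"
      proof (intro Set.set_eqI iffI)
        fix v assume v: "v \<in> V"
        then obtain x where x: "x \<in> pre S" "v = h x" using image_pre[OF SM] VS by blast
        then have "x \<in> U" using U(2) v by (auto simp: s.pre_def)
        then show "v \<in> h ` (Z \<inter> U) \<inter> S" using x by (auto simp: pre_def)
      next
        fix v assume "v \<in> h ` (Z \<inter> U) \<inter> S"
        then obtain x where x: "x \<in> pre S \<inter> U" "v = h x" by (auto simp: pre_def)
        then show "v \<in> V" using U(2)[symmetric] by (auto simp: s.pre_def)
      qed
      then show "openin (topo (submod M S)) V" using pre_image_open(2)[OF U(1)] by (auto simp: submod_def openin_subtopology)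
    qed
  qed
qed

text \<open>With \<open>Z\<close> the whole group, the open sets saturated under
  \<open>pre S\<close> correspond exactly to the families of cosets with open union in
  \<open>M\<close>.\<close>

lemma top_pres_quotmod:
  assumes Z: "Z = UNIV" and S: "submodule A M S" "closedin (topo M) S"
  shows "top_pres (qtop T (pre S)) A ac Z (\<lambda>x. S #>\<^bsub>M\<^esub> h x) (quotmod M S)"
proof -
  note SM = submodule_subset[OF S(1)] and Sm = smod_pre[OF S(1)]
  have Sc: "closedin T (pre S)" using S(2) closed_iff[OF SM] by simp
  have ZI: "x \<in> Z" "Z \<inter> U = U" for x U using Z by auto
  interpret l: lc_mod "qtop T (pre S)" A ac by (rule lc_mod_qtop[OF Sc Sm])
  interpret q0: alg_pres T A ac Z "\<lambda>x. S #>\<^bsub>M\<^esub> h x" "quotmod M S" by (rule alg_pres_quotmod[OF S(1)])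
  interpret q: alg_pres "qtop T (pre S)" A ac Z "\<lambda>x. S #>\<^bsub>M\<^esub> h x" "quotmod M S"
    using q0.alg_pres_axioms l.lc_mod_axioms by (simp add: alg_pres_def)
  show ?thesis
  proof (intro top_pres.intro top_pres_axioms.intro q.alg_pres_axioms)
    show "closedin (qtop T (pre S)) Z" using closedin_topspace[of "qtop T (pre S)"] l.topspace_UNIV Z by metis
    show "q.pre {\<one>\<^bsub>quotmod M S\<^esub>} = l.zcl" using pre_quotmod[OF S(1)] by (simp add: zcl_qtop[OF Sc Sm])
    fix V
    have sat: "pre (\<Union>V) + pre S \<subseteq> pre (\<Union>V)" if V: "V \<subseteq> rcosets\<^bsub>M\<^esub> S"
    proof
      fix x assume "x \<in> pre (\<Union>V) + pre S"
      then obtain v s where vs: "x = v + s" "v \<in> pre (\<Union>V)" "s \<in> pre S" by (rule set_plus_elim)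
      then have "x - v \<in> pre S" by simp
      then have "S #>\<^bsub>M\<^esub> h x = S #>\<^bsub>M\<^esub> h v" using rcoset_eq_iff[OF S(1), of v x] by (simp add: ZI)
      then show "x \<in> pre (\<Union>V)" using vs(2) unfolding pre_Union_rcosets[OF S(1) V] by (simp add: ZI)
    qed
    have e: "q.pre V = pre (\<Union>V)" if "V \<subseteq> rcosets\<^bsub>M\<^esub> S" using pre_Union_rcosets[OF S(1) that] by (simp add: q.pre_def)
    have c: "\<Union>V \<subseteq> carrier M" if "V \<subseteq> rcosets\<^bsub>M\<^esub> S"
      using that subgroup.rcosets_carrier[OF _ M_group] S(1) by (auto simp: submodule_def)
    have "carrier (quotmod M S) = rcosets\<^bsub>M\<^esub> S" by (simp add: quotmod_def)
    then show "openin (topo (quotmod M S)) V \<longleftrightarrow> V \<subseteq> carrier (quotmod M S) \<and> (\<exists>U. openin (qtop T (pre S)) U \<and> q.pre V = Z \<inter> U)"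
      using sat e c by (auto simp: openin_quotmod[OF S(1)] open_iff openin_qtop ZI)
  qed
qed

theorem sheer_submod_iff_quotmod:
  assumes Z: "Z = UNIV" and sh: "sheer A M" and N: "submodule A M N" "closedin (topo M) N"
  shows "sheer A (submod M N) \<longleftrightarrow> sheer A (quotmod M N)"
proof -
  note NM = submodule_subset[OF N(1)] and Nm = smod_pre[OF N(1)]
  have Nc: "closedin T (pre N)" using N(2) closed_iff[OF NM] by simp
  interpret s: top_pres T A ac "pre N" h "submod M N" by (rule top_pres_submod[OF N])
  interpret q: top_pres "qtop T (pre N)" A ac Z "\<lambda>x. N #>\<^bsub>M\<^esub> h x" "quotmod M N" by (rule top_pres_quotmod[OF Z N])
  have M: "flat_zero UNIV" "sharp_full UNIV" using sh sheer_iff Z by auto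
  have "flat_zero (pre N)" using M(1) by (auto simp: flat_zero_def)
  moreover have "q.sharp_full Z" using sharp_full_qtop[OF Nc Nm M(2)] by (simp only: Z[symmetric])
  moreover have "q.flat_zero Z \<longleftrightarrow> sharp_full (pre N)" using flat_zero_quotient_iff[OF M Nc Nm] by (simp only: Z[symmetric])
  ultimately show ?thesis by (simp add: s.sheer_iff q.sheer_iff)
qed

end

section \<open>Existence of a presentation\<close>

lemma continuous_map_prod_nbhds:
  assumes "continuous_map (prod_topology X1 X2) Y (\<lambda>(x, y). g x y)" "openin Y V" "x \<in> topspace X1" "y \<in> topspace X2" "g x y \<in> V"
  shows "\<exists>U W. openin X1 U \<and> openin X2 W \<and> x \<in> U \<and> y \<in> W \<and> (\<forall>u\<in>U. \<forall>w\<in>W. g u w \<in> V)"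
proof -
  let ?P = "{p \<in> topspace (prod_topology X1 X2). (\<lambda>(x, y). g x y) p \<in> V}"
  have "openin (prod_topology X1 X2) ?P" by (rule openin_continuous_map_preimage[OF assms(1,2)])
  then have *: "\<exists>U V. openin X1 U \<and> openin X2 V \<and> x' \<in> U \<and> y' \<in> V \<and> U \<times> V \<subseteq> ?P" if "(x', y') \<in> ?P" for x' y'
    using that by (simp only: openin_prod_topology_alt)
  have "(x, y) \<in> ?P" using assms(3-5) by simp
  from *[OF this] obtain U W where "openin X1 U" "openin X2 W" "x \<in> U" "y \<in> W" "U \<times> W \<subseteq> ?P" by (elim exE conjE)
  then show ?thesis by (intro exI[of _ U] exI[of _ W]) auto
qed

lemma frag_induct [case_names zero one diff]:
  assumes "P 0" "\<And>x. P (frag_of x)" "\<And>c d. P c \<Longrightarrow> P d \<Longrightarrow> P (c - d)"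
  shows "P c"
  by (rule frag_induction[OF subset_UNIV]) (use assms in auto)

text \<open>The free abelian group on all points of the carrier type maps onto \<open>M\<close>. The
  action is extended linearly and the topology is pulled back; since \<open>M\<close> is Hausdorff,
  the closure of zero is exactly the kernel.\<close>

theorem LC_module_presentation:
  fixes A :: "'g tmonoid" and M :: "('g, 'a) amod"
  assumes A: "LCA A" "compactly_generated A" and M: "LC_module A M"
  shows "\<exists>T ac h. top_pres T A ac (UNIV :: ('a \<Rightarrow>\<^sub>0 int) set) h M"
proof -
  have A_top: "topological_group A" and A_comm: "comm_group A" and A_space: "topspace (topo A) = carrier A"
    using A(1) by (auto simp: LCA_def topological_group_def)
  have M_top: "topological_group M" and M_comm: "comm_group M" and haus: "Hausdorff_space (topo M)" and lc: "locally_compact_space (topo M)"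
    using M by (auto simp: LC_module_def LCA_def)
  have M_space: "topspace (topo M) = carrier M" using M_top by (simp add: topological_group_def)
  have act1: "\<And>x. x \<in> carrier M \<Longrightarrow> act M \<one>\<^bsub>A\<^esub> x = x"
    and actm: "\<And>a b x. a \<in> carrier A \<Longrightarrow> b \<in> carrier A \<Longrightarrow> x \<in> carrier M \<Longrightarrow> act M (a \<otimes>\<^bsub>A\<^esub> b) x = act M a (act M b x)"
    and acth: "\<And>a. a \<in> carrier A \<Longrightarrow> act M a \<in> hom M M"
    and actc: "continuous_map (prod_topology (topo A) (topo M)) (topo M) (\<lambda>(a, x). act M a x)"
    using M by (auto simp: LC_module_def)
  interpret M: comm_group M by (rule M_comm)
  \<comment> \<open>Points of the type outside the carrier are sent to the identity, which the
    action fixes; correspondingly \<open>g\<close> leaves these generators in place.\<close>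
  define f where "f x = (if x \<in> carrier M then x else \<one>\<^bsub>M\<^esub>)" for x
  obtain e where e: "e \<in> hom (free_Abelian_group UNIV) M" "\<And>x. e (frag_of x) = f x"
    using M.free_Abelian_group_universal[of f UNIV] by (auto simp: f_def)
  have e_in: "e c \<in> carrier M" for c using hom_in_carrier[OF e(1), of c] by simp
  have e_add: "e (c + d) = e c \<otimes>\<^bsub>M\<^esub> e d" for c d using hom_mult[OF e(1), of c d] by simp
  have e_0: "e 0 = \<one>\<^bsub>M\<^esub>" using e_add[of 0 0] e_in[of 0] M.l_cancel_one[of "e 0" "e 0"] by simp
  have e_minus: "e (- c) = inv\<^bsub>M\<^esub> e c" for c using M.inv_equality[of "e (- c)" "e c"] e_add[of "- c" c] e_in e_0 by simp
  have e_surj: "\<exists>c. e c = x" if "x \<in> carrier M" for x using e(2)[of x] that by (auto simp: f_def)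
  define g where "g a x = (if x \<in> carrier M then act M a x else x)" for a x
  define ac where "ac a = frag_extend (frag_of \<circ> g a)" for a
  have ac_add: "ac a (c + d) = ac a c + ac a d" and ac_diff: "ac a (c - d) = ac a c - ac a d" for a c d
    by (auto simp: ac_def frag_extend_add frag_extend_diff)
  have act_in: "act M a x \<in> carrier M" if "a \<in> carrier A" "x \<in> carrier M" for a x using hom_in_carrier[OF acth[OF that(1)] that(2)] .
  have act_one: "act M a \<one>\<^bsub>M\<^esub> = \<one>\<^bsub>M\<^esub>" if "a \<in> carrier A" for a using hom_one[OF acth[OF that] M.is_group M.is_group] .
  have e_ac: "e (ac a c) = act M a (e c)" if a: "a \<in> carrier A" for a c
  proof (induct c rule: frag_induct)
    case (diff c d)
    have "act M a (e c \<otimes>\<^bsub>M\<^esub> inv\<^bsub>M\<^esub> e d) = act M a (e c) \<otimes>\<^bsub>M\<^esub> inv\<^bsub>M\<^esub> act M a (e d)"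
      using hom_mult[OF acth[OF a], of "e c" "inv\<^bsub>M\<^esub> e d"] group_hom.hom_inv[of M M "act M a" "e d"] e_in acth[OF a]
      by (simp add: group_hom_def group_hom_axioms_def)
    then show ?case using e_add[of "ac a c" "- ac a d"] e_add[of c "- d"] e_minus diff by (simp add: ac_diff)
  qed (auto simp: ac_def e_0 e(2) f_def g_def act_in[OF a] act_one[OF a])
  have ac_one: "ac \<one>\<^bsub>A\<^esub> c = c" for c
    by (induct c rule: frag_induct) (auto simp: ac_diff, auto simp: ac_def g_def act1)
  have ac_mult: "ac (a \<otimes>\<^bsub>A\<^esub> b) c = ac a (ac b c)" if "a \<in> carrier A" "b \<in> carrier A" for a b c
    by (induct c rule: frag_induct) (auto simp: ac_diff, auto simp: ac_def g_def actm[OF that] act_in[OF that(2)])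
  define T where "T = pullback_topology UNIV e (topo M)"
  have openT: "openin T U \<longleftrightarrow> (\<exists>V. openin (topo M) V \<and> U = e -` V)" for U by (simp add: T_def openin_pullback_topology)
  have T_space: "topspace T = UNIV" using e_in by (auto simp: T_def topspace_pullback_topology M_space)
  interpret T: top_ab_group T
  proof (unfold_locales, goal_cases)
    case 1
    show ?case by (rule T_space)
  next
    case (2 U x y)
    then obtain V where V: "openin (topo M) V" "U = e -` V" by (auto simp: openT)
    have "continuous_map (prod_topology (topo M) (topo M)) (topo M) (\<lambda>(x, y). x \<otimes>\<^bsub>M\<^esub> y)" using M_top by (simp add: topological_group_def)
    from continuous_map_prod_nbhds[OF this V(1), of "e x" "e y"]
    obtain P Q where PQ: "openin (topo M) P" "openin (topo M) Q" "e x \<in> P" "e y \<in> Q" "\<forall>u\<in>P. \<forall>w\<in>Q. u \<otimes>\<^bsub>M\<^esub> w \<in> V"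
      using 2(2) V(2) e_in M_space e_add by auto
    have "openin T (e -` P)" "openin T (e -` Q)" using PQ(1,2) openT by auto
    moreover have "x \<in> e -` P" "y \<in> e -` Q" "\<forall>v\<in>e -` P. \<forall>w\<in>e -` Q. v + w \<in> U" using PQ(3-5) V(2) e_add by auto
    ultimately show ?case by blast
  next
    case (3 U)
    then obtain V where V: "openin (topo M) V" "U = e -` V" by (auto simp: openT)
    have "continuous_map (topo M) (topo M) (\<lambda>x. inv\<^bsub>M\<^esub> x)" using M_top by (simp add: topological_group_def)
    then have "openin (topo M) {x \<in> topspace (topo M). inv\<^bsub>M\<^esub> x \<in> V}" using V(1) by (rule openin_continuous_map_preimage)
    moreover have "uminus -` U = e -` {x \<in> topspace (topo M). inv\<^bsub>M\<^esub> x \<in> V}" using V(2) e_in by (auto simp: e_minus M_space)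
    ultimately show ?case by (auto simp: openT)
  qed
  interpret T: lc_mod T A ac
  proof (intro lc_mod.intro lc_ab_group.intro T.top_ab_group_axioms lc_ab_group_axioms.intro lc_mod_axioms.intro
      A_top A_comm A(2) ac_add ac_one ac_mult)
    obtain U K where UK: "openin (topo M) U" "compactin (topo M) K" "\<one>\<^bsub>M\<^esub> \<in> U" "U \<subseteq> K"
      using lc M.one_closed unfolding locally_compact_space_def M_space by blast
    have "compactin T (e -` K)"
      unfolding compactin_def
    proof (intro conjI allI impI)
      fix \<U> assume U: "Ball \<U> (openin T) \<and> e -` K \<subseteq> \<Union>\<U>"
      let ?V = "{V. openin (topo M) V \<and> e -` V \<in> \<U>}"
      have "K \<subseteq> \<Union>?V"
      proof
        fix k assume k: "k \<in> K"
        then obtain c where c: "e c = k" using e_surj compactin_subset_topspace[OF UK(2)] M_space by blast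
        then have "c \<in> \<Union>\<U>" using U k by auto
        then obtain W where W: "W \<in> \<U>" "c \<in> W" by auto
        then obtain V where "openin (topo M) V" "W = e -` V" using U openT by auto
        then show "k \<in> \<Union>?V" using W c by auto
      qed
      then obtain \<F> where F: "finite \<F>" "\<F> \<subseteq> ?V" "K \<subseteq> \<Union>\<F>" using compactinD[OF UK(2), of ?V] by auto
      have "e -` K \<subseteq> \<Union>((-`) e ` \<F>)" using F(3) by auto
      then show "\<exists>\<F>. finite \<F> \<and> \<F> \<subseteq> \<U> \<and> e -` K \<subseteq> \<Union>\<F>" using F(1,2) by (intro exI[of _ "(-`) e ` \<F>"]) auto
    qed (simp add: T_space)
    moreover have "T.small (e -` U)" using UK(1,3) e_0 by (auto simp: T.small_def openT)
    ultimately show "\<exists>G C. T.small G \<and> compactin T C \<and> G \<subseteq> C" using UK(4) by (intro exI[of _ "e -` U"] exI[of _ "e -` K"]) auto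
  next
    fix U a x assume U: "openin T U" "a \<in> carrier A" "ac a x \<in> U"
    then obtain V where V: "openin (topo M) V" "U = e -` V" by (auto simp: openT)
    obtain P Q where PQ: "openin (topo A) P" "openin (topo M) Q" "a \<in> P" "e x \<in> Q" "\<forall>u\<in>P. \<forall>w\<in>Q. act M u w \<in> V"
      using continuous_map_prod_nbhds[OF actc V(1), of a "e x"] U e_in e_ac V(2) M_space A_space by auto
    have "ac b v \<in> U" if "b \<in> P" "v \<in> e -` Q" for b v
      using that PQ(5) V(2) e_ac[of b v] openin_subset[OF PQ(1)] A_space by auto
    moreover have "openin T (e -` Q)" using PQ(2) openT by auto
    ultimately show "\<exists>P V. openin (topo A) P \<and> a \<in> P \<and> openin T V \<and> x \<in> V \<and> (\<forall>b\<in>P. \<forall>v\<in>V. ac b v \<in> U)"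
      using PQ(1,3,4) by (intro exI[of _ P] exI[of _ "e -` Q"]) auto
  qed
  interpret p: alg_pres T A ac UNIV e M
  proof (intro alg_pres.intro alg_pres_axioms.intro T.lc_mod_axioms T.smod_UNIV M_comm e_add e_ac)
    show "range e = carrier M" using e_in e_surj by blast
  qed
  have pre: "p.pre V = e -` V" for V by (auto simp: p.pre_def)
  have oM: "openin (topo M) V \<longleftrightarrow> V \<subseteq> carrier M \<and> openin T (e -` V)" for V
  proof
    show "V \<subseteq> carrier M \<and> openin T (e -` V)" if "openin (topo M) V" using that openin_subset[OF that] M_space openT by auto
    assume V: "V \<subseteq> carrier M \<and> openin T (e -` V)"
    then obtain W where W: "openin (topo M) W" "e -` V = e -` W" by (auto simp: openT)
    have "x \<in> V \<longleftrightarrow> x \<in> W" if "x \<in> carrier M" for x using e_surj[OF that] W(2) by auto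
    then have "V = W" using V openin_subset[OF W(1)] M_space by auto
    then show "openin (topo M) V" using W(1) by simp
  qed
  have "top_pres T A ac UNIV e M"
  proof (intro top_pres.intro top_pres_axioms.intro p.alg_pres_axioms)
    show "closedin T UNIV" using closedin_topspace[of T] T_space by simp
    show "openin (topo M) V \<longleftrightarrow> V \<subseteq> carrier M \<and> (\<exists>U. openin T U \<and> p.pre V = UNIV \<inter> U)" for V using oM[of V] by (auto simp: pre)
    have "closedin (topo M) {\<one>\<^bsub>M\<^esub>}" using closedin_Hausdorff_sing_eq[OF haus] M_space by simp
    then have "openin (topo M) (carrier M - {\<one>\<^bsub>M\<^esub>})" by (simp add: closedin_def M_space)
    then have "openin T (e -` (carrier M - {\<one>\<^bsub>M\<^esub>}))" using openT by auto
    moreover have "e -` (carrier M - {\<one>\<^bsub>M\<^esub>}) = UNIV - e -` {\<one>\<^bsub>M\<^esub>}" using e_in by auto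
    ultimately have "closedin T (e -` {\<one>\<^bsub>M\<^esub>})" by (simp add: closedin_def T_space)
    then have "T.zcl \<subseteq> e -` {\<one>\<^bsub>M\<^esub>}" using T.zcl_subset e_0 by auto
    moreover have "c \<in> T.zcl" if c: "e c = \<one>\<^bsub>M\<^esub>" for c
    proof (rule T.in_zclI)
      fix U assume "T.small U"
      then obtain V where "U = e -` V" "\<one>\<^bsub>M\<^esub> \<in> V" using e_0 by (auto simp: T.small_def openT)
      then show "- c \<in> U" by (simp add: e_minus c)
    qed
    ultimately show "p.pre {\<one>\<^bsub>M\<^esub>} = T.zcl" by (auto simp: pre)
  qed
  then show ?thesis by blast
qed

theorem mainTheorem7:
  fixes A :: "'g tmonoid" and M :: "('g, 'a) amod" and N :: "'a set"
  assumes "LCA A" and "compactly_generated A"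
    and "LC_module A M" and "sheer A M"
    and "closed_submodule A M N"
  shows "sheer A (submod M N) \<longleftrightarrow> sheer A (quotmod M N)"
proof -
  obtain T ac h where "top_pres T A ac (UNIV :: ('a \<Rightarrow>\<^sub>0 int) set) h M" using LC_module_presentation[OF assms(1-3)] by blast
  then interpret top_pres T A ac "UNIV :: ('a \<Rightarrow>\<^sub>0 int) set" h M .
  show ?thesis using sheer_submod_iff_quotmod[OF refl assms(4)] assms(5) by (simp add: closed_submodule_def)
qed

end
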